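(* Let $(u,\omega)$ be a functional vorticity solution of the incompressible Euler equations on $\mathbb{T}^3\times(0,T)$ and assume that $u\in L^{2r}((0,T);W^{\beta,2p}(\mathbb{T}^3))$ and $\omega\in L^k((0,T);W^{\alpha,q}(\mathbb{T}^3))$ for some $0<\alpha,\beta<1$ and $1\le p,q,r,k\le\infty$ such that $$\frac1p+\frac1q=\frac1r+\frac1k=1,\qquad 2\beta+\alpha>1.$$ Then the solution conserves helicity, i.e. $\mathcal{H}(t)=\langle\omega(\cdot,t),u(\cdot,t)\rangle_{H^{-1/2}\times H^{1/2}}$ satisfies $\mathcal{H}(t_1)=\mathcal{H}(t_2)$ for almost every $t_1,t_2\in(0,T)$.
   Context: $\mathbb{T}^3$ is the three-dimensional torus, $T>0$. $\mathcal{D}$ denotes $C_c^\infty$. $f\in L^r((0,T);X^{s+})$ means there is $\epsilon_0>0$ with $f\in L^r((0,T);X^{s+\epsilon_0})$. $(a\otimes b)_{ij}=a_ib_j$, $(\nabla\psi)_{ij}=\partial_i\psi_j$. $\langle\cdot,\cdot\rangle$ is the spatial distributional duality bracket. $W^{s,p}$ with fractional $s$ are fractional Sobolev spaces. Functional vorticity solution: a pair $(u,\omega)$ with $u\in L^\infty((0,T);H^{1/2+}(\mathbb{T}^3))$, $\omega=\nabla\times u$, $\nabla\cdot u=\nabla\cdot\omega=0$ in the sense of distributions, and for all $\psi\in\mathcal{D}(\mathbb{T}^3\times(0,T);\mathbb{R}^3)$ $$\int_0^T\langle\omega,\partial_t\psi\rangle dt+\int_0^T\langle u\otimes\omega-\omega\otimes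 u,\nabla\psi\rangle dt=0,$$ where the products $u\otimes\omega$, $\omega\otimes u$ are understood in the sense of Bony's paraproducts, i.e. as the continuous extension of the pointwise product (equivalently as limits of products of mollified functions). *)

theory Defs
  imports "HOL-Analysis.Analysis" "HOL-Probability.Essential_Supremum"
begin

text \<open>
  The torus is \<open>\<real>\<^sup>3 / \<int>\<^sup>3\<close>: functions on it are \<open>\<int>\<^sup>3\<close>-periodic functions on \<open>real ^ 3\<close>, and
  integration is over the unit cube. The total volume is 1, so Parseval's identity for the
  exponentials \<open>exp (2 \<pi> \<i> k \<bullet> x)\<close> carries no constant.
\<close>

definition lattice_vec :: "int ^ 3 \<Rightarrow> real ^ 3" where
  "lattice_vec k = (\<chi> i. real_of_int (k $ i))"

definition periodic :: "(real ^ 3 \<Rightarrow> 'b) \<Rightarrow> bool" where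
  "periodic f \<longleftrightarrow> (\<forall>x k. f (x + lattice_vec k) = f x)"

definition torus :: "(real ^ 3) measure" where
  "torus = restrict_space lborel (cbox 0 1)"

definition centred_torus :: "(real ^ 3) measure" where
  "centred_torus = restrict_space lborel {h. \<forall>i. \<bar>h $ i\<bar> \<le> 1 / 2}"


section \<open>Smooth functions and distributions\<close>

primrec iterated_deriv ::
    "'a list \<Rightarrow> ('a::real_normed_vector \<Rightarrow> 'b::real_normed_vector) \<Rightarrow> 'a \<Rightarrow> 'b" where
  "iterated_deriv [] f = f"
| "iterated_deriv (v # vs) f = (\<lambda>x. frechet_derivative (iterated_deriv vs f) (at x) v)"

definition smooth :: "('a::real_normed_vector \<Rightarrow> 'b::real_normed_vector) \<Rightarrow> bool" where
  "smooth f \<longleftrightarrow> (\<forall>vs. iterated_deriv vs f differentiable_on UNIV)"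

definition partial_deriv :: "3 \<Rightarrow> (real ^ 3 \<Rightarrow> real) \<Rightarrow> real ^ 3 \<Rightarrow> real" where
  "partial_deriv i f = (\<lambda>x. frechet_derivative f (at x) (axis i 1))"

definition test_fun :: "(real ^ 3 \<Rightarrow> real) \<Rightarrow> bool" where
  "test_fun \<phi> \<longleftrightarrow> smooth \<phi> \<and> periodic \<phi>"

text \<open>
  A distribution is a functional of which only the values on test functions matter; its values on
  other functions are unconstrained, and equality of distributions is equality on test functions.
  Differences of (vectors of) distributions are the pointwise ones.
\<close>

type_synonym distr = "(real ^ 3 \<Rightarrow> real) \<Rightarrow> real"

definition distribution :: "distr \<Rightarrow> bool" where
  "distribution \<Lambda> \<longleftrightarrow>
     (\<forall>\<phi> \<psi> a b. test_fun \<phi> \<longrightarrow> test_fun \<psi> \<longrightarrow>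
        \<Lambda> (\<lambda>x. a * \<phi> x + b * \<psi> x) = a * \<Lambda> \<phi> + b * \<Lambda> \<psi>) \<and>
     (\<exists>C N. \<forall>\<phi>. test_fun \<phi> \<longrightarrow>
        \<bar>\<Lambda> \<phi>\<bar> \<le> C * (\<Sum>js\<in>{js. length js \<le> N}.
          SUP x. \<bar>iterated_deriv (map (\<lambda>j. axis j 1) js) \<phi> x\<bar>))"

definition distr_eq :: "distr \<Rightarrow> distr \<Rightarrow> bool" where
  "distr_eq \<Lambda> M \<longleftrightarrow> (\<forall>\<phi>. test_fun \<phi> \<longrightarrow> \<Lambda> \<phi> = M \<phi>)"

definition distr_deriv :: "3 \<Rightarrow> distr \<Rightarrow> distr" where
  "distr_deriv i \<Lambda> = (\<lambda>\<phi>. - \<Lambda> (partial_deriv i \<phi>))"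

definition divergence :: "distr ^ 3 \<Rightarrow> distr" where
  "divergence u = (\<lambda>\<phi>. \<Sum>i\<in>UNIV. distr_deriv i (u $ i) \<phi>)"

text \<open>Arithmetic in the index type \<^typ>\<open>3\<close> is modulo 3, so \<open>i, i + 1, i + 2\<close> are in cyclic order.\<close>

definition curl :: "distr ^ 3 \<Rightarrow> distr ^ 3" where
  "curl u = (\<chi> i. distr_deriv (i + 1) (u $ (i + 2)) - distr_deriv (i + 2) (u $ (i + 1)))"

definition represents :: "(real ^ 3 \<Rightarrow> real ^ 3) \<Rightarrow> distr ^ 3 \<Rightarrow> bool" where
  "represents f u \<longleftrightarrow> f \<in> borel_measurable borel \<and> periodic f \<and> integrable torus f \<and>
     (\<forall>i \<phi>. test_fun \<phi> \<longrightarrow> (u $ i) \<phi> = (LINT x|torus. f x $ i * \<phi> x))"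


section \<open>Products of distributions\<close>

definition mollifier :: "(real ^ 3 \<Rightarrow> real) \<Rightarrow> bool" where
  "mollifier \<rho> \<longleftrightarrow> smooth \<rho> \<and> (\<forall>x. \<rho> x \<ge> 0) \<and> (\<forall>x. norm x \<ge> 1 \<longrightarrow> \<rho> x = 0) \<and>
     (LINT x|lborel. \<rho> x) = 1"

text \<open>
  Convolution of \<open>\<Lambda>\<close> with the periodization of \<open>\<epsilon>\<^sup>-\<^sup>3 \<rho> (x / \<epsilon>)\<close>; the lattice sum has finitely many
  nonzero terms.
\<close>

definition mollify :: "(real ^ 3 \<Rightarrow> real) \<Rightarrow> real \<Rightarrow> distr \<Rightarrow> real ^ 3 \<Rightarrow> real" where
  "mollify \<rho> \<epsilon> \<Lambda> = (\<lambda>x. \<Lambda> (\<lambda>y. \<Sum>\<^sub>\<infinity>k. \<rho> ((x - y + lattice_vec k) /\<^sub>R \<epsilon>) / \<epsilon> ^ 3))"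

text \<open>
  The product as limit of the products of mollifications, whichever mollifier is used. For factors
  in \<open>H\<^sup>s\<close> and \<open>H\<^sup>-\<^sup>s\<close> with \<open>s \<ge> 0\<close> the limit exists and is the paraproduct extension of
  pointwise multiplication.
\<close>

definition distr_mult :: "distr \<Rightarrow> distr \<Rightarrow> distr" where
  "distr_mult \<Lambda> M = (\<lambda>\<phi>. THE L. \<forall>\<rho>. mollifier \<rho> \<longrightarrow>
     ((\<lambda>\<epsilon>. LINT x|torus. mollify \<rho> \<epsilon> \<Lambda> x * mollify \<rho> \<epsilon> M x * \<phi> x) \<longlongrightarrow> L) (at_right 0))"


section \<open>Function spaces\<close>

text \<open>Only used for positive exponents.\<close>

definition ennreal_powr :: "ennreal \<Rightarrow> real \<Rightarrow> ennreal" where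
  "ennreal_powr x a = (if x = \<infinity> then \<infinity> else ennreal (enn2real x powr a))"

definition Lp_norm :: "ennreal \<Rightarrow> 'a measure \<Rightarrow> ('a \<Rightarrow> ennreal) \<Rightarrow> ennreal" where
  "Lp_norm p M f = (if p = \<infinity> then esssup M f
     else ennreal_powr (\<integral>\<^sup>+x. ennreal_powr (f x) (enn2real p) \<partial>M) (1 / enn2real p))"

definition fourier_coeff :: "distr \<Rightarrow> int ^ 3 \<Rightarrow> complex" where
  "fourier_coeff \<Lambda> k =
     Complex (\<Lambda> (\<lambda>x. cos (2 * pi * (lattice_vec k \<bullet> x)))) (- \<Lambda> (\<lambda>x. sin (2 * pi * (lattice_vec k \<bullet> x))))"

text \<open>The norms below are infinite exactly off the respective space.\<close>

definition H_norm :: "real \<Rightarrow> distr ^ 3 \<Rightarrow> ennreal" where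
  "H_norm s u = (if \<forall>i. distribution (u $ i)
     then ennreal_powr (\<Sum>i\<in>UNIV. \<integral>\<^sup>+k. ennreal ((1 + (2 * pi * norm (lattice_vec k))\<^sup>2) powr s *
            (cmod (fourier_coeff (u $ i) k))\<^sup>2) \<partial>count_space UNIV) (1 / 2)
     else \<infinity>)"

text \<open>
  The Gagliardo (Sobolev-Slobodeckij) seminorm, where \<open>|h|\<close> for \<open>h\<close> in the centred unit cube is the
  distance on the torus between \<open>x\<close> and \<open>x + h\<close>. For \<open>p < \<infinity>\<close> the \<open>p\<close>-th power of the integrand is
  \<open>|f (x + h) - f x|\<^sup>p / |h|\<^bsup>3 + s p\<^esup>\<close>; for \<open>p = \<infinity>\<close> the summand \<open>3 / p\<close> is 0 and the seminorm is
  the Hoelder one.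
\<close>

definition gagliardo :: "real \<Rightarrow> ennreal \<Rightarrow> (real ^ 3 \<Rightarrow> real ^ 3) \<Rightarrow> ennreal" where
  "gagliardo s p f = Lp_norm p (centred_torus \<Otimes>\<^sub>M torus)
     (\<lambda>(h, x). ennreal (norm (f (x + h) - f x) / norm h powr (s + enn2real (3 / p))))"

text \<open>
  All functions representing the same distribution agree almost everywhere, so the infimum is over
  equal values; it is \<open>\<infinity>\<close> if there is no representing function.
\<close>

definition W_norm :: "real \<Rightarrow> ennreal \<Rightarrow> distr ^ 3 \<Rightarrow> ennreal" where
  "W_norm s p u =
     (INF f\<in>{f. represents f u}. Lp_norm p torus (\<lambda>x. ennreal (norm (f x))) + gagliardo s p f)"

text \<open>
  The Bochner space \<open>L\<^sup>r((0,T); X)\<close> for the space \<open>X\<close> of those distributions whose norm \<open>N\<close> is finite.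
\<close>

definition strongly_measurable ::
    "real \<Rightarrow> (distr ^ 3 \<Rightarrow> ennreal) \<Rightarrow> (real \<Rightarrow> distr ^ 3) \<Rightarrow> bool" where
  "strongly_measurable T N u \<longleftrightarrow>
     (\<exists>s. (\<forall>n. simple_function (lebesgue_on {0<..<T}) (s n)) \<and>
          (\<forall>n. \<forall>t\<in>{0<..<T}. N (s n t) < \<infinity>) \<and>
          (AE t in lebesgue_on {0<..<T}. (\<lambda>n. N (u t - s n t)) \<longlonglongrightarrow> 0))"

definition bochner_space ::
    "real \<Rightarrow> ennreal \<Rightarrow> (distr ^ 3 \<Rightarrow> ennreal) \<Rightarrow> (real \<Rightarrow> distr ^ 3) set" where
  "bochner_space T r N =
     {u. strongly_measurable T N u \<and> Lp_norm r (lebesgue_on {0<..<T}) (\<lambda>t. N (u t)) < \<infinity>}"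


section \<open>Functional vorticity solutions and helicity\<close>

definition spacetime_test_fun :: "real \<Rightarrow> (real \<Rightarrow> real ^ 3 \<Rightarrow> real ^ 3) \<Rightarrow> bool" where
  "spacetime_test_fun T \<psi> \<longleftrightarrow> smooth (\<lambda>(t, x). \<psi> t x) \<and> (\<forall>t. periodic (\<psi> t)) \<and>
     (\<exists>a b. 0 < a \<and> b < T \<and> (\<forall>t x. t \<notin> {a..b} \<longrightarrow> \<psi> t x = 0))"

definition bracket :: "distr ^ 3 \<Rightarrow> (real ^ 3 \<Rightarrow> real ^ 3) \<Rightarrow> real" where
  "bracket u \<phi> = (\<Sum>i\<in>UNIV. (u $ i) (\<lambda>x. \<phi> x $ i))"

definition time_deriv :: "(real \<Rightarrow> real ^ 3 \<Rightarrow> real ^ 3) \<Rightarrow> real \<Rightarrow> real ^ 3 \<Rightarrow> real ^ 3" where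
  "time_deriv \<psi> t x = vector_derivative (\<lambda>\<tau>. \<psi> \<tau> x) (at t)"

text \<open>Matrix fields: row index first, with \<open>(a \<otimes> b)\<^sub>i\<^sub>j = a\<^sub>i b\<^sub>j\<close> and \<open>(\<nabla>\<phi>)\<^sub>i\<^sub>j = \<partial>\<^sub>i \<phi>\<^sub>j\<close>.\<close>

definition tensor :: "distr ^ 3 \<Rightarrow> distr ^ 3 \<Rightarrow> distr ^ 3 ^ 3" where
  "tensor a b = (\<chi> i j. distr_mult (a $ i) (b $ j))"

definition gradient :: "(real ^ 3 \<Rightarrow> real ^ 3) \<Rightarrow> real ^ 3 \<Rightarrow> real ^ 3 ^ 3" where
  "gradient \<phi> x = (\<chi> i j. partial_deriv i (\<lambda>y. \<phi> y $ j) x)"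

definition matrix_bracket :: "distr ^ 3 ^ 3 \<Rightarrow> (real ^ 3 \<Rightarrow> real ^ 3 ^ 3) \<Rightarrow> real" where
  "matrix_bracket A \<Phi> = (\<Sum>i\<in>UNIV. \<Sum>j\<in>UNIV. (A $ i $ j) (\<lambda>x. \<Phi> x $ i $ j))"

definition functional_vorticity_solution ::
    "real \<Rightarrow> (real \<Rightarrow> distr ^ 3) \<Rightarrow> (real \<Rightarrow> distr ^ 3) \<Rightarrow> bool" where
  "functional_vorticity_solution T u \<omega> \<longleftrightarrow>
     (\<exists>\<epsilon>\<^sub>0>0. u \<in> bochner_space T \<infinity> (H_norm (1 / 2 + \<epsilon>\<^sub>0))) \<and>
     (AE t in lebesgue_on {0<..<T}. \<forall>i. distr_eq (\<omega> t $ i) (curl (u t) $ i)) \<and>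
     (AE t in lebesgue_on {0<..<T}. distr_eq (divergence (u t)) (\<lambda>_. 0)) \<and>
     (AE t in lebesgue_on {0<..<T}. distr_eq (divergence (\<omega> t)) (\<lambda>_. 0)) \<and>
     (\<forall>\<psi>. spacetime_test_fun T \<psi> \<longrightarrow>
        (LINT t|lebesgue_on {0<..<T}. bracket (\<omega> t) (time_deriv \<psi> t)) +
        (LINT t|lebesgue_on {0<..<T}.
           matrix_bracket (tensor (u t) (\<omega> t) - tensor (\<omega> t) (u t)) (gradient (\<psi> t))) = 0)"

text \<open>
  The duality pairing of \<open>H\<^sup>-\<^sup>s\<close> with \<open>H\<^sup>s\<close> that extends the \<open>L\<^sup>2\<close> inner product. For real distributions
  the terms for \<open>k\<close> and \<open>-k\<close> are conjugate, so only real parts contribute.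
\<close>

definition sobolev_pairing :: "distr ^ 3 \<Rightarrow> distr ^ 3 \<Rightarrow> real" where
  "sobolev_pairing w v =
     (\<Sum>i\<in>UNIV. \<Sum>\<^sub>\<infinity>k. Re (fourier_coeff (w $ i) k * cnj (fourier_coeff (v $ i) k)))"

definition helicity ::
    "(real \<Rightarrow> distr ^ 3) \<Rightarrow> (real \<Rightarrow> distr ^ 3) \<Rightarrow> real \<Rightarrow> real" where
  "helicity u \<omega> t = sobolev_pairing (\<omega> t) (u t)"

end

theory Submission
  imports Defs
begin

text \<open>
  Expand the helicity over the Fourier modes, with weights given by the square of the multiplier of
  a nonnegative trigonometric kernel of width \<open>\<epsilon> = 1 / sqrt m\<close>. Tested against a mode, the
  vorticity equation becomes an ordinary differential equation for a Fourier coefficient of \<open>\<omega>\<close>.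
  As the curl is symmetric and \<open>\<omega> = curl u\<close>, the smoothed helicity is absolutely continuous in time,
  and its derivative is twice the pairing of the smoothed \<open>u \<times> \<omega>\<close> with the smoothed \<open>\<omega>\<close>. The
  cross product of the smoothed \<open>u\<close> and the smoothed \<open>\<omega>\<close> is orthogonal to the smoothed \<open>\<omega>\<close>, so only
  the commutator of the smoothing with the product matters (the argument of Constantin, E and Titi).
  It is bilinear in the increments of \<open>u\<close> and \<open>\<omega>\<close>, hence of order \<open>\<epsilon>\<^bsup>\<beta> + \<alpha>\<^esup>\<close>, and the
  remaining \<open>\<omega>\<close> is the curl of the smoothed \<open>u\<close>, which costs \<open>\<epsilon>\<^bsup>\<beta> - 1\<^esup>\<close>. Altogether the
  derivative is of order \<open>\<epsilon>\<^bsup>2\<beta> + \<alpha> - 1\<^esup>\<close>, integrably in time, so that the limit of the smoothed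
  helicities is constant.
\<close>

section \<open>Lebesgue norms\<close>

text \<open>The Gagliardo norm controls increments f(x + h) - f(x) only after integration over the
  shift h, not for each h. The estimates are therefore trilinear Hoelder inequalities on the product
  of the torus with three copies of the shift variable, weighted by a majorant of the kernel. The
  majorant has height of order \<epsilon>^-3, which costs \<epsilon>^(-3/p) in L^p; the singular
  weight |h|^-(s + 3/p) returns \<epsilon>^(s + 3/p), and exactly \<epsilon>^s is left. A
  trigonometric kernel keeps the smoothed helicity a finite sum over modes, so that the evolution in
  time concerns one scalar coefficient at a time and countably many null sets suffice; the price is
  that its decay has to be proved. Representatives of u(t) and \<omega>(t) are chosen separately for
  each t and carry no measurability in time. The flux is therefore written as a limit of expressions
  in u(t) and \<omega>(t) applied to fixed test functions before it is integrated in time.\<close>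

lemma ennreal_powr_top [simp]: "ennreal_powr \<infinity> a = \<infinity>" "ennreal_powr top a = top"
  by (simp_all add: ennreal_powr_def)

lemma ennreal_powr_ennreal: "0 \<le> x \<Longrightarrow> ennreal_powr (ennreal x) a = ennreal (x powr a)"
  by (simp add: ennreal_powr_def)

lemma ennreal_powr_0 [simp]: "ennreal_powr 0 a = 0"
  by (simp add: ennreal_powr_def)

lemma ennreal_powr_one [simp]: "ennreal_powr x 1 = x"
  by (cases x) (simp_all add: ennreal_powr_def)

lemma ennreal_powr_measurable [measurable]:
  assumes [measurable]: "f \<in> borel_measurable M"
  shows "(\<lambda>x. ennreal_powr (f x) a) \<in> borel_measurable M"
  unfolding ennreal_powr_def by measurable

lemma ennreal_powr_mono:
  assumes "0 \<le> a" "x \<le> y" shows "ennreal_powr x a \<le> ennreal_powr y a"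
proof (cases y)
  case (real r)
  with assms obtain s where "x = ennreal s" "0 \<le> s" "s \<le> r"
    by (cases x) (auto simp: top_unique)
  with real assms show ?thesis
    by (simp add: ennreal_powr_ennreal powr_mono2)
qed simp

lemma ennreal_powr_mult: "ennreal_powr (x * y) a = ennreal_powr x a * ennreal_powr y a"
proof (cases "x = 0 \<or> y = 0")
  case False
  show ?thesis
  proof (cases x; cases y)
    fix r s assume *: "x = ennreal r" "0 \<le> r" "y = ennreal s" "0 \<le> s"
    show ?thesis
      unfolding *(1,3) using *(2,4)
      by (simp add: ennreal_powr_ennreal powr_mult flip: ennreal_mult)
  qed (use False in \<open>auto simp: ennreal_powr_ennreal ennreal_mult_top ennreal_top_mult\<close>)
qed auto

lemma ennreal_powr_powr:
  assumes "0 < a" "0 < b" shows "ennreal_powr (ennreal_powr x a) b = ennreal_powr x (a * b)"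
  using assms by (cases x) (auto simp: ennreal_powr_ennreal powr_powr)

lemma ennreal_powr_inverse:
  assumes "0 < a"
  shows "ennreal_powr (ennreal_powr x a) (1 / a) = x" "ennreal_powr (ennreal_powr x (1 / a)) a = x"
  using assms by (simp_all add: ennreal_powr_powr)

lemma ennreal_powr_eq_0_iff [simp]: "ennreal_powr x a = 0 \<longleftrightarrow> x = 0"
  by (cases x) (auto simp: ennreal_powr_ennreal)

lemma ennreal_powr_eq_top_iff [simp]: "ennreal_powr x a = top \<longleftrightarrow> x = top"
  by (cases x) (auto simp: ennreal_powr_ennreal)

lemma exponent_cases:
  assumes "1 \<le> (p::ennreal)"
  obtains "p = \<infinity>" | P where "1 \<le> P" "p = ennreal P" "enn2real p = P" "p \<noteq> \<infinity>"
  using assms by (cases p) (auto simp: top_unique)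

lemma Lp_norm_inf: "Lp_norm \<infinity> M f = esssup M f" "Lp_norm top M f = esssup M f"
  by (simp_all add: Lp_norm_def)

lemma Lp_norm_ennreal:
  "0 \<le> P \<Longrightarrow> Lp_norm (ennreal P) M f =
    ennreal_powr (\<integral>\<^sup>+x. ennreal_powr (f x) P \<partial>M) (1 / P)"
  by (simp add: Lp_norm_def)

lemma Lp_norm_powr:
  assumes "0 < P"
  shows "ennreal_powr (Lp_norm (ennreal P) M f) P = (\<integral>\<^sup>+x. ennreal_powr (f x) P \<partial>M)"
  using assms by (simp add: Lp_norm_ennreal ennreal_powr_inverse)

lemma Lp_norm_eq_0_AE:
  assumes [measurable]: "f \<in> borel_measurable M" and "1 \<le> p" "Lp_norm p M f = 0"
  shows "AE x in M. f x = 0"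
  using assms(2)
proof (cases p rule: exponent_cases)
  case 1
  with assms(3) esssup_AE[where f=f and M=M] show ?thesis by (simp add: Lp_norm_inf)
next
  case (2 P)
  with assms(3) have "(\<integral>\<^sup>+x. ennreal_powr (f x) P \<partial>M) = 0"
    by (simp add: Lp_norm_def)
  then show ?thesis by (subst (asm) nn_integral_0_iff_AE) auto
qed

lemma Lp_norm_mono_AE:
  assumes [measurable]: "f \<in> borel_measurable M" and "1 \<le> p" "AE x in M. f x \<le> g x"
  shows "Lp_norm p M f \<le> Lp_norm p M g"
  using assms(2)
proof (cases p rule: exponent_cases)
  case 1
  then show ?thesis using assms by (simp add: Lp_norm_inf esssup_AE_mono)
next
  case (2 P)
  have "(\<integral>\<^sup>+x. ennreal_powr (f x) P \<partial>M) \<le> (\<integral>\<^sup>+x. ennreal_powr (g x) P \<partial>M)"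
    using assms(3) 2 by (intro nn_integral_mono_AE) (auto elim!: eventually_mono intro!: ennreal_powr_mono)
  with 2 show ?thesis by (auto simp: Lp_norm_def intro!: ennreal_powr_mono)
qed

text \<open>The image of \<open>M\<close> under \<pi> is at most \<open>C\<close> times
  \<open>N\<close>, so the p-th powers lose a factor \<open>C\<close> and the norms a factor
  \<open>C\<close> to the power 1/p. At p = \<infinity> that exponent is 0, since null sets of
  \<open>N\<close> pull back to null sets of \<open>M\<close>. With \<open>C\<close> of the order of
  the height of a kernel of width \<epsilon>, this is the loss \<epsilon>^(-3/p) in the estimates of
  increments.\<close>

lemma Lp_norm_transfer:
  assumes [measurable]: "\<pi> \<in> M \<rightarrow>\<^sub>M N" "\<Psi> \<in> borel_measurable N" "\<Phi> \<in> borel_measurable M"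
    and "1 \<le> p" "0 < C" "0 < a"
    and push: "\<And>\<Theta>. \<Theta> \<in> borel_measurable N \<Longrightarrow>
      (\<integral>\<^sup>+z. \<Theta> (\<pi> z) \<partial>M) \<le> ennreal C * (\<integral>\<^sup>+y. \<Theta> y \<partial>N)"
    and bound: "AE z in M. \<Phi> z \<le> ennreal a * \<Psi> (\<pi> z)"
  shows "Lp_norm p M \<Phi> \<le> ennreal (a * C powr enn2real (1 / p)) * Lp_norm p N \<Psi>"
  using \<open>1 \<le> p\<close>
proof (cases p rule: exponent_cases)
  case 1
  define S where "S = esssup N \<Psi>"
  have "AE y in N. \<Psi> y \<le> S" unfolding S_def by (rule esssup_AE)
  then have "(\<integral>\<^sup>+y. indicator {y\<in>space N. S < \<Psi> y} y \<partial>N) = 0"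
    by (subst nn_integral_0_iff_AE) (auto elim!: eventually_mono simp: indicator_def)
  with push[of "indicator {y\<in>space N. S < \<Psi> y}"]
  have "(\<integral>\<^sup>+z. indicator {y\<in>space N. S < \<Psi> y} (\<pi> z) \<partial>M) = 0" by simp
  then have "AE z in M. \<Psi> (\<pi> z) \<le> S"
    using measurable_space[OF assms(1)]
    by (subst (asm) nn_integral_0_iff_AE)
      (auto elim!: AE_mp intro!: AE_I2 simp: indicator_def not_less split: if_splits)
  with bound have "AE z in M. \<Phi> z \<le> ennreal a * S"
    by eventually_elim (meson mult_left_mono order_trans zero_le)
  then have "esssup M \<Phi> \<le> ennreal a * S" by (intro esssup_I) auto
  with 1 assms(5) show ?thesis by (simp add: Lp_norm_inf S_def)
next
  case (2 P)
  then have "0 < P" by simp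
  have "(\<integral>\<^sup>+z. ennreal_powr (\<Phi> z) P \<partial>M) \<le> (\<integral>\<^sup>+z. ennreal_powr (ennreal a) P * ennreal_powr (\<Psi> (\<pi> z)) P \<partial>M)"
    using bound 2
    by (intro nn_integral_mono_AE, simp add: ennreal_powr_mult[symmetric])
      (auto elim!: eventually_mono intro!: ennreal_powr_mono)
  also have "\<dots> = ennreal_powr (ennreal a) P * (\<integral>\<^sup>+z. ennreal_powr (\<Psi> (\<pi> z)) P \<partial>M)"
    by (rule nn_integral_cmult) measurable
  also have "\<dots> \<le> ennreal_powr (ennreal a) P * (ennreal C * (\<integral>\<^sup>+y. ennreal_powr (\<Psi> y) P \<partial>N))"
    by (intro mult_left_mono push) auto
  finally have "Lp_norm p M \<Phi> \<le> ennreal_powr (ennreal_powr (ennreal a) P *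
      (ennreal C * (\<integral>\<^sup>+y. ennreal_powr (\<Psi> y) P \<partial>N))) (1 / P)"
    using 2 by (auto simp: Lp_norm_def intro!: ennreal_powr_mono)
  also have "\<dots> = ennreal a * ennreal (C powr (1 / P)) * Lp_norm p N \<Psi>"
    using 2 \<open>0 < P\<close> \<open>0 < C\<close>
    by (simp add: ennreal_powr_mult ennreal_powr_inverse Lp_norm_def ennreal_powr_ennreal mult.assoc)
  also have "enn2real (1 / p) = 1 / P"
    using 2 divide_ennreal[of 1 P] by simp
  then have "ennreal a * ennreal (C powr (1 / P)) = ennreal (a * C powr enn2real (1 / p))"
    using \<open>0 < a\<close> by (simp add: ennreal_mult)
  finally show ?thesis .
qed

section \<open>Hoelder's inequality with the exponents 2p, 2p, q\<close>

text \<open>Young's inequality with P and Q separates the pair x y from z, and the inequality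
  between product and squares then separates x from y. The free scales \<open>A\<close>,
  \<open>B\<close>, \<open>C\<close> will be the norms of three functions, which makes the
  integrated right-hand side equal to their product.\<close>

lemma Young_three:
  fixes x y z A B C P Q :: real
  assumes "1 < P" "1 < Q" "1 / P + 1 / Q = 1" "0 < A" "0 < B" "0 < C" "0 \<le> x" "0 \<le> y" "0 \<le> z"
  shows "x * y * z \<le> A * B * C *
    (A powr (- 2 * P) * x powr (2 * P) / (2 * P) + B powr (- 2 * P) * y powr (2 * P) / (2 * P)
      + C powr (- Q) * z powr Q / Q)"
proof -
  define x' y' z' where "x' = x / A" and "y' = y / B" and "z' = z / C"
  have nn: "0 \<le> x'" "0 \<le> y'" "0 \<le> z'" using assms by (auto simp: x'_def y'_def z'_def)
  have "x' * y' * z' \<le> (x' * y') powr P / P + z' powr Q / Q"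
    using assms nn by (intro Youngs_inequality) auto
  also have "(x' * y') powr P = x' powr P * y' powr P"
    using nn by (simp add: powr_mult)
  also have "\<dots> \<le> ((x' powr P)\<^sup>2 + (y' powr P)\<^sup>2) / 2"
    using sum_squares_bound[of "x' powr P" "y' powr P"] by simp
  finally have "x' * y' * z' \<le> ((x' powr P)\<^sup>2 + (y' powr P)\<^sup>2) / 2 / P + z' powr Q / Q"
    using assms by (simp add: divide_right_mono)
  also have "(x' powr P)\<^sup>2 = x' powr (2 * P)"
    by (simp add: powr_add[of _ P P, folded mult_2] power2_eq_square)
  also have "(y' powr P)\<^sup>2 = y' powr (2 * P)"
    by (simp add: powr_add[of _ P P, folded mult_2] power2_eq_square)
  finally have *: "x' * y' * z' \<le> x' powr (2 * P) / (2 * P) + y' powr (2 * P) / (2 * P) + z' powr Q / Q"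
    using assms by (simp add: divide_right_mono add_divide_distrib)
  have eqs: "x' powr (2 * P) = A powr (- 2 * P) * x powr (2 * P)"
    "y' powr (2 * P) = B powr (- 2 * P) * y powr (2 * P)"
    "z' powr Q = C powr (- Q) * z powr Q"
    using assms by (simp_all add: x'_def y'_def z'_def powr_divide powr_minus_divide)
  have "x * y * z = A * B * C * (x' * y' * z')"
    using assms by (simp add: x'_def y'_def z'_def)
  also have "\<dots> \<le> A * B * C * (x' powr (2 * P) / (2 * P) + y' powr (2 * P) / (2 * P) + z' powr Q / Q)"
    using * assms by (intro mult_left_mono) auto
  finally show ?thesis by (simp only: eqs)
qed

lemma Lp_norm_pos_cases:
  assumes "f \<in> borel_measurable M" "1 \<le> p"
  obtains "AE x in M. f x = 0" | "Lp_norm p M f = top" | A where "0 < A" "Lp_norm p M f = ennreal A"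
  using Lp_norm_eq_0_AE[OF assms] by (cases "Lp_norm p M f") (force simp: less_le)+

text \<open>Integrating \<open>Young_three\<close> at the scale of the norms: each of the first two
  terms contributes A B C / (2 P) and the third A B C / Q, and these fractions add up to 1. The
  coefficients are positive, so the pointwise inequality persists for infinite values.\<close>

lemma Hoelder_three_finite:
  fixes P Q :: real
  assumes [measurable]: "f \<in> borel_measurable M" "g \<in> borel_measurable M" "h \<in> borel_measurable M"
    and PQ: "1 < P" "1 < Q" "1 / P + 1 / Q = 1"
    and A: "0 < A" "Lp_norm (2 * ennreal P) M f = ennreal A"
    and B: "0 < B" "Lp_norm (2 * ennreal P) M g = ennreal B"
    and C: "0 < C" "Lp_norm (ennreal Q) M h = ennreal C"
  shows "(\<integral>\<^sup>+x. f x * g x * h x \<partial>M) \<le> ennreal (A * B * C)"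
proof -
  have two: "2 * ennreal P = ennreal (2 * P)" using PQ by (simp add: ennreal_mult')
  define \<alpha> where "\<alpha> = A * B * C * (A powr (- 2 * P) / (2 * P))"
  define \<beta> where "\<beta> = A * B * C * (B powr (- 2 * P) / (2 * P))"
  define \<gamma> where "\<gamma> = A * B * C * (C powr (- Q) / Q)"
  have pos: "0 < \<alpha>" "0 < \<beta>" "0 < \<gamma>"
    using A B C PQ by (simp_all add: \<alpha>_def \<beta>_def \<gamma>_def)
  have pointwise: "x * y * z \<le> ennreal \<alpha> * ennreal_powr x (2 * P) +
      ennreal \<beta> * ennreal_powr y (2 * P) + ennreal \<gamma> * ennreal_powr z Q" for x y z :: ennreal
  proof (cases "x = top \<or> y = top \<or> z = top")
    case True
    then show ?thesis using pos by (auto simp: ennreal_mult_top)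
  next
    case False
    then obtain a b c where *: "x = ennreal a" "y = ennreal b" "z = ennreal c" "0 \<le> a" "0 \<le> b" "0 \<le> c"
      by (cases x; cases y; cases z) auto
    have "a * b * c \<le> \<alpha> * a powr (2 * P) + \<beta> * b powr (2 * P) + \<gamma> * c powr Q"
      using Young_three[OF PQ A(1) B(1) C(1) *(4-6)]
      by (simp add: \<alpha>_def \<beta>_def \<gamma>_def algebra_simps)
    then show ?thesis
      using * pos by (simp add: ennreal_powr_ennreal flip: ennreal_mult ennreal_plus)
  qed
  have "(\<integral>\<^sup>+x. f x * g x * h x \<partial>M) \<le> (\<integral>\<^sup>+x. (ennreal \<alpha> * ennreal_powr (f x) (2 * P) +
      ennreal \<beta> * ennreal_powr (g x) (2 * P)) + ennreal \<gamma> * ennreal_powr (h x) Q \<partial>M)"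
    by (intro nn_integral_mono pointwise)
  also have "\<dots> = ennreal \<alpha> * (\<integral>\<^sup>+x. ennreal_powr (f x) (2 * P) \<partial>M) +
      ennreal \<beta> * (\<integral>\<^sup>+x. ennreal_powr (g x) (2 * P) \<partial>M) +
      ennreal \<gamma> * (\<integral>\<^sup>+x. ennreal_powr (h x) Q \<partial>M)"
    by (simp add: nn_integral_add nn_integral_cmult)
  also have "\<dots> = ennreal (\<alpha> * A powr (2 * P) + \<beta> * B powr (2 * P) + \<gamma> * C powr Q)"
    using A B C PQ pos
    by (simp add: Lp_norm_powr[symmetric] two[symmetric] ennreal_powr_ennreal
        flip: ennreal_mult ennreal_plus)
  also have "\<alpha> * A powr (2 * P) + \<beta> * B powr (2 * P) + \<gamma> * C powr Q = A * B * C * (1 / P + 1 / Q)"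
    using A B C PQ by (simp add: \<alpha>_def \<beta>_def \<gamma>_def powr_minus field_simps)
  finally show ?thesis using PQ by simp
qed

text \<open>The endpoint p = 1, q = \<infinity> of the three-factor inequality, where the exponents
  2 p are 2. The weights B / (2 A) and A / (2 B) balance the two squares at the given norms.\<close>

lemma Cauchy_Schwarz_Lp:
  assumes [measurable]: "f \<in> borel_measurable M" "g \<in> borel_measurable M"
    and A: "0 < A" "Lp_norm 2 M f = ennreal A" and B: "0 < B" "Lp_norm 2 M g = ennreal B"
  shows "(\<integral>\<^sup>+x. f x * g x \<partial>M) \<le> ennreal (A * B)"
proof -
  have sq: "(\<integral>\<^sup>+x. ennreal_powr (f x) 2 \<partial>M) = ennreal (A\<^sup>2)" "(\<integral>\<^sup>+x. ennreal_powr (g x) 2 \<partial>M) = ennreal (B\<^sup>2)"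
    using Lp_norm_powr[of 2 M f] Lp_norm_powr[of 2 M g] A B by (simp_all add: ennreal_powr_ennreal)
  have pointwise: "x * y \<le> ennreal (B / (2 * A)) * ennreal_powr x 2 + ennreal (A / (2 * B)) * ennreal_powr y 2"
    for x y :: ennreal
  proof (cases "x = top \<or> y = top")
    case True
    then show ?thesis using A B by (auto simp: ennreal_mult_top)
  next
    case False
    then obtain a b where *: "x = ennreal a" "y = ennreal b" "0 \<le> a" "0 \<le> b"
      by (cases x; cases y) auto
    have "a * b \<le> B / (2 * A) * a\<^sup>2 + A / (2 * B) * b\<^sup>2"
      using sum_squares_bound[of "B * a" "A * b"] A B
      by (simp add: field_simps power2_eq_square)
    then show ?thesis
      using * A B by (simp add: ennreal_powr_ennreal flip: ennreal_mult ennreal_plus)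
  qed
  have "(\<integral>\<^sup>+x. f x * g x \<partial>M) \<le> (\<integral>\<^sup>+x. ennreal (B / (2 * A)) * ennreal_powr (f x) 2 +
      ennreal (A / (2 * B)) * ennreal_powr (g x) 2 \<partial>M)"
    by (intro nn_integral_mono pointwise)
  also have "\<dots> = ennreal (B / (2 * A)) * ennreal (A\<^sup>2) + ennreal (A / (2 * B)) * ennreal (B\<^sup>2)"
    by (simp add: nn_integral_add nn_integral_cmult sq)
  also have "\<dots> = ennreal (B / (2 * A) * A\<^sup>2 + A / (2 * B) * B\<^sup>2)"
    using A B by (simp flip: ennreal_mult ennreal_plus)
  also have "B / (2 * A) * A\<^sup>2 + A / (2 * B) * B\<^sup>2 = A * B"
    using A B by (simp add: power2_eq_square)
  finally show ?thesis .
qed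

lemma conjugate_exponent_cases:
  assumes "1 \<le> (p::ennreal)" "1 \<le> q" "1 / p + 1 / q = 1"
  obtains "p = \<infinity>" "q = 1" | "p = 1" "q = \<infinity>"
  | P Q where "1 < P" "1 < Q" "1 / P + 1 / Q = 1" "p = ennreal P" "q = ennreal Q"
proof -
  have one: "x = 1" if "1 / x = 1" for x :: ennreal
  proof (cases x)
    case (real r)
    with that show ?thesis
      by (cases "r = 0") (auto simp: divide_ennreal simp flip: ennreal_1)
  qed (use that in simp)
  show ?thesis
    using assms(1)
  proof (cases p rule: exponent_cases)
    case 1
    then show ?thesis using assms that(1) one by simp
  next
    case p: (2 P)
    show ?thesis
      using assms(2)
    proof (cases q rule: exponent_cases)
      case 1
      then show ?thesis using assms that(2) one by simp
    next
      case q: (2 Q)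
      have "ennreal (1 / P + 1 / Q) = ennreal 1"
        using assms(3) p q divide_ennreal[of 1 P] divide_ennreal[of 1 Q] by simp
      then have *: "1 / P + 1 / Q = 1" using p q by (subst (asm) ennreal_inj) auto
      moreover have "P \<noteq> 1" "Q \<noteq> 1" using * p q by auto
      ultimately show ?thesis using that(3)[of P Q] p q by auto
    qed
  qed
qed

text \<open>A vanishing norm is treated before an infinite one, because 0 * \<infinity> = 0 in
  \<open>ennreal\<close>: the right-hand side is then 0 and the integrand vanishes almost
  everywhere. Once all three norms are nonzero, an infinite one makes the bound trivial.\<close>

lemma Hoelder_three:
  assumes [measurable]: "f \<in> borel_measurable M" "g \<in> borel_measurable M" "h \<in> borel_measurable M"
    and pq: "1 \<le> p" "1 \<le> q" "1 / p + 1 / q = 1"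
  shows "(\<integral>\<^sup>+x. f x * g x * h x \<partial>M) \<le> Lp_norm (2 * p) M f * Lp_norm (2 * p) M g * Lp_norm q M h"
proof (cases "Lp_norm (2 * p) M f = 0 \<or> Lp_norm (2 * p) M g = 0 \<or> Lp_norm q M h = 0")
  case True
  have "1 \<le> 2 * p" using pq by (metis mult_mono' mult.right_neutral one_le_numeral zero_le)
  with True have "AE x in M. f x * g x * h x = 0"
    using Lp_norm_eq_0_AE[of f M "2 * p"] Lp_norm_eq_0_AE[of g M "2 * p"] Lp_norm_eq_0_AE[of h M q] pq
    by (auto elim!: eventually_mono)
  then have "(\<integral>\<^sup>+x. f x * g x * h x \<partial>M) = 0" by (subst nn_integral_0_iff_AE) auto
  then show ?thesis by simp
next
  case nz: False
  show ?thesis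
  proof (cases "Lp_norm (2 * p) M f = top \<or> Lp_norm (2 * p) M g = top \<or> Lp_norm q M h = top")
    case True
    with nz show ?thesis by (auto simp: ennreal_mult_top ennreal_top_mult)
  next
    case False
    with nz obtain A B C where ABC: "0 < A" "0 < B" "0 < C" "Lp_norm (2 * p) M f = ennreal A"
      "Lp_norm (2 * p) M g = ennreal B" "Lp_norm q M h = ennreal C"
      by (cases "Lp_norm (2 * p) M f"; cases "Lp_norm (2 * p) M g"; cases "Lp_norm q M h")
        (auto simp: less_le)
    have "(\<integral>\<^sup>+x. f x * g x * h x \<partial>M) \<le> ennreal (A * B * C)"
      using pq
    proof (cases rule: conjugate_exponent_cases)
      case 1
      have "AE x in M. f x \<le> ennreal A" "AE x in M. g x \<le> ennreal B"
        using esssup_AE[where f=f and M=M] esssup_AE[where f=g and M=M] ABC 1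
        by (simp_all add: Lp_norm_inf ennreal_mult_top)
      then have "(\<integral>\<^sup>+x. f x * g x * h x \<partial>M) \<le> (\<integral>\<^sup>+x. ennreal A * ennreal B * h x \<partial>M)"
        by (intro nn_integral_mono_AE, eventually_elim) (auto intro!: mult_mono)
      also have "\<dots> = ennreal A * ennreal B * ennreal C"
        using ABC 1 Lp_norm_ennreal[of 1 M h] by (simp add: nn_integral_cmult)
      finally show ?thesis using ABC by (simp add: ennreal_mult)
    next
      case 2
      have "AE x in M. h x \<le> ennreal C"
        using esssup_AE[where f=h and M=M] ABC 2 by (simp add: Lp_norm_inf)
      then have "(\<integral>\<^sup>+x. f x * g x * h x \<partial>M) \<le> (\<integral>\<^sup>+x. f x * g x * ennreal C \<partial>M)"
        by (intro nn_integral_mono_AE) (auto elim!: eventually_mono intro!: mult_mono)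
      also have "\<dots> = (\<integral>\<^sup>+x. f x * g x \<partial>M) * ennreal C"
        by (rule nn_integral_multc) measurable
      also have "\<dots> \<le> ennreal (A * B) * ennreal C"
        using ABC 2 by (intro mult_right_mono Cauchy_Schwarz_Lp) auto
      finally show ?thesis using ABC by (simp add: ennreal_mult)
    next
      case (3 P Q)
      with ABC show ?thesis by (intro Hoelder_three_finite) auto
    qed
    with ABC show ?thesis by (simp add: ennreal_mult)
  qed
qed

section \<open>Minkowski's inequality\<close>

text \<open>Convexity of the P-th power at the mean of x / A and y / B with weights A / (A + B) and
  B / (A + B). For \<open>A\<close> and \<open>B\<close> the norms of two functions, integration
  turns the right-hand side into (A + B)^P.\<close>

lemma powr_add_le:
  fixes x y A B P :: real
  assumes "1 \<le> P" "0 < A" "0 < B" "0 \<le> x" "0 \<le> y"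
  shows "(x + y) powr P \<le>
    (A + B) powr (P - 1) * (A powr (1 - P) * x powr P + B powr (1 - P) * y powr P)"
proof -
  \<comment> \<open>At the endpoint 0 the convexity inequality reduces to s^P \<le> s for 0 < s < 1;
    elsewhere it is convexity on the open half-line.\<close>
  have conv: "convex_on {0..} (\<lambda>x::real. x powr P)"
  proof (rule convex_onI)
    fix t x y :: real assume t: "0 < t" "t < 1" and xy: "x \<in> {0..}" "y \<in> {0..}"
    have tP: "s powr P \<le> s" if "0 < s" "s < 1" for s
      using powr_mono'[of 1 P s] that assms by simp
    consider "x = 0" | "y = 0" | "0 < x" "0 < y" using xy by fastforce
    then show "((1 - t) *\<^sub>R x + t *\<^sub>R y) powr P \<le> (1 - t) * x powr P + t * y powr P"
    proof cases
      case 1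
      then show ?thesis using t tP[of t] xy by (simp add: powr_mult mult_right_mono)
    next
      case 2
      then show ?thesis using t tP[of "1 - t"] xy by (simp add: powr_mult mult_right_mono)
    next
      case 3
      then show ?thesis using convex_onD[OF powr_convex[OF assms(1)], of t x y] t by simp
    qed
  qed (rule convex_real_interval)
  have "((1 - B / (A + B)) *\<^sub>R (x / A) + (B / (A + B)) *\<^sub>R (y / B)) powr P
      \<le> (1 - B / (A + B)) * (x / A) powr P + B / (A + B) * (y / B) powr P"
    using assms by (intro convex_onD[OF conv]) auto
  moreover have "1 - B / (A + B) = A / (A + B)" using assms by (simp add: field_simps)
  moreover have "A / (A + B) * (x / A) + B / (A + B) * (y / B) = (x + y) / (A + B)"
    using assms by (simp add: add_divide_distrib)
  ultimately have "((x + y) / (A + B)) powr P \<le> A / (A + B) * (x / A) powr P + B / (A + B) * (y / B) powr P"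
    by simp
  then have "(x + y) powr P \<le> (A + B) powr P * (A / (A + B) * (x / A) powr P + B / (A + B) * (y / B) powr P)"
    using assms by (simp add: powr_divide pos_divide_le_eq mult.commute)
  also have "\<dots> = (A + B) powr (P - 1) * (A powr (1 - P) * x powr P + B powr (1 - P) * y powr P)"
    using assms by (simp add: powr_divide powr_diff algebra_simps)
  finally show ?thesis .
qed

lemma Minkowski:
  assumes [measurable]: "f \<in> borel_measurable M" "g \<in> borel_measurable M" and p: "1 \<le> p"
  shows "Lp_norm p M (\<lambda>x. f x + g x) \<le> Lp_norm p M f + Lp_norm p M g"
proof -
  consider "AE x in M. f x = 0" | "AE x in M. g x = 0"
    | "Lp_norm p M f = top \<or> Lp_norm p M g = top"
    | A B where "0 < A" "Lp_norm p M f = ennreal A" "0 < B" "Lp_norm p M g = ennreal B"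
    using Lp_norm_pos_cases[OF assms(1) p] Lp_norm_pos_cases[OF assms(2) p] by metis
  then show ?thesis
  proof cases
    case 1
    then have "Lp_norm p M (\<lambda>x. f x + g x) \<le> Lp_norm p M g"
      by (intro Lp_norm_mono_AE p) (auto elim!: eventually_mono)
    then show ?thesis by (simp add: add_increasing)
  next
    case 2
    then have "Lp_norm p M (\<lambda>x. f x + g x) \<le> Lp_norm p M f"
      by (intro Lp_norm_mono_AE p) (auto elim!: eventually_mono)
    then show ?thesis by (simp add: add_increasing2)
  next
    case 3
    then show ?thesis by auto
  next
    case AB: 4
    show ?thesis
      using p
    proof (cases p rule: exponent_cases)
      case 1
      have "AE x in M. f x + g x \<le> esssup M f + esssup M g"
        using esssup_AE[where f=f and M=M] esssup_AE[where f=g and M=M] by eventually_elim (rule add_mono)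
      with 1 show ?thesis by (auto simp: Lp_norm_inf)
    next
      case (2 P)
      define \<alpha> where "\<alpha> = (A + B) powr (P - 1) * A powr (1 - P)"
      define \<beta> where "\<beta> = (A + B) powr (P - 1) * B powr (1 - P)"
      have pos: "0 < \<alpha>" "0 < \<beta>" using AB by (simp_all add: \<alpha>_def \<beta>_def)
      have pointwise: "ennreal_powr (x + y) P \<le> ennreal \<alpha> * ennreal_powr x P + ennreal \<beta> * ennreal_powr y P"
        for x y :: ennreal
      proof (cases "x = top \<or> y = top")
        case True
        then show ?thesis using pos by (auto simp: ennreal_mult_top)
      next
        case False
        then obtain a b where *: "x = ennreal a" "y = ennreal b" "0 \<le> a" "0 \<le> b"
          by (cases x; cases y) auto
        have "(a + b) powr P \<le> \<alpha> * a powr P + \<beta> * b powr P"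
          using powr_add_le[OF 2(1) AB(1,3) *(3,4)] by (simp add: \<alpha>_def \<beta>_def algebra_simps)
        then show ?thesis
          using * pos by (simp add: ennreal_powr_ennreal flip: ennreal_mult ennreal_plus)
      qed
      have "(\<integral>\<^sup>+x. ennreal_powr (f x + g x) P \<partial>M) \<le>
          (\<integral>\<^sup>+x. ennreal \<alpha> * ennreal_powr (f x) P + ennreal \<beta> * ennreal_powr (g x) P \<partial>M)"
        by (intro nn_integral_mono pointwise)
      also have "\<dots> = ennreal \<alpha> * ennreal (A powr P) + ennreal \<beta> * ennreal (B powr P)"
        using AB 2 Lp_norm_powr[of P M f] Lp_norm_powr[of P M g]
        by (simp add: nn_integral_add nn_integral_cmult ennreal_powr_ennreal)
      also have "\<dots> = ennreal (\<alpha> * A powr P + \<beta> * B powr P)"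
        using pos by (simp flip: ennreal_mult ennreal_plus)
      also have "\<alpha> * A powr P + \<beta> * B powr P = (A + B) powr (P - 1) * (A + B)"
      proof -
        have "c powr (1 - P) * c powr P = c" if "0 < c" for c
          using that by (simp flip: powr_add)
        from this[OF AB(1)] this[OF AB(3)] show ?thesis
          by (simp add: \<alpha>_def \<beta>_def mult.assoc distrib_left)
      qed
      also have "\<dots> = (A + B) powr P"
        using AB by (simp add: powr_diff)
      finally have "Lp_norm p M (\<lambda>x. f x + g x) \<le> ennreal_powr (ennreal ((A + B) powr P)) (1 / P)"
        using 2 by (auto simp: Lp_norm_def intro!: ennreal_powr_mono)
      also have "\<dots> = ennreal (A + B)"
        using AB 2 by (simp add: ennreal_powr_ennreal powr_powr)
      finally show ?thesis using AB by simp
    qed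
  qed
qed

lemma Lp_norm_const_finite:
  assumes "finite_measure M" "1 \<le> p"
  shows "Lp_norm p M (\<lambda>x. ennreal c) < \<infinity>"
  using assms(2)
proof (cases p rule: exponent_cases)
  case 1
  have "esssup M (\<lambda>x. ennreal c) \<le> ennreal c" by (intro esssup_I) auto
  with 1 show ?thesis by (simp add: Lp_norm_inf order.strict_trans1)
next
  case (2 P)
  interpret finite_measure M by fact
  have "(\<integral>\<^sup>+x. ennreal_powr (ennreal c) P \<partial>M) < top"
    using emeasure_finite[of "space M"]
    by (auto simp: ennreal_powr_def less_top[symmetric] ennreal_mult_eq_top_iff)
  with 2 show ?thesis by (simp add: Lp_norm_def flip: less_top)
qed

section \<open>Integration over the torus\<close>

lemma lattice_vec_nth [simp]: "lattice_vec k $ i = real_of_int (k $ i)"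
  by (simp add: lattice_vec_def)

lemma lattice_vec_simps [simp]:
  "lattice_vec 0 = 0" "lattice_vec (- k) = - lattice_vec k"
  "lattice_vec (k + l) = lattice_vec k + lattice_vec l"
  "lattice_vec (k - l) = lattice_vec k - lattice_vec l"
  by (simp_all add: vec_eq_iff)

text \<open>The projection to the torus. A periodic function factors through \<open>wrap\<close>, so
  translation invariance becomes an identity between image measures under \<open>wrap\<close>, which
  then serves Banach-valued integrals as well as nonnegative ones.\<close>

definition wrap :: "real ^ 3 \<Rightarrow> real ^ 3" where
  "wrap x = x - lattice_vec (\<chi> i. \<lfloor>x $ i\<rfloor>)"

lemma wrap_periodic: "wrap (x + lattice_vec k) = wrap x"
  by (simp add: wrap_def vec_eq_iff)

lemma periodic_wrap: "periodic f \<Longrightarrow> f (wrap x) = f x"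
proof -
  assume "periodic f"
  then have "f (x + lattice_vec (- (\<chi> i. \<lfloor>x $ i\<rfloor>))) = f x" unfolding periodic_def by blast
  then show ?thesis unfolding wrap_def by simp
qed

lemma wrap_measurable [measurable]: "wrap \<in> borel_measurable borel"
proof -
  have "wrap = (\<lambda>x. \<Sum>b\<in>Basis. (frac (x \<bullet> b)) *\<^sub>R b)"
  proof
    fix x :: "real ^ 3"
    show "wrap x = (\<Sum>b\<in>Basis. (frac (x \<bullet> b)) *\<^sub>R b)"
      by (rule euclidean_eqI)
        (auto simp: wrap_def inner_sum_left inner_Basis Basis_vec_def inner_axis frac_def if_distrib cong: if_cong)
  qed
  moreover have "(\<lambda>x::real^3. \<Sum>b\<in>Basis. (frac (x \<bullet> b)) *\<^sub>R b) \<in> borel_measurable borel"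
    unfolding frac_def by measurable
  ultimately show ?thesis by simp
qed

text \<open>The half-open cell: its lattice translates tile space without overlap, so exactly one of
  them contains a given point. It differs from the closed cube of \<open>torus\<close> by a null
  set.\<close>

definition unit_cell :: "(real ^ 3) set" where
  "unit_cell = {x. \<forall>i. 0 \<le> x $ i \<and> x $ i < 1}"

lemma unit_cell_measurable [measurable]: "unit_cell \<in> sets borel"
  unfolding unit_cell_def by measurable

lemma in_unit_cell_shift_iff:
  "x + lattice_vec k \<in> unit_cell \<longleftrightarrow> k = - (\<chi> i. \<lfloor>x $ i\<rfloor>)"
proof -
  have "0 \<le> r + real_of_int m \<and> r + real_of_int m < 1 \<longleftrightarrow> m = - \<lfloor>r\<rfloor>" for r m
    by linarith
  then show ?thesis by (simp add: unit_cell_def vec_eq_iff)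
qed

lemma sum_indicator_unit_cell:
  "(\<integral>\<^sup>+k. indicator unit_cell (x + lattice_vec k) \<partial>count_space UNIV) = 1"
proof -
  have "(\<integral>\<^sup>+k. indicator unit_cell (x + lattice_vec k) \<partial>count_space UNIV) =
      (\<integral>\<^sup>+k. indicator {- (\<chi> i. \<lfloor>x $ i\<rfloor>)} k \<partial>count_space UNIV)"
    by (intro nn_integral_cong) (simp add: indicator_def in_unit_cell_shift_iff)
  then show ?thesis by simp
qed

lemma AE_cbox_unit_cell:
  "AE x in lborel. x \<in> cbox 0 1 \<longleftrightarrow> x \<in> unit_cell"
proof -
  have "emeasure lborel (cbox 0 1 - box 0 (1::real^3)) = 0"
    by (subst emeasure_Diff) (auto simp: emeasure_lborel_cbox_eq emeasure_lborel_box_eq box_subset_cbox)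
  then have "AE x in lborel. x \<notin> cbox 0 1 - box 0 (1::real^3)"
    by (intro AE_not_in) (auto simp: null_sets_def)
  then show ?thesis
    by eventually_elim (auto simp: mem_box_cart unit_cell_def less_le)
qed

lemma nn_integral_torus:
  assumes [measurable]: "f \<in> borel_measurable borel"
  shows "(\<integral>\<^sup>+x. f x \<partial>torus) = (\<integral>\<^sup>+x. indicator unit_cell x * f x \<partial>lborel)"
  unfolding torus_def using AE_cbox_unit_cell
  by (subst nn_integral_restrict_space)
    (auto intro!: nn_integral_cong_AE elim!: eventually_mono simp: indicator_def)

lemma nn_integral_lborel_shift:
  fixes f :: "real ^ 3 \<Rightarrow> ennreal"
  assumes [measurable]: "f \<in> borel_measurable borel"
  shows "(\<integral>\<^sup>+x. f (x + h) \<partial>lborel) = (\<integral>\<^sup>+x. f x \<partial>lborel)"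
proof -
  have "(\<integral>\<^sup>+x. f x \<partial>lborel) = (\<integral>\<^sup>+x. f x \<partial>distr lborel borel ((+) h))"
    by (simp add: lborel_distr_plus)
  also have "\<dots> = (\<integral>\<^sup>+x. f (h + x) \<partial>lborel)"
    by (subst nn_integral_distr) auto
  finally show ?thesis by (simp add: add.commute)
qed

text \<open>Any two fundamental cells of the lattice give the same integral of a periodic function.
  The constant 1 is expanded as the sum over the lattice translates of the indicator of the cell,
  the sum is exchanged with the integral, and each piece is translated back by periodicity.\<close>

lemma nn_integral_torus_shift:
  fixes f :: "real ^ 3 \<Rightarrow> ennreal"
  assumes [measurable]: "f \<in> borel_measurable borel" and f: "periodic f"
  shows "(\<integral>\<^sup>+x. f (x + h) \<partial>torus) = (\<integral>\<^sup>+x. f x \<partial>torus)"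
proof -
  have fk: "f (x + lattice_vec k) = f x" for x k using f by (simp add: periodic_def)
  have "(\<integral>\<^sup>+x. f (x + h) \<partial>torus) = (\<integral>\<^sup>+x. indicator unit_cell x * f (x + h) \<partial>lborel)"
    by (rule nn_integral_torus) measurable
  also have "\<dots> = (\<integral>\<^sup>+x. indicator unit_cell (x - h) * f x \<partial>lborel)"
    using nn_integral_lborel_shift[of "\<lambda>x. indicator unit_cell (x - h) * f x" h] by simp
  also have "\<dots> = (\<integral>\<^sup>+x. \<integral>\<^sup>+k. indicator unit_cell (x - h) * f x * indicator unit_cell (x + lattice_vec k)
      \<partial>count_space UNIV \<partial>lborel)"
    by (simp add: nn_integral_cmult sum_indicator_unit_cell)
  also have "\<dots> = (\<integral>\<^sup>+k. \<integral>\<^sup>+x. indicator unit_cell (x - h) * f x * indicator unit_cell (x + lattice_vec k)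
      \<partial>lborel \<partial>count_space UNIV)"
    by (rule nn_integral_count_space_nn_integral) auto
  also have "\<dots> = (\<integral>\<^sup>+k. \<integral>\<^sup>+x. indicator unit_cell (x - h + lattice_vec k) * f x * indicator unit_cell x
      \<partial>lborel \<partial>count_space UNIV)"
  proof (rule trans[OF _ nn_integral_bij_count_space[where g = uminus]])
    show "bij_betw uminus (UNIV::(int^3) set) UNIV" by (rule bij_uminus)
    show "(\<integral>\<^sup>+k. \<integral>\<^sup>+x. indicator unit_cell (x - h) * f x * indicator unit_cell (x + lattice_vec k)
      \<partial>lborel \<partial>count_space UNIV) = (\<integral>\<^sup>+k. \<integral>\<^sup>+x. indicator unit_cell (x - h + lattice_vec (- k)) * f x * indicator unit_cell x
      \<partial>lborel \<partial>count_space UNIV)"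
    proof (rule nn_integral_cong)
      fix k
      show "(\<integral>\<^sup>+x. indicator unit_cell (x - h) * f x * indicator unit_cell (x + lattice_vec k) \<partial>lborel) =
        (\<integral>\<^sup>+x. indicator unit_cell (x - h + lattice_vec (- k)) * f x * indicator unit_cell x \<partial>lborel)"
        using nn_integral_lborel_shift[of "\<lambda>x. indicator unit_cell (x - h + lattice_vec (- k)) * f x * indicator unit_cell x" "lattice_vec k"]
        by (simp add: fk algebra_simps)
    qed
  qed
  also have "\<dots> = (\<integral>\<^sup>+x. \<integral>\<^sup>+k. f x * indicator unit_cell x * indicator unit_cell (x - h + lattice_vec k)
      \<partial>count_space UNIV \<partial>lborel)"
    by (subst nn_integral_count_space_nn_integral) (auto intro!: nn_integral_cong simp: mult_ac)
  also have "\<dots> = (\<integral>\<^sup>+x. indicator unit_cell x * f x \<partial>lborel)"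
    by (simp add: nn_integral_cmult sum_indicator_unit_cell mult.commute)
  also have "\<dots> = (\<integral>\<^sup>+x. f x \<partial>torus)"
    by (rule nn_integral_torus[symmetric]) measurable
  finally show ?thesis .
qed

lemma nn_integral_centred_torus:
  fixes f :: "real ^ 3 \<Rightarrow> ennreal"
  assumes [measurable]: "f \<in> borel_measurable borel" and f: "periodic f"
  shows "(\<integral>\<^sup>+h. f h \<partial>centred_torus) = (\<integral>\<^sup>+x. f x \<partial>torus)"
proof -
  define c :: "real ^ 3" where "c = (\<chi> i. 1 / 2)"
  have mem: "h - c \<in> {h. \<forall>i. \<bar>h $ i\<bar> \<le> 1 / 2} \<longleftrightarrow> h \<in> cbox 0 1" for h
    by (auto simp: mem_box_cart c_def abs_le_iff field_simps)
  have [measurable]: "{h::real^3. \<forall>i. \<bar>h $ i\<bar> \<le> 1 / 2} \<in> sets borel" by measurable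
  have "(\<integral>\<^sup>+h. f h \<partial>centred_torus) = (\<integral>\<^sup>+h. f h * indicator {h. \<forall>i. \<bar>h $ i\<bar> \<le> 1 / 2} h \<partial>lborel)"
    unfolding centred_torus_def by (rule nn_integral_restrict_space) simp
  also have "\<dots> = (\<integral>\<^sup>+h. f (h + - c) * indicator {h. \<forall>i. \<bar>h $ i\<bar> \<le> 1 / 2} (h + - c) \<partial>lborel)"
    by (rule nn_integral_lborel_shift[symmetric]) measurable
  also have "\<dots> = (\<integral>\<^sup>+h. f (h + - c) * indicator (cbox 0 1) h \<partial>lborel)"
    using mem by (intro nn_integral_cong) (simp add: indicator_def)
  also have "\<dots> = (\<integral>\<^sup>+h. f (h + - c) \<partial>torus)"
    unfolding torus_def by (rule nn_integral_restrict_space[symmetric]) simp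
  also have "\<dots> = (\<integral>\<^sup>+h. f h \<partial>torus)"
    by (rule nn_integral_torus_shift) (use f in auto)
  finally show ?thesis .
qed

lemma space_centred_torus: "space centred_torus = {h. \<forall>i. \<bar>h $ i\<bar> \<le> 1 / 2}"
  by (simp add: centred_torus_def space_restrict_space)

lemma borel_measurable_torus [measurable (raw)]:
  "f \<in> borel \<rightarrow>\<^sub>M N \<Longrightarrow> f \<in> torus \<rightarrow>\<^sub>M N"
  unfolding torus_def by (rule measurable_restrict_space1) (simp add: measurable_lborel1)

lemma borel_measurable_centred_torus [measurable (raw)]:
  "f \<in> borel \<rightarrow>\<^sub>M N \<Longrightarrow> f \<in> centred_torus \<rightarrow>\<^sub>M N"
  unfolding centred_torus_def by (rule measurable_restrict_space1) (simp add: measurable_lborel1)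

lemma emeasure_torus: "emeasure torus (space torus) = 1"
proof -
  have "emeasure torus (space torus) = emeasure lborel (cbox 0 (1::real^3))"
    unfolding torus_def by (subst emeasure_restrict_space) (auto simp: space_restrict_space)
  also have "\<dots> = 1"
    by (subst emeasure_lborel_cbox) (auto simp: Basis_vec_def inner_axis intro!: prod.neutral)
  finally show ?thesis .
qed

lemma emeasure_centred_torus: "emeasure centred_torus (space centred_torus) = 1"
proof -
  have "emeasure centred_torus (space centred_torus) = (\<integral>\<^sup>+h. 1 \<partial>centred_torus)" by simp
  also have "\<dots> = (\<integral>\<^sup>+h. 1 \<partial>torus)"
    by (rule nn_integral_centred_torus) (auto simp: periodic_def)
  finally show ?thesis by (simp add: emeasure_torus)
qed

interpretation torus: finite_measure torus
  by standard (simp add: emeasure_torus)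

interpretation centred_torus: finite_measure centred_torus
  by standard (simp add: emeasure_centred_torus)

lemma measure_torus [simp]: "measure torus (space torus) = 1"
  by (simp add: measure_def emeasure_torus)

lemma distr_torus_shift: "distr torus borel (\<lambda>x. wrap (x + h)) = distr torus borel wrap"
proof (rule measure_eqI)
  fix A assume "A \<in> sets (distr torus borel (\<lambda>x. wrap (x + h)))"
  then have [measurable]: "A \<in> sets borel" by simp
  have "emeasure (distr torus borel (\<lambda>x. wrap (x + h))) A = (\<integral>\<^sup>+x. indicator A (wrap (x + h)) \<partial>torus)"
    by (subst nn_integral_indicator[symmetric], simp, subst nn_integral_distr) auto
  also have "\<dots> = (\<integral>\<^sup>+x. indicator A (wrap x) \<partial>torus)"
    by (rule nn_integral_torus_shift) (auto simp: periodic_def wrap_periodic)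
  also have "\<dots> = emeasure (distr torus borel wrap) A"
    by (subst nn_integral_indicator[symmetric], simp, subst nn_integral_distr) auto
  finally show "emeasure (distr torus borel (\<lambda>x. wrap (x + h))) A = emeasure (distr torus borel wrap) A" .
qed simp

lemma distr_centred_torus_shift: "distr centred_torus borel (\<lambda>x. wrap (x + h)) = distr torus borel wrap"
proof (rule measure_eqI)
  fix A assume "A \<in> sets (distr centred_torus borel (\<lambda>x. wrap (x + h)))"
  then have [measurable]: "A \<in> sets borel" by simp
  have "emeasure (distr centred_torus borel (\<lambda>x. wrap (x + h))) A = (\<integral>\<^sup>+x. indicator A (wrap (x + h)) \<partial>centred_torus)"
    by (subst nn_integral_indicator[symmetric], simp, subst nn_integral_distr) auto
  also have "\<dots> = (\<integral>\<^sup>+x. indicator A (wrap (x + h)) \<partial>torus)"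
  proof (rule nn_integral_centred_torus)
    have "wrap (x + lattice_vec k + h) = wrap (x + h)" for x k
      using wrap_periodic[of "x + h" k] by (simp add: ac_simps)
    then show "periodic (\<lambda>x. indicator A (wrap (x + h)) :: ennreal)" by (simp add: periodic_def)
  qed measurable
  also have "\<dots> = (\<integral>\<^sup>+x. indicator A (wrap x) \<partial>torus)"
    by (rule nn_integral_torus_shift) (auto simp: periodic_def wrap_periodic)
  also have "\<dots> = emeasure (distr torus borel wrap) A"
    by (subst nn_integral_indicator[symmetric], simp, subst nn_integral_distr) auto
  finally show "emeasure (distr centred_torus borel (\<lambda>x. wrap (x + h))) A = emeasure (distr torus borel wrap) A" .
qed simp

lemma
  fixes f :: "real ^ 3 \<Rightarrow> 'b :: {banach, second_countable_topology}"
  assumes [measurable]: "f \<in> borel_measurable borel" and f: "periodic f"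
  shows integrable_torus_shift: "integrable torus (\<lambda>x. f (x + h)) \<longleftrightarrow> integrable torus f"
    and integral_torus_shift: "(LINT x|torus. f (x + h)) = (LINT x|torus. f x)"
    and integrable_centred_torus_shift: "integrable centred_torus (\<lambda>x. f (x + h)) \<longleftrightarrow> integrable torus f"
    and integral_centred_torus_shift: "(LINT x|centred_torus. f (x + h)) = (LINT x|torus. f x)"
proof -
  have "integrable torus (\<lambda>x. f (wrap (x + h))) \<longleftrightarrow> integrable (distr torus borel (\<lambda>x. wrap (x + h))) f"
    by (subst integrable_distr_eq) auto
  also have "\<dots> \<longleftrightarrow> integrable torus (\<lambda>x. f (wrap x))"
    unfolding distr_torus_shift by (subst integrable_distr_eq) auto
  finally show "integrable torus (\<lambda>x. f (x + h)) \<longleftrightarrow> integrable torus f"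
    by (simp add: periodic_wrap f)
  have "integrable centred_torus (\<lambda>x. f (wrap (x + h))) \<longleftrightarrow> integrable (distr centred_torus borel (\<lambda>x. wrap (x + h))) f"
    by (subst integrable_distr_eq) auto
  also have "\<dots> \<longleftrightarrow> integrable torus (\<lambda>x. f (wrap x))"
    unfolding distr_centred_torus_shift by (subst integrable_distr_eq) auto
  finally show "integrable centred_torus (\<lambda>x. f (x + h)) \<longleftrightarrow> integrable torus f"
    by (simp add: periodic_wrap f)
  have "(LINT x|torus. f (wrap (x + h))) = (LINT x|distr torus borel (\<lambda>x. wrap (x + h)). f x)"
    by (subst integral_distr) auto
  also have "\<dots> = (LINT x|torus. f (wrap x))"
    unfolding distr_torus_shift by (subst integral_distr) auto
  finally show "(LINT x|torus. f (x + h)) = (LINT x|torus. f x)"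
    by (simp add: periodic_wrap f)
  have "(LINT x|centred_torus. f (wrap (x + h))) = (LINT x|distr centred_torus borel (\<lambda>x. wrap (x + h)). f x)"
    by (subst integral_distr) auto
  also have "\<dots> = (LINT x|torus. f (wrap x))"
    unfolding distr_centred_torus_shift by (subst integral_distr) auto
  finally show "(LINT x|centred_torus. f (x + h)) = (LINT x|torus. f x)"
    by (simp add: periodic_wrap f)
qed

lemma integrable_torus_bounded:
  fixes f :: "real ^ 3 \<Rightarrow> 'b :: {banach, second_countable_topology}"
  assumes "f \<in> borel_measurable borel" "\<And>x. norm (f x) \<le> B"
  shows "integrable torus f" "integrable centred_torus f"
  using assms by (auto intro!: torus.integrable_const_bound[where B = B] centred_torus.integrable_const_bound[where B = B])

section \<open>Integrals of trigonometric modes\<close>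

lemma periodic_mode: "periodic (\<lambda>x. cos (2 * pi * (lattice_vec k \<bullet> x) + \<theta>))"
  unfolding periodic_def
proof safe
  fix x l
  have kl: "lattice_vec k \<bullet> lattice_vec l = of_int (\<Sum>i\<in>UNIV. k $ i * l $ i)"
    by (simp add: inner_vec_def)
  have "2 * pi * (lattice_vec k \<bullet> (x + lattice_vec l)) + \<theta> =
      (2 * pi * (lattice_vec k \<bullet> x) + \<theta>) + 2 * pi * of_int (\<Sum>i\<in>UNIV. k $ i * l $ i)"
    unfolding kl[symmetric] by (simp add: inner_add_right algebra_simps)
  then show "cos (2 * pi * (lattice_vec k \<bullet> (x + lattice_vec l)) + \<theta>) = cos (2 * pi * (lattice_vec k \<bullet> x) + \<theta>)"
    by (simp only: cos_add[of _ "2 * pi * of_int _"] cos_int_2pin sin_int_2pin mult_1_right mult_zero_right diff_zero)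
qed

text \<open>A shift by half a wavelength in a coordinate where k is nonzero changes the sign of the
  integrand but not the integral. The phase \<theta> covers cosine and sine modes at once.\<close>

lemma integral_torus_cos:
  "(LINT x|torus. cos (2 * pi * (lattice_vec k \<bullet> x) + \<theta>)) = (if k = 0 then cos \<theta> else 0)"
proof (cases "k = 0")
  case False
  then obtain j where j: "k $ j \<noteq> 0" by (auto simp: vec_eq_iff)
  define h :: "real ^ 3" where "h = axis j (1 / (2 * real_of_int (k $ j)))"
  let ?f = "\<lambda>x. cos (2 * pi * (lattice_vec k \<bullet> x) + \<theta>)"
  have "(LINT x|torus. ?f x) = (LINT x|torus. ?f (x + h))"
    by (intro integral_torus_shift[symmetric] periodic_mode) auto
  also have "(\<lambda>x. ?f (x + h)) = (\<lambda>x. - ?f x)"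
  proof
    fix x
    have "2 * pi * (lattice_vec k \<bullet> (x + h)) + \<theta> = (2 * pi * (lattice_vec k \<bullet> x) + \<theta>) + pi"
      using j by (simp add: inner_add_right h_def inner_axis algebra_simps)
    then show "?f (x + h) = - ?f x" by (simp only: cos_periodic_pi)
  qed
  finally have "(LINT x|torus. ?f x) = - (LINT x|torus. ?f x)" by simp
  then show ?thesis using False by simp
qed simp

section \<open>Smooth functions\<close>

lemma iterated_deriv_append:
  "iterated_deriv (vs @ [v]) f = iterated_deriv vs (\<lambda>x. frechet_derivative f (at x) v)"
  by (induction vs) simp_all

text \<open>The last entry of the list is the innermost derivative in \<open>iterated_deriv\<close>,
  so induction from the end of the list replaces f by a directional derivative of f, which stays in
  the class P.\<close>

lemma smooth_coinduct:
  assumes "P f"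
    and "\<And>f. P f \<Longrightarrow>
      (\<forall>x. f differentiable (at x)) \<and> (\<forall>v. P (\<lambda>x. frechet_derivative f (at x) v))"
  shows "smooth f"
proof -
  have "\<forall>f. P f \<longrightarrow> iterated_deriv vs f differentiable_on UNIV" for vs
    by (induction vs rule: rev_induct)
      (use assms(2) in \<open>auto simp: iterated_deriv_append differentiable_on_def\<close>)
  with assms(1) show ?thesis by (simp add: smooth_def)
qed

lemma smooth_differentiable: "smooth f \<Longrightarrow> f differentiable (at x)"
  unfolding smooth_def differentiable_on_def by (drule spec[of _ "[]"]) simp

lemma smooth_has_derivative: "smooth f \<Longrightarrow> (f has_derivative frechet_derivative f (at x)) (at x)"
  using smooth_differentiable frechet_derivative_works by blast

lemma smooth_frechet_derivative: "smooth f \<Longrightarrow> smooth (\<lambda>x. frechet_derivative f (at x) v)"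
  unfolding smooth_def by (simp flip: iterated_deriv_append)

lemma smooth_continuous_on: "smooth f \<Longrightarrow> continuous_on S f"
  by (meson continuous_at_imp_continuous_on differentiable_imp_continuous_within smooth_differentiable)

lemma smooth_borel_measurable:
  fixes f :: "'a::euclidean_space \<Rightarrow> 'b::euclidean_space"
  shows "smooth f \<Longrightarrow> f \<in> borel_measurable borel"
  by (intro borel_measurable_continuous_onI smooth_continuous_on)

lemma smooth_coinductI:
  assumes "P f"
    and "\<And>f x. P f \<Longrightarrow> \<exists>D. (\<forall>x. (f has_derivative D x) (at x)) \<and> (\<forall>v. P (\<lambda>x. D x v))"
  shows "smooth f"
  using assms(1)
proof (rule smooth_coinduct)
  fix f
  assume "P f"
  then obtain D where D: "\<And>x. (f has_derivative D x) (at x)" "\<And>v. P (\<lambda>x. D x v)"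
    using assms(2) by blast
  then have "frechet_derivative f (at x) = D x" for x
    by (metis frechet_derivative_at)
  with D show "(\<forall>x. f differentiable at x) \<and> (\<forall>v. P (\<lambda>x. frechet_derivative f (at x) v))"
    by (auto simp: differentiable_def)
qed

lemma smooth_const: "smooth (\<lambda>x. c)"
  by (rule smooth_coinductI[where P = "\<lambda>f. \<exists>c. f = (\<lambda>x. c)"])
    (auto intro!: exI[where x = "\<lambda>_ _. 0"])

lemma smooth_bounded_linear:
  assumes "bounded_linear A" shows "smooth A"
proof (rule smooth_coinductI[where P = "\<lambda>f. bounded_linear f \<or> (\<exists>c. f = (\<lambda>x. c))"])
  fix f :: "'a \<Rightarrow> 'b"
  assume "bounded_linear f \<or> (\<exists>c. f = (\<lambda>x. c))"
  then show "\<exists>D. (\<forall>x. (f has_derivative D x) (at x)) \<and>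
      (\<forall>v. bounded_linear (\<lambda>x. D x v) \<or> (\<exists>c. (\<lambda>x. D x v) = (\<lambda>x. c)))"
  proof
    assume "bounded_linear f"
    then show ?thesis
      by (intro exI[where x = "\<lambda>_. f"]) (auto intro: bounded_linear_imp_has_derivative)
  qed (auto intro!: exI[where x = "\<lambda>_ _. 0"])
qed (use assms in simp)

lemma smooth_add:
  assumes "smooth f" "smooth g" shows "smooth (\<lambda>x. f x + g x)"
proof (rule smooth_coinductI[where P = "\<lambda>h. \<exists>f g. smooth f \<and> smooth g \<and> h = (\<lambda>x. f x + g x)"])
  fix h
  assume "\<exists>f g. smooth f \<and> smooth g \<and> h = (\<lambda>x. f x + g x)"
  then obtain f g where *: "smooth f" "smooth g" "h = (\<lambda>x. f x + g x)" by blast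
  then show "\<exists>D. (\<forall>x. (h has_derivative D x) (at x)) \<and>
      (\<forall>v. \<exists>f g. smooth f \<and> smooth g \<and> (\<lambda>x. D x v) = (\<lambda>x. f x + g x))"
    by (intro exI[where x = "\<lambda>x v. frechet_derivative f (at x) v + frechet_derivative g (at x) v"])
      (auto intro!: has_derivative_add smooth_has_derivative smooth_frechet_derivative)
qed (use assms in blast)

lemma smooth_compose_linear:
  assumes "bounded_linear L" "smooth f" shows "smooth (\<lambda>x. L (f x))"
proof (rule smooth_coinductI[where P = "\<lambda>h. \<exists>f. smooth f \<and> h = (\<lambda>x. L (f x))"])
  fix h
  assume "\<exists>f. smooth f \<and> h = (\<lambda>x. L (f x))"
  then obtain f where "smooth f" "h = (\<lambda>x. L (f x))" by blast
  then show "\<exists>D. (\<forall>x. (h has_derivative D x) (at x)) \<and>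
      (\<forall>v. \<exists>f. smooth f \<and> (\<lambda>x. D x v) = (\<lambda>x. L (f x)))"
    by (intro exI[where x = "\<lambda>x v. L (frechet_derivative f (at x) v)"])
      (auto intro!: bounded_linear.has_derivative[OF assms(1)] smooth_has_derivative smooth_frechet_derivative)
qed (use assms in blast)

lemma smooth_compose_affine:
  assumes "bounded_linear A" "smooth f" shows "smooth (\<lambda>x. f (A x + c))"
proof (rule smooth_coinductI[where P = "\<lambda>h. \<exists>f. smooth f \<and> h = (\<lambda>x. f (A x + c))"])
  fix h
  assume "\<exists>f. smooth f \<and> h = (\<lambda>x. f (A x + c))"
  then obtain f where f: "smooth f" "h = (\<lambda>x. f (A x + c))" by blast
  have "((\<lambda>x. f (A x + c)) has_derivative (\<lambda>v. frechet_derivative f (at (A x + c)) (A v))) (at x)" for x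
  proof (rule has_derivative_compose[where f = "\<lambda>x. A x + c" and g = f and f' = A])
    show "((\<lambda>x. A x + c) has_derivative A) (at x)"
      using has_derivative_add[OF bounded_linear_imp_has_derivative[OF assms(1)] has_derivative_const]
      by simp
  qed (rule smooth_has_derivative[OF f(1)])
  with f show "\<exists>D. (\<forall>x. (h has_derivative D x) (at x)) \<and>
      (\<forall>v. \<exists>f. smooth f \<and> (\<lambda>x. D x v) = (\<lambda>x. f (A x + c)))"
    by (intro exI[where x = "\<lambda>x v. frechet_derivative f (at (A x + c)) (A v)"])
      (auto intro!: smooth_frechet_derivative)
qed (use assms in blast)

text \<open>Closing off under both sums and products makes the coinduction for products go through.\<close>

inductive smooth_closure :: "('a::real_normed_vector \<Rightarrow> real) \<Rightarrow> bool" where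
  base: "smooth f \<Longrightarrow> smooth_closure f"
| add: "smooth_closure f \<Longrightarrow> smooth_closure g \<Longrightarrow> smooth_closure (\<lambda>x. f x + g x)"
| mult: "smooth_closure f \<Longrightarrow> smooth_closure g \<Longrightarrow> smooth_closure (\<lambda>x. f x * g x)"
| comp: "smooth (\<phi> :: real \<Rightarrow> real) \<Longrightarrow> smooth_closure f \<Longrightarrow> smooth_closure (\<lambda>x. \<phi> (f x))"

lemma smooth_closure_derivative:
  "smooth_closure f \<Longrightarrow>
    \<exists>D. (\<forall>x. (f has_derivative D x) (at x)) \<and> (\<forall>v. smooth_closure (\<lambda>x. D x v))"
proof (induction rule: smooth_closure.induct)
  case (base f)
  then show ?case
    by (intro exI[where x = "\<lambda>x. frechet_derivative f (at x)"])
      (auto intro: smooth_has_derivative smooth_frechet_derivative smooth_closure.base)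
next
  case (add f g)
  then obtain D E where "\<And>x. (f has_derivative D x) (at x)" "\<And>x. (g has_derivative E x) (at x)"
    "\<And>v. smooth_closure (\<lambda>x. D x v)" "\<And>v. smooth_closure (\<lambda>x. E x v)" by blast
  then show ?case
    by (intro exI[where x = "\<lambda>x v. D x v + E x v"]) (auto intro!: has_derivative_add smooth_closure.add)
next
  case (mult f g)
  then obtain D E where "\<And>x. (f has_derivative D x) (at x)" "\<And>x. (g has_derivative E x) (at x)"
    "\<And>v. smooth_closure (\<lambda>x. D x v)" "\<And>v. smooth_closure (\<lambda>x. E x v)" by blast
  with mult.hyps show ?case
    by (intro exI[where x = "\<lambda>x v. f x * E x v + D x v * g x"])
      (auto intro!: has_derivative_mult smooth_closure.add smooth_closure.mult)
next
  case (comp \<phi> f)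
  then obtain D where D: "\<And>x. (f has_derivative D x) (at x)" "\<And>v. smooth_closure (\<lambda>x. D x v)"
    by blast
  define \<phi>' where "\<phi>' = (\<lambda>y. frechet_derivative \<phi> (at y) 1)"
  have "((\<lambda>x. \<phi> (f x)) has_derivative (\<lambda>v. \<phi>' (f x) * D x v)) (at x)" for x
  proof -
    have "frechet_derivative \<phi> (at (f x)) r = \<phi>' (f x) * r" for r
      using linear_frechet_derivative[OF smooth_differentiable[OF comp.hyps(1)], of "f x"]
        linear_scale[of "frechet_derivative \<phi> (at (f x))" r 1]
      by (simp add: \<phi>'_def)
    with has_derivative_compose[OF D(1) smooth_has_derivative[OF comp.hyps(1)], of x] show ?thesis
      by simp
  qed
  moreover have "smooth \<phi>'" unfolding \<phi>'_def by (rule smooth_frechet_derivative) fact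
  then have "smooth_closure (\<lambda>x. \<phi>' (f x) * D x v)" for v
    by (rule smooth_closure.mult[OF smooth_closure.comp[OF _ comp.hyps(2)] D(2)])
  ultimately show ?case
    by (intro exI[where x = "\<lambda>x v. \<phi>' (f x) * D x v"]) blast
qed

lemma smooth_closure_smooth: "smooth_closure f \<Longrightarrow> smooth f"
  by (rule smooth_coinductI[where P = smooth_closure]) (auto dest: smooth_closure_derivative)

lemma smooth_mult:
  fixes f g :: "'a::real_normed_vector \<Rightarrow> real"
  shows "smooth f \<Longrightarrow> smooth g \<Longrightarrow> smooth (\<lambda>x. f x * g x)"
  by (rule smooth_closure_smooth[OF smooth_closure.mult[OF smooth_closure.base smooth_closure.base]])

lemma smooth_compose_real:
  fixes f :: "'a::real_normed_vector \<Rightarrow> real" and \<phi> :: "real \<Rightarrow> real"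
  shows "smooth \<phi> \<Longrightarrow> smooth f \<Longrightarrow> smooth (\<lambda>x. \<phi> (f x))"
  by (rule smooth_closure_smooth[OF smooth_closure.comp[OF _ smooth_closure.base]])

lemma smooth_sum:
  "(\<And>i. i \<in> I \<Longrightarrow> smooth (f i)) \<Longrightarrow> smooth (\<lambda>x. \<Sum>i\<in>I. f i x)"
  by (induction I rule: infinite_finite_induct) (auto intro: smooth_const smooth_add)

lemma smooth_cmult: "smooth f \<Longrightarrow> smooth (\<lambda>x. c * f x :: real)"
  by (intro smooth_mult smooth_const)

lemma smooth_diff:
  "smooth f \<Longrightarrow> smooth g \<Longrightarrow> smooth (\<lambda>x. f x - g x)"
  using smooth_add[OF _ smooth_compose_linear[OF bounded_linear_minus[OF bounded_linear_ident]], of f g]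
  by simp

lemma smooth_trig: "smooth (\<lambda>x::real. a * sin x + b * cos x)"
proof (rule smooth_coinductI[where P = "\<lambda>f. \<exists>a b. f = (\<lambda>x. a * sin x + b * cos x)"])
  fix f :: "real \<Rightarrow> real"
  assume "\<exists>a b. f = (\<lambda>x. a * sin x + b * cos x)"
  then obtain a b where f: "f = (\<lambda>x. a * sin x + b * cos x)" by blast
  have "(f has_derivative (\<lambda>v. v * (a * cos x - b * sin x))) (at x)" for x
    unfolding f by (auto intro!: derivative_eq_intros simp: algebra_simps)
  moreover have "\<exists>c d. (\<lambda>x. v * (a * cos x - b * sin x)) = (\<lambda>x. c * sin x + d * cos x)" for v
    by (rule exI[where x = "- (v * b)"], rule exI[where x = "v * a"]) (auto simp: algebra_simps)
  ultimately show "\<exists>D. (\<forall>x. (f has_derivative D x) (at x)) \<and>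
      (\<forall>v. \<exists>a b. (\<lambda>x. D x v) = (\<lambda>x. a * sin x + b * cos x))"
    by (intro exI[where x = "\<lambda>x v. v * (a * cos x - b * sin x)"]) blast
qed blast

lemma smooth_sin: "smooth (sin :: real \<Rightarrow> real)" and smooth_cos: "smooth (cos :: real \<Rightarrow> real)"
  using smooth_trig[of 1 0] smooth_trig[of 0 1] by simp_all

text \<open>Needed for sums that are finite only locally, such as the periodized mollifier. The
  class of functions that agree near every point with a smooth one is closed under directional
  derivatives.\<close>

lemma smooth_local:
  assumes "\<And>x. \<exists>U g. open U \<and> x \<in> U \<and> smooth g \<and> (\<forall>y\<in>U. f y = g y)"
  shows "smooth f"
proof (rule smooth_coinductI[where P = "\<lambda>f. \<forall>x. \<exists>U g. open U \<and> x \<in> U \<and> smooth g \<and> (\<forall>y\<in>U. f y = g y)"])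
  fix f :: "'a \<Rightarrow> 'b"
  assume "\<forall>x. \<exists>U g. open U \<and> x \<in> U \<and> smooth g \<and> (\<forall>y\<in>U. f y = g y)"
  then obtain U g where *: "\<And>x. open (U x)" "\<And>x. x \<in> U x" "\<And>x. smooth (g x)"
    "\<And>x y. y \<in> U x \<Longrightarrow> f y = g x y" by metis
  have der: "(f has_derivative frechet_derivative (g x) (at y)) (at y)" if "y \<in> U x" for x y
    by (rule has_derivative_transform_within_open[OF smooth_has_derivative[OF *(3)] *(1) that])
      (simp add: *(4))
  then have eq: "frechet_derivative (g x) (at y) = frechet_derivative f (at y)" if "y \<in> U x" for x y
    using frechet_derivative_at that by blast
  show "\<exists>D. (\<forall>x. (f has_derivative D x) (at x)) \<and>
      (\<forall>v. \<forall>x. \<exists>U g. open U \<and> x \<in> U \<and> smooth g \<and> (\<forall>y\<in>U. D y v = g y))"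
  proof (intro exI[where x = "\<lambda>x. frechet_derivative f (at x)"] conjI allI)
    show "(f has_derivative frechet_derivative f (at x)) (at x)" for x
      using der[OF *(2)] eq[OF *(2)] by simp
    show "\<exists>U g. open U \<and> x \<in> U \<and> smooth g \<and> (\<forall>y\<in>U. frechet_derivative f (at y) v = g y)" for v x
      using * eq smooth_frechet_derivative[OF *(3)[of x], of v]
      by (intro exI[where x = "U x"] exI[where x = "\<lambda>y. frechet_derivative (g x) (at y) v"]) auto
  qed
qed (use assms in blast)

lemma smooth_inner_self:
  "smooth (\<lambda>x::'a::euclidean_space. x \<bullet> x)"
proof -
  have "(\<lambda>x::'a. x \<bullet> x) = (\<lambda>x. \<Sum>b\<in>Basis. (x \<bullet> b) * (x \<bullet> b))"
    by (rule ext) (rule euclidean_inner)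
  then show ?thesis
    by (simp only:) (intro smooth_sum smooth_mult smooth_bounded_linear bounded_linear_inner_left)
qed

section \<open>A bump function, mollifiers and their periodization\<close>

definition bump :: "real \<Rightarrow> real" where
  "bump x = (if 0 < x then exp (- (1 / x)) else 0)"

lemma tendsto_poly_exp_neg: "((\<lambda>y::real. y ^ n * poly p y * exp (- y)) \<longlongrightarrow> 0) at_top"
proof (induction p arbitrary: n)
  case (pCons a p)
  have "((\<lambda>y::real. a * (y ^ n / exp y) + y ^ Suc n * poly p y * exp (- y)) \<longlongrightarrow> a * 0 + 0) at_top"
    by (intro tendsto_intros tendsto_power_div_exp_0 pCons)
  then show ?case
    by (simp add: algebra_simps exp_minus divide_inverse)
qed simp

text \<open>The functions p(1/x) exp(-1/x) with p a polynomial, extended by 0 to the left, are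
  closed under differentiation: the derivative has the polynomial y^2 (p - p'). At 0 the difference
  quotient is y p(y) exp(-y) with y = 1/x, which tends to 0.\<close>

lemma smooth_bump: "smooth bump"
proof (rule smooth_coinductI[where
      P = "\<lambda>f. \<exists>p. f = (\<lambda>x. if 0 < x then poly p (1 / x) * exp (- (1 / x)) else 0)"])
  show "\<exists>p. bump = (\<lambda>x. if 0 < x then poly p (1 / x) * exp (- (1 / x)) else 0)"
    by (rule exI[where x = 1]) (simp add: bump_def fun_eq_iff)
  fix f :: "real \<Rightarrow> real"
  assume "\<exists>p. f = (\<lambda>x. if 0 < x then poly p (1 / x) * exp (- (1 / x)) else 0)"
  then obtain p where f: "f = (\<lambda>x. if 0 < x then poly p (1 / x) * exp (- (1 / x)) else 0)" by blast
  define q where "q = [:0, 0, 1:] * (p - pderiv p)"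
  define f' where "f' = (\<lambda>x::real. if 0 < x then poly q (1 / x) * exp (- (1 / x)) else 0)"
  have "(f has_real_derivative f' x) (at x)" for x
  proof -
    consider "0 < x" | "x < 0" | "x = 0" by linarith
    then show ?thesis
    proof cases
      case 1
      have "((\<lambda>x. poly p (1 / x) * exp (- (1 / x))) has_real_derivative f' x) (at x)"
        using 1 unfolding f'_def q_def
        by (auto intro!: derivative_eq_intros DERIV_chain'[OF _ poly_DERIV]
            simp: field_simps power2_eq_square)
      then show ?thesis
        by (rule has_field_derivative_transform_within_open[where S = "{0<..}"]) (use 1 in \<open>simp_all add: f\<close>)
    next
      case 2
      have "((\<lambda>x. 0) has_real_derivative f' x) (at x)" using 2 by (simp add: f'_def)
      then show ?thesis
        by (rule has_field_derivative_transform_within_open[where S = "{..<0}"]) (use 2 in \<open>simp_all add: f\<close>)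
    next
      case 3
      have "((\<lambda>h. (1 / h) ^ 1 * poly p (1 / h) * exp (- (1 / h))) \<longlongrightarrow> 0) (at_right 0)"
        by (rule filterlim_compose[OF tendsto_poly_exp_neg])
          (use filterlim_inverse_at_top_right in \<open>simp add: inverse_eq_divide\<close>)
      then have "((\<lambda>h. (f h - f 0) / (h - 0)) \<longlongrightarrow> 0) (at_right 0)"
        by (rule Lim_transform_eventually)
          (auto simp: f eventually_at_right_field intro!: exI[where x = 1])
      moreover have "((\<lambda>h. (f h - f 0) / (h - 0)) \<longlongrightarrow> 0) (at_left 0)"
        by (rule Lim_transform_eventually[OF tendsto_const])
          (auto simp: f eventually_at_left_field intro!: exI[where x = "-1"])
      ultimately have "((\<lambda>h. (f h - f 0) / (h - 0)) \<longlongrightarrow> 0) (at 0)"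
        by (simp add: filterlim_at_split)
      then show ?thesis using 3 by (simp add: has_field_derivative_iff f'_def)
    qed
  qed
  then have "\<forall>x. (f has_derivative (\<lambda>v. f' x * v)) (at x)"
    by (simp add: has_field_derivative_def)
  moreover have "\<exists>r. (\<lambda>x. f' x * v) = (\<lambda>x. if 0 < x then poly r (1 / x) * exp (- (1 / x)) else 0)" for v
    by (rule exI[where x = "smult v q"]) (auto simp: f'_def)
  ultimately show "\<exists>D. (\<forall>x. (f has_derivative D x) (at x)) \<and>
      (\<forall>v. \<exists>p. (\<lambda>x. D x v) = (\<lambda>x. if 0 < x then poly p (1 / x) * exp (- (1 / x)) else 0))"
    by (intro exI[where x = "\<lambda>x v. f' x * v"]) blast
qed

lemma bump_nonneg: "0 \<le> bump x" and bump_le_1: "bump x \<le> 1" and bump_pos: "0 < x \<Longrightarrow> 0 < bump x"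
  by (auto simp: bump_def)

text \<open>\<open>distr_mult\<close> asks for a limit valid for all mollifiers; the existence of
  one makes that limit unique. The construction normalizes exp(-1 / (1 - |x|^2)) on the unit
  ball.\<close>

lemma mollifier_exists: "\<exists>\<rho>. mollifier \<rho>"
proof -
  define g :: "real ^ 3 \<Rightarrow> real" where "g = (\<lambda>x. bump (1 - x \<bullet> x))"
  have g: "smooth g"
    unfolding g_def by (intro smooth_compose_real[OF smooth_bump] smooth_diff smooth_const smooth_inner_self)
  then have [measurable]: "g \<in> borel_measurable borel" by (rule smooth_borel_measurable)
  have g0: "g x = 0" if "1 \<le> norm x" for x
    using that power_mono[of 1 "norm x" 2] by (simp add: g_def bump_def power2_norm_eq_inner)
  have int: "integrable lborel g"
  proof (rule Bochner_Integration.integrable_bound)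
    show "integrable lborel (indicator (cball 0 1) :: real ^ 3 \<Rightarrow> real)"
      using emeasure_lborel_cball_finite[of "0::real^3" 1] by simp
    show "AE x in lborel. norm (g x) \<le> norm (indicator (cball 0 1) x :: real)"
    proof (rule AE_I2)
      fix x :: "real ^ 3"
      show "norm (g x) \<le> norm (indicator (cball 0 1) x :: real)"
        using g0[of x] by (auto simp: indicator_def g_def bump_nonneg bump_le_1)
    qed
  qed simp
  have pos: "0 < (LINT x|lborel. g x)"
  proof -
    have "(LINT x|lborel. g x) \<noteq> 0"
    proof
      assume "(LINT x|lborel. g x) = 0"
      then have "AE x in lborel. g x = 0"
        using int by (subst (asm) integral_nonneg_eq_0_iff_AE) (auto simp: g_def bump_nonneg)
      then have "AE x in lborel. x \<notin> ball (0::real^3) 1"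
      proof eventually_elim
        case (elim x)
        show ?case
        proof
          assume "x \<in> ball 0 1"
          then have "0 < 1 - x \<bullet> x"
            using power_strict_mono[of "norm x" 1 2] by (simp add: power2_norm_eq_inner)
          with elim bump_pos[of "1 - x \<bullet> x"] show False by (simp add: g_def)
        qed
      qed
      then have "emeasure lborel (ball (0::real^3) 1) = 0"
        by (subst (asm) AE_iff_measurable[OF _ refl]) (auto simp: ball_def)
      then show False using content_ball_pos[of 1 "0::real^3"] by (simp add: measure_def)
    qed
    moreover have "0 \<le> (LINT x|lborel. g x)"
      by (intro integral_nonneg_AE) (simp add: g_def bump_nonneg)
    ultimately show ?thesis by simp
  qed
  have "smooth (\<lambda>x. (1 / (LINT x|lborel. g x)) * g x)"
    by (intro smooth_cmult g)
  moreover have "0 \<le> g x" for x by (simp add: g_def bump_nonneg)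
  ultimately have "mollifier (\<lambda>x. (1 / (LINT x|lborel. g x)) * g x)"
    unfolding mollifier_def using pos g0 by simp
  then show ?thesis by blast
qed

lemma finite_bounded_int_vec: "finite {k :: int ^ 3. norm (lattice_vec k) \<le> R}"
proof -
  have "finite ((\<lambda>(a, b, c). vector [a, b, c] :: int ^ 3) `
      ({- \<lceil>R\<rceil>..\<lceil>R\<rceil>} \<times> {- \<lceil>R\<rceil>..\<lceil>R\<rceil>} \<times> {- \<lceil>R\<rceil>..\<lceil>R\<rceil>}))"
    by (intro finite_imageI finite_cartesian_product) auto
  moreover have "k \<in> (\<lambda>(a, b, c). vector [a, b, c] :: int ^ 3) `
      ({- \<lceil>R\<rceil>..\<lceil>R\<rceil>} \<times> {- \<lceil>R\<rceil>..\<lceil>R\<rceil>} \<times> {- \<lceil>R\<rceil>..\<lceil>R\<rceil>})" if "norm (lattice_vec k) \<le> R" for k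
  proof -
    have "\<bar>real_of_int (k $ i)\<bar> \<le> R" for i
      using component_le_norm_cart[of "lattice_vec k" i] that by simp
    then have "k $ i \<in> {- \<lceil>R\<rceil>..\<lceil>R\<rceil>}" for i
      unfolding atLeastAtMost_iff by (smt (verit) le_of_int_ceiling of_int_le_iff of_int_minus)
    then show ?thesis
      by (intro image_eqI[where x = "(k $ 1, k $ 2, k $ 3)"]) (auto simp: vec_eq_iff forall_3)
  qed
  ultimately show ?thesis by (metis (no_types, lifting) finite_subset mem_Collect_eq subsetI)
qed

text \<open>On the unit ball around y the sum runs over finitely many lattice vectors: a vector
  longer than |x - y| + 1 + \<epsilon> moves the argument of \<rho> out of the unit ball.
  Periodicity is a reindexing of the lattice sum.\<close>

lemma test_fun_periodized_mollifier:
  assumes \<rho>: "mollifier \<rho>" and "0 < \<epsilon>"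
  shows "test_fun (\<lambda>y. \<Sum>\<^sub>\<infinity>k. \<rho> ((x - y + lattice_vec k) /\<^sub>R \<epsilon>) / \<epsilon> ^ 3)"
  unfolding test_fun_def
proof
  let ?F = "\<lambda>y k. \<rho> ((x - y + lattice_vec k) /\<^sub>R \<epsilon>) / \<epsilon> ^ 3"
  show "smooth (\<lambda>y. infsum (?F y) UNIV)"
  proof (rule smooth_local)
    fix y
    define S where "S = {k. norm (lattice_vec k) \<le> norm (x - y) + 1 + \<epsilon>}"
    have "smooth (\<lambda>z. ?F z k)" for k
    proof -
      have "bounded_linear (\<lambda>z::real^3. (- 1 / \<epsilon>) *\<^sub>R z)" by (rule bounded_linear_scaleR_right)
      moreover have "smooth \<rho>" using \<rho> by (simp add: mollifier_def)
      ultimately have "smooth (\<lambda>z. (1 / \<epsilon> ^ 3) * \<rho> ((- 1 / \<epsilon>) *\<^sub>R z + (x + lattice_vec k) /\<^sub>R \<epsilon>))"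
        by (intro smooth_cmult smooth_compose_affine)
      moreover have "(- 1 / \<epsilon>) *\<^sub>R z + (x + lattice_vec k) /\<^sub>R \<epsilon> = (x - z + lattice_vec k) /\<^sub>R \<epsilon>" for z
        by (simp add: algebra_simps inverse_eq_divide)
      ultimately show ?thesis by simp
    qed
    then have "smooth (\<lambda>z. \<Sum>k\<in>S. ?F z k)" by (rule smooth_sum)
    moreover have "infsum (?F z) UNIV = (\<Sum>k\<in>S. ?F z k)" if "z \<in> ball y 1" for z
    proof -
      have "?F z k = 0" if "k \<notin> S" for k
      proof -
        have "norm (x - y) + 1 + \<epsilon> < norm (lattice_vec k)" using that by (simp add: S_def)
        also have "\<dots> = norm ((x - z + lattice_vec k) - (x - y) - (y - z))" by (simp add: algebra_simps)
        also have "\<dots> \<le> norm (x - z + lattice_vec k) + norm (x - y) + norm (y - z)"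
          by (meson add_mono norm_triangle_ineq4 order_refl order_trans)
        finally have "\<epsilon> < norm (x - z + lattice_vec k)"
          using \<open>z \<in> ball y 1\<close> by (simp add: dist_norm)
        then have "1 \<le> norm ((x - z + lattice_vec k) /\<^sub>R \<epsilon>)"
          using \<open>0 < \<epsilon>\<close> by (simp only: norm_scaleR) (simp add: field_simps)
        with \<rho> show ?thesis by (simp add: mollifier_def)
      qed
      then have "infsum (?F z) UNIV = infsum (?F z) S" by (intro infsum_cong_neutral) auto
      then show ?thesis using finite_bounded_int_vec by (simp add: S_def)
    qed
    ultimately show "\<exists>U g. open U \<and> y \<in> U \<and> smooth g \<and> (\<forall>z\<in>U. infsum (?F z) UNIV = g z)"
      by (intro exI[where x = "ball y 1"] exI[where x = "\<lambda>z. \<Sum>k\<in>S. ?F z k"]) auto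
  qed
  show "periodic (\<lambda>y. infsum (?F y) UNIV)"
    unfolding periodic_def
  proof safe
    fix y l
    have "infsum (?F (y + lattice_vec l)) UNIV = infsum (?F y \<circ> (\<lambda>k. k - l)) UNIV"
      by (intro infsum_cong) (simp add: algebra_simps)
    also have "\<dots> = infsum (?F y) UNIV"
      by (subst infsum_reindex[symmetric]) (auto simp: inj_on_def surj_diff_right)
    finally show "infsum (?F (y + lattice_vec l)) UNIV = infsum (?F y) UNIV" .
  qed
qed

text \<open>The primitive that vanishes at a is constant on either side of [a, b]. On the left that
  constant is 0 by the choice of the base point, on the right it is the integral of \<eta>, so mean
  zero is what gives compact support.\<close>

lemma smooth_antiderivative:
  fixes \<eta> :: "real \<Rightarrow> real"
  assumes "smooth \<eta>" "a < b" "\<And>t. t \<notin> {a..b} \<Longrightarrow> \<eta> t = 0" "integral {a..b} \<eta> = 0"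
  obtains X where "smooth X" "\<And>t. (X has_real_derivative \<eta> t) (at t)" "\<And>t. t \<notin> {a..b} \<Longrightarrow> X t = 0"
proof -
  obtain F where F: "\<And>t. (F has_vector_derivative \<eta> t) (at t)"
    using einterval_antiderivative[of "-\<infinity>" \<infinity> \<eta>] smooth_continuous_on[OF assms(1), of UNIV]
    by (auto simp: continuous_on_eq_continuous_at)
  define X where "X = (\<lambda>t. F t - F a)"
  have der: "(X has_real_derivative \<eta> t) (at t)" for t
    unfolding X_def using F[of t]
    by (auto intro!: derivative_eq_intros simp: has_real_derivative_iff_has_vector_derivative)
  have cont: "continuous_on S X" for S
    using der by (auto intro: DERIV_continuous_on has_field_derivative_at_within)
  have der0: "(X has_real_derivative 0) (at t)" if "t \<notin> {a..b}" for t
    using der[of t] assms(3)[OF that] by simp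
  have "smooth X"
  proof (rule smooth_coinductI[where P = "\<lambda>f. smooth f \<or> f = X"])
    fix f assume "smooth f \<or> f = X"
    then show "\<exists>D. (\<forall>x. (f has_derivative D x) (at x)) \<and> (\<forall>v. smooth (\<lambda>x. D x v) \<or> (\<lambda>x. D x v) = X)"
    proof
      assume "smooth f"
      then show ?thesis
        by (intro exI[where x = "\<lambda>x. frechet_derivative f (at x)"])
          (auto intro: smooth_has_derivative smooth_frechet_derivative)
    next
      assume "f = X"
      moreover have "smooth (\<lambda>x. \<eta> x * v)" for v by (intro smooth_mult assms smooth_const)
      ultimately show ?thesis
        using der by (intro exI[where x = "\<lambda>x v. \<eta> x * v"]) (auto simp: has_field_derivative_def)
    qed
  qed simp
  moreover have "X t = 0" if "t \<notin> {a..b}" for t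
  proof -
    have "t < a \<or> b < t" using that by auto
    then consider "t < a" | "b < t" by blast
    then show ?thesis
    proof cases
      case 1
      have "X t = X a"
        by (rule DERIV_isconst2[of t a X a, symmetric])
          (use 1 in \<open>auto intro!: cont der0\<close>)
      then show ?thesis by (simp add: X_def)
    next
      case 2
      have "(\<eta> has_integral F b - F a) {a..b}"
        using assms(2) F by (intro fundamental_theorem_of_calculus) (auto intro: has_vector_derivative_at_within)
      then have "X b = 0" using assms(4) by (simp add: X_def integral_unique)
      moreover have "X t = X b"
        by (rule DERIV_isconst2[of b t X t])
          (use 2 in \<open>auto intro!: cont der0\<close>)
      ultimately show ?thesis by simp
    qed
  qed
  ultimately show ?thesis using der that by blast
qed

section \<open>Kernel estimates\<close>

definition field_norm :: "real \<Rightarrow> ennreal \<Rightarrow> (real ^ 3 \<Rightarrow> real ^ 3) \<Rightarrow> ennreal" where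
  "field_norm s p f = Lp_norm p torus (\<lambda>x. ennreal (norm (f x))) + gagliardo s p f"

text \<open>\<kappa> is the majorant against which kernels of width \<epsilon> are measured. Its
  height governs the passage from shifts weighted by \<kappa> to the Lebesgue measure of the
  Gagliardo norm; the lower bound 1 on its mass allows a factor free of the shift to be bounded by
  its average over the shift.\<close>

definition kernel_mass :: "real \<Rightarrow> real \<Rightarrow> (real ^ 3 \<Rightarrow> real) \<Rightarrow> bool" where
  "kernel_mass C \<epsilon> \<kappa> \<longleftrightarrow> \<kappa> \<in> borel_measurable borel \<and> (\<forall>h. 0 \<le> \<kappa> h) \<and>
     (\<forall>h\<in>space centred_torus. \<kappa> h \<le> C / \<epsilon> ^ 3) \<and>
     1 \<le> (\<integral>\<^sup>+h. \<kappa> h \<partial>centred_torus) \<and> (\<integral>\<^sup>+h. \<kappa> h \<partial>centred_torus) \<le> ennreal C"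

text \<open>The exponent 7 exceeds the largest sum of exponents of weights below,
  \<open>(\<beta> + 3 / (2 p)) + (\<alpha> + 3 / q) \<le> 5 / 2 + 4\<close>.\<close>

definition dominated :: "real \<Rightarrow> (real ^ 3 \<Rightarrow> real) \<Rightarrow> (real ^ 3 \<Rightarrow> real) \<Rightarrow> bool" where
  "dominated \<epsilon> \<kappa> K \<longleftrightarrow> K \<in> borel_measurable borel \<and>
     (\<forall>h\<in>space centred_torus. \<bar>K h\<bar> * (1 + norm h / \<epsilon>) ^ 7 \<le> \<kappa> h)"

locale kernel =
  fixes C \<epsilon> :: real and \<kappa> :: "real ^ 3 \<Rightarrow> real"
  assumes C: "1 \<le> C" and eps: "0 < \<epsilon>" and mass: "kernel_mass C \<epsilon> \<kappa>"
begin

lemma kappa_measurable [measurable]: "\<kappa> \<in> borel_measurable borel"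
  using mass by (simp add: kernel_mass_def)

lemma kappa_nonneg: "0 \<le> \<kappa> h"
  using mass by (simp add: kernel_mass_def)

definition kappa_measure :: "(real ^ 3) measure" where
  "kappa_measure = density centred_torus (\<lambda>h. ennreal (\<kappa> h))"

lemma sets_kappa_measure [measurable_cong]: "sets kappa_measure = sets centred_torus"
  by (simp add: kappa_measure_def)

lemma nn_integral_kappa_measure:
  "f \<in> borel_measurable borel \<Longrightarrow>
    (\<integral>\<^sup>+h. f h \<partial>kappa_measure) = (\<integral>\<^sup>+h. ennreal (\<kappa> h) * f h \<partial>centred_torus)"
  unfolding kappa_measure_def by (rule nn_integral_density) auto

lemma emeasure_kappa_measure:
  "1 \<le> emeasure kappa_measure (space kappa_measure)"
  "emeasure kappa_measure (space kappa_measure) \<le> ennreal C"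
proof -
  have "emeasure kappa_measure (space kappa_measure) = (\<integral>\<^sup>+h. \<kappa> h \<partial>centred_torus)"
    using nn_integral_kappa_measure[of "\<lambda>_. 1"] by simp
  then show "1 \<le> emeasure kappa_measure (space kappa_measure)"
    "emeasure kappa_measure (space kappa_measure) \<le> ennreal C"
    using mass by (simp_all add: kernel_mass_def)
qed

sublocale kappa_measure: finite_measure kappa_measure
  by standard (use emeasure_kappa_measure(2) in \<open>auto simp: top_unique\<close>)

section \<open>The product of the torus with three shift variables\<close>

text \<open>Every factor of a trilinear expression gets its own shift, so a product of three
  averages over shifts is a single integral, to which Hoelder's inequality applies directly.\<close>

definition cube4 :: "((real ^ 3) \<times> (real ^ 3) \<times> (real ^ 3) \<times> (real ^ 3)) measure" where
  "cube4 = torus \<Otimes>\<^sub>M (kappa_measure \<Otimes>\<^sub>M (kappa_measure \<Otimes>\<^sub>M kappa_measure))"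

lemma cube4_measurable [measurable]:
  "(\<lambda>z. fst z) \<in> cube4 \<rightarrow>\<^sub>M torus" "(\<lambda>z. fst (snd z)) \<in> cube4 \<rightarrow>\<^sub>M kappa_measure"
  "(\<lambda>z. fst (snd (snd z))) \<in> cube4 \<rightarrow>\<^sub>M kappa_measure"
  "(\<lambda>z. snd (snd (snd z))) \<in> cube4 \<rightarrow>\<^sub>M kappa_measure"
  unfolding cube4_def by measurable

lemma kappa_measure_borel: "(\<lambda>h. h) \<in> kappa_measure \<rightarrow>\<^sub>M borel"
  by (simp add: measurable_cong_sets[OF sets_kappa_measure refl] borel_measurable_centred_torus)

lemma torus_borel: "(\<lambda>h. h) \<in> torus \<rightarrow>\<^sub>M borel"
  by (simp add: borel_measurable_torus)

lemma cube4_measurable_borel [measurable]: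
  "(\<lambda>z. fst z) \<in> cube4 \<rightarrow>\<^sub>M borel" "(\<lambda>z. fst (snd z)) \<in> cube4 \<rightarrow>\<^sub>M borel"
  "(\<lambda>z. fst (snd (snd z))) \<in> cube4 \<rightarrow>\<^sub>M borel" "(\<lambda>z. snd (snd (snd z))) \<in> cube4 \<rightarrow>\<^sub>M borel"
  using measurable_compose[OF cube4_measurable(1) torus_borel]
    cube4_measurable(2-4)[THEN measurable_compose, OF kappa_measure_borel] by simp_all

lemma nn_integral_cube4:
  assumes f: "f \<in> borel_measurable cube4"
  shows "(\<integral>\<^sup>+z. f z \<partial>cube4) = (\<integral>\<^sup>+x. \<integral>\<^sup>+h. \<integral>\<^sup>+h'. \<integral>\<^sup>+h''. f (x, h, h', h'')
    \<partial>kappa_measure \<partial>kappa_measure \<partial>kappa_measure \<partial>torus)"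
proof -
  interpret K2: pair_sigma_finite kappa_measure kappa_measure ..
  interpret K3: pair_sigma_finite kappa_measure "kappa_measure \<Otimes>\<^sub>M kappa_measure" ..
  have f3: "(\<lambda>z. f (x, z)) \<in> borel_measurable (kappa_measure \<Otimes>\<^sub>M (kappa_measure \<Otimes>\<^sub>M kappa_measure))"
    if "x \<in> space torus" for x
    using f that unfolding cube4_def by (rule measurable_Pair2)
  have f2: "(\<lambda>z. f (x, h, z)) \<in> borel_measurable (kappa_measure \<Otimes>\<^sub>M kappa_measure)"
    if "x \<in> space torus" "h \<in> space kappa_measure" for x h
    using f3[OF that(1)] that(2) by (rule measurable_Pair2)
  have "(\<integral>\<^sup>+z. f z \<partial>cube4) = (\<integral>\<^sup>+x. \<integral>\<^sup>+z. f (x, z) \<partial>(kappa_measure \<Otimes>\<^sub>M (kappa_measure \<Otimes>\<^sub>M kappa_measure)) \<partial>torus)"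
    unfolding cube4_def
    by (rule sigma_finite_measure.nn_integral_fst[symmetric]) (use f in \<open>simp_all add: cube4_def K3.P.sigma_finite_measure_axioms\<close>)
  also have "\<dots> = (\<integral>\<^sup>+x. \<integral>\<^sup>+h. \<integral>\<^sup>+z. f (x, h, z) \<partial>(kappa_measure \<Otimes>\<^sub>M kappa_measure) \<partial>kappa_measure \<partial>torus)"
    using f3 by (intro nn_integral_cong sigma_finite_measure.nn_integral_fst[symmetric]) (simp_all add: K2.P.sigma_finite_measure_axioms)
  also have "\<dots> = (\<integral>\<^sup>+x. \<integral>\<^sup>+h. \<integral>\<^sup>+h'. \<integral>\<^sup>+h''. f (x, h, h', h'')
    \<partial>kappa_measure \<partial>kappa_measure \<partial>kappa_measure \<partial>torus)"
    using f2 by (intro nn_integral_cong kappa_measure.nn_integral_fst[symmetric]) simp_all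
  finally show ?thesis .
qed

lemma kappa_torus_push:
  assumes [measurable]: "\<Theta> \<in> borel_measurable (centred_torus \<Otimes>\<^sub>M torus)"
  shows "(\<integral>\<^sup>+x. \<integral>\<^sup>+h. \<Theta> (h, x) \<partial>kappa_measure \<partial>torus)
    \<le> ennreal (C / \<epsilon> ^ 3) * (\<integral>\<^sup>+y. \<Theta> y \<partial>(centred_torus \<Otimes>\<^sub>M torus))"
proof -
  interpret P: pair_sigma_finite centred_torus torus ..
  have meas: "(\<lambda>h. \<Theta> (h, x)) \<in> borel_measurable centred_torus" if "x \<in> space torus" for x
    using assms that by (rule measurable_Pair1)
  have "(\<integral>\<^sup>+h. \<Theta> (h, x) \<partial>kappa_measure) \<le> ennreal (C / \<epsilon> ^ 3) * (\<integral>\<^sup>+h. \<Theta> (h, x) \<partial>centred_torus)"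
    if "x \<in> space torus" for x
  proof -
    have "(\<integral>\<^sup>+h. \<Theta> (h, x) \<partial>kappa_measure) = (\<integral>\<^sup>+h. ennreal (\<kappa> h) * \<Theta> (h, x) \<partial>centred_torus)"
      unfolding kappa_measure_def using meas[OF that] by (intro nn_integral_density) auto
    also have "\<dots> \<le> (\<integral>\<^sup>+h. ennreal (C / \<epsilon> ^ 3) * \<Theta> (h, x) \<partial>centred_torus)"
      using mass by (intro nn_integral_mono mult_right_mono ennreal_leI) (auto simp: kernel_mass_def)
    also have "\<dots> = ennreal (C / \<epsilon> ^ 3) * (\<integral>\<^sup>+h. \<Theta> (h, x) \<partial>centred_torus)"
      using meas[OF that] by (rule nn_integral_cmult)
    finally show ?thesis .
  qed
  then have "(\<integral>\<^sup>+x. \<integral>\<^sup>+h. \<Theta> (h, x) \<partial>kappa_measure \<partial>torus)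
      \<le> (\<integral>\<^sup>+x. ennreal (C / \<epsilon> ^ 3) * (\<integral>\<^sup>+h. \<Theta> (h, x) \<partial>centred_torus) \<partial>torus)"
    by (intro nn_integral_mono) auto
  also have "\<dots> = ennreal (C / \<epsilon> ^ 3) * (\<integral>\<^sup>+x. \<integral>\<^sup>+h. \<Theta> (h, x) \<partial>centred_torus \<partial>torus)"
    by (rule nn_integral_cmult) measurable
  also have "(\<integral>\<^sup>+x. \<integral>\<^sup>+h. \<Theta> (h, x) \<partial>centred_torus \<partial>torus) = (\<integral>\<^sup>+y. \<Theta> y \<partial>(centred_torus \<Otimes>\<^sub>M torus))"
    by (rule P.nn_integral_snd) (simp add: assms)
  finally show ?thesis .
qed

definition slots :: "(((real ^ 3) \<times> (real ^ 3) \<times> (real ^ 3) \<times> (real ^ 3)) \<Rightarrow> real ^ 3) set" where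
  "slots = {\<lambda>z. fst (snd z), \<lambda>z. fst (snd (snd z)), \<lambda>z. snd (snd (snd z))}"

lemma slots_measurable:
  assumes "\<pi> \<in> slots"
  shows "\<pi> \<in> cube4 \<rightarrow>\<^sub>M centred_torus" "\<pi> \<in> cube4 \<rightarrow>\<^sub>M borel"
  using assms cube4_measurable cube4_measurable_borel
  by (auto simp: slots_def measurable_cong_sets[OF refl sets_kappa_measure])

text \<open>The two shifts that are not selected integrate out at a cost of \<open>C\<close> each,
  the selected one at C / \<epsilon>^3, the bound on the density \<kappa>.\<close>

lemma cube4_push:
  assumes \<Theta> [measurable]: "\<Theta> \<in> borel_measurable (centred_torus \<Otimes>\<^sub>M torus)" and \<pi>: "\<pi> \<in> slots"
  shows "(\<integral>\<^sup>+z. \<Theta> (\<pi> z, fst z) \<partial>cube4) \<le> ennreal (C ^ 3 / \<epsilon> ^ 3) * (\<integral>\<^sup>+y. \<Theta> y \<partial>(centred_torus \<Otimes>\<^sub>M torus))"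
proof -
  let ?m = "emeasure kappa_measure (space kappa_measure)"
  note [measurable] = slots_measurable[OF \<pi>]
  have meas: "(\<lambda>h. \<Theta> (h, x)) \<in> borel_measurable kappa_measure" if "x \<in> space torus" for x
    using measurable_Pair1[OF \<Theta> that] by (simp add: measurable_cong_sets[OF sets_kappa_measure refl])
  have "(\<integral>\<^sup>+z. \<Theta> (\<pi> z, fst z) \<partial>cube4) = (\<integral>\<^sup>+x. \<integral>\<^sup>+h. \<integral>\<^sup>+h'. \<integral>\<^sup>+h''. \<Theta> (\<pi> (x, h, h', h''), x)
    \<partial>kappa_measure \<partial>kappa_measure \<partial>kappa_measure \<partial>torus)"
    by (subst nn_integral_cube4) simp_all
  also have "\<dots> = (\<integral>\<^sup>+x. (\<integral>\<^sup>+h. \<Theta> (h, x) \<partial>kappa_measure) * (?m * ?m) \<partial>torus)"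
  proof (rule nn_integral_cong)
    fix x assume x: "x \<in> space torus"
    note [measurable] = meas[OF x]
    show "(\<integral>\<^sup>+h. \<integral>\<^sup>+h'. \<integral>\<^sup>+h''. \<Theta> (\<pi> (x, h, h', h''), x)
      \<partial>kappa_measure \<partial>kappa_measure \<partial>kappa_measure) = (\<integral>\<^sup>+h. \<Theta> (h, x) \<partial>kappa_measure) * (?m * ?m)"
      using \<pi> by (auto simp: slots_def nn_integral_multc mult.assoc)
  qed
  also have "\<dots> \<le> (\<integral>\<^sup>+x. (\<integral>\<^sup>+h. \<Theta> (h, x) \<partial>kappa_measure) * (ennreal C * ennreal C) \<partial>torus)"
    by (intro nn_integral_mono mult_mono emeasure_kappa_measure) auto
  also have "\<dots> = (\<integral>\<^sup>+x. \<integral>\<^sup>+h. \<Theta> (h, x) \<partial>kappa_measure \<partial>torus) * (ennreal C * ennreal C)"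
    by (rule nn_integral_multc) measurable
  also have "\<dots> \<le> (ennreal (C / \<epsilon> ^ 3) * (\<integral>\<^sup>+y. \<Theta> y \<partial>(centred_torus \<Otimes>\<^sub>M torus))) * (ennreal C * ennreal C)"
    by (intro mult_right_mono kappa_torus_push) auto
  also have "\<dots> = (ennreal (C / \<epsilon> ^ 3) * (ennreal C * ennreal C)) * (\<integral>\<^sup>+y. \<Theta> y \<partial>(centred_torus \<Otimes>\<^sub>M torus))"
    by (simp add: mult_ac)
  also have "ennreal (C / \<epsilon> ^ 3) * (ennreal C * ennreal C) = ennreal (C ^ 3 / \<epsilon> ^ 3)"
    using C eps by (simp add: power3_eq_cube flip: ennreal_mult)
  finally show ?thesis .
qed

lemma cube4_push_torus:
  assumes [measurable]: "\<Theta> \<in> borel_measurable torus"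
  shows "(\<integral>\<^sup>+z. \<Theta> (fst z) \<partial>cube4) \<le> ennreal (C ^ 3) * (\<integral>\<^sup>+x. \<Theta> x \<partial>torus)"
proof -
  let ?m = "emeasure kappa_measure (space kappa_measure)"
  have "(\<integral>\<^sup>+z. \<Theta> (fst z) \<partial>cube4) = (\<integral>\<^sup>+x. \<Theta> x * (?m * ?m * ?m) \<partial>torus)"
    by (subst nn_integral_cube4) (simp_all add: mult.assoc)
  also have "\<dots> \<le> (\<integral>\<^sup>+x. \<Theta> x * (ennreal C * ennreal C * ennreal C) \<partial>torus)"
    by (intro nn_integral_mono mult_mono emeasure_kappa_measure) auto
  also have "\<dots> = (\<integral>\<^sup>+x. \<Theta> x \<partial>torus) * (ennreal C * ennreal C * ennreal C)"
    by (rule nn_integral_multc) measurable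
  also have "ennreal C * ennreal C * ennreal C = ennreal (C ^ 3)"
    using C by (simp add: power3_eq_cube ennreal_mult)
  finally show ?thesis by (simp add: mult.commute)
qed

text \<open>A factor depending on \<open>x\<close> and one of the shifts, of norm at most \<open>N\<close> whichever shift it is.\<close>

definition slot :: "ennreal \<Rightarrow> ennreal \<Rightarrow> (real ^ 3 \<Rightarrow> real ^ 3 \<Rightarrow> ennreal) \<Rightarrow> bool" where
  "slot p N F \<longleftrightarrow> (\<lambda>(h, x). F h x) \<in> borel_measurable (borel \<Otimes>\<^sub>M borel) \<and>
     (\<forall>\<pi>\<in>slots. Lp_norm p cube4 (\<lambda>z. F (\<pi> z) (fst z)) \<le> N)"

lemma slot_mono: "slot p N F \<Longrightarrow> N \<le> N' \<Longrightarrow> slot p N' F"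
  unfolding slot_def by (meson order_trans)

lemma slot_measurable:
  assumes "slot p N F"
  shows "\<pi> \<in> slots \<Longrightarrow> (\<lambda>z. F (\<pi> z) (fst z)) \<in> borel_measurable cube4"
    and "(\<lambda>h. F h x) \<in> borel_measurable kappa_measure"
    and "(\<lambda>h. F h x) \<in> borel_measurable borel"
proof -
  have F: "(\<lambda>(h, x). F h x) \<in> borel_measurable (borel \<Otimes>\<^sub>M borel)" using assms by (simp add: slot_def)
  show "(\<lambda>z. F (\<pi> z) (fst z)) \<in> borel_measurable cube4" if "\<pi> \<in> slots"
    using measurable_compose[OF measurable_Pair[OF slots_measurable(2)[OF that] cube4_measurable_borel(1)] F]
    by simp
  show b: "(\<lambda>h. F h x) \<in> borel_measurable borel"
    using measurable_compose[OF _ F, of "\<lambda>h. (h, x)" borel] by simp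
  show "(\<lambda>h. F h x) \<in> borel_measurable kappa_measure"
    using borel_measurable_centred_torus[OF b] by (simp add: measurable_cong_sets[OF sets_kappa_measure refl])
qed

lemma C_powr_le:
  assumes "1 \<le> p" shows "(C ^ 3) powr enn2real (1 / p) \<le> C ^ 3"
proof -
  have "enn2real (1 / p) \<le> 1"
    using assms
  proof (cases p rule: exponent_cases)
    case (2 P)
    then show ?thesis using divide_ennreal[of 1 P] by simp
  qed simp
  moreover have "1 \<le> C ^ 3" using C by (rule one_le_power)
  ultimately show ?thesis
    using powr_mono[of "enn2real (1 / p)" 1 "C ^ 3"] C by simp
qed

lemma slot_torus:
  assumes [measurable]: "\<phi> \<in> borel_measurable borel" and p: "1 \<le> p"
  shows "slot p (ennreal (C ^ 3) * Lp_norm p torus \<phi>) (\<lambda>h. \<phi>)"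
  unfolding slot_def
proof (intro conjI ballI)
  fix \<pi> assume "\<pi> \<in> slots"
  have "Lp_norm p cube4 (\<lambda>z. \<phi> (fst z)) \<le> ennreal (1 * (C ^ 3) powr enn2real (1 / p)) * Lp_norm p torus \<phi>"
    by (rule Lp_norm_transfer[where \<pi> = fst]) (use C p cube4_push_torus in auto)
  also have "\<dots> \<le> ennreal (C ^ 3) * Lp_norm p torus \<phi>"
    using C_powr_le[OF p] by (intro mult_right_mono ennreal_leI) auto
  finally show "Lp_norm p cube4 (\<lambda>z. \<phi> (fst z)) \<le> ennreal (C ^ 3) * Lp_norm p torus \<phi>" .
qed measurable

text \<open>Fills the free factor when only two functions occur in a trilinear estimate.\<close>

lemma slot_one:
  assumes p: "1 \<le> p" shows "slot p (ennreal (C ^ 3)) (\<lambda>h x. 1)"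
proof -
  have "Lp_norm p torus (\<lambda>x. 1) \<le> 1"
    using p
  proof (cases p rule: exponent_cases)
    case (2 P)
    then show ?thesis
      using ennreal_powr_ennreal[of 1] by (simp add: Lp_norm_def emeasure_torus ennreal_powr_ennreal[of 1, simplified])
  qed (auto simp: Lp_norm_inf)
  then have "ennreal (C ^ 3) * Lp_norm p torus (\<lambda>x. 1) \<le> ennreal (C ^ 3)"
    by (metis mult.right_neutral mult_left_mono zero_le)
  with slot_torus[of "\<lambda>x. 1" p] p show ?thesis
    by (auto intro: slot_mono)
qed

text \<open>The weight 1 + |h| / \<epsilon> dominates |h| / \<epsilon>, so dividing by its power s +
  3/p produces \<epsilon>^(s + 3/p) times the Gagliardo integrand. Replacing \<kappa> by Lebesgue
  measure in the shift costs (C / \<epsilon>)^(3/p), and \<epsilon>^s remains.\<close>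

lemma slot_increment:
  assumes [measurable]: "f \<in> borel_measurable borel" and p: "1 \<le> p" and s: "0 < s"
  shows "slot p (ennreal (C ^ 3 * \<epsilon> powr s) * gagliardo s p f)
    (\<lambda>h x. ennreal (norm (f (x + h) - f x) / (1 + norm h / \<epsilon>) powr (s + enn2real (3 / p))))"
  unfolding slot_def
proof (intro conjI ballI)
  let ?b = "s + enn2real (3 / p)" and ?e = "enn2real (1 / p)"
  let ?\<Psi> = "\<lambda>(h, x). ennreal (norm (f (x + h) - f x) / norm h powr ?b)"
  let ?F = "\<lambda>h x. ennreal (norm (f (x + h) - f x) / (1 + norm h / \<epsilon>) powr ?b)"
  show "(\<lambda>(h, x). ?F h x) \<in> borel_measurable (borel \<Otimes>\<^sub>M borel)" by measurable
  have fst': "fst \<in> centred_torus \<Otimes>\<^sub>M torus \<rightarrow>\<^sub>M borel" and snd': "snd \<in> centred_torus \<Otimes>\<^sub>M torus \<rightarrow>\<^sub>M borel"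
    using measurable_compose[OF measurable_fst borel_measurable_centred_torus[OF measurable_ident]]
      measurable_compose[OF measurable_snd borel_measurable_torus[OF measurable_ident]] by simp_all
  have \<Psi>: "?\<Psi> \<in> borel_measurable (centred_torus \<Otimes>\<^sub>M torus)"
  proof -
    have "?\<Psi> \<in> borel_measurable (borel \<Otimes>\<^sub>M borel)" by measurable
    from measurable_compose[OF measurable_Pair[OF fst' snd'] this] show ?thesis by simp
  qed
  fix \<pi> assume \<pi>: "\<pi> \<in> slots"
  have F: "(\<lambda>z. ?F (\<pi> z) (fst z)) \<in> borel_measurable cube4"
  proof -
    have "(\<lambda>(h, x). ?F h x) \<in> borel_measurable (borel \<Otimes>\<^sub>M borel)" by measurable
    from measurable_compose[OF measurable_Pair[OF slots_measurable(2)[OF \<pi>] cube4_measurable_borel(1)] this]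
    show ?thesis by simp
  qed
  have e3: "enn2real (3 / p) = 3 * ?e"
    using p
  proof (cases p rule: exponent_cases)
    case (2 P)
    then show ?thesis using divide_ennreal[of 1 P] divide_ennreal[of 3 P] by simp
  qed simp
  have "Lp_norm p cube4 (\<lambda>z. ?F (\<pi> z) (fst z)) \<le>
      ennreal (\<epsilon> powr ?b * (C ^ 3 / \<epsilon> ^ 3) powr ?e) * Lp_norm p (centred_torus \<Otimes>\<^sub>M torus) ?\<Psi>"
  proof (rule Lp_norm_transfer[where \<pi> = "\<lambda>z. (\<pi> z, fst z)"])
    show "(\<lambda>z. (\<pi> z, fst z)) \<in> cube4 \<rightarrow>\<^sub>M centred_torus \<Otimes>\<^sub>M torus"
      using slots_measurable[OF \<pi>] by simp
    show "AE z in cube4. ?F (\<pi> z) (fst z) \<le> ennreal (\<epsilon> powr ?b) * ?\<Psi> (\<pi> z, fst z)"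
    proof (rule AE_I2)
      fix z
      define h x where "h = \<pi> z" and "x = fst z"
      have "norm (f (x + h) - f x) / (1 + norm h / \<epsilon>) powr ?b
          \<le> \<epsilon> powr ?b * (norm (f (x + h) - f x) / norm h powr ?b)"
      proof (cases "h = 0")
        case False
        have "norm (f (x + h) - f x) / (1 + norm h / \<epsilon>) powr ?b \<le> norm (f (x + h) - f x) / (norm h / \<epsilon>) powr ?b"
          using False eps s add_pos_nonneg[of 1 "norm h / \<epsilon>"]
          by (intro divide_left_mono powr_mono2 mult_pos_pos) auto
        also have "\<dots> = \<epsilon> powr ?b * (norm (f (x + h) - f x) / norm h powr ?b)"
          using eps by (simp add: powr_divide)
        finally show ?thesis .
      qed simp
      then show "?F (\<pi> z) (fst z) \<le> ennreal (\<epsilon> powr ?b) * ?\<Psi> (\<pi> z, fst z)"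
        by (simp add: h_def x_def flip: ennreal_mult)
    qed
  qed (use C eps p \<pi> \<Psi> F cube4_push in auto)
  also have "\<epsilon> powr ?b * (C ^ 3 / \<epsilon> ^ 3) powr ?e = (C ^ 3) powr ?e * \<epsilon> powr s"
  proof -
    have "(\<epsilon> ^ 3) powr ?e = \<epsilon> powr (3 * ?e)"
      using eps by (simp add: powr_powr flip: powr_numeral)
    then show ?thesis using C eps by (simp add: e3 powr_add powr_divide)
  qed
  also have "ennreal ((C ^ 3) powr ?e * \<epsilon> powr s) * Lp_norm p (centred_torus \<Otimes>\<^sub>M torus) ?\<Psi>
      \<le> ennreal (C ^ 3 * \<epsilon> powr s) * gagliardo s p f"
    unfolding gagliardo_def using C_powr_le[OF p] by (intro mult_right_mono ennreal_leI) auto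
  finally show "Lp_norm p cube4 (\<lambda>z. ?F (\<pi> z) (fst z)) \<le> ennreal (C ^ 3 * \<epsilon> powr s) * gagliardo s p f" .
qed

text \<open>The first bound gives each factor its own coordinate of \<open>cube4\<close>. In the
  second, F and G share a shift; the spare coordinate is inserted at no loss because \<kappa> has
  mass at least 1.\<close>

lemma slot_Hoelder:
  assumes F: "slot (2 * p) A F" and H: "slot (2 * p) B H" and G: "slot q D G"
    and pq: "1 \<le> p" "1 \<le> q" "1 / p + 1 / q = 1"
  shows "(\<integral>\<^sup>+x. (\<integral>\<^sup>+h. F h x \<partial>kappa_measure) * (\<integral>\<^sup>+h. H h x \<partial>kappa_measure) * (\<integral>\<^sup>+h. G h x \<partial>kappa_measure) \<partial>torus)
      \<le> A * B * D"
    and "(\<integral>\<^sup>+x. (\<integral>\<^sup>+h. F h x * G h x \<partial>kappa_measure) * (\<integral>\<^sup>+h. H h x \<partial>kappa_measure) \<partial>torus) \<le> A * B * D"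
proof -
  let ?\<pi>1 = "\<lambda>z::((real ^ 3) \<times> (real ^ 3) \<times> (real ^ 3) \<times> (real ^ 3)). fst (snd z)"
  let ?\<pi>2 = "\<lambda>z::((real ^ 3) \<times> (real ^ 3) \<times> (real ^ 3) \<times> (real ^ 3)). fst (snd (snd z))"
  let ?\<pi>3 = "\<lambda>z::((real ^ 3) \<times> (real ^ 3) \<times> (real ^ 3) \<times> (real ^ 3)). snd (snd (snd z))"
  have sl: "?\<pi>1 \<in> slots" "?\<pi>2 \<in> slots" "?\<pi>3 \<in> slots" by (simp_all add: slots_def)
  note [measurable] = slot_measurable(1)[OF F] slot_measurable(1)[OF G] slot_measurable(1)[OF H]
    slot_measurable(2)[OF F] slot_measurable(2)[OF G] slot_measurable(2)[OF H]
  have bound: "(\<integral>\<^sup>+z. F (\<pi> z) (fst z) * H (\<pi>' z) (fst z) * G (\<pi>'' z) (fst z) \<partial>cube4) \<le> A * B * D"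
    if "\<pi> \<in> slots" "\<pi>' \<in> slots" "\<pi>'' \<in> slots" for \<pi> \<pi>' \<pi>''
  proof -
    have "(\<integral>\<^sup>+z. F (\<pi> z) (fst z) * H (\<pi>' z) (fst z) * G (\<pi>'' z) (fst z) \<partial>cube4)
      \<le> Lp_norm (2 * p) cube4 (\<lambda>z. F (\<pi> z) (fst z)) * Lp_norm (2 * p) cube4 (\<lambda>z. H (\<pi>' z) (fst z))
        * Lp_norm q cube4 (\<lambda>z. G (\<pi>'' z) (fst z))"
      using that by (intro Hoelder_three pq) auto
    also have "\<dots> \<le> A * B * D"
      using that F G H by (intro mult_mono) (auto simp: slot_def)
    finally show ?thesis .
  qed
  have "(\<integral>\<^sup>+x. (\<integral>\<^sup>+h. F h x \<partial>kappa_measure) * (\<integral>\<^sup>+h. H h x \<partial>kappa_measure) * (\<integral>\<^sup>+h. G h x \<partial>kappa_measure) \<partial>torus)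
      = (\<integral>\<^sup>+z. F (?\<pi>1 z) (fst z) * H (?\<pi>2 z) (fst z) * G (?\<pi>3 z) (fst z) \<partial>cube4)"
    using sl by (subst nn_integral_cube4) (simp_all add: nn_integral_cmult nn_integral_multc)
  with bound[OF sl] show "(\<integral>\<^sup>+x. (\<integral>\<^sup>+h. F h x \<partial>kappa_measure) * (\<integral>\<^sup>+h. H h x \<partial>kappa_measure) * (\<integral>\<^sup>+h. G h x \<partial>kappa_measure) \<partial>torus)
      \<le> A * B * D" by simp
  have "(\<integral>\<^sup>+x. (\<integral>\<^sup>+h. F h x * G h x \<partial>kappa_measure) * (\<integral>\<^sup>+h. H h x \<partial>kappa_measure) \<partial>torus)
      \<le> (\<integral>\<^sup>+x. (\<integral>\<^sup>+h. F h x * G h x \<partial>kappa_measure) * (\<integral>\<^sup>+h. H h x \<partial>kappa_measure)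
        * emeasure kappa_measure (space kappa_measure) \<partial>torus)"
    using mult_left_mono[OF emeasure_kappa_measure(1)] by (intro nn_integral_mono) fastforce
  also have "\<dots> = (\<integral>\<^sup>+z. F (?\<pi>1 z) (fst z) * G (?\<pi>1 z) (fst z) * H (?\<pi>2 z) (fst z) \<partial>cube4)"
    using sl by (subst nn_integral_cube4) (simp_all add: nn_integral_cmult nn_integral_multc)
  also have "\<dots> = (\<integral>\<^sup>+z. F (?\<pi>1 z) (fst z) * H (?\<pi>2 z) (fst z) * G (?\<pi>1 z) (fst z) \<partial>cube4)"
    by (intro nn_integral_cong) (simp only: mult_ac)
  also have "\<dots> \<le> A * B * D" using bound[of ?\<pi>1 ?\<pi>2 ?\<pi>1] sl by simp
  finally show "(\<integral>\<^sup>+x. (\<integral>\<^sup>+h. F h x * G h x \<partial>kappa_measure) * (\<integral>\<^sup>+h. H h x \<partial>kappa_measure) \<partial>torus) \<le> A * B * D" .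
qed

end

section \<open>Averages over shifts\<close>

lemma borel_measurable_component [measurable (raw)]:
  fixes f :: "'a \<Rightarrow> real ^ 'n"
  shows "f \<in> borel_measurable M \<Longrightarrow> (\<lambda>x. f x $ i) \<in> borel_measurable M"
  by (erule measurable_compose) (intro borel_measurable_continuous_onI continuous_intros)

text \<open>A correlation: K(h) weighs the value at x + h, so increments f(x + h) - f(x) appear
  without a change of sign. The shift ranges over the centred cube, where |h| is the distance on the
  torus, as in the Gagliardo norm.\<close>

definition conv :: "(real ^ 3 \<Rightarrow> real) \<Rightarrow> (real ^ 3 \<Rightarrow> 'b) \<Rightarrow> real ^ 3 \<Rightarrow> 'b :: {banach, second_countable_topology}" where
  "conv K f x = (LINT h|centred_torus. K h *\<^sub>R f (x + h))"

definition torus_field :: "(real ^ 3 \<Rightarrow> 'b :: {banach, second_countable_topology}) \<Rightarrow> bool" where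
  "torus_field f \<longleftrightarrow> f \<in> borel_measurable borel \<and> periodic f \<and> integrable torus f"

lemma torus_fieldD:
  assumes "torus_field f"
  shows "f \<in> borel_measurable borel" "periodic f" "integrable torus f"
  using assms by (auto simp: torus_field_def)

lemma torus_field_shift:
  assumes "torus_field f"
  shows "integrable centred_torus (\<lambda>h. f (x + h))"
    and "(LINT h|centred_torus. f (x + h)) = (LINT y|torus. f y)"
  using integrable_centred_torus_shift[of f x] integral_centred_torus_shift[of f x] torus_fieldD[OF assms]
  by (simp_all add: add.commute)

lemma conv_integrable:
  assumes f: "torus_field f" and [measurable]: "K \<in> borel_measurable borel"
    and B: "\<And>h. h \<in> space centred_torus \<Longrightarrow> \<bar>K h\<bar> \<le> B"
  shows "integrable centred_torus (\<lambda>h. K h *\<^sub>R f (x + h))"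
proof (rule Bochner_Integration.integrable_bound)
  note [measurable] = torus_fieldD(1)[OF f]
  show "integrable centred_torus (\<lambda>h. B * norm (f (x + h)))"
    using torus_field_shift(1)[OF f] by (intro integrable_mult_right integrable_norm)
  have "0 \<le> B" using B[of 0] by (simp add: space_centred_torus)
  then show "AE h in centred_torus. norm (K h *\<^sub>R f (x + h)) \<le> norm (B * norm (f (x + h)))"
    using B by (intro AE_I2) (simp add: mult_right_mono)
qed (use torus_fieldD(1)[OF f] in measurable)

lemma conv_measurable [measurable]:
  assumes [measurable]: "f \<in> borel_measurable borel" "K \<in> borel_measurable borel"
  shows "conv K f \<in> borel_measurable borel"
proof -
  have [measurable]: "snd \<in> borel \<Otimes>\<^sub>M centred_torus \<rightarrow>\<^sub>M borel"
    using measurable_compose[OF measurable_snd borel_measurable_centred_torus[OF measurable_ident]] by simp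
  show ?thesis
    unfolding conv_def by (intro centred_torus.borel_measurable_lebesgue_integral) measurable
qed

lemma conv_bounded:
  assumes f: "torus_field f" and [measurable]: "K \<in> borel_measurable borel"
    and B: "\<And>h. h \<in> space centred_torus \<Longrightarrow> \<bar>K h\<bar> \<le> B"
  shows "norm (conv K f x) \<le> B * (LINT y|torus. norm (f y))"
proof -
  note [measurable] = torus_fieldD(1)[OF f]
  have nf: "torus_field (\<lambda>y. norm (f y))"
    using f by (auto simp: torus_field_def periodic_def)
  have "norm (conv K f x) \<le> (LINT h|centred_torus. norm (K h *\<^sub>R f (x + h)))"
    unfolding conv_def by (rule integral_norm_bound)
  also have "\<dots> \<le> (LINT h|centred_torus. B * norm (f (x + h)))"
    using conv_integrable[OF f assms(2) B] torus_field_shift(1)[OF f] B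
    by (intro integral_mono integrable_norm integrable_mult_right) (auto intro: mult_right_mono)
  also have "\<dots> = B * (LINT y|torus. norm (f y))"
    using torus_field_shift(2)[OF nf] by simp
  finally show ?thesis .
qed

lemma conv_diff_bound:
  assumes f: "torus_field f" and K [measurable]: "K \<in> borel_measurable borel"
    and B: "\<And>h. h \<in> space centred_torus \<Longrightarrow> \<bar>K h\<bar> \<le> B"
    and one: "(LINT h|centred_torus. K h) = 1"
  shows "ennreal (norm (conv K f x - f x)) \<le>
    (\<integral>\<^sup>+h. ennreal (\<bar>K h\<bar> * norm (f (x + h) - f x)) \<partial>centred_torus)"
proof -
  have Kint: "integrable centred_torus K"
    by (rule centred_torus.integrable_const_bound[where B = B]) (use B in \<open>auto intro!: AE_I2\<close>)
  have int: "integrable centred_torus (\<lambda>h. K h *\<^sub>R (f (x + h) - f x))"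
    using conv_integrable[OF f K B] Kint by (simp add: scaleR_diff_right)
  have "conv K f x - f x = (LINT h|centred_torus. K h *\<^sub>R (f (x + h) - f x))"
    using conv_integrable[OF f K B] Kint one by (simp add: conv_def scaleR_diff_right)
  also have "ennreal (norm \<dots>) \<le> (\<integral>\<^sup>+h. norm (K h *\<^sub>R (f (x + h) - f x)) \<partial>centred_torus)"
    by (rule integral_norm_bound_ennreal[OF int])
  finally show ?thesis by simp
qed

lemma norm_cross3_le: "norm (cross3 x y) \<le> norm x * norm y"
proof (rule power2_le_imp_le)
  show "(norm (cross3 x y))\<^sup>2 \<le> (norm x * norm y)\<^sup>2"
    using norm_cross_dot[of x y] zero_le_power2[of "x \<bullet> y"] by linarith
qed simp

lemma bounded_bilinear_cross3: "bounded_bilinear cross3"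
  using bilinear_cross by (simp add: bilinear_conv_bounded_bilinear)

interpretation cross3: bounded_bilinear cross3
  by (rule bounded_bilinear_cross3)

lemma cross3_measurable [measurable]:
  assumes "f \<in> borel_measurable M" "g \<in> borel_measurable M"
  shows "(\<lambda>x. cross3 (f x) (g x)) \<in> borel_measurable M"
  by (rule borel_measurable_continuous_Pair[OF assms]) (intro cross3.continuous_on continuous_intros)

lemma Lp_norm_le_field_norm: "Lp_norm p torus (\<lambda>x. ennreal (norm (f x))) \<le> field_norm s p f"
  and gagliardo_le_field_norm: "gagliardo s p f \<le> field_norm s p f"
  by (simp_all add: field_norm_def add_increasing add_increasing2)

lemma one_le_double: "1 \<le> (p::ennreal) \<Longrightarrow> 1 \<le> 2 * p"
  by (metis mult_mono' mult.right_neutral one_le_numeral zero_le)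

text \<open>The exponents 2p, 2p, q with the constant 1 in the second place: on the torus, of finite
  volume, this lowers f from L^(2p) to L^p, the dual exponent of q.\<close>

lemma nn_integral_product_le:
  assumes [measurable]: "f \<in> borel_measurable borel" "g \<in> borel_measurable borel"
    and pq: "1 \<le> p" "1 \<le> q" "1 / p + 1 / q = 1"
  shows "(\<integral>\<^sup>+x. ennreal (norm (f x) * norm (g x)) \<partial>torus)
    \<le> field_norm s (2 * p) f * Lp_norm (2 * p) torus (\<lambda>x. ennreal 1) * field_norm s' q g"
proof -
  have "(\<integral>\<^sup>+x. ennreal (norm (f x) * norm (g x)) \<partial>torus)
      = (\<integral>\<^sup>+x. ennreal (norm (f x)) * ennreal 1 * ennreal (norm (g x)) \<partial>torus)"
    by (simp add: ennreal_mult)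
  also have "\<dots> \<le> Lp_norm (2 * p) torus (\<lambda>x. ennreal (norm (f x))) * Lp_norm (2 * p) torus (\<lambda>x. ennreal 1)
      * Lp_norm q torus (\<lambda>x. ennreal (norm (g x)))"
    by (rule Hoelder_three[OF _ _ _ pq]) auto
  also have "\<dots> \<le> field_norm s (2 * p) f * Lp_norm (2 * p) torus (\<lambda>x. ennreal 1) * field_norm s' q g"
    by (intro mult_mono Lp_norm_le_field_norm) auto
  finally show ?thesis .
qed

lemma integrable_product:
  assumes [measurable]: "f \<in> borel_measurable borel" "g \<in> borel_measurable borel"
    and pq: "1 \<le> p" "1 \<le> q" "1 / p + 1 / q = 1"
    and fin: "field_norm s (2 * p) f < \<infinity>" "field_norm s' q g < \<infinity>"
  shows "integrable torus (\<lambda>x. norm (f x) * norm (g x))"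
proof (rule integrableI_bounded)
  have "(\<integral>\<^sup>+x. ennreal (norm (f x) * norm (g x)) \<partial>torus) < \<infinity>"
    using nn_integral_product_le[OF assms(1-5), of s s'] fin
      Lp_norm_const_finite[OF torus.finite_measure_axioms one_le_double[OF pq(1)], of 1]
    by (auto simp: ennreal_mult_less_top intro: order.strict_trans1)
  then show "(\<integral>\<^sup>+x. ennreal (norm (norm (f x) * norm (g x))) \<partial>torus) < \<infinity>" by simp
qed measurable

section \<open>Estimates for smoothed products and for the commutator\<close>

context kernel
begin

text \<open>The power of 1 + |h| / \<epsilon> divided out here is the one that
  \<open>dominated\<close> supplies for the kernel, so that an increment times K is bounded by this
  quantity times \<kappa>.\<close>

definition increment :: "real \<Rightarrow> ennreal \<Rightarrow> (real ^ 3 \<Rightarrow> real ^ 3) \<Rightarrow> real ^ 3 \<Rightarrow> real ^ 3 \<Rightarrow> ennreal" where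
  "increment s p f h x =
    ennreal (norm (f (x + h) - f x) / (1 + norm h / \<epsilon>) powr (s + enn2real (3 / p)))"

lemma slot_increment_field:
  assumes "torus_field f" "1 \<le> p" "0 < s"
  shows "slot p (ennreal (C ^ 3 * \<epsilon> powr s) * field_norm s p f) (increment s p f)"
  unfolding increment_def
  by (rule slot_mono[OF slot_increment[OF torus_fieldD(1)]])
    (use assms gagliardo_le_field_norm in \<open>auto intro: mult_left_mono\<close>)

lemma slot_field:
  assumes "torus_field f" "1 \<le> p"
  shows "slot p (ennreal (C ^ 3) * field_norm s p f) (\<lambda>h x. ennreal (norm (f x)))"
  by (rule slot_mono[OF slot_torus])
    (use assms Lp_norm_le_field_norm torus_fieldD(1)[OF assms(1)] in \<open>auto intro: mult_left_mono\<close>)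

lemma dominated_measurable: "dominated \<epsilon> \<kappa> K \<Longrightarrow> K \<in> borel_measurable borel"
  by (simp add: dominated_def)

lemma dominated_weight:
  assumes "dominated \<epsilon> \<kappa> K" "h \<in> space centred_torus" "0 \<le> b" "b \<le> 7" "0 \<le> y"
  shows "\<bar>K h\<bar> * y \<le> \<kappa> h * (y / (1 + norm h / \<epsilon>) powr b)"
proof -
  have w: "1 \<le> 1 + norm h / \<epsilon>" using eps by simp
  have "\<bar>K h\<bar> * (1 + norm h / \<epsilon>) powr b \<le> \<bar>K h\<bar> * (1 + norm h / \<epsilon>) powr 7"
    using w assms by (intro mult_left_mono powr_mono) auto
  also have "\<dots> = \<bar>K h\<bar> * (1 + norm h / \<epsilon>) ^ 7"
    using w by (simp add: powr_numeral)
  also have "\<dots> \<le> \<kappa> h" using assms by (simp add: dominated_def)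
  finally have "\<bar>K h\<bar> * (1 + norm h / \<epsilon>) powr b * y \<le> \<kappa> h * y"
    using assms by (intro mult_right_mono)
  moreover have "0 < (1 + norm h / \<epsilon>) powr b" using w by (simp add: powr_gt_zero)
  ultimately show ?thesis by (simp add: field_simps)
qed

lemma dominated_bound:
  assumes "dominated \<epsilon> \<kappa> K" "h \<in> space centred_torus"
  shows "\<bar>K h\<bar> \<le> C / \<epsilon> ^ 3"
  using dominated_weight[OF assms, of 0 1] mass assms
  by (force simp: kernel_mass_def intro: order_trans)

lemma enn2real_exponent:
  assumes "1 \<le> p" shows "0 \<le> enn2real (3 / p)" "enn2real (3 / p) \<le> 3" "enn2real (3 / (2 * p)) \<le> 3 / 2"
proof -
  show "enn2real (3 / p) \<le> 3"
    using assms
  proof (cases p rule: exponent_cases)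
    case (2 P)
    then show ?thesis using divide_ennreal[of 3 P] by (simp add: divide_le_eq)
  qed simp
  show "enn2real (3 / (2 * p)) \<le> 3 / 2"
    using assms
  proof (cases p rule: exponent_cases)
    case (2 P)
    then have "2 * p = ennreal (2 * P)" by (simp add: ennreal_mult')
    then show ?thesis using 2 divide_ennreal[of 3 "2 * P"] by (simp add: divide_le_eq)
  qed (simp add: ennreal_mult_top)
qed simp

lemma increment_measurable:
  assumes "torus_field f"
  shows "(\<lambda>h. increment s p f h x) \<in> borel_measurable borel"
proof -
  note [measurable] = torus_fieldD(1)[OF assms]
  show ?thesis unfolding increment_def by measurable
qed

lemma increment_measurable_pair:
  assumes "torus_field f"
  shows "(\<lambda>(h, x). increment s p f h x) \<in> borel_measurable (borel \<Otimes>\<^sub>M borel)"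
proof -
  note [measurable] = torus_fieldD(1)[OF assms]
  show ?thesis unfolding increment_def by measurable
qed

lemma kappa_integral_measurable:
  assumes "(\<lambda>(h, x). F h x) \<in> borel_measurable (borel \<Otimes>\<^sub>M borel)"
  shows "(\<lambda>x. \<integral>\<^sup>+h. F h x \<partial>kappa_measure) \<in> borel_measurable torus"
proof -
  have "(\<lambda>z. (snd z, fst z)) \<in> torus \<Otimes>\<^sub>M kappa_measure \<rightarrow>\<^sub>M borel \<Otimes>\<^sub>M borel"
    by (intro measurable_Pair measurable_compose[OF measurable_snd kappa_measure_borel]
        measurable_compose[OF measurable_fst torus_borel])
  from measurable_compose[OF this assms]
  have "(\<lambda>(x, h). F h x) \<in> borel_measurable (torus \<Otimes>\<^sub>M kappa_measure)"
    by (simp add: case_prod_beta)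
  then show ?thesis by (rule kappa_measure.borel_measurable_nn_integral)
qed

lemma nn_integral_dominated_le:
  assumes K: "dominated \<epsilon> \<kappa> K" and f: "torus_field f" and p: "1 \<le> p" and s: "0 < s" "s < 1"
  shows "(\<integral>\<^sup>+h. ennreal (\<bar>K h\<bar> * norm (f (x + h) - f x)) \<partial>centred_torus)
    \<le> (\<integral>\<^sup>+h. increment s p f h x \<partial>kappa_measure)"
proof -
  have "(\<integral>\<^sup>+h. ennreal (\<bar>K h\<bar> * norm (f (x + h) - f x)) \<partial>centred_torus)
      \<le> (\<integral>\<^sup>+h. ennreal (\<kappa> h) * increment s p f h x \<partial>centred_torus)"
    using dominated_weight[OF K, of _ "s + enn2real (3 / p)"] s enn2real_exponent[OF p]
    by (intro nn_integral_mono) (auto simp: increment_def kappa_nonneg simp flip: ennreal_mult intro!: ennreal_leI)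
  also have "\<dots> = (\<integral>\<^sup>+h. increment s p f h x \<partial>kappa_measure)"
    by (rule nn_integral_kappa_measure[symmetric, OF increment_measurable[OF f]])
  finally show ?thesis .
qed

lemma nn_integral_dominated_two_le:
  assumes K: "dominated \<epsilon> \<kappa> K" and f: "torus_field f" and g: "torus_field g"
    and pq: "1 \<le> p" "1 \<le> q" and s: "0 < \<beta>" "\<beta> < 1" "0 < \<alpha>" "\<alpha> < 1"
  shows "(\<integral>\<^sup>+h. ennreal (\<bar>K h\<bar> * (norm (f (x + h) - f x) * norm (g (x + h) - g x))) \<partial>centred_torus)
    \<le> (\<integral>\<^sup>+h. increment \<beta> (2 * p) f h x * increment \<alpha> q g h x \<partial>kappa_measure)"
proof -
  let ?b = "\<beta> + enn2real (3 / (2 * p))" and ?c = "\<alpha> + enn2real (3 / q)"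
  have w: "0 < 1 + norm h / \<epsilon>" for h using eps by (intro add_pos_nonneg) auto
  have "ennreal (\<bar>K h\<bar> * (norm (f (x + h) - f x) * norm (g (x + h) - g x)))
      \<le> ennreal (\<kappa> h) * (increment \<beta> (2 * p) f h x * increment \<alpha> q g h x)"
    if h: "h \<in> space centred_torus" for h
  proof -
    have "\<bar>K h\<bar> * (norm (f (x + h) - f x) * norm (g (x + h) - g x))
        \<le> \<kappa> h * ((norm (f (x + h) - f x) * norm (g (x + h) - g x)) / (1 + norm h / \<epsilon>) powr (?b + ?c))"
      using s enn2real_exponent[OF pq(1)] enn2real_exponent[OF pq(2)]
      by (intro dominated_weight[OF K h] add_nonneg_nonneg) auto
    also have "\<dots> = \<kappa> h * (norm (f (x + h) - f x) / (1 + norm h / \<epsilon>) powr ?b *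
        (norm (g (x + h) - g x) / (1 + norm h / \<epsilon>) powr ?c))"
      using w[of h] by (simp add: powr_add)
    finally show ?thesis
      by (simp add: increment_def kappa_nonneg ennreal_leI flip: ennreal_mult)
  qed
  then have "(\<integral>\<^sup>+h. ennreal (\<bar>K h\<bar> * (norm (f (x + h) - f x) * norm (g (x + h) - g x))) \<partial>centred_torus)
      \<le> (\<integral>\<^sup>+h. ennreal (\<kappa> h) * (increment \<beta> (2 * p) f h x * increment \<alpha> q g h x) \<partial>centred_torus)"
    by (intro nn_integral_mono)
  also have "\<dots> = (\<integral>\<^sup>+h. increment \<beta> (2 * p) f h x * increment \<alpha> q g h x \<partial>kappa_measure)"
    using increment_measurable[OF f] increment_measurable[OF g]
    by (intro nn_integral_kappa_measure[symmetric]) measurable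
  finally show ?thesis .
qed

text \<open>Turns a factor that is free of the shift into an average over the shift, the form in
  which \<open>slot_Hoelder\<close> expects every factor.\<close>

lemma le_nn_integral_kappa_measure: "c \<le> (\<integral>\<^sup>+h. c \<partial>kappa_measure)"
  using mult_left_mono[OF emeasure_kappa_measure(1), of c] by simp

text \<open>With a and b bounding the errors of the smoothed fields, the difference of the products
  consists of terms of the size of a b, |f| b and a |g|. Each is a trilinear estimate with one slot
  filled by the constant 1, and every slot costs a factor C^3.\<close>

lemma product_conv_estimate:
  assumes K: "dominated \<epsilon> \<kappa> K" and one: "(LINT h|centred_torus. K h) = 1"
    and f: "torus_field f" and g: "torus_field g"
    and pq: "1 \<le> p" "1 \<le> q" "1 / p + 1 / q = 1" and s: "0 < \<beta>" "\<beta> < 1" "0 < \<alpha>" "\<alpha> < 1"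
    and fin: "field_norm \<beta> (2 * p) f < \<infinity>" "field_norm \<alpha> q g < \<infinity>"
    and [measurable]: "\<phi> \<in> borel_measurable borel" and B: "\<And>x. \<bar>\<phi> x\<bar> \<le> B"
  shows "ennreal \<bar>(LINT x|torus. conv K f x $ i * conv K g x $ j * \<phi> x) - (LINT x|torus. f x $ i * g x $ j * \<phi> x)\<bar>
    \<le> ennreal (B * C ^ 9 * (\<epsilon> powr \<beta> + \<epsilon> powr \<alpha> + \<epsilon> powr (\<beta> + \<alpha>))) * field_norm \<beta> (2 * p) f * field_norm \<alpha> q g"
proof -
  note [measurable] = torus_fieldD(1)[OF f] torus_fieldD(1)[OF g] dominated_measurable[OF K]
  note p2 = one_le_double[OF pq(1)]
  let ?Nf = "field_norm \<beta> (2 * p) f" and ?Ng = "field_norm \<alpha> q g"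
  have B0: "0 \<le> B" using B[of 0] by linarith
  define a where "a = (\<lambda>x. \<integral>\<^sup>+h. increment \<beta> (2 * p) f h x \<partial>kappa_measure)"
  define b where "b = (\<lambda>x. \<integral>\<^sup>+h. increment \<alpha> q g h x \<partial>kappa_measure)"
  have dom: "\<bar>K h\<bar> \<le> C / \<epsilon> ^ 3" if "h \<in> space centred_torus" for h
    using dominated_bound[OF K that] .
  have a: "ennreal (norm (conv K f x - f x)) \<le> a x" for x
    unfolding a_def by (rule order_trans[OF conv_diff_bound nn_integral_dominated_le])
      (use f K dom one p2 s in auto)
  have b: "ennreal (norm (conv K g x - g x)) \<le> b x" for x
    unfolding b_def by (rule order_trans[OF conv_diff_bound nn_integral_dominated_le])
      (use g K dom one pq s in auto)
  have [measurable]: "conv K f \<in> borel_measurable borel" "conv K g \<in> borel_measurable borel"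
    by (rule conv_measurable; measurable)+
  have int1: "integrable torus (\<lambda>x. conv K f x $ i * conv K g x $ j * \<phi> x)"
  proof (rule integrable_torus_bounded)
    fix x
    have "norm (conv K f x $ i * conv K g x $ j * \<phi> x) \<le> norm (conv K f x) * norm (conv K g x) * B"
      unfolding norm_mult using B[of x] B0 by (intro mult_mono) (auto simp: component_le_norm_cart)
    also have "\<dots> \<le> (C / \<epsilon> ^ 3 * (LINT y|torus. norm (f y))) * (C / \<epsilon> ^ 3 * (LINT y|torus. norm (g y))) * B"
      using conv_bounded[OF f dominated_measurable[OF K] dom] conv_bounded[OF g dominated_measurable[OF K] dom] B0
      by (intro mult_right_mono mult_mono) (auto intro: order_trans[OF norm_ge_zero])
    finally show "norm (conv K f x $ i * conv K g x $ j * \<phi> x) \<le> \<dots>" .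
  qed measurable
  have int2: "integrable torus (\<lambda>x. f x $ i * g x $ j * \<phi> x)"
  proof (rule Bochner_Integration.integrable_bound)
    show "integrable torus (\<lambda>x. norm (f x) * norm (g x) * B)"
      using integrable_product[OF torus_fieldD(1)[OF f] torus_fieldD(1)[OF g] pq fin] by simp
    show "AE x in torus. norm (f x $ i * g x $ j * \<phi> x) \<le> norm (norm (f x) * norm (g x) * B)"
    proof (rule AE_I2)
      fix x
      have "norm (f x $ i * g x $ j * \<phi> x) \<le> norm (f x) * norm (g x) * B"
        unfolding norm_mult using B[of x] B0 by (intro mult_mono) (auto simp: component_le_norm_cart)
      then show "norm (f x $ i * g x $ j * \<phi> x) \<le> norm (norm (f x) * norm (g x) * B)" using B0 by simp
    qed
  qed measurable
  have pointwise: "ennreal (norm (conv K f x $ i * conv K g x $ j * \<phi> x - f x $ i * g x $ j * \<phi> x))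
      \<le> ennreal B * (a x * 1 * b x + ennreal (norm (f x)) * 1 * b x + a x * 1 * ennreal (norm (g x)))" for x
  proof -
    let ?u = "conv K f x - f x" and ?v = "conv K g x - g x"
    have eq: "conv K f x $ i * conv K g x $ j * \<phi> x - f x $ i * g x $ j * \<phi> x =
        (?u $ i * ?v $ j + f x $ i * ?v $ j + ?u $ i * g x $ j) * \<phi> x"
      by (simp add: algebra_simps)
    have "norm ((?u $ i * ?v $ j + f x $ i * ?v $ j + ?u $ i * g x $ j) * \<phi> x)
        \<le> (norm ?u * norm ?v + norm (f x) * norm ?v + norm ?u * norm (g x)) * B"
    proof -
      have "\<bar>?u $ i * ?v $ j + f x $ i * ?v $ j + ?u $ i * g x $ j\<bar>
          \<le> \<bar>?u $ i\<bar> * \<bar>?v $ j\<bar> + \<bar>f x $ i\<bar> * \<bar>?v $ j\<bar> + \<bar>?u $ i\<bar> * \<bar>g x $ j\<bar>"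
        unfolding abs_mult[symmetric] by linarith
      also have "\<dots> \<le> norm ?u * norm ?v + norm (f x) * norm ?v + norm ?u * norm (g x)"
        by (intro add_mono mult_mono) (auto simp: component_le_norm_cart simp del: vector_minus_component)
      finally have "\<bar>?u $ i * ?v $ j + f x $ i * ?v $ j + ?u $ i * g x $ j\<bar> * \<bar>\<phi> x\<bar>
          \<le> (norm ?u * norm ?v + norm (f x) * norm ?v + norm ?u * norm (g x)) * B"
        by (rule mult_mono[OF _ B[of x]]) simp_all
      then show ?thesis
        unfolding real_norm_def abs_mult[of "?u $ i * ?v $ j + f x $ i * ?v $ j + ?u $ i * g x $ j" "\<phi> x"] .
    qed
    then have "ennreal (norm (conv K f x $ i * conv K g x $ j * \<phi> x - f x $ i * g x $ j * \<phi> x))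
      \<le> ennreal ((norm ?u * norm ?v + norm (f x) * norm ?v + norm ?u * norm (g x)) * B)"
      unfolding eq by (rule ennreal_leI)
    also have "\<dots> = ennreal B * (ennreal (norm ?u) * ennreal (norm ?v) + ennreal (norm (f x)) * ennreal (norm ?v)
        + ennreal (norm ?u) * ennreal (norm (g x)))"
      by (subst mult.commute) (simp add: ennreal_mult ennreal_plus B0)
    also have "\<dots> \<le> ennreal B * (a x * b x + ennreal (norm (f x)) * b x + a x * ennreal (norm (g x)))"
      by (intro mult_left_mono add_mono mult_mono a b) auto
    finally show ?thesis by simp
  qed
  have sa: "slot (2 * p) (ennreal (C ^ 3 * \<epsilon> powr \<beta>) * ?Nf) (increment \<beta> (2 * p) f)"
    using f p2 s by (intro slot_increment_field)
  have sb: "slot q (ennreal (C ^ 3 * \<epsilon> powr \<alpha>) * ?Ng) (increment \<alpha> q g)"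
    using g pq s by (intro slot_increment_field)
  have sf: "slot (2 * p) (ennreal (C ^ 3) * ?Nf) (\<lambda>h x. ennreal (norm (f x)))"
    using f p2 by (rule slot_field)
  have sg: "slot q (ennreal (C ^ 3) * ?Ng) (\<lambda>h x. ennreal (norm (g x)))"
    using g pq(2) by (rule slot_field)
  note s1 = slot_one[OF p2]
  have meas_b: "b \<in> borel_measurable torus" and meas_a: "a \<in> borel_measurable torus"
  proof -
    show "b \<in> borel_measurable torus" "a \<in> borel_measurable torus"
      unfolding a_def b_def
      by (intro kappa_integral_measurable increment_measurable_pair f g)+
  qed
  note [measurable] = meas_a meas_b
  have "ennreal \<bar>(LINT x|torus. conv K f x $ i * conv K g x $ j * \<phi> x) - (LINT x|torus. f x $ i * g x $ j * \<phi> x)\<bar>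
      \<le> (\<integral>\<^sup>+x. ennreal (norm (conv K f x $ i * conv K g x $ j * \<phi> x - f x $ i * g x $ j * \<phi> x)) \<partial>torus)"
    using integral_norm_bound_ennreal[OF Bochner_Integration.integrable_diff[OF int1 int2]] int1 int2 by simp
  also have "\<dots> \<le> (\<integral>\<^sup>+x. ennreal B * (a x * 1 * b x + ennreal (norm (f x)) * 1 * b x + a x * 1 * ennreal (norm (g x))) \<partial>torus)"
    by (intro nn_integral_mono pointwise)
  also have "\<dots> = ennreal B * ((\<integral>\<^sup>+x. a x * 1 * b x \<partial>torus) + (\<integral>\<^sup>+x. ennreal (norm (f x)) * 1 * b x \<partial>torus)
      + (\<integral>\<^sup>+x. a x * 1 * ennreal (norm (g x)) \<partial>torus))"
    by (simp add: nn_integral_cmult nn_integral_add)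
  also have "\<dots> \<le> ennreal B * (
      (ennreal (C ^ 3 * \<epsilon> powr \<beta>) * ?Nf) * ennreal (C ^ 3) * (ennreal (C ^ 3 * \<epsilon> powr \<alpha>) * ?Ng) +
      (ennreal (C ^ 3) * ?Nf) * ennreal (C ^ 3) * (ennreal (C ^ 3 * \<epsilon> powr \<alpha>) * ?Ng) +
      (ennreal (C ^ 3 * \<epsilon> powr \<beta>) * ?Nf) * ennreal (C ^ 3) * (ennreal (C ^ 3) * ?Ng))"
  proof (intro mult_left_mono add_mono)
    show "(\<integral>\<^sup>+x. a x * 1 * b x \<partial>torus) \<le>
        (ennreal (C ^ 3 * \<epsilon> powr \<beta>) * ?Nf) * ennreal (C ^ 3) * (ennreal (C ^ 3 * \<epsilon> powr \<alpha>) * ?Ng)"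
      by (rule order_trans[OF nn_integral_mono slot_Hoelder(1)[OF sa s1 sb pq]])
        (unfold a_def b_def, intro mult_mono le_nn_integral_kappa_measure order_refl zero_le)
    show "(\<integral>\<^sup>+x. ennreal (norm (f x)) * 1 * b x \<partial>torus) \<le>
        (ennreal (C ^ 3) * ?Nf) * ennreal (C ^ 3) * (ennreal (C ^ 3 * \<epsilon> powr \<alpha>) * ?Ng)"
      by (rule order_trans[OF nn_integral_mono slot_Hoelder(1)[OF sf s1 sb pq]])
        (unfold a_def b_def, intro mult_mono le_nn_integral_kappa_measure order_refl zero_le)
    show "(\<integral>\<^sup>+x. a x * 1 * ennreal (norm (g x)) \<partial>torus) \<le>
        (ennreal (C ^ 3 * \<epsilon> powr \<beta>) * ?Nf) * ennreal (C ^ 3) * (ennreal (C ^ 3) * ?Ng)"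
      by (rule order_trans[OF nn_integral_mono slot_Hoelder(1)[OF sa s1 sg pq]])
        (unfold a_def b_def, intro mult_mono le_nn_integral_kappa_measure order_refl zero_le)
  qed auto
  also have "\<dots> = (ennreal B * (
      (ennreal (C ^ 3 * \<epsilon> powr \<beta>)) * ennreal (C ^ 3) * (ennreal (C ^ 3 * \<epsilon> powr \<alpha>)) +
      (ennreal (C ^ 3)) * ennreal (C ^ 3) * (ennreal (C ^ 3 * \<epsilon> powr \<alpha>)) +
      (ennreal (C ^ 3 * \<epsilon> powr \<beta>)) * ennreal (C ^ 3) * (ennreal (C ^ 3)))) * ?Nf * ?Ng"
    by (simp add: algebra_simps)
  also have "ennreal B * (
      (ennreal (C ^ 3 * \<epsilon> powr \<beta>)) * ennreal (C ^ 3) * (ennreal (C ^ 3 * \<epsilon> powr \<alpha>)) +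
      (ennreal (C ^ 3)) * ennreal (C ^ 3) * (ennreal (C ^ 3 * \<epsilon> powr \<alpha>)) +
      (ennreal (C ^ 3 * \<epsilon> powr \<beta>)) * ennreal (C ^ 3) * (ennreal (C ^ 3)))
      = ennreal (B * C ^ 9 * (\<epsilon> powr \<beta> + \<epsilon> powr \<alpha> + \<epsilon> powr (\<beta> + \<alpha>)))"
  proof -
    have "C ^ 9 = C ^ 3 * C ^ 3 * C ^ 3" by (simp flip: power_add)
    then show ?thesis
      using C B0 eps by (simp add: powr_add algebra_simps flip: ennreal_mult ennreal_plus)
  qed
  finally show ?thesis .
qed

text \<open>Centring f at its average \<open>U\<close> makes the commutator an exact average: it is
  the smoothed f \<times> g minus U \<times> G, where G is the smoothed g and U \<times> G is
  orthogonal to G. Replacing U by f(x) afterwards gives one term in which both increments share a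
  shift (\<open>ab\<close>) and one product of separate averages (\<open>a\<close> and
  \<open>b\<close>). The remaining factor G is bounded by \<open>a\<close> / \<epsilon>, so both
  integrals are trilinear with exponents 2p, 2p, q.\<close>

lemma commutator_estimate:
  fixes L :: "real ^ 3 \<Rightarrow> real ^ 3"
  assumes K: "dominated \<epsilon> \<kappa> K" and one: "(LINT h|centred_torus. K h) = 1"
    and L [measurable]: "L \<in> borel_measurable borel" and domL: "dominated \<epsilon> \<kappa> (\<lambda>h. \<epsilon> * norm (L h))"
    and L0: "(LINT h|centred_torus. L h) = 0"
    and f: "torus_field f" and g: "torus_field g"
    and pq: "1 \<le> p" "1 \<le> q" "1 / p + 1 / q = 1" and s: "0 < \<beta>" "\<beta> < 1" "0 < \<alpha>" "\<alpha> < 1"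
    and fin: "field_norm \<beta> (2 * p) f < \<infinity>" "field_norm \<alpha> q g < \<infinity>"
    and curl: "\<And>x. conv K g x = (LINT h|centred_torus. cross3 (L h) (f (x + h)))"
  shows "ennreal \<bar>LINT x|torus. conv K (\<lambda>y. cross3 (f y) (g y)) x \<bullet> conv K g x\<bar>
    \<le> ennreal (2 * C ^ 9 * \<epsilon> powr (2 * \<beta> + \<alpha> - 1)) *
      (field_norm \<beta> (2 * p) f * field_norm \<beta> (2 * p) f * field_norm \<alpha> q g)"
proof -
  note [measurable] = torus_fieldD(1)[OF f] torus_fieldD(1)[OF g] dominated_measurable[OF K]
  note p2 = one_le_double[OF pq(1)]
  let ?Nf = "field_norm \<beta> (2 * p) f" and ?Ng = "field_norm \<alpha> q g"
  let ?F = "\<lambda>y. cross3 (f y) (g y)"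
  define a where "a = (\<lambda>x. \<integral>\<^sup>+h. increment \<beta> (2 * p) f h x \<partial>kappa_measure)"
  define b where "b = (\<lambda>x. \<integral>\<^sup>+h. increment \<alpha> q g h x \<partial>kappa_measure)"
  define ab where "ab = (\<lambda>x. \<integral>\<^sup>+h. increment \<beta> (2 * p) f h x * increment \<alpha> q g h x \<partial>kappa_measure)"
  have dom: "\<bar>K h\<bar> \<le> C / \<epsilon> ^ 3" if "h \<in> space centred_torus" for h
    using dominated_bound[OF K that] .
  have [measurable]: "?F \<in> borel_measurable borel"
    by measurable
  have F: "torus_field ?F"
    unfolding torus_field_def
  proof (intro conjI)
    show "periodic ?F" using torus_fieldD(2)[OF f] torus_fieldD(2)[OF g] by (simp add: periodic_def)
    show "integrable torus ?F"
      by (rule Bochner_Integration.integrable_bound[OF integrable_product[OF torus_fieldD(1)[OF f] torus_fieldD(1)[OF g] pq fin]])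
        (auto intro!: AE_I2 norm_cross3_le)
  qed fact
  have Kint: "integrable centred_torus K"
    by (rule centred_torus.integrable_const_bound[where B = "C / \<epsilon> ^ 3"]) (use dom in \<open>auto intro!: AE_I2\<close>)
  have domL': "norm (L h) \<le> C / \<epsilon> ^ 4" if "h \<in> space centred_torus" for h
    using dominated_bound[OF domL that] eps by (simp add: field_simps abs_mult power4_eq_xxxx power3_eq_cube)
  have Lint: "integrable centred_torus L"
    by (rule centred_torus.integrable_const_bound[where B = "C / \<epsilon> ^ 4"]) (use domL' in \<open>auto intro!: AE_I2\<close>)
  have Lf: "integrable centred_torus (\<lambda>h. cross3 (L h) (f (x + h)))" for x
  proof (rule Bochner_Integration.integrable_bound)
    show "integrable centred_torus (\<lambda>h. C / \<epsilon> ^ 4 * norm (f (x + h)))"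
      using torus_field_shift(1)[OF f] by (intro integrable_mult_right integrable_norm)
    have "norm (cross3 (L h) (f (x + h))) \<le> C / \<epsilon> ^ 4 * norm (f (x + h))" if "h \<in> space centred_torus" for h
      by (rule order_trans[OF norm_cross3_le mult_right_mono[OF domL'[OF that]]]) simp
    then show "AE h in centred_torus. norm (cross3 (L h) (f (x + h))) \<le> norm (C / \<epsilon> ^ 4 * norm (f (x + h)))"
      using C eps by (intro AE_I2) (simp add: abs_mult)
    show "(\<lambda>h. cross3 (L h) (f (x + h))) \<in> borel_measurable centred_torus"
      by (intro borel_measurable_centred_torus) measurable
  qed
  have a: "ennreal (norm (conv K f x - f x)) \<le> a x" for x
    unfolding a_def by (rule order_trans[OF conv_diff_bound nn_integral_dominated_le])
      (use f K dom one p2 s in auto)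
  have conv_g: "ennreal (norm (conv K g x)) \<le> ennreal (1 / \<epsilon>) * a x" for x
  proof -
    \<comment> \<open>The mean of \<open>L\<close> is zero, so f(x) can be subtracted; the increment
      of f then offsets part of the factor 1 / \<epsilon> in the size of \<open>L\<close>.\<close>
    have eq: "conv K g x = (LINT h|centred_torus. cross3 (L h) (f (x + h) - f x))"
      using Lf[of x] Lint L0
      by (simp add: curl cross3.diff_right integral_bounded_linear[OF cross3.bounded_linear_left]
          cross3.zero_left integrable_bounded_linear[OF cross3.bounded_linear_left])
    have "integrable centred_torus (\<lambda>h. cross3 (L h) (f (x + h) - f x))"
      using Lf[of x] Lint by (simp add: cross3.diff_right integrable_bounded_linear[OF cross3.bounded_linear_left])
    then have "ennreal (norm (conv K g x)) \<le> (\<integral>\<^sup>+h. norm (cross3 (L h) (f (x + h) - f x)) \<partial>centred_torus)"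
      unfolding eq by (rule integral_norm_bound_ennreal)
    also have "\<dots> \<le> (\<integral>\<^sup>+h. ennreal (1 / \<epsilon>) * ennreal (\<bar>\<epsilon> * norm (L h)\<bar> * norm (f (x + h) - f x)) \<partial>centred_torus)"
      using eps by (intro nn_integral_mono) (auto simp: abs_mult norm_cross3_le intro!: ennreal_leI simp flip: ennreal_mult)
    also have "\<dots> = ennreal (1 / \<epsilon>) * (\<integral>\<^sup>+h. ennreal (\<bar>\<epsilon> * norm (L h)\<bar> * norm (f (x + h) - f x)) \<partial>centred_torus)"
      by (rule nn_integral_cmult) measurable
    also have "\<dots> \<le> ennreal (1 / \<epsilon>) * a x"
      unfolding a_def using f domL p2 s by (intro mult_left_mono nn_integral_dominated_le) auto
    finally show ?thesis .
  qed
  have pointwise: "ennreal (norm (conv K ?F x \<bullet> conv K g x)) \<le> ennreal (1 / \<epsilon>) * (ab x * a x + a x * a x * b x)" for x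
  proof -
    define U G where "U = conv K f x" and "G = conv K g x"
    have i1: "integrable centred_torus (\<lambda>h. K h *\<^sub>R ?F (x + h))"
      by (rule conv_integrable[OF F _ dom]) measurable
    have i2: "integrable centred_torus (\<lambda>h. K h *\<^sub>R f (x + h))"
      by (rule conv_integrable[OF f _ dom]) measurable
    have i3: "integrable centred_torus (\<lambda>h. K h *\<^sub>R g (x + h))"
      by (rule conv_integrable[OF g _ dom]) measurable
    \<comment> \<open>Integrated over h this gives \<open>conv K ?F x - cross3 U G\<close>: the two
      terms with g(x) cancel, because \<open>U\<close> is the average of f and \<open>K\<close> has
      integral 1.\<close>
    have expand: "K h *\<^sub>R cross3 (f (x + h) - U) (g (x + h) - g x) = K h *\<^sub>R ?F (x + h)
        - cross3 U (K h *\<^sub>R g (x + h)) - cross3 (K h *\<^sub>R f (x + h)) (g x) + K h *\<^sub>R cross3 U (g x)" for h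
      by (simp add: cross3.diff_left cross3.diff_right cross3.scaleR_left cross3.scaleR_right algebra_simps)
    have j: "integrable centred_torus (\<lambda>h. cross3 U (K h *\<^sub>R g (x + h)))"
      "integrable centred_torus (\<lambda>h. cross3 (K h *\<^sub>R f (x + h)) (g x))"
      "(LINT h|centred_torus. cross3 U (K h *\<^sub>R g (x + h))) = cross3 U G"
      "(LINT h|centred_torus. cross3 (K h *\<^sub>R f (x + h)) (g x)) = cross3 U (g x)"
      using i2 i3 unfolding U_def G_def conv_def
      by (auto intro: integrable_bounded_linear[OF cross3.bounded_linear_left]
          integrable_bounded_linear[OF cross3.bounded_linear_right]
          simp: integral_bounded_linear[OF cross3.bounded_linear_left] integral_bounded_linear[OF cross3.bounded_linear_right])
    have int: "integrable centred_torus (\<lambda>h. K h *\<^sub>R cross3 (f (x + h) - U) (g (x + h) - g x))"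
      unfolding expand using i1 j Kint by simp
    have "(LINT h|centred_torus. K h *\<^sub>R cross3 (f (x + h) - U) (g (x + h) - g x)) = conv K ?F x - cross3 U G"
      unfolding expand using i1 j Kint one by (simp add: conv_def)
    then have "conv K ?F x \<bullet> G = (LINT h|centred_torus. K h *\<^sub>R cross3 (f (x + h) - U) (g (x + h) - g x)) \<bullet> G"
      by (simp add: inner_diff_left dot_cross_self)
    then have "norm (conv K ?F x \<bullet> G) \<le> norm (LINT h|centred_torus. K h *\<^sub>R cross3 (f (x + h) - U) (g (x + h) - g x)) * norm G"
      by (simp add: Cauchy_Schwarz_ineq2)
    then have "ennreal (norm (conv K ?F x \<bullet> G)) \<le>
        ennreal (norm (LINT h|centred_torus. K h *\<^sub>R cross3 (f (x + h) - U) (g (x + h) - g x))) * ennreal (norm G)"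
      by (simp flip: ennreal_mult)
    also have "\<dots> \<le> (\<integral>\<^sup>+h. ennreal (norm (K h *\<^sub>R cross3 (f (x + h) - U) (g (x + h) - g x))) \<partial>centred_torus)
        * (ennreal (1 / \<epsilon>) * a x)"
      unfolding G_def by (intro mult_mono integral_norm_bound_ennreal[OF int] conv_g) auto
    also have "(\<integral>\<^sup>+h. ennreal (norm (K h *\<^sub>R cross3 (f (x + h) - U) (g (x + h) - g x))) \<partial>centred_torus)
        \<le> (\<integral>\<^sup>+h. ennreal (\<bar>K h\<bar> * (norm (f (x + h) - f x) * norm (g (x + h) - g x)))
          + ennreal (norm (U - f x)) * ennreal (\<bar>K h\<bar> * norm (g (x + h) - g x)) \<partial>centred_torus)"
    proof (rule nn_integral_mono)
      fix h
      have "norm (cross3 (f (x + h) - U) (g (x + h) - g x)) \<le> norm (f (x + h) - U) * norm (g (x + h) - g x)"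
        by (rule norm_cross3_le)
      also have "\<dots> \<le> (norm (f (x + h) - f x) + norm (U - f x)) * norm (g (x + h) - g x)"
        using norm_triangle_ineq4[of "f (x + h) - f x" "U - f x"] by (intro mult_right_mono) auto
      finally have "\<bar>K h\<bar> * norm (cross3 (f (x + h) - U) (g (x + h) - g x)) \<le>
          \<bar>K h\<bar> * ((norm (f (x + h) - f x) + norm (U - f x)) * norm (g (x + h) - g x))"
        by (rule mult_left_mono) simp
      then show "ennreal (norm (K h *\<^sub>R cross3 (f (x + h) - U) (g (x + h) - g x)))
        \<le> ennreal (\<bar>K h\<bar> * (norm (f (x + h) - f x) * norm (g (x + h) - g x)))
          + ennreal (norm (U - f x)) * ennreal (\<bar>K h\<bar> * norm (g (x + h) - g x))"
        by (auto simp: algebra_simps intro!: ennreal_leI simp flip: ennreal_mult ennreal_plus)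
    qed
    also have "\<dots> = (\<integral>\<^sup>+h. ennreal (\<bar>K h\<bar> * (norm (f (x + h) - f x) * norm (g (x + h) - g x))) \<partial>centred_torus)
        + ennreal (norm (U - f x)) * (\<integral>\<^sup>+h. ennreal (\<bar>K h\<bar> * norm (g (x + h) - g x)) \<partial>centred_torus)"
      by (simp add: nn_integral_add nn_integral_cmult)
    also have "\<dots> \<le> ab x + a x * b x"
      unfolding U_def ab_def b_def using f g K pq s
      by (intro add_mono mult_mono a nn_integral_dominated_le nn_integral_dominated_two_le) auto
    finally show ?thesis
      unfolding G_def by (simp add: algebra_simps mult_right_mono)
  qed
  have sa: "slot (2 * p) (ennreal (C ^ 3 * \<epsilon> powr \<beta>) * ?Nf) (increment \<beta> (2 * p) f)"
    using f p2 s by (intro slot_increment_field)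
  have sb: "slot q (ennreal (C ^ 3 * \<epsilon> powr \<alpha>) * ?Ng) (increment \<alpha> q g)"
    using g pq s by (intro slot_increment_field)
  have int: "integrable torus (\<lambda>x. conv K ?F x \<bullet> conv K g x)"
  proof (rule integrable_torus_bounded)
    fix x
    have "norm (conv K ?F x \<bullet> conv K g x) \<le> norm (conv K ?F x) * norm (conv K g x)"
      by (simp add: Cauchy_Schwarz_ineq2)
    also have "\<dots> \<le> (C / \<epsilon> ^ 3 * (LINT y|torus. norm (?F y))) * (C / \<epsilon> ^ 3 * (LINT y|torus. norm (g y)))"
      using conv_bounded[OF F dominated_measurable[OF K] dom] conv_bounded[OF g dominated_measurable[OF K] dom]
      by (intro mult_mono) (auto intro: order_trans[OF norm_ge_zero])
    finally show "norm (conv K ?F x \<bullet> conv K g x) \<le> \<dots>" .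
  qed measurable
  have "ennreal \<bar>LINT x|torus. conv K ?F x \<bullet> conv K g x\<bar> \<le> (\<integral>\<^sup>+x. norm (conv K ?F x \<bullet> conv K g x) \<partial>torus)"
    using integral_norm_bound_ennreal[OF int] by simp
  also have "\<dots> \<le> (\<integral>\<^sup>+x. ennreal (1 / \<epsilon>) * (ab x * a x + a x * a x * b x) \<partial>torus)"
    by (intro nn_integral_mono pointwise)
  also have "\<dots> = ennreal (1 / \<epsilon>) * ((\<integral>\<^sup>+x. ab x * a x \<partial>torus) + (\<integral>\<^sup>+x. a x * a x * b x \<partial>torus))"
  proof -
    have [measurable]: "a \<in> borel_measurable torus" "b \<in> borel_measurable torus" "ab \<in> borel_measurable torus"
      unfolding a_def b_def ab_def
      using increment_measurable_pair[OF f, of \<beta> "2 * p"] increment_measurable_pair[OF g, of \<alpha> q]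
      by (auto intro!: kappa_integral_measurable borel_measurable_times simp: case_prod_beta)
    show ?thesis by (simp add: nn_integral_cmult nn_integral_add)
  qed
  also have "\<dots> \<le> ennreal (1 / \<epsilon>) * (
      (ennreal (C ^ 3 * \<epsilon> powr \<beta>) * ?Nf) * (ennreal (C ^ 3 * \<epsilon> powr \<beta>) * ?Nf) * (ennreal (C ^ 3 * \<epsilon> powr \<alpha>) * ?Ng) +
      (ennreal (C ^ 3 * \<epsilon> powr \<beta>) * ?Nf) * (ennreal (C ^ 3 * \<epsilon> powr \<beta>) * ?Nf) * (ennreal (C ^ 3 * \<epsilon> powr \<alpha>) * ?Ng))"
    unfolding ab_def a_def b_def
    by (intro mult_left_mono add_mono slot_Hoelder[OF sa sa sb pq]) auto
  also have "\<dots> = (ennreal (1 / \<epsilon>) * 2 *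
      (ennreal (C ^ 3 * \<epsilon> powr \<beta>) * ennreal (C ^ 3 * \<epsilon> powr \<beta>) * ennreal (C ^ 3 * \<epsilon> powr \<alpha>))) * (?Nf * ?Nf * ?Ng)"
    by (subst mult_2[symmetric]) (simp only: mult_ac)
  also have "ennreal (1 / \<epsilon>) * 2 *
      (ennreal (C ^ 3 * \<epsilon> powr \<beta>) * ennreal (C ^ 3 * \<epsilon> powr \<beta>) * ennreal (C ^ 3 * \<epsilon> powr \<alpha>))
      = ennreal (2 * C ^ 9 * \<epsilon> powr (2 * \<beta> + \<alpha> - 1))"
  proof -
    have "C ^ 9 = C ^ 3 * C ^ 3 * C ^ 3" by (simp flip: power_add)
    moreover have "\<epsilon> powr (2 * \<beta> + \<alpha> - 1) = \<epsilon> powr \<beta> * \<epsilon> powr \<beta> * \<epsilon> powr \<alpha> / \<epsilon>"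
    proof -
      have e: "2 * \<beta> + \<alpha> - 1 = \<beta> + \<beta> + \<alpha> - 1" by simp
      show ?thesis unfolding e powr_diff powr_add using eps by simp
    qed
    moreover have "ennreal (1 / \<epsilon>) * 2 = ennreal (2 / \<epsilon>)"
      using ennreal_mult[of "1 / \<epsilon>" 2] eps by simp
    ultimately show ?thesis
      using C eps by (simp add: mult_ac flip: ennreal_mult)
  qed
  finally show ?thesis .
qed

end

section \<open>A trigonometric kernel\<close>

definition cos_mode :: "int ^ 3 \<Rightarrow> real ^ 3 \<Rightarrow> real" where
  "cos_mode k x = cos (2 * pi * (lattice_vec k \<bullet> x))"

definition sin_mode :: "int ^ 3 \<Rightarrow> real ^ 3 \<Rightarrow> real" where
  "sin_mode k x = sin (2 * pi * (lattice_vec k \<bullet> x))"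

text \<open>The reciprocal of the mean of cos^(2n) over a period, hence the normalization to
  integral 1.\<close>

definition central :: "nat \<Rightarrow> real" where
  "central n = 4 ^ n / real ((2 * n) choose n)"

text \<open>A product of three one-dimensional de la Vallee Poussin kernels: a nonnegative
  trigonometric polynomial of degree n in each coordinate, concentrated at the scale 1 / sqrt
  n.\<close>

definition trig_kernel :: "nat \<Rightarrow> real ^ 3 \<Rightarrow> real" where
  "trig_kernel n h = (\<Prod>i\<in>UNIV. central n * cos (pi * h $ i) ^ (2 * n))"

text \<open>The Fourier coefficients of the one-dimensional kernel. The case distinction is
  essential for j < -n, where \<open>nat\<close> would truncate to 0 and the binomial coefficient
  would be 1.\<close>

definition weight1 :: "nat \<Rightarrow> int \<Rightarrow> real" where
  "weight1 n j = (if \<bar>j\<bar> \<le> int n then real ((2 * n) choose nat (int n + j)) / real ((2 * n) choose n) else 0)"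

definition weight :: "nat \<Rightarrow> int ^ 3 \<Rightarrow> real" where
  "weight n k = (\<Prod>i\<in>UNIV. weight1 n (k $ i))"

definition modes :: "nat \<Rightarrow> (int ^ 3) set" where
  "modes n = (\<lambda>(a, b, c). vector [a, b, c]) ` ({- int n..int n} \<times> {- int n..int n} \<times> {- int n..int n})"

section \<open>Central binomial coefficients and Fourier weights\<close>

lemma central_pos: "0 < central n"
  by (simp add: central_def)

lemma central_Suc: "real ((2 * Suc n) choose Suc n) = real ((2 * n) choose n) * (2 * (2 * real n + 1) / (real n + 1))"
proof -
  have 1: "Suc n * ((2 * Suc n) choose Suc n) = (2 * Suc n) * (Suc (2 * n) choose n)"
    using Suc_times_binomial[of n "Suc (2 * n)"] by simp
  have 2: "Suc n * (Suc (2 * n) choose n) = Suc (2 * n) * ((2 * n) choose n)"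
    using binomial_absorb_comp[of "Suc (2 * n)" n] by (simp add: Suc_diff_le)
  have "real (Suc n) * real ((2 * Suc n) choose Suc n) = 2 * (real (Suc n) * real (Suc (2 * n) choose n))"
    using arg_cong[OF 1, of real] by (simp only: of_nat_mult of_nat_numeral mult_ac)
  also have "\<dots> = 2 * (real (Suc (2 * n)) * real ((2 * n) choose n))"
    using arg_cong[OF 2, of real] by (simp only: of_nat_mult)
  finally show ?thesis by (simp add: field_simps)
qed

text \<open>Elementary substitutes for Stirling's formula. With the ratio 2 (2n + 1) / (n + 1) of
  successive central binomial coefficients, the prefactors 2n + 1 and 4n are chosen so that the
  induction steps become (2n + 3) (2n + 1) \<le> 4 (n + 1)^2 and 4n (n + 1) \<le> (2n +
  1)^2.\<close>

lemma central_square_bounds: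
  "(2 * real n + 1) * (real ((2 * n) choose n))\<^sup>2 \<le> 16 ^ n"
  "1 \<le> n \<Longrightarrow> 16 ^ n \<le> 4 * real n * (real ((2 * n) choose n))\<^sup>2"
proof -
  show "(2 * real n + 1) * (real ((2 * n) choose n))\<^sup>2 \<le> 16 ^ n"
  proof (induction n)
    case (Suc n)
    define b where "b = real ((2 * n) choose n)"
    have nn: "0 \<le> 2 * (2 * real n + 1) * b\<^sup>2 * 2" by simp
    have "(2 * real n + 3) * (2 * real n + 1) * (2 * (2 * real n + 1) * b\<^sup>2 * 2)
        \<le> 4 * (real n + 1)\<^sup>2 * (2 * (2 * real n + 1) * b\<^sup>2 * 2)"
      by (rule mult_right_mono[OF _ nn]) (simp add: power2_eq_square algebra_simps)
    then have "(2 * real (Suc n) + 1) * (b * (2 * (2 * real n + 1) / (real n + 1)))\<^sup>2 \<le> 16 * ((2 * real n + 1) * b\<^sup>2)"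
      by (simp add: power_mult_distrib power_divide divide_le_eq)
        (simp add: power2_eq_square algebra_simps, simp add: b_def)
    also have "\<dots> \<le> 16 * 16 ^ n" using Suc by (simp add: b_def)
    finally show ?case unfolding central_Suc b_def by simp
  qed simp
  show "1 \<le> n \<Longrightarrow> 16 ^ n \<le> 4 * real n * (real ((2 * n) choose n))\<^sup>2"
  proof (induction n rule: nat_induct_at_least)
    case (Suc n)
    define b where "b = real ((2 * n) choose n)"
    have "16 ^ Suc n \<le> 16 * (4 * real n * b\<^sup>2)" using Suc by (simp add: b_def)
    also have "\<dots> \<le> 4 * real (Suc n) * (b * (2 * (2 * real n + 1) / (real n + 1)))\<^sup>2"
    proof -
      have "4 * real n * (real n + 1) * (16 * b\<^sup>2) \<le> (2 * real n + 1)\<^sup>2 * (16 * b\<^sup>2)"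
        by (intro mult_right_mono) (auto simp: power2_eq_square algebra_simps)
      then show ?thesis
        by (simp add: power_mult_distrib power_divide le_divide_eq)
          (simp add: power2_eq_square field_simps, simp add: b_def)
    qed
    finally show ?case by (simp only: central_Suc b_def)
  qed (simp add: numeral_2_eq_2)
qed

lemma central_bounds:
  "sqrt (real n) \<le> central n" "1 \<le> n \<Longrightarrow> central n \<le> 2 * sqrt (real n)"
proof -
  have pos: "0 < real ((2 * n) choose n)" by simp
  have sq: "(central n)\<^sup>2 = 16 ^ n / (real ((2 * n) choose n))\<^sup>2"
    by (simp add: central_def power_divide) (simp add: power2_eq_square flip: power_mult_distrib)
  have "real n * (real ((2 * n) choose n))\<^sup>2 \<le> (2 * real n + 1) * (real ((2 * n) choose n))\<^sup>2"
    by (intro mult_right_mono) auto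
  also have "\<dots> \<le> 16 ^ n" by (rule central_square_bounds)
  finally have "real n \<le> (central n)\<^sup>2" using pos by (simp add: sq le_divide_eq)
  then show "sqrt (real n) \<le> central n" using central_pos[of n] by (intro real_le_lsqrt) auto
  assume "1 \<le> n"
  then have "(central n)\<^sup>2 \<le> 4 * real n"
    using central_square_bounds(2)[of n] pos by (simp add: sq divide_le_eq)
  then have "sqrt ((central n)\<^sup>2) \<le> sqrt (4 * real n)" by (rule real_sqrt_le_mono)
  then show "central n \<le> 2 * sqrt (real n)"
    using central_pos[of n] by (simp add: real_sqrt_mult)
qed

lemma weight1_bounds: "0 \<le> weight1 n j" "weight1 n j \<le> 1"
  using binomial_maximum'[of n] by (auto simp: weight1_def)

lemma weight1_0: "weight1 n 0 = 1"
  by (simp add: weight1_def)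

lemma weight1_minus: "weight1 n (- j) = weight1 n j"
proof -
  have "(2 * n) choose nat (int n - j) = (2 * n) choose nat (int n + j)" if "\<bar>j\<bar> \<le> int n"
  proof -
    have "nat (int n + j) \<le> 2 * n" "2 * n - nat (int n + j) = nat (int n - j)" using that by linarith+
    then show ?thesis using binomial_symmetric[of "nat (int n + j)" "2 * n"] by simp
  qed
  then show ?thesis by (simp add: weight1_def)
qed

lemma weight_bounds: "0 \<le> weight n k" "weight n k \<le> 1"
  unfolding weight_def by (auto intro!: prod_nonneg prod_le_1 simp: weight1_bounds)

lemma weight_0: "weight n 0 = 1"
  by (simp add: weight_def weight1_0)

lemma weight_minus: "weight n (- k) = weight n k"
  by (simp add: weight_def weight1_minus)

lemma finite_modes [simp]: "finite (modes n)"
  unfolding modes_def by (intro finite_imageI) simp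

lemma in_modes_iff: "k \<in> modes n \<longleftrightarrow> (\<forall>i. \<bar>k $ i\<bar> \<le> int n)"
proof
  assume "\<forall>i. \<bar>k $ i\<bar> \<le> int n"
  then have "- int n \<le> k $ i \<and> k $ i \<le> int n" for i by (simp add: abs_le_iff minus_le_iff)
  then show "k \<in> modes n"
    unfolding modes_def
    by (intro image_eqI[where x = "(k $ 1, k $ 2, k $ 3)"]) (auto simp: vec_eq_iff forall_3)
qed (auto simp: modes_def forall_3)

lemma weight_eq_0: "k \<notin> modes n \<Longrightarrow> weight n k = 0"
  by (auto simp: in_modes_iff weight_def weight1_def)

text \<open>Consecutive weights have ratio (n - i) / (n + i + 1), which tends to 1 for fixed i;
  negative j follow from evenness.\<close>

lemma weight1_tendsto: "(\<lambda>n. weight1 n j) \<longlonglongrightarrow> 1"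
proof -
  have nonneg: "(\<lambda>n. weight1 n (int i)) \<longlonglongrightarrow> 1" for i
  proof (induction i)
    case 0
    then show ?case by (simp add: weight1_0)
  next
    case (Suc i)
    have step: "weight1 n (int (Suc i)) = weight1 n (int i) * ((real n - real i) / (real n + real i + 1))"
      if "Suc i \<le> n" for n
    proof -
      have nn: "nat (int n + int i) = n + i" "nat (1 + (int n + int i)) = Suc (n + i)" "nat (int n + (1 + int i)) = Suc (n + i)"
        by linarith+
      have "Suc (n + i) * ((2 * n) choose Suc (n + i)) = (n - i) * ((2 * n) choose (n + i))"
        using binomial_absorption[of "n + i" "2 * n"] binomial_absorb_comp[of "2 * n" "n + i"] that
        by (simp add: mult_2)
      then have "real (Suc (n + i)) * real ((2 * n) choose Suc (n + i)) = real (n - i) * real ((2 * n) choose (n + i))"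
        by (metis of_nat_mult)
      then have "real ((2 * n) choose Suc (n + i)) = real ((2 * n) choose (n + i)) * ((real n - real i) / (real n + real i + 1))"
        using that by (simp add: field_simps of_nat_diff)
      then show ?thesis using that by (simp add: weight1_def nn)
    qed
    have "(\<lambda>n. 1 - (2 * real i + 1) * inverse (real (n + (i + 1)))) \<longlonglongrightarrow> 1 - (2 * real i + 1) * 0"
      by (intro tendsto_intros LIMSEQ_ignore_initial_segment lim_inverse_n)
    moreover have "1 - (2 * real i + 1) * inverse (real (n + (i + 1))) = (real n - real i) / (real n + real i + 1)" for n
      by (simp add: field_simps)
    ultimately have "(\<lambda>n. (real n - real i) / (real n + real i + 1)) \<longlonglongrightarrow> 1" by simp
    with Suc have "(\<lambda>n. weight1 n (int i) * ((real n - real i) / (real n + real i + 1))) \<longlonglongrightarrow> 1 * 1"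
      by (intro tendsto_mult)
    then have "(\<lambda>n. weight1 n (int i) * ((real n - real i) / (real n + real i + 1))) \<longlonglongrightarrow> 1" by simp
    then show ?case
      by (rule Lim_transform_eventually) (rule eventually_sequentiallyI[of "Suc i"], rule step[symmetric])
  qed
  show ?thesis
  proof (cases "0 \<le> j")
    case True
    then show ?thesis using nonneg[of "nat j"] by simp
  next
    case False
    then show ?thesis using nonneg[of "nat (- j)"] by (simp add: weight1_minus)
  qed
qed

lemma weight_tendsto: "(\<lambda>n. weight n k) \<longlonglongrightarrow> 1"
  unfolding weight_def using tendsto_prod[of UNIV "\<lambda>i n. weight1 n (k $ i)" "\<lambda>_. 1"] weight1_tendsto by simp

text \<open>The binomial theorem for the cosine as half the sum of two opposite exponentials. The
  summation index k becomes the frequency j = k - n, and the normalization turns the binomial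
  coefficients into \<open>weight1\<close>.\<close>

lemma central_cos_power:
  "complex_of_real (central n * cos (pi * t) ^ (2 * n)) =
    (\<Sum>j\<in>{- int n..int n}. complex_of_real (weight1 n j) * cis (2 * pi * (of_int j * t)))"
proof -
  have eq: "complex_of_real (cos (pi * t)) = (cis (pi * t) + cis (- (pi * t))) / 2"
    by (simp add: complex_eq_iff)
  have "complex_of_real (cos (pi * t) ^ (2 * n)) = (cis (pi * t) + cis (- (pi * t))) ^ (2 * n) / 4 ^ n"
    unfolding of_real_power eq by (simp add: power_divide power_mult)
  also have "(cis (pi * t) + cis (- (pi * t))) ^ (2 * n) =
      (\<Sum>k\<le>2 * n. of_nat ((2 * n) choose k) * cis (pi * t) ^ k * cis (- (pi * t)) ^ (2 * n - k))"
    by (rule binomial_ring)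
  also have "\<dots> = (\<Sum>k\<le>2 * n. of_nat ((2 * n) choose k) * cis (2 * pi * ((real k - real n) * t)))"
  proof (rule sum.cong)
    fix k assume "k \<in> {..2 * n}"
    then have "cis (pi * t) ^ k * cis (- (pi * t)) ^ (2 * n - k) = cis (real k * (pi * t) + (2 * real n - real k) * (- (pi * t)))"
      unfolding Complex.DeMoivre cis_mult by (simp add: of_nat_diff)
    also have "real k * (pi * t) + (2 * real n - real k) * (- (pi * t)) = 2 * pi * ((real k - real n) * t)"
      by (simp add: algebra_simps)
    finally show "of_nat ((2 * n) choose k) * cis (pi * t) ^ k * cis (- (pi * t)) ^ (2 * n - k)
        = of_nat ((2 * n) choose k) * cis (2 * pi * ((real k - real n) * t))"
      by (simp add: mult.assoc)
  qed simp
  also have "\<dots> = (\<Sum>j\<in>{- int n..int n}. of_nat ((2 * n) choose nat (int n + j)) * cis (2 * pi * (of_int j * t)))"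
    by (rule sum.reindex_bij_witness[where i = "\<lambda>j. nat (int n + j)" and j = "\<lambda>k. int k - int n"]) auto
  finally show ?thesis
    by (simp add: central_def sum_distrib_left sum_divide_distrib weight1_def)
      (auto intro!: sum.cong)
qed

lemma prod_3: "prod f (UNIV :: 3 set) = f 1 * f 2 * f 3"
  unfolding UNIV_3 by (simp add: ac_simps)

lemma sum_triple_product:
  fixes f g h :: "'a \<Rightarrow> 'b::comm_semiring_0"
  shows "sum f I * sum g I * sum h I = (\<Sum>(a, b, c)\<in>I \<times> I \<times> I. f a * g b * h c)"
proof -
  have "(\<Sum>(a, b, c)\<in>I \<times> I \<times> I. f a * g b * h c) = (\<Sum>a\<in>I. \<Sum>b\<in>I. \<Sum>c\<in>I. f a * g b * h c)"
    by (simp add: sum.cartesian_product)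
  also have "\<dots> = (\<Sum>a\<in>I. \<Sum>b\<in>I. f a * g b * sum h I)"
    by (simp add: sum_distrib_left)
  also have "\<dots> = (\<Sum>a\<in>I. \<Sum>b\<in>I. f a * g b) * sum h I"
    by (simp add: sum_distrib_right)
  also have "(\<Sum>a\<in>I. \<Sum>b\<in>I. f a * g b) = sum f I * sum g I"
    by (rule sum_product[symmetric])
  finally show ?thesis by simp
qed

lemma trig_kernel_expansion: "trig_kernel n h = (\<Sum>k\<in>modes n. weight n k * cos_mode k h)"
proof -
  let ?I = "{- int n..int n}"
  let ?g = "\<lambda>i j. complex_of_real (weight1 n j) * cis (2 * pi * (of_int j * h $ i))"
  have inj: "inj_on (\<lambda>(a, b, c). vector [a, b, c] :: int ^ 3) (?I \<times> ?I \<times> ?I)"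
    by (auto simp: inj_on_def vec_eq_iff forall_3)
  have "complex_of_real (trig_kernel n h) = (\<Sum>a\<in>?I. ?g 1 a) * (\<Sum>b\<in>?I. ?g 2 b) * (\<Sum>c\<in>?I. ?g 3 c)"
    unfolding trig_kernel_def prod_3 central_cos_power[symmetric] by (simp only: of_real_mult)
  also have "\<dots> = (\<Sum>(a, b, c)\<in>?I \<times> ?I \<times> ?I. ?g 1 a * ?g 2 b * ?g 3 c)"
    by (rule sum_triple_product)
  also have "\<dots> = (\<Sum>(a, b, c)\<in>?I \<times> ?I \<times> ?I.
      complex_of_real (weight n (vector [a, b, c])) * cis (2 * pi * (lattice_vec (vector [a, b, c]) \<bullet> h)))"
  proof (intro sum.cong refl, safe)
    fix a b c :: int
    have "weight n (vector [a, b, c]) = weight1 n a * weight1 n b * weight1 n c"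
      by (simp add: weight_def prod_3)
    moreover have "2 * pi * (lattice_vec (vector [a, b, c]) \<bullet> h) =
        2 * pi * (of_int a * h $ 1) + 2 * pi * (of_int b * h $ 2) + 2 * pi * (of_int c * h $ 3)"
      by (simp add: inner_vec_def sum_3 distrib_left)
    ultimately show "?g 1 a * ?g 2 b * ?g 3 c =
        complex_of_real (weight n (vector [a, b, c])) * cis (2 * pi * (lattice_vec (vector [a, b, c]) \<bullet> h))"
      by (simp only: cis_mult[symmetric] of_real_mult mult_ac)
  qed
  also have "\<dots> = (\<Sum>k\<in>modes n. complex_of_real (weight n k) * cis (2 * pi * (lattice_vec k \<bullet> h)))"
    unfolding modes_def by (subst sum.reindex[OF inj]) (simp add: case_prod_beta o_def)
  finally have "Re (complex_of_real (trig_kernel n h)) = Re (\<Sum>k\<in>modes n. complex_of_real (weight n k) * cis (2 * pi * (lattice_vec k \<bullet> h)))"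
    by simp
  then show ?thesis by (simp add: cos_mode_def)
qed

section \<open>Trigonometric modes and the kernel as test functions\<close>

lemma test_fun_partial_deriv:
  assumes "test_fun f" shows "test_fun (partial_deriv i f)"
  unfolding test_fun_def
proof
  have f: "smooth f" "periodic f" using assms by (auto simp: test_fun_def)
  show "smooth (partial_deriv i f)"
    unfolding partial_deriv_def by (rule smooth_frechet_derivative[OF f(1)])
  show "periodic (partial_deriv i f)"
    unfolding periodic_def
  proof safe
    fix x k
    have "((\<lambda>y. f (y + lattice_vec k)) has_derivative frechet_derivative f (at (x + lattice_vec k))) (at x)"
    proof -
      have "((\<lambda>y. y + lattice_vec k) has_derivative (\<lambda>v. v)) (at x)"
        by (auto intro!: derivative_eq_intros)
      from has_derivative_compose[OF this smooth_has_derivative[OF f(1)]] show ?thesis .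
    qed
    moreover have "(\<lambda>y. f (y + lattice_vec k)) = f" using f(2) by (simp add: periodic_def)
    ultimately have "frechet_derivative f (at x) = frechet_derivative f (at (x + lattice_vec k))"
      by (metis frechet_derivative_at)
    then show "partial_deriv i f (x + lattice_vec k) = partial_deriv i f x" by (simp add: partial_deriv_def)
  qed
qed

lemma sin_mode_eq: "sin_mode k x = cos (2 * pi * (lattice_vec k \<bullet> x) + - (pi / 2))"
  by (simp add: sin_mode_def cos_diff)

lemma smooth_mode: "smooth (\<lambda>x. cos (2 * pi * (lattice_vec k \<bullet> x) + \<theta>))"
proof -
  have "bounded_linear (\<lambda>x. 2 * pi * (lattice_vec k \<bullet> x))"
    by (intro bounded_linear_const_mult bounded_linear_inner_right)
  from smooth_compose_affine[OF this smooth_cos] show ?thesis .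
qed

lemma test_fun_cos_mode: "test_fun (cos_mode k)" and test_fun_sin_mode: "test_fun (sin_mode k)"
proof -
  have c: "cos_mode k = (\<lambda>x. cos (2 * pi * (lattice_vec k \<bullet> x) + 0))"
    by (simp add: cos_mode_def fun_eq_iff)
  have s: "sin_mode k = (\<lambda>x. cos (2 * pi * (lattice_vec k \<bullet> x) + - (pi / 2)))"
    by (simp add: sin_mode_eq fun_eq_iff)
  show "test_fun (cos_mode k)" "test_fun (sin_mode k)"
    unfolding test_fun_def c s using smooth_mode periodic_mode by blast+
qed

lemma test_fun_sum: "(\<And>i. i \<in> I \<Longrightarrow> test_fun (f i)) \<Longrightarrow> test_fun (\<lambda>x. \<Sum>i\<in>I. f i x)"
  by (auto simp: test_fun_def periodic_def intro!: smooth_sum)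

lemma test_fun_cmult: "test_fun f \<Longrightarrow> test_fun (\<lambda>x. c * f x)"
  by (auto simp: test_fun_def periodic_def intro!: smooth_cmult)

lemma test_fun_shift:
  assumes "test_fun f" shows "test_fun (\<lambda>y. f (y - x))"
  unfolding test_fun_def
proof
  have "smooth (\<lambda>y. f (y + - x))"
    using assms by (intro smooth_compose_affine bounded_linear_ident) (simp add: test_fun_def)
  then show "smooth (\<lambda>y. f (y - x))" by simp
  have eq: "y + lattice_vec k - x = (y - x) + lattice_vec k" for y k by simp
  show "periodic (\<lambda>y. f (y - x))"
    unfolding periodic_def eq using assms by (simp add: test_fun_def periodic_def)
qed

lemma test_fun_trig_kernel: "test_fun (trig_kernel n)"
proof -
  have "trig_kernel n = (\<lambda>h. \<Sum>k\<in>modes n. weight n k * cos_mode k h)"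
    by (rule ext) (rule trig_kernel_expansion)
  then show ?thesis by (simp add: test_fun_sum test_fun_cmult test_fun_cos_mode)
qed

lemma test_fun_measurable: "test_fun \<phi> \<Longrightarrow> \<phi> \<in> borel_measurable borel"
  by (simp add: test_fun_def smooth_borel_measurable)

lemma mode_measurable [measurable]: "cos_mode k \<in> borel_measurable borel" "sin_mode k \<in> borel_measurable borel"
  by (simp_all add: test_fun_measurable test_fun_cos_mode test_fun_sin_mode)

lemma mode_bounds: "\<bar>cos_mode k x\<bar> \<le> 1" "\<bar>sin_mode k x\<bar> \<le> 1"
  by (simp_all add: cos_mode_def sin_mode_def)

lemma integrable_mode [simp]: "integrable torus (cos_mode k)" "integrable torus (sin_mode k)"
  using mode_bounds by (auto intro!: integrable_torus_bounded(1)[where B = 1])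

lemma integral_cos_mode: "(LINT x|torus. cos_mode k x) = (if k = 0 then 1 else 0)"
  using integral_torus_cos[of k 0] by (simp add: cos_mode_def)

lemma integral_sin_mode: "(LINT x|torus. sin_mode k x) = 0"
  unfolding sin_mode_eq integral_torus_cos by simp

lemma trig_kernel_measurable [measurable]: "trig_kernel n \<in> borel_measurable borel"
  by (rule test_fun_measurable[OF test_fun_trig_kernel])

lemma integral_trig_kernel: "(LINT h|centred_torus. trig_kernel n h) = 1"
proof -
  have "(LINT h|centred_torus. trig_kernel n (h + 0)) = (LINT h|torus. trig_kernel n h)"
    using test_fun_trig_kernel by (intro integral_centred_torus_shift) (simp_all add: test_fun_def)
  also have "\<dots> = (\<Sum>k\<in>modes n. weight n k * (if k = 0 then 1 else 0))"
    unfolding trig_kernel_expansion by (simp add: integral_cos_mode)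
  also have "\<dots> = 1"
    using in_modes_iff[of 0 n] by (simp add: weight_0 if_distrib cong: if_cong)
  finally show ?thesis by simp
qed

lemma trig_kernel_nonneg: "0 \<le> trig_kernel n h"
  unfolding trig_kernel_def using central_pos[of n] by (intro prod_nonneg) (auto simp: less_imp_le)

definition trig_grad :: "nat \<Rightarrow> real ^ 3 \<Rightarrow> real ^ 3" where
  "trig_grad n h = (\<chi> i. partial_deriv i (trig_kernel n) h)"

lemma trig_grad_measurable [measurable]: "trig_grad n \<in> borel_measurable borel"
proof -
  have "trig_grad n = (\<lambda>h. \<Sum>i\<in>UNIV. partial_deriv i (trig_kernel n) h *\<^sub>R axis i 1)"
    by (auto simp: trig_grad_def vec_eq_iff fun_eq_iff axis_def if_distrib cong: if_cong)
  moreover have [measurable]: "partial_deriv i (trig_kernel n) \<in> borel_measurable borel" for i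
    by (intro test_fun_measurable test_fun_partial_deriv test_fun_trig_kernel)
  have "(\<lambda>h. \<Sum>i\<in>UNIV. partial_deriv i (trig_kernel n) h *\<^sub>R (axis i 1 :: real ^ 3)) \<in> borel_measurable borel"
    by measurable
  ultimately show ?thesis by simp
qed

lemma partial_deriv_eqI:
  "(f has_derivative f') (at x) \<Longrightarrow> partial_deriv i f x = f' (axis i 1)"
  unfolding partial_deriv_def by (metis frechet_derivative_at)

lemma partial_deriv_modes:
  "partial_deriv i (cos_mode k) x = - (2 * pi * of_int (k $ i)) * sin_mode k x"
  "partial_deriv i (sin_mode k) x = (2 * pi * of_int (k $ i)) * cos_mode k x"
proof -
  have "(cos_mode k has_derivative (\<lambda>v. - (2 * pi * (lattice_vec k \<bullet> v)) * sin_mode k x)) (at x)"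
    "(sin_mode k has_derivative (\<lambda>v. (2 * pi * (lattice_vec k \<bullet> v)) * cos_mode k x)) (at x)"
    unfolding cos_mode_def[abs_def] sin_mode_def[abs_def]
    by (auto intro!: derivative_eq_intros)
  from this[THEN partial_deriv_eqI, of i] show
    "partial_deriv i (cos_mode k) x = - (2 * pi * of_int (k $ i)) * sin_mode k x"
    "partial_deriv i (sin_mode k) x = (2 * pi * of_int (k $ i)) * cos_mode k x"
    by (simp_all add: inner_axis)
qed

lemma partial_deriv_trig_kernel:
  "partial_deriv i (trig_kernel n) x = (\<Sum>k\<in>modes n. weight n k * (- (2 * pi * of_int (k $ i)) * sin_mode k x))"
proof -
  have "((\<lambda>x. \<Sum>k\<in>modes n. weight n k * cos_mode k x) has_derivative
      (\<lambda>v. \<Sum>k\<in>modes n. weight n k * frechet_derivative (cos_mode k) (at x) v)) (at x)"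
    by (intro has_derivative_sum has_derivative_mult_right smooth_has_derivative)
      (use test_fun_cos_mode in \<open>simp add: test_fun_def\<close>)
  from partial_deriv_eqI[OF this, of i] show ?thesis
    by (simp add: trig_kernel_expansion[abs_def] partial_deriv_modes[unfolded partial_deriv_def])
qed

lemma integral_trig_grad: "(LINT h|centred_torus. trig_grad n h) = 0"
proof -
  have per: "periodic (trig_grad n)"
    using test_fun_partial_deriv[OF test_fun_trig_kernel[of n]]
    by (simp add: periodic_def trig_grad_def test_fun_def)
  have bound: "norm (trig_grad n h) \<le> (\<Sum>i\<in>UNIV. \<Sum>k\<in>modes n. 2 * pi * \<bar>of_int (k $ i)\<bar>)" for h
  proof -
    have "\<bar>trig_grad n h $ i\<bar> \<le> (\<Sum>k\<in>modes n. 2 * pi * \<bar>of_int (k $ i)\<bar>)" for i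
      unfolding trig_grad_def vec_lambda_beta partial_deriv_trig_kernel
    proof (intro order_trans[OF sum_abs sum_mono])
      fix k
      have "\<bar>weight n k * (- (2 * pi * of_int (k $ i)) * sin_mode k h)\<bar> = weight n k * ((2 * pi * \<bar>of_int (k $ i)\<bar>) * \<bar>sin_mode k h\<bar>)"
        by (simp add: abs_mult weight_bounds)
      also have "\<dots> \<le> 1 * ((2 * pi * \<bar>of_int (k $ i)\<bar>) * 1)"
        using weight_bounds mode_bounds by (intro mult_mono) auto
      finally show "\<bar>weight n k * (- (2 * pi * of_int (k $ i)) * sin_mode k h)\<bar> \<le> 2 * pi * \<bar>of_int (k $ i)\<bar>" by simp
    qed
    then show ?thesis by (intro order_trans[OF norm_le_l1_cart sum_mono])
  qed
  have int: "integrable torus (trig_grad n)"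
    using bound by (intro integrable_torus_bounded) measurable
  have "(LINT h|torus. trig_grad n h) $ i = 0" for i
  proof -
    have "(LINT h|torus. trig_grad n h) $ i = (LINT h|torus. trig_grad n h $ i)"
      by (rule integral_bounded_linear[OF bounded_linear_vec_nth int, symmetric])
    also have "\<dots> = 0"
      unfolding trig_grad_def vec_lambda_beta partial_deriv_trig_kernel by (simp add: integral_sin_mode)
    finally show ?thesis .
  qed
  then have "(LINT h|torus. trig_grad n h) = 0" by (simp add: vec_eq_iff)
  then show ?thesis using integral_centred_torus_shift[OF trig_grad_measurable per, where h = 0] by simp
qed

section \<open>Gaussian decay of the kernel\<close>

text \<open>With y = pi |t| / 2 \<le> pi / 4, the mean value theorem gives sin y \<ge> y cos (pi /
  4), so the double angle formula yields cos (pi t) \<le> 1 - y^2 \<le> exp (- y^2). Finally pi^2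
  \<ge> 9 gives y^2 \<ge> 2 t^2.\<close>

lemma cos_le_exp:
  assumes "\<bar>t\<bar> \<le> 1 / 2" shows "0 \<le> cos (pi * t)" "cos (pi * t) \<le> exp (- 2 * t\<^sup>2)"
proof -
  have full: "\<bar>pi * t\<bar> \<le> pi / 2"
    using mult_left_mono[OF assms, of pi] by (simp add: abs_mult)
  then have half: "\<bar>pi * t / 2\<bar> \<le> pi / 4" by simp
  show "0 \<le> cos (pi * t)"
    by (rule cos_ge_zero) (use full in linarith)+
  define y where "y = \<bar>pi * t / 2\<bar>"
  have y: "0 \<le> y" "y \<le> pi / 4" using half by (simp_all add: y_def)
  have "y * cos (pi / 4) \<le> sin y"
  proof (cases "y = 0")
    case False
    then have "0 < y" using y by simp
    then obtain z where z: "0 < z" "z < y" "sin y - sin 0 = (y - 0) * cos z"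
      using MVT2[of 0 y sin cos] by auto
    have "cos (pi / 4) \<le> cos z" using z y by (intro cos_monotone_0_pi_le) auto
    with z y show ?thesis by (simp add: mult_left_mono)
  qed simp
  then have "(y * cos (pi / 4))\<^sup>2 \<le> (sin y)\<^sup>2"
    using y by (intro power_mono) (auto simp: cos_45)
  moreover have "(y * cos (pi / 4))\<^sup>2 = y\<^sup>2 / 2" by (simp add: cos_45 power_mult_distrib power_divide)
  moreover have "(sin y)\<^sup>2 = (sin (pi * t / 2))\<^sup>2" by (simp add: y_def abs_if)
  moreover have "cos (pi * t) = 1 - 2 * (sin (pi * t / 2))\<^sup>2"
    using cos_double_sin[of "pi * t / 2"] by simp
  ultimately have "cos (pi * t) \<le> 1 - y\<^sup>2" by simp
  also have "\<dots> \<le> exp (- (y\<^sup>2))" using exp_ge_add_one_self[of "- (y\<^sup>2)"] by simp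
  also have "\<dots> \<le> exp (- 2 * t\<^sup>2)"
  proof -
    have "9 \<le> pi\<^sup>2" using pi_gt3 power_mono[of 3 pi 2] by simp
    then have "9 * t\<^sup>2 \<le> pi\<^sup>2 * t\<^sup>2" by (intro mult_right_mono) auto
    moreover have "y\<^sup>2 = pi\<^sup>2 * t\<^sup>2 / 4"
      unfolding y_def power2_abs by (simp add: power_mult_distrib power_divide)
    ultimately have "2 * t\<^sup>2 \<le> y\<^sup>2" using zero_le_power2[of t] by linarith
    then show ?thesis by simp
  qed
  finally show "cos (pi * t) \<le> exp (- 2 * t\<^sup>2)" .
qed

text \<open>The Fourier expansion of the derivative suits integration, but the product form shows
  the decay in h: a single power of the cosine is lost, in one coordinate.\<close>

lemma partial_deriv_trig_kernel_prod:
  "partial_deriv i (trig_kernel n) h =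
    central n * (2 * real n) * cos (pi * h $ i) ^ (2 * n - 1) * (- sin (pi * h $ i) * pi) *
      (\<Prod>j\<in>UNIV - {i}. central n * cos (pi * h $ j) ^ (2 * n))"
proof -
  have comp: "((\<lambda>h. central n * cos (pi * h $ j) ^ (2 * n)) has_derivative
      (\<lambda>v. central n * (2 * real n) * cos (pi * h $ j) ^ (2 * n - 1) * (- sin (pi * h $ j) * pi) * v $ j)) (at h)" for j
  proof -
    have "((\<lambda>h. h $ j) has_derivative (\<lambda>v. v $ j)) (at h)"
      by (rule bounded_linear_imp_has_derivative[OF bounded_linear_vec_nth])
    moreover have "((\<lambda>t. central n * cos (pi * t) ^ (2 * n)) has_derivative
        (\<lambda>r. central n * (2 * real n) * cos (pi * h $ j) ^ (2 * n - 1) * (- sin (pi * h $ j) * pi) * r)) (at (h $ j))"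
      by (auto intro!: derivative_eq_intros simp: algebra_simps)
    ultimately show ?thesis by (rule has_derivative_compose)
  qed
  have "(trig_kernel n has_derivative (\<lambda>v. \<Sum>j\<in>UNIV.
      (central n * (2 * real n) * cos (pi * h $ j) ^ (2 * n - 1) * (- sin (pi * h $ j) * pi) * v $ j) *
      (\<Prod>l\<in>UNIV - {j}. central n * cos (pi * h $ l) ^ (2 * n)))) (at h)"
    unfolding trig_kernel_def[abs_def] by (rule has_derivative_prod) (rule comp)
  from partial_deriv_eqI[OF this, of i] show ?thesis
    by (subst (asm) sum.remove[of _ i]) (simp_all add: axis_def)
qed

text \<open>Halving the exponent of the cosines leaves a Gaussian that absorbs polynomial weights.\<close>

lemma trig_kernel_halve:
  assumes h: "h \<in> space centred_torus" and m: "1 \<le> m"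
  shows "trig_kernel (2 * m) h \<le> 27 * trig_kernel m h * exp (- 2 * real m * (norm h)\<^sup>2)"
    and "\<bar>partial_deriv i (trig_kernel (2 * m)) h\<bar>
      \<le> 27 * (40 * real m * norm h) * trig_kernel m h * exp (- 2 * real m * (norm h)\<^sup>2)"
proof -
  define x where "x j = cos (pi * h $ j)" for j
  define e where "e j = exp (- 2 * real m * (h $ j)\<^sup>2)" for j
  have hj: "\<bar>h $ j\<bar> \<le> 1 / 2" for j using h by (simp add: space_centred_torus)
  have x: "0 \<le> x j" "x j \<le> 1" "x j ^ m \<le> e j" for j
  proof -
    show "0 \<le> x j" "x j \<le> 1" unfolding x_def using cos_le_exp[OF hj] by auto
    have "x j ^ m \<le> exp (- 2 * (h $ j)\<^sup>2) ^ m"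
      unfolding x_def using cos_le_exp[OF hj] by (intro power_mono) auto
    also have "\<dots> = e j" by (simp add: e_def mult_ac flip: exp_of_nat_mult)
    finally show "x j ^ m \<le> e j" .
  qed
  \<comment> \<open>Of at least 3 m powers of the cosine, 2 m are kept for
    \<open>trig_kernel m\<close> and m give the Gaussian. The kernel supplies 4 m powers and its
    differentiated factor 4 m - 1, which suffices as m \<ge> 1.\<close>
  have pw: "x j ^ N \<le> x j ^ (2 * m) * e j" if "3 * m \<le> N" for j N
  proof -
    have "x j ^ N \<le> x j ^ (2 * m + m)" using that x by (intro power_decreasing) auto
    also have "\<dots> = x j ^ (2 * m) * x j ^ m" by (rule power_add)
    also have "\<dots> \<le> x j ^ (2 * m) * e j" using x by (intro mult_left_mono) auto
    finally show ?thesis .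
  qed
  \<comment> \<open>From sqrt m \<le> central m and central (2 m) \<le> 2 sqrt (2 m), with 2 sqrt 2
    \<le> 3. One factor 3 for each coordinate makes the 27.\<close>
  have c: "0 < central (2 * m)" "central (2 * m) \<le> 3 * central m"
  proof -
    have "central (2 * m) \<le> 2 * sqrt (real (2 * m))" using m by (intro central_bounds) simp
    also have "\<dots> \<le> 3 * sqrt (real m)"
    proof -
      have "sqrt 2 \<le> 3 / 2" by (rule real_le_lsqrt) (auto simp: power2_eq_square)
      then have "2 * sqrt 2 * sqrt (real m) \<le> 3 * sqrt (real m)" by (intro mult_right_mono) auto
      then show ?thesis by (simp add: real_sqrt_mult)
    qed
    also have "\<dots> \<le> 3 * central m" using central_bounds(1)[of m] by simp
    finally show "central (2 * m) \<le> 3 * central m" .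
  qed (rule central_pos)
  define b where "b j = 3 * (central m * x j ^ (2 * m)) * e j" for j
  have b: "central (2 * m) * x j ^ N \<le> b j" if "3 * m \<le> N" for j N
  proof -
    have "central (2 * m) * x j ^ N \<le> (3 * central m) * (x j ^ (2 * m) * e j)"
      using c x pw[OF that] by (intro mult_mono) auto
    then show ?thesis by (simp add: b_def mult_ac)
  qed
  have b0: "0 \<le> b j" for j
    using b[of "3 * m" j] c x(1)[of j] by (auto intro: order_trans[rotated])
  have prod_b: "prod b UNIV = 27 * trig_kernel m h * exp (- 2 * real m * (norm h)\<^sup>2)"
  proof -
    have "(norm h)\<^sup>2 = (h $ 1)\<^sup>2 + (h $ 2)\<^sup>2 + (h $ 3)\<^sup>2"
      unfolding power2_norm_eq_inner inner_vec_def sum_3 by (simp add: power2_eq_square)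
    then have "prod e UNIV = exp (- 2 * real m * (norm h)\<^sup>2)"
      by (simp add: e_def prod_3 algebra_simps flip: exp_add)
    moreover have "(\<Prod>j\<in>UNIV. central m * x j ^ (2 * m)) = trig_kernel m h"
      by (simp add: trig_kernel_def x_def)
    ultimately show ?thesis unfolding b_def by (simp add: prod.distrib prod_3)
  qed
  have "trig_kernel (2 * m) h = (\<Prod>j\<in>UNIV. central (2 * m) * x j ^ (2 * (2 * m)))"
    by (simp add: trig_kernel_def x_def)
  also have "\<dots> \<le> prod b UNIV"
    using b c x by (intro prod_mono) auto
  finally show "trig_kernel (2 * m) h \<le> 27 * trig_kernel m h * exp (- 2 * real m * (norm h)\<^sup>2)"
    by (simp only: prod_b)
  \<comment> \<open>The exponent of the cosine gives 4 m; with |sin (pi h_i)| pi \<le> pi^2 |h|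
    \<le> 10 |h| this is the origin of 40 m |h|.\<close>
  have "\<bar>partial_deriv i (trig_kernel (2 * m)) h\<bar> =
      (4 * real m * (\<bar>sin (pi * h $ i)\<bar> * pi)) * ((central (2 * m) * x i ^ (2 * (2 * m) - 1)) *
        (\<Prod>j\<in>UNIV - {i}. central (2 * m) * x j ^ (2 * (2 * m))))"
    unfolding partial_deriv_trig_kernel_prod abs_mult abs_prod
    using c x by (simp add: x_def[symmetric] abs_mult power_abs)
  also have "\<dots> \<le> (40 * real m * norm h) * (b i * prod b (UNIV - {i}))"
  proof (rule mult_mono[OF _ mult_mono])
    have "\<bar>sin (pi * h $ i)\<bar> \<le> pi * \<bar>h $ i\<bar>"
      using abs_sin_x_le_abs_x[of "pi * h $ i"] by (simp add: abs_mult)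
    also have "\<dots> \<le> pi * norm h" by (intro mult_left_mono component_le_norm_cart) auto
    finally have "\<bar>sin (pi * h $ i)\<bar> * pi \<le> (pi * norm h) * pi" by (intro mult_right_mono) auto
    also have "\<dots> \<le> 10 * norm h"
    proof -
      have "pi \<le> 3.15" using pi_approx by simp
      then have "pi\<^sup>2 \<le> 3.15\<^sup>2" by (intro power_mono) auto
      also have "\<dots> \<le> (10::real)" by (simp add: power2_eq_square)
      finally have "pi\<^sup>2 * norm h \<le> 10 * norm h" by (intro mult_right_mono) auto
      then show ?thesis by (simp add: power2_eq_square mult_ac)
    qed
    finally have "(4 * real m) * (\<bar>sin (pi * h $ i)\<bar> * pi) \<le> (4 * real m) * (10 * norm h)"
      by (rule mult_left_mono) simp
    then show "4 * real m * (\<bar>sin (pi * h $ i)\<bar> * pi) \<le> 40 * real m * norm h" by simp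
    show "central (2 * m) * x i ^ (2 * (2 * m) - 1) \<le> b i" using m by (intro b) simp
    show "(\<Prod>j\<in>UNIV - {i}. central (2 * m) * x j ^ (2 * (2 * m))) \<le> prod b (UNIV - {i})"
      using b c x by (intro prod_mono) auto
  qed (use c x b0 in \<open>auto intro!: mult_nonneg_nonneg prod_nonneg\<close>)
  also have "b i * prod b (UNIV - {i}) = prod b UNIV"
    by (simp add: prod.remove[symmetric])
  finally show "\<bar>partial_deriv i (trig_kernel (2 * m)) h\<bar>
      \<le> 27 * (40 * real m * norm h) * trig_kernel m h * exp (- 2 * real m * (norm h)\<^sup>2)"
    by (simp add: prod_b mult_ac)
qed

text \<open>From 1 + y \<le> 8 exp ((1 + y) / 8) the eighth power costs exp (1 + y), and 1 + y - 2
  y^2 \<le> 2. The power 8 is the 7 of \<open>dominated\<close> plus one for the factor |h| in the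
  gradient of the kernel.\<close>

lemma weight_exp_bound:
  assumes "0 \<le> y" "N \<le> 8" shows "(1 + y) ^ N * exp (- 2 * y\<^sup>2) \<le> 8 ^ 8 * exp (2::real)"
proof -
  define E where "E = exp ((1 + y) / 8)"
  have "1 + (1 + y) / 8 \<le> E" unfolding E_def by (rule exp_ge_add_one_self)
  then have "1 + y \<le> 8 * exp ((1 + y) / 8)"
    unfolding E_def[symmetric] by (simp add: field_simps)
  then have "(1 + y) ^ 8 \<le> (8 * exp ((1 + y) / 8)) ^ 8"
    using assms by (intro power_mono) auto
  also have "\<dots> = 8 ^ 8 * exp (1 + y)" by (simp add: power_mult_distrib flip: exp_of_nat_mult)
  finally have "(1 + y) ^ 8 \<le> 8 ^ 8 * exp (1 + y)" .
  moreover have "(1 + y) ^ N \<le> (1 + y) ^ 8" using assms by (intro power_increasing) auto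
  ultimately have "(1 + y) ^ N * exp (- 2 * y\<^sup>2) \<le> (8 ^ 8 * exp (1 + y)) * exp (- 2 * y\<^sup>2)"
    by (intro mult_right_mono) auto
  also have "\<dots> = 8 ^ 8 * exp (1 + y - 2 * y\<^sup>2)" by (simp add: exp_diff exp_minus divide_inverse)
  also have "1 + y - 2 * y\<^sup>2 \<le> 2"
  proof -
    have "2 * y \<le> 1 + y\<^sup>2" using zero_le_power2[of "y - 1"] by (simp add: power2_diff)
    then show ?thesis using zero_le_power2[of y] by linarith
  qed
  finally show ?thesis by simp
qed

text \<open>The majorant of the kernel with index 2 m is a multiple of the kernel with index m,
  which is why smoothing always uses even indices. The factor 3240 = 3 * 27 * 40 comes from the
  three components of the gradient, 8^8 exp 2 from absorbing the weight; the 8 in the constant 8 A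
  is the height bound (2 sqrt m)^3 in units of \<epsilon>^-3.\<close>

lemma trig_kernel_family:
  obtains C where "1 \<le> C" "\<And>m. 1 \<le> m \<Longrightarrow> \<exists>\<kappa>. kernel_mass C (1 / sqrt (real m)) \<kappa> \<and>
    dominated (1 / sqrt (real m)) \<kappa> (trig_kernel (2 * m)) \<and>
    dominated (1 / sqrt (real m)) \<kappa> (\<lambda>h. (1 / sqrt (real m)) * norm (- trig_grad (2 * m) h))"
proof -
  define A :: real where "A = 3240 * 8 ^ 8 * exp 2"
  have A: "1 \<le> A"
  proof -
    have "1 * 1 \<le> (3240 * 8 ^ 8) * exp (2::real)" by (intro mult_mono) auto
    then show ?thesis by (simp add: A_def)
  qed
  have "\<exists>\<kappa>. kernel_mass (8 * A) (1 / sqrt (real m)) \<kappa> \<and>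
    dominated (1 / sqrt (real m)) \<kappa> (trig_kernel (2 * m)) \<and>
    dominated (1 / sqrt (real m)) \<kappa> (\<lambda>h. (1 / sqrt (real m)) * norm (- trig_grad (2 * m) h))"
    if m: "1 \<le> m" for m
  proof (intro exI[where x = "\<lambda>h. A * trig_kernel m h"] conjI)
    let ?s = "sqrt (real m)"
    have s: "0 < ?s" "?s * ?s = real m" using m by auto
    have y2: "2 * real m * (norm h)\<^sup>2 = 2 * (?s * norm h)\<^sup>2" for h :: "real ^ 3"
      using m by (simp add: power_mult_distrib)
    have T: "0 \<le> trig_kernel m h" for h by (rule trig_kernel_nonneg)
    show "kernel_mass (8 * A) (1 / ?s) (\<lambda>h. A * trig_kernel m h)"
      unfolding kernel_mass_def
    proof (intro conjI allI ballI)
      show "0 \<le> A * trig_kernel m h" for h using A T by simp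
      show "A * trig_kernel m h \<le> 8 * A / (1 / ?s) ^ 3" if "h \<in> space centred_torus" for h
      proof -
        have "trig_kernel m h \<le> (\<Prod>i\<in>(UNIV::3 set). 2 * ?s)"
          unfolding trig_kernel_def
        proof (intro prod_mono conjI)
          fix i
          have "cos (pi * h $ i) ^ (2 * m) \<le> 1"
            by (simp add: power_mult power_le_one abs_square_le_1)
          then have "central m * cos (pi * h $ i) ^ (2 * m) \<le> (2 * ?s) * 1"
            using central_bounds(2)[OF m] central_pos[of m] by (intro mult_mono) auto
          then show "central m * cos (pi * h $ i) ^ (2 * m) \<le> 2 * ?s" by simp
          show "0 \<le> central m * cos (pi * h $ i) ^ (2 * m)" using central_pos[of m] by simp
        qed
        then have "trig_kernel m h \<le> 8 * ?s ^ 3" by (simp add: prod_3 power3_eq_cube)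
        then have "A * trig_kernel m h \<le> A * (8 * ?s ^ 3)" using A by (intro mult_left_mono) auto
        then show ?thesis by (simp add: power_divide mult_ac)
      qed
      have "integrable torus (trig_kernel m)"
        unfolding trig_kernel_expansion[abs_def] by (intro Bochner_Integration.integrable_sum integrable_mult_right integrable_mode)
      then have "integrable centred_torus (trig_kernel m)"
        using integrable_centred_torus_shift[OF trig_kernel_measurable, of m 0] test_fun_trig_kernel[of m]
        by (simp add: test_fun_def)
      then have "(\<integral>\<^sup>+h. ennreal (A * trig_kernel m h) \<partial>centred_torus) = ennreal A"
        using A T by (subst nn_integral_eq_integral) (auto simp: integral_trig_kernel)
      then show "1 \<le> (\<integral>\<^sup>+h. ennreal (A * trig_kernel m h) \<partial>centred_torus)"
        "(\<integral>\<^sup>+h. ennreal (A * trig_kernel m h) \<partial>centred_torus) \<le> ennreal (8 * A)"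
        using A by (auto intro: ennreal_leI)
    qed measurable
    show "dominated (1 / ?s) (\<lambda>h. A * trig_kernel m h) (trig_kernel (2 * m))"
      unfolding dominated_def
    proof (intro conjI ballI)
      fix h assume h: "h \<in> space centred_torus"
      have "\<bar>trig_kernel (2 * m) h\<bar> * (1 + norm h / (1 / ?s)) ^ 7
          \<le> (27 * trig_kernel m h * exp (- 2 * real m * (norm h)\<^sup>2)) * (1 + ?s * norm h) ^ 7"
        using trig_kernel_halve(1)[OF h m] trig_kernel_nonneg
        by (simp add: mult.commute[of "norm h"] mult_right_mono)
      also have "\<dots> = 27 * trig_kernel m h * ((1 + ?s * norm h) ^ 7 * exp (- 2 * (?s * norm h)\<^sup>2))"
        using y2[of h] by simp
      also have "\<dots> \<le> 3240 * trig_kernel m h * (8 ^ 8 * exp 2)"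
        using T s by (intro mult_mono weight_exp_bound) auto
      finally show "\<bar>trig_kernel (2 * m) h\<bar> * (1 + norm h / (1 / ?s)) ^ 7 \<le> A * trig_kernel m h"
        by (simp add: A_def mult_ac)
    qed measurable
    show "dominated (1 / ?s) (\<lambda>h. A * trig_kernel m h) (\<lambda>h. (1 / ?s) * norm (- trig_grad (2 * m) h))"
      unfolding dominated_def
    proof (intro conjI ballI)
      fix h assume h: "h \<in> space centred_torus"
      let ?y = "?s * norm h"
      have "norm (trig_grad (2 * m) h) \<le> (\<Sum>i\<in>UNIV. \<bar>trig_grad (2 * m) h $ i\<bar>)"
        by (rule norm_le_l1_cart)
      also have "\<dots> \<le> (\<Sum>i\<in>(UNIV::3 set). 27 * (40 * real m * norm h) * trig_kernel m h * exp (- 2 * real m * (norm h)\<^sup>2))"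
        unfolding trig_grad_def vec_lambda_beta by (intro sum_mono trig_kernel_halve(2)[OF h m])
      \<comment> \<open>Since m |h| = ?s * ?y, one factor ?s is left over, and it is the one
        cancelled by \<epsilon> = 1 / ?s.\<close>
      also have "\<dots> = ?s * (3240 * trig_kernel m h * (?y * exp (- 2 * ?y\<^sup>2)))"
      proof -
        have e: "exp (- 2 * real m * (norm h)\<^sup>2) = exp (- 2 * ?y\<^sup>2)" using y2[of h] by simp
        have "?s * ?y = real m * norm h" by (simp only: mult.assoc[symmetric] s(2))
        moreover have "(\<Sum>i\<in>(UNIV::3 set). 27 * (40 * real m * norm h) * trig_kernel m h * E) =
            3240 * (real m * norm h) * trig_kernel m h * E" for E by simp
        moreover have "?s * (3240 * trig_kernel m h * (?y * E)) = 3240 * (?s * ?y) * trig_kernel m h * E" for E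
          by (simp only: mult_ac)
        ultimately show ?thesis unfolding e by simp
      qed
      finally have R: "(1 / ?s) * norm (trig_grad (2 * m) h) \<le> 3240 * trig_kernel m h * (?y * exp (- 2 * ?y\<^sup>2))"
        using s(1) by (simp add: pos_divide_le_eq mult_ac)
      have eq: "\<bar>(1 / ?s) * norm (- trig_grad (2 * m) h)\<bar> = (1 / ?s) * norm (trig_grad (2 * m) h)"
        "1 + norm h / (1 / ?s) = 1 + ?y" by (simp_all add: mult.commute)
      have "\<bar>(1 / ?s) * norm (- trig_grad (2 * m) h)\<bar> * (1 + norm h / (1 / ?s)) ^ 7
          \<le> (3240 * trig_kernel m h * (?y * exp (- 2 * ?y\<^sup>2))) * (1 + ?y) ^ 7"
        unfolding eq by (rule mult_right_mono[OF R]) (use s in simp)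
      also have "\<dots> \<le> (3240 * trig_kernel m h * ((1 + ?y) * exp (- 2 * ?y\<^sup>2))) * (1 + ?y) ^ 7"
        using T s by (intro mult_mono) auto
      also have "\<dots> = 3240 * trig_kernel m h * ((1 + ?y) ^ 8 * exp (- 2 * ?y\<^sup>2))"
        by (simp add: power_Suc[of _ 7, simplified] mult_ac)
      also have "\<dots> \<le> 3240 * trig_kernel m h * (8 ^ 8 * exp 2)"
        using T s by (intro mult_left_mono weight_exp_bound) auto
      finally show "\<bar>(1 / ?s) * norm (- trig_grad (2 * m) h)\<bar> * (1 + norm h / (1 / ?s)) ^ 7 \<le> A * trig_kernel m h"
        by (simp add: A_def mult_ac)
    qed measurable
  qed
  with A show ?thesis by (intro that[of "8 * A"]) auto
qed

section \<open>Fourier coefficients and products of represented distributions\<close>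

lemma wrap_in_cbox: "wrap x \<in> cbox 0 1"
  by (auto simp: wrap_def mem_box_cart) linarith+

lemma test_fun_bounded:
  assumes "test_fun \<phi>" obtains B where "0 \<le> B" "\<And>x. \<bar>\<phi> x\<bar> \<le> B"
proof -
  have "compact (\<phi> ` cbox 0 1)"
    using assms by (intro compact_continuous_image smooth_continuous_on compact_cbox) (simp add: test_fun_def)
  then obtain B where B: "\<And>y. y \<in> \<phi> ` cbox 0 1 \<Longrightarrow> norm y \<le> B"
    using compact_imp_bounded bounded_iff by metis
  have "\<bar>\<phi> x\<bar> \<le> B" for x
    using B[OF imageI[OF wrap_in_cbox], of x] assms by (simp add: periodic_wrap test_fun_def)
  moreover have "0 \<le> B" using calculation[of 0] by linarith
  ultimately show ?thesis using that by blast
qed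

lemma represents_torus_field: "represents f u \<Longrightarrow> torus_field f"
  by (simp add: represents_def torus_field_def)

lemma represents_eq: "represents f u \<Longrightarrow> test_fun \<phi> \<Longrightarrow> (u $ i) \<phi> = (LINT x|torus. f x $ i * \<phi> x)"
  by (simp add: represents_def)

lemma integrable_scaleR_bounded:
  fixes f :: "real ^ 3 \<Rightarrow> 'b :: {banach, second_countable_topology}"
  assumes f: "torus_field f" and [measurable]: "\<phi> \<in> borel_measurable borel" and B: "\<And>x. \<bar>\<phi> x\<bar> \<le> B"
  shows "integrable torus (\<lambda>x. \<phi> x *\<^sub>R f x)"
proof (rule Bochner_Integration.integrable_bound)
  note [measurable] = torus_fieldD(1)[OF f]
  show "integrable torus (\<lambda>x. B * norm (f x))"
    using torus_fieldD(3)[OF f] by (intro integrable_mult_right integrable_norm)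
  have "0 \<le> B" using B[of 0] by linarith
  then show "AE x in torus. norm (\<phi> x *\<^sub>R f x) \<le> norm (B * norm (f x))"
    using B by (intro AE_I2) (simp add: mult_right_mono)
qed (use torus_fieldD(1)[OF f] in measurable)

lemma integrable_component_mult:
  fixes f :: "real ^ 3 \<Rightarrow> real ^ 'n"
  assumes f: "torus_field f" and [measurable]: "\<phi> \<in> borel_measurable borel" and B: "\<And>x. \<bar>\<phi> x\<bar> \<le> B"
  shows "integrable torus (\<lambda>x. f x $ i * \<phi> x)"
    and "(LINT x|torus. f x $ i * \<phi> x) = (LINT x|torus. \<phi> x *\<^sub>R f x) $ i"
proof -
  note int = integrable_scaleR_bounded[OF assms]
  have eq: "(\<lambda>x. f x $ i * \<phi> x) = (\<lambda>x. (\<phi> x *\<^sub>R f x) $ i)" by (simp add: mult.commute)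
  show "integrable torus (\<lambda>x. f x $ i * \<phi> x)"
    unfolding eq by (rule integrable_bounded_linear[OF bounded_linear_vec_nth int])
  show "(LINT x|torus. f x $ i * \<phi> x) = (LINT x|torus. \<phi> x *\<^sub>R f x) $ i"
    unfolding eq by (rule integral_bounded_linear[OF bounded_linear_vec_nth int])
qed

lemma represents_cmult:
  assumes "represents f u" "test_fun \<phi>" shows "(u $ i) (\<lambda>x. c * \<phi> x) = c * (u $ i) \<phi>"
  using assms by (simp add: represents_eq test_fun_cmult mult.left_commute)

section \<open>Fourier coefficients in real coordinates and Parseval's identity\<close>

text \<open>Real coordinates of the Fourier coefficient: the first part is its real part, the second
  the negative of its imaginary part. In these coordinates the real part of the Hermitian product is
  the Euclidean inner product, and the values lie in a Euclidean space.\<close>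

definition coef :: "distr ^ 3 \<Rightarrow> int ^ 3 \<Rightarrow> (real ^ 3) \<times> (real ^ 3)" where
  "coef u k = (\<chi> i. (u $ i) (cos_mode k), \<chi> i. (u $ i) (sin_mode k))"

definition field_coef :: "(real ^ 3 \<Rightarrow> real ^ 3) \<Rightarrow> int ^ 3 \<Rightarrow> (real ^ 3) \<times> (real ^ 3)" where
  "field_coef f k = (LINT x|torus. cos_mode k x *\<^sub>R f x, LINT x|torus. sin_mode k x *\<^sub>R f x)"

lemma coef_eq_field_coef:
  assumes "represents f u" shows "coef u k = field_coef f k"
  unfolding coef_def field_coef_def
  using represents_eq[OF assms test_fun_cos_mode] represents_eq[OF assms test_fun_sin_mode]
    integrable_component_mult(2)[OF represents_torus_field[OF assms] mode_measurable(1) mode_bounds(1)]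
    integrable_component_mult(2)[OF represents_torus_field[OF assms] mode_measurable(2) mode_bounds(2)]
  by (simp add: vec_eq_iff)

lemma mode_products:
  "cos_mode k x * cos_mode l x = (cos_mode (k - l) x + cos_mode (k + l) x) / 2"
  "sin_mode k x * sin_mode l x = (cos_mode (k - l) x - cos_mode (k + l) x) / 2"
  "cos_mode k x * sin_mode l x = (sin_mode (k + l) x - sin_mode (k - l) x) / 2"
  "sin_mode k x * cos_mode l x = (sin_mode (k + l) x + sin_mode (k - l) x) / 2"
  by (simp_all add: cos_mode_def sin_mode_def inner_add_left inner_diff_left distrib_left
      right_diff_distrib cos_add cos_diff sin_add sin_diff)

text \<open>The modes k and -k give the same functions up to sign: cosines agree and sines are
  opposite. Hence the second diagonal l = -k, and for k = 0 both conditions hold at once.\<close>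

lemma mode_orthogonality:
  "(LINT x|torus. cos_mode k x * cos_mode l x) = ((if l = k then 1 else 0) + (if l = - k then 1 else 0)) / 2"
  "(LINT x|torus. sin_mode k x * sin_mode l x) = ((if l = k then 1 else 0) - (if l = - k then 1 else 0)) / 2"
  "(LINT x|torus. cos_mode k x * sin_mode l x) = 0"
  "(LINT x|torus. sin_mode k x * cos_mode l x) = 0"
  unfolding mode_products
  by (auto simp: integral_cos_mode integral_sin_mode eq_neg_iff_add_eq_0 add.commute)

lemma mode_uminus: "cos_mode (- k) x = cos_mode k x" "sin_mode (- k) x = - sin_mode k x"
  by (simp_all add: cos_mode_def sin_mode_def)

lemma field_coef_uminus:
  "fst (field_coef f (- k)) = fst (field_coef f k)" "snd (field_coef f (- k)) = - snd (field_coef f k)"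
  by (simp_all add: field_coef_def mode_uminus)

lemma conv_eq_torus_integral:
  fixes f :: "real ^ 3 \<Rightarrow> 'b :: {banach, second_countable_topology}"
  assumes f: "f \<in> borel_measurable borel" "periodic f" and K: "K \<in> borel_measurable borel" "periodic K"
  shows "(LINT y|torus. K (y - x) *\<^sub>R f y) = conv K f x"
proof -
  have "y + lattice_vec k - x = (y - x) + lattice_vec k" for y k by simp
  then have "periodic (\<lambda>y. K (y - x) *\<^sub>R f y)"
    using f(2) K(2) unfolding periodic_def by metis
  from integral_centred_torus_shift[OF _ this, of x] show ?thesis
    using f K by (simp add: conv_def add.commute)
qed

lemma conv_trig_kernel:
  assumes f: "torus_field f"
  shows "conv (trig_kernel n) f x = (\<Sum>k\<in>modes n. weight n k *\<^sub>R
    (cos_mode k x *\<^sub>R fst (field_coef f k) + sin_mode k x *\<^sub>R snd (field_coef f k)))"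
proof -
  have tk: "trig_kernel n (y - x) *\<^sub>R f y = (\<Sum>k\<in>modes n. weight n k *\<^sub>R
      (cos_mode k x *\<^sub>R (cos_mode k y *\<^sub>R f y) + sin_mode k x *\<^sub>R (sin_mode k y *\<^sub>R f y)))" for y
    by (simp add: trig_kernel_expansion cos_mode_def sin_mode_def inner_diff_right right_diff_distrib
        cos_diff scaleR_sum_left algebra_simps)
  note i = integrable_scaleR_bounded[OF f mode_measurable(1) mode_bounds(1)]
    integrable_scaleR_bounded[OF f mode_measurable(2) mode_bounds(2)]
  have "conv (trig_kernel n) f x = (LINT y|torus. trig_kernel n (y - x) *\<^sub>R f y)"
    using torus_fieldD[OF f] test_fun_trig_kernel[of n]
    by (intro conv_eq_torus_integral[symmetric]) (auto simp: test_fun_def)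
  also have "\<dots> = (\<Sum>k\<in>modes n. weight n k *\<^sub>R
    (cos_mode k x *\<^sub>R fst (field_coef f k) + sin_mode k x *\<^sub>R snd (field_coef f k)))"
    unfolding tk field_coef_def using i by (simp del: scaleR_scaleR)
  finally show ?thesis .
qed

text \<open>Parseval's identity for the smoothed fields. Each mode meets itself and its opposite;
  weights and cosine coefficients are even and sine coefficients odd in k, so both contributions are
  equal and make up for the 1/2 of the orthogonality relations.\<close>

lemma integral_conv_inner:
  assumes f: "torus_field f" and g: "torus_field g"
  shows "(LINT x|torus. conv (trig_kernel n) f x \<bullet> conv (trig_kernel n) g x) =
    (\<Sum>k\<in>modes n. (weight n k)\<^sup>2 * (field_coef f k \<bullet> field_coef g k))"
proof -
  define a b where "a k = fst (field_coef f k)" and "b k = snd (field_coef f k)" for k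
  define c d where "c k = fst (field_coef g k)" and "d k = snd (field_coef g k)" for k
  let ?w = "weight n"
  have uminus: "c (- k) = c k" "d (- k) = - d k" for k
    by (simp_all add: c_def d_def field_coef_uminus)
  have int: "integrable torus (\<lambda>x. cos_mode k x * cos_mode l x)" "integrable torus (\<lambda>x. sin_mode k x * sin_mode l x)"
    "integrable torus (\<lambda>x. cos_mode k x * sin_mode l x)" "integrable torus (\<lambda>x. sin_mode k x * cos_mode l x)" for k l
    unfolding mode_products by simp_all
  \<comment> \<open>Separates l = k from l = -k without assuming them distinct, as they coincide at
    k = 0.\<close>
  have split: "w * (((if P then 1 else 0) + (if Q then 1 else 0)) / 2 * s + ((if P then 1 else 0) - (if Q then 1 else 0)) / 2 * t)
      = (if P then w / 2 * (s + t) else 0) + (if Q then w / 2 * (s - t) else 0)" for P Q and w s t :: real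
    by (simp add: field_simps)
  have "conv (trig_kernel n) f x \<bullet> conv (trig_kernel n) g x = (\<Sum>k\<in>modes n. \<Sum>l\<in>modes n. ?w k * ?w l *
      ((cos_mode k x * cos_mode l x) * (a k \<bullet> c l) + (cos_mode k x * sin_mode l x) * (a k \<bullet> d l)
        + (sin_mode k x * cos_mode l x) * (b k \<bullet> c l) + (sin_mode k x * sin_mode l x) * (b k \<bullet> d l)))" for x
    unfolding conv_trig_kernel[OF f] conv_trig_kernel[OF g] inner_sum_left inner_sum_right
    by (subst sum.swap, intro sum.cong refl)
      (simp add: a_def b_def c_def d_def inner_add_left inner_add_right algebra_simps)
  then have "(LINT x|torus. conv (trig_kernel n) f x \<bullet> conv (trig_kernel n) g x) =
      (\<Sum>k\<in>modes n. \<Sum>l\<in>modes n. ?w k * ?w l *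
        (((if l = k then 1 else 0) + (if l = - k then 1 else 0)) / 2 * (a k \<bullet> c l) +
         ((if l = k then 1 else 0) - (if l = - k then 1 else 0)) / 2 * (b k \<bullet> d l)))"
    using int by (simp add: mode_orthogonality)
  also have "\<dots> = (\<Sum>k\<in>modes n. (?w k)\<^sup>2 * (a k \<bullet> c k + b k \<bullet> d k))"
  proof (rule sum.cong[OF refl])
    fix k assume k: "k \<in> modes n"
    then have k': "- k \<in> modes n" by (simp add: in_modes_iff)
    have "(\<Sum>l\<in>modes n. ?w k * ?w l *
        (((if l = k then 1 else 0) + (if l = - k then 1 else 0)) / 2 * (a k \<bullet> c l) +
         ((if l = k then 1 else 0) - (if l = - k then 1 else 0)) / 2 * (b k \<bullet> d l))) =
      (\<Sum>l\<in>modes n. (if l = k then ?w k * ?w l / 2 * (a k \<bullet> c l + b k \<bullet> d l) else 0) +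
        (if l = - k then ?w k * ?w l / 2 * (a k \<bullet> c l - b k \<bullet> d l) else 0))"
      by (intro sum.cong refl split)
    also have "\<dots> = ?w k * ?w k / 2 * (a k \<bullet> c k + b k \<bullet> d k) + ?w k * ?w (- k) / 2 * (a k \<bullet> c (- k) - b k \<bullet> d (- k))"
      using k k' by (simp add: sum.distrib sum.delta)
    also have "\<dots> = (?w k)\<^sup>2 * (a k \<bullet> c k + b k \<bullet> d k)"
      unfolding weight_minus uminus by (simp add: power2_eq_square field_simps)
    finally show "(\<Sum>l\<in>modes n. ?w k * ?w l *
        (((if l = k then 1 else 0) + (if l = - k then 1 else 0)) / 2 * (a k \<bullet> c l) +
         ((if l = k then 1 else 0) - (if l = - k then 1 else 0)) / 2 * (b k \<bullet> d l))) = (?w k)\<^sup>2 * (a k \<bullet> c k + b k \<bullet> d k)" .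
  qed
  finally show ?thesis by (simp add: a_def b_def c_def d_def inner_prod_def)
qed

section \<open>The curl in Fourier variables\<close>

lemma cross3_component: "cross3 a b $ i = a $ (i + 1) * b $ (i + 2) - a $ (i + 2) * b $ (i + 1)"
proof -
  have "(3::3) = 0" "(4::3) = 1" "(5::3) = 2" by simp_all
  note numerals = this
  show ?thesis
    using exhaust_3[of i] by (auto simp: cross3_def vector_def numerals)
qed

text \<open>Multiplication by 2 pi i k in the cross product, written in the real coordinates of
  \<open>coef\<close>: the factor i exchanges the cosine and the sine part with a sign.\<close>

definition curl_symbol :: "int ^ 3 \<Rightarrow> (real ^ 3) \<times> (real ^ 3) \<Rightarrow> (real ^ 3) \<times> (real ^ 3)" where
  "curl_symbol k z = (cross3 ((2 * pi) *\<^sub>R lattice_vec k) (snd z), - cross3 ((2 * pi) *\<^sub>R lattice_vec k) (fst z))"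

text \<open>The cross product with a fixed vector and the signed exchange of the two parts are both
  antisymmetric and commute, so their composition is symmetric.\<close>

lemma curl_symbol_symmetric: "curl_symbol k z \<bullet> z' = z \<bullet> curl_symbol k z'"
proof -
  have "cross3 a b \<bullet> c = - (b \<bullet> cross3 a c)" for a b c
    by (simp add: cross3_simps)
  then show ?thesis by (simp add: curl_symbol_def inner_prod_def)
qed

lemma bounded_linear_curl_symbol: "bounded_linear (curl_symbol k)"
  unfolding curl_symbol_def[abs_def]
  by (intro bounded_linear_Pair bounded_linear_minus bounded_linear_compose[OF cross3.bounded_linear_right]
      bounded_linear_fst bounded_linear_snd)

text \<open>Only linearity on multiples of the modes is needed, so this also applies to distributions given
  by the product of two fields.\<close>

lemma coef_curl:
  assumes lin: "\<And>i \<phi> c. test_fun \<phi> \<Longrightarrow> (u $ i) (\<lambda>x. c * \<phi> x) = c * (u $ i) \<phi>"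
  shows "coef (curl u) k = curl_symbol k (coef u k)"
proof -
  have "(u $ i) (partial_deriv j (cos_mode k)) = - (2 * pi * of_int (k $ j)) * (u $ i) (sin_mode k)"
    "(u $ i) (partial_deriv j (sin_mode k)) = 2 * pi * of_int (k $ j) * (u $ i) (cos_mode k)" for i j
    using lin[OF test_fun_sin_mode, of i "- (2 * pi * of_int (k $ j))"] lin[OF test_fun_cos_mode, of i "2 * pi * of_int (k $ j)"]
    by (simp_all add: partial_deriv_modes[abs_def])
  then show ?thesis
    by (simp add: coef_def curl_symbol_def vec_eq_iff curl_def distr_deriv_def cross3_component)
qed

lemma coef_cong: "(\<And>i. distr_eq (u $ i) (v $ i)) \<Longrightarrow> coef u k = coef v k"
  using test_fun_cos_mode test_fun_sin_mode by (simp add: coef_def distr_eq_def vec_eq_iff)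

text \<open>The derivatives of the curl are moved onto the kernel y \<mapsto> K(y - x), and the sign
  of distributional differentiation produces the minus. This supplies the representation through a
  kernel \<open>L\<close> of mean zero that \<open>commutator_estimate\<close> requires.\<close>

lemma conv_curl:
  assumes f: "represents f u" and g: "represents g w" and curl: "\<And>i. distr_eq (w $ i) (curl u $ i)"
  shows "conv (trig_kernel n) g x = (LINT h|centred_torus. cross3 (- trig_grad n h) (f (x + h)))"
proof -
  note F = represents_torus_field[OF f] and G = represents_torus_field[OF g]
  let ?\<phi> = "\<lambda>y. trig_kernel n (y - x)"
  have \<phi>: "test_fun ?\<phi>" by (rule test_fun_shift[OF test_fun_trig_kernel])
  have grad: "test_fun (partial_deriv j (trig_kernel n))" for j
    by (rule test_fun_partial_deriv[OF test_fun_trig_kernel])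
  have shift: "partial_deriv j ?\<phi> = (\<lambda>y. partial_deriv j (trig_kernel n) (y - x))" for j
  proof
    fix y
    have "((\<lambda>y. y - x) has_derivative (\<lambda>v. v)) (at y)" by (auto intro!: derivative_eq_intros)
    from has_derivative_compose[OF this smooth_has_derivative, of "trig_kernel n"] test_fun_trig_kernel[of n]
    show "partial_deriv j ?\<phi> y = partial_deriv j (trig_kernel n) (y - x)"
      by (simp add: partial_deriv_eqI test_fun_def) (simp add: partial_deriv_def)
  qed
  have conv_i: "(v $ i) (\<lambda>y. K (y - x)) = conv K e x $ i"
    if K: "test_fun K" and e: "represents e v" for K e v i
  proof -
    note E = represents_torus_field[OF e]
    obtain B where B: "\<And>x. \<bar>K x\<bar> \<le> B" using test_fun_bounded[OF K] by blast
    have [measurable]: "K \<in> borel_measurable borel" by (rule test_fun_measurable[OF K])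
    have "(v $ i) (\<lambda>y. K (y - x)) = (LINT y|torus. e y $ i * K (y - x))"
      by (rule represents_eq[OF e test_fun_shift[OF K]])
    also have "\<dots> = (LINT y|torus. K (y - x) *\<^sub>R e y) $ i"
      by (rule integrable_component_mult(2)[OF E, where B = B]) (use B in \<open>auto\<close>)
    also have "\<dots> = conv K e x $ i"
      using torus_fieldD[OF E] K by (subst conv_eq_torus_integral) (auto simp: test_fun_def)
    finally show ?thesis .
  qed
  have conv_int: "integrable centred_torus (\<lambda>h. partial_deriv j (trig_kernel n) h *\<^sub>R f (x + h))" for j
  proof -
    obtain B where "\<And>x. \<bar>partial_deriv j (trig_kernel n) x\<bar> \<le> B" using test_fun_bounded[OF grad] by blast
    then show ?thesis by (intro conv_integrable[OF F test_fun_measurable[OF grad]])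
  qed
  have comp: "conv (partial_deriv j (trig_kernel n)) f x $ i =
      (LINT h|centred_torus. partial_deriv j (trig_kernel n) h * f (x + h) $ i)"
    and comp_int: "integrable centred_torus (\<lambda>h. partial_deriv j (trig_kernel n) h * f (x + h) $ i)" for i j
    using integral_bounded_linear[OF bounded_linear_vec_nth conv_int, of j i]
      integrable_bounded_linear[OF bounded_linear_vec_nth conv_int, of j i]
    by (simp_all add: conv_def)
  have split: "cross3 (- trig_grad n h) (f (x + h)) = (\<Sum>i\<in>UNIV.
      (partial_deriv (i + 2) (trig_kernel n) h * f (x + h) $ (i + 1)
        - partial_deriv (i + 1) (trig_kernel n) h * f (x + h) $ (i + 2)) *\<^sub>R axis i 1)" for h
    by (auto simp: vec_eq_iff cross3_component trig_grad_def axis_def if_distrib cong: if_cong)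
  have "conv (trig_kernel n) g x $ i = (LINT h|centred_torus. cross3 (- trig_grad n h) (f (x + h))) $ i" for i
  proof -
    have "conv (trig_kernel n) g x $ i = (w $ i) ?\<phi>"
      by (rule conv_i[OF test_fun_trig_kernel g, symmetric])
    also have "\<dots> = (curl u $ i) ?\<phi>" using curl \<phi> by (simp add: distr_eq_def)
    also have "\<dots> = - (u $ (i + 2)) (partial_deriv (i + 1) ?\<phi>) + (u $ (i + 1)) (partial_deriv (i + 2) ?\<phi>)"
      by (simp add: curl_def distr_deriv_def)
    also have "\<dots> = - conv (partial_deriv (i + 1) (trig_kernel n)) f x $ (i + 2)
        + conv (partial_deriv (i + 2) (trig_kernel n)) f x $ (i + 1)"
      unfolding shift by (simp add: conv_i[OF grad f])
    also have "\<dots> = (LINT h|centred_torus. cross3 (- trig_grad n h) (f (x + h))) $ i"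
      unfolding split comp using comp_int
      by (simp add: axis_def if_distrib cong: if_cong)
    finally show ?thesis .
  qed
  then show ?thesis by (simp add: vec_eq_iff)
qed

section \<open>Mollifications as averages over shifts\<close>

lemma mollifier_scaled_integral:
  assumes "mollifier \<rho>" "0 < \<epsilon>"
  shows "(LINT h|lborel. \<rho> (- (h /\<^sub>R \<epsilon>)) / \<epsilon> ^ 3) = 1"
proof -
  have [measurable]: "\<rho> \<in> borel_measurable borel"
    using assms by (intro smooth_borel_measurable) (simp add: mollifier_def)
  let ?c = "- 1 / \<epsilon>"
  have "1 = (LINT x|lborel. \<rho> x)" using assms by (simp add: mollifier_def)
  also have "\<dots> = (LINT x|density (distr lborel borel (\<lambda>x. 0 + ?c *\<^sub>R x)) (\<lambda>_. ennreal (\<bar>?c\<bar> ^ DIM(real ^ 3))). \<rho> x)"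
    using lborel_affine[of ?c "0 :: real ^ 3"] assms by simp
  also have "\<dots> = (LINT x|distr lborel borel (\<lambda>x. 0 + ?c *\<^sub>R x). (\<bar>?c\<bar> ^ DIM(real ^ 3)) *\<^sub>R \<rho> x)"
    by (rule integral_density) auto
  also have "\<dots> = (LINT h|lborel. (\<bar>?c\<bar> ^ DIM(real ^ 3)) *\<^sub>R \<rho> (0 + ?c *\<^sub>R h))"
    by (rule integral_distr) auto
  also have "\<dots> = (LINT h|lborel. \<rho> (- (h /\<^sub>R \<epsilon>)) / \<epsilon> ^ 3)"
    using assms by (simp add: power_divide inverse_eq_divide)
  finally show ?thesis by (rule sym)
qed

text \<open>For h in the centred cube and k \<noteq> 0 some coordinate of k - h has absolute value
  at least 1/2, beyond the radius \<epsilon> of the support, so only k = 0 is left in the lattice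
  sum. The mollifier is evaluated at x - y = -h, hence the reflection.\<close>

lemma mollify_eq_conv:
  assumes \<rho>: "mollifier \<rho>" and eps: "0 < \<epsilon>" "\<epsilon> < 1 / 2" and f: "represents f u"
  shows "mollify \<rho> \<epsilon> (u $ i) x = conv (\<lambda>h. \<rho> (- (h /\<^sub>R \<epsilon>)) / \<epsilon> ^ 3) f x $ i"
proof -
  note F = represents_torus_field[OF f]
  note [measurable] = torus_fieldD(1)[OF F]
  have \<rho>0: "\<rho> y = 0" if "1 \<le> norm y" for y using \<rho> that by (simp add: mollifier_def)
  let ?P = "\<lambda>y. \<Sum>\<^sub>\<infinity>k. \<rho> ((x - y + lattice_vec k) /\<^sub>R \<epsilon>) / \<epsilon> ^ 3"
  have P: "test_fun ?P" by (rule test_fun_periodized_mollifier[OF \<rho> eps(1)])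
  obtain B where B: "\<And>y. \<bar>?P y\<bar> \<le> B" using test_fun_bounded[OF P] by blast
  have "mollify \<rho> \<epsilon> (u $ i) x = (LINT y|torus. f y $ i * ?P y)"
    unfolding mollify_def by (rule represents_eq[OF f P])
  also have "\<dots> = (LINT y|torus. ?P y *\<^sub>R f y) $ i"
    by (rule integrable_component_mult(2)[OF F test_fun_measurable[OF P] B])
  also have "(LINT y|torus. ?P y *\<^sub>R f y) = (LINT h|centred_torus. ?P (h + x) *\<^sub>R f (h + x))"
    using P test_fun_measurable[OF P] torus_fieldD(2)[OF F]
    by (intro integral_centred_torus_shift[symmetric]) (auto simp: periodic_def test_fun_def)
  also have "\<dots> = conv (\<lambda>h. \<rho> (- (h /\<^sub>R \<epsilon>)) / \<epsilon> ^ 3) f x"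
    unfolding conv_def
  proof (rule Bochner_Integration.integral_cong[OF refl])
    fix h assume h: "h \<in> space centred_torus"
    have "\<rho> ((x - (h + x) + lattice_vec k) /\<^sub>R \<epsilon>) / \<epsilon> ^ 3 = 0" if k: "k \<noteq> 0" for k
    proof -
      obtain j where j: "k $ j \<noteq> 0" using k by (auto simp: vec_eq_iff)
      have "1 / 2 \<le> \<bar>(lattice_vec k - h) $ j\<bar>"
      proof -
        have "1 \<le> \<bar>k $ j\<bar>" using j by linarith
        then have "1 \<le> \<bar>real_of_int (k $ j)\<bar>" by linarith
        moreover have "\<bar>h $ j\<bar> \<le> 1 / 2" using h by (simp add: space_centred_torus)
        ultimately show ?thesis
          using abs_triangle_ineq2[of "real_of_int (k $ j)" "h $ j"]
          unfolding vector_minus_component lattice_vec_nth by linarith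
      qed
      also have "\<dots> \<le> norm (lattice_vec k - h)" by (rule component_le_norm_cart)
      finally have "\<epsilon> \<le> norm (lattice_vec k - h)" using eps by simp
      moreover have "norm ((x - (h + x) + lattice_vec k) /\<^sub>R \<epsilon>) = norm (lattice_vec k - h) / \<epsilon>"
      proof -
        have "x - (h + x) + lattice_vec k = lattice_vec k - h" by simp
        then show ?thesis using eps by (simp only: norm_scaleR) (simp add: field_simps)
      qed
      ultimately have "1 \<le> norm ((x - (h + x) + lattice_vec k) /\<^sub>R \<epsilon>)"
        using eps by simp
      from \<rho>0[OF this] show ?thesis by simp
    qed
    then have "?P (h + x) = (\<Sum>\<^sub>\<infinity>k\<in>{0}. \<rho> ((x - (h + x) + lattice_vec k) /\<^sub>R \<epsilon>) / \<epsilon> ^ 3)"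
      by (intro infsum_cong_neutral) auto
    then show "?P (h + x) *\<^sub>R f (h + x) = (\<rho> (- (h /\<^sub>R \<epsilon>)) / \<epsilon> ^ 3) *\<^sub>R f (x + h)"
      by (simp add: add.commute)
  qed
  finally show ?thesis .
qed

text \<open>On the support |h| \<le> \<epsilon>, so the weight (1 + |h| / \<epsilon>)^7 is at most
  2^7 = 128, and 128 times the kernel serves as the majorant.\<close>

lemma mollifier_kernel:
  assumes \<rho>: "mollifier \<rho>"
  obtains C where "1 \<le> C" "\<And>\<epsilon>. 0 < \<epsilon> \<Longrightarrow> \<epsilon> < 1 / 2 \<Longrightarrow>
    (LINT h|centred_torus. \<rho> (- (h /\<^sub>R \<epsilon>)) / \<epsilon> ^ 3) = 1 \<and>
    kernel_mass C \<epsilon> (\<lambda>h. 128 * (\<rho> (- (h /\<^sub>R \<epsilon>)) / \<epsilon> ^ 3)) \<and>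
    dominated \<epsilon> (\<lambda>h. 128 * (\<rho> (- (h /\<^sub>R \<epsilon>)) / \<epsilon> ^ 3)) (\<lambda>h. \<rho> (- (h /\<^sub>R \<epsilon>)) / \<epsilon> ^ 3)"
proof -
  have [measurable]: "\<rho> \<in> borel_measurable borel"
    using \<rho> by (intro smooth_borel_measurable) (simp add: mollifier_def)
  have \<rho>0: "\<rho> y = 0" if "1 \<le> norm y" for y using \<rho> that by (simp add: mollifier_def)
  have nonneg: "0 \<le> \<rho> y" for y using \<rho> by (simp add: mollifier_def)
  have "compact (\<rho> ` cball 0 1)"
    using \<rho> by (intro compact_continuous_image smooth_continuous_on compact_cball) (simp add: mollifier_def)
  then obtain B where B: "\<And>y. y \<in> \<rho> ` cball 0 1 \<Longrightarrow> norm y \<le> B"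
    using compact_imp_bounded bounded_iff by metis
  define C where "C = max 128 (128 * B)"
  have \<rho>B: "128 * \<rho> y \<le> C" for y
  proof (cases "norm y \<le> 1")
    case True
    then have "\<rho> y \<le> B" using B[of "\<rho> y"] by auto
    then show ?thesis by (simp add: C_def)
  next
    case False
    then show ?thesis using \<rho>0[of y] by (simp add: C_def)
  qed
  show ?thesis
  proof (rule that)
    show "1 \<le> C" by (simp add: C_def)
    fix \<epsilon> :: real assume eps: "0 < \<epsilon>" "\<epsilon> < 1 / 2"
    let ?K = "\<lambda>h::real^3. \<rho> (- (h /\<^sub>R \<epsilon>)) / \<epsilon> ^ 3"
    have K0: "?K h = 0" if "\<epsilon> \<le> norm h" for h
    proof -
      have "1 \<le> norm (- (h /\<^sub>R \<epsilon>))" using that eps by (simp add: field_simps)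
      from \<rho>0[OF this] show ?thesis by simp
    qed
    have [measurable]: "{h::real^3. \<forall>i. \<bar>h $ i\<bar> \<le> 1 / 2} \<in> sets borel" by measurable
    have "(LINT h|centred_torus. ?K h) = (LINT h|lborel. indicator {h. \<forall>i. \<bar>h $ i\<bar> \<le> 1 / 2} h *\<^sub>R ?K h)"
      unfolding centred_torus_def by (rule integral_restrict_space) simp
    also have "\<dots> = (LINT h|lborel. ?K h)"
    proof (rule Bochner_Integration.integral_cong[OF refl])
      fix h :: "real ^ 3"
      show "indicator {h. \<forall>i. \<bar>h $ i\<bar> \<le> 1 / 2} h *\<^sub>R ?K h = ?K h"
      proof (cases "\<epsilon> \<le> norm h")
        case False
        have "\<bar>h $ i\<bar> \<le> 1 / 2" for i
          using component_le_norm_cart[of h i] False eps by simp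
        then show ?thesis by simp
      next
        case True
        show ?thesis unfolding K0[OF True] by simp
      qed
    qed
    finally have one: "(LINT h|centred_torus. ?K h) = 1"
      unfolding mollifier_scaled_integral[OF \<rho> eps(1)] .
    \<comment> \<open>A function that is not integrable has integral 0 by convention, so the value 1
      shows integrability.\<close>
    have int: "integrable centred_torus ?K"
      using one not_integrable_integral_eq by fastforce
    have "(\<integral>\<^sup>+h. ennreal (128 * ?K h) \<partial>centred_torus) = ennreal (LINT h|centred_torus. 128 * ?K h)"
      using integrable_mult_right[OF int, of 128] nonneg eps by (intro nn_integral_eq_integral) simp_all
    also have "(LINT h|centred_torus. 128 * ?K h) = 128"
      by (simp only: integral_mult_right_zero one mult_1_right)
    finally have "(\<integral>\<^sup>+h. ennreal (128 * ?K h) \<partial>centred_torus) = 128" by simp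
    moreover have "(128::ennreal) \<le> ennreal C"
      using ennreal_leI[of 128 C] by (simp add: C_def)
    ultimately have "kernel_mass C \<epsilon> (\<lambda>h. 128 * ?K h)"
      using nonneg eps \<rho>B by (auto simp: kernel_mass_def divide_right_mono)
    moreover have "dominated \<epsilon> (\<lambda>h. 128 * ?K h) ?K"
      unfolding dominated_def
    proof (intro conjI ballI)
      fix h :: "real ^ 3"
      show "\<bar>?K h\<bar> * (1 + norm h / \<epsilon>) ^ 7 \<le> 128 * ?K h"
      proof (cases "\<epsilon> \<le> norm h")
        case False
        then have "(1 + norm h / \<epsilon>) ^ 7 \<le> 2 ^ 7"
          using eps by (intro power_mono) (auto simp: field_simps)
        then have "\<bar>?K h\<bar> * (1 + norm h / \<epsilon>) ^ 7 \<le> \<bar>?K h\<bar> * 2 ^ 7" by (intro mult_left_mono) auto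
        then show ?thesis using nonneg eps by (simp add: mult.commute[of 128])
      next
        case True
        show ?thesis unfolding K0[OF True] by simp
      qed
    qed measurable
    ultimately show "(LINT h|centred_torus. ?K h) = 1 \<and> kernel_mass C \<epsilon> (\<lambda>h. 128 * ?K h) \<and>
      dominated \<epsilon> (\<lambda>h. 128 * ?K h) ?K" using one by blast
  qed
qed

section \<open>Products of distributions represented by functions\<close>

text \<open>Any family of kernels with a uniform constant \<open>C\<close> and width tending to 0
  will do. The filter is arbitrary because mollifiers are indexed by \<epsilon> tending to 0 and the
  trigonometric kernels by m tending to \<infinity>.\<close>

lemma product_tendsto:
  assumes C: "1 \<le> C" and eps: "filterlim eps (at_right 0) F"
    and ev: "eventually (\<lambda>z. \<exists>\<kappa>. kernel_mass C (eps z) \<kappa> \<and> dominated (eps z) \<kappa> (K z) \<and>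
      (LINT h|centred_torus. K z h) = 1) F"
    and f: "torus_field f" and g: "torus_field g"
    and pq: "1 \<le> p" "1 \<le> q" "1 / p + 1 / q = 1" and s: "0 < \<beta>" "\<beta> < 1" "0 < \<alpha>" "\<alpha> < 1"
    and fin: "field_norm \<beta> (2 * p) f < \<infinity>" "field_norm \<alpha> q g < \<infinity>"
    and \<phi>: "\<phi> \<in> borel_measurable borel" "\<And>x. \<bar>\<phi> x\<bar> \<le> B"
  shows "((\<lambda>z. LINT x|torus. conv (K z) f x $ i * conv (K z) g x $ j * \<phi> x) \<longlongrightarrow>
    (LINT x|torus. f x $ i * g x $ j * \<phi> x)) F"
proof -
  obtain Nf Ng where N: "field_norm \<beta> (2 * p) f = ennreal Nf" "0 \<le> Nf" "field_norm \<alpha> q g = ennreal Ng" "0 \<le> Ng"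
    using fin by (metis ennreal_cases infinity_ennreal_def less_irrefl)
  have B0: "0 \<le> B" using \<phi>(2)[of 0] by linarith
  define b where "b z = B * C ^ 9 * (eps z powr \<beta> + eps z powr \<alpha> + eps z powr (\<beta> + \<alpha>)) * Nf * Ng" for z
  have pos: "eventually (\<lambda>z. 0 < eps z) F" and lim: "(eps \<longlongrightarrow> 0) F"
    using eps by (auto simp: filterlim_at elim: eventually_mono)
  have powr: "((\<lambda>z. eps z powr a) \<longlongrightarrow> 0) F" if "0 < a" for a
  proof -
    have "eventually (\<lambda>z. 0 \<le> eps z) F" using pos by (rule eventually_mono) simp
    with tendsto_powr'[OF lim tendsto_const, of a] that show ?thesis by simp
  qed
  have "(b \<longlongrightarrow> B * C ^ 9 * (0 + 0 + 0) * Nf * Ng) F"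
    unfolding b_def using s by (intro tendsto_intros powr) auto
  then have b: "(b \<longlongrightarrow> 0) F" by simp
  have "eventually (\<lambda>z. norm ((LINT x|torus. conv (K z) f x $ i * conv (K z) g x $ j * \<phi> x)
      - (LINT x|torus. f x $ i * g x $ j * \<phi> x)) \<le> b z) F"
    using ev pos
  proof eventually_elim
    case (elim z)
    then obtain \<kappa> where \<kappa>: "kernel_mass C (eps z) \<kappa>" "dominated (eps z) \<kappa> (K z)" "(LINT h|centred_torus. K z h) = 1"
      by blast
    interpret kernel C "eps z" \<kappa> using C elim \<kappa> by unfold_locales
    have "ennreal \<bar>(LINT x|torus. conv (K z) f x $ i * conv (K z) g x $ j * \<phi> x) - (LINT x|torus. f x $ i * g x $ j * \<phi> x)\<bar>
      \<le> ennreal (B * C ^ 9 * (eps z powr \<beta> + eps z powr \<alpha> + eps z powr (\<beta> + \<alpha>))) * field_norm \<beta> (2 * p) f * field_norm \<alpha> q g"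
      by (rule product_conv_estimate[OF \<kappa>(2,3) f g pq s fin \<phi>])
    also have "\<dots> = ennreal (b z)"
      unfolding N b_def using N B0 C by (simp add: ennreal_mult)
    finally show ?case
      using B0 C N by (subst (asm) ennreal_le_iff) (auto simp: b_def)
  qed
  then have "((\<lambda>z. (LINT x|torus. conv (K z) f x $ i * conv (K z) g x $ j * \<phi> x)
      - (LINT x|torus. f x $ i * g x $ j * \<phi> x)) \<longlongrightarrow> 0) F"
    using b by (rule Lim_null_comparison)
  then show ?thesis by (rule LIM_zero_cancel)
qed

lemma distr_mult_commute: "distr_mult \<Lambda> M = distr_mult M \<Lambda>"
  by (simp add: distr_mult_def mult.commute)

text \<open>The products of mollifications converge to the pointwise product for every mollifier,
  and since a mollifier exists no other number fits the defining description. Thus the tensors in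
  the vorticity equation are given by integrable functions.\<close>

lemma distr_mult_eq:
  assumes f: "represents f u" and g: "represents g w"
    and pq: "1 \<le> p" "1 \<le> q" "1 / p + 1 / q = 1" and s: "0 < \<beta>" "\<beta> < 1" "0 < \<alpha>" "\<alpha> < 1"
    and fin: "field_norm \<beta> (2 * p) f < \<infinity>" "field_norm \<alpha> q g < \<infinity>"
    and \<phi>: "test_fun \<phi>"
  shows "distr_mult (u $ i) (w $ j) \<phi> = (LINT x|torus. f x $ i * g x $ j * \<phi> x)"
proof -
  let ?X = "LINT x|torus. f x $ i * g x $ j * \<phi> x"
  obtain B where B: "\<And>x. \<bar>\<phi> x\<bar> \<le> B" using test_fun_bounded[OF \<phi>] by blast
  have lim: "((\<lambda>\<epsilon>. LINT x|torus. mollify \<rho> \<epsilon> (u $ i) x * mollify \<rho> \<epsilon> (w $ j) x * \<phi> x) \<longlongrightarrow> ?X) (at_right 0)"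
    if \<rho>: "mollifier \<rho>" for \<rho>
  proof -
    obtain C where C: "1 \<le> C" "\<And>\<epsilon>. 0 < \<epsilon> \<Longrightarrow> \<epsilon> < 1 / 2 \<Longrightarrow>
      (LINT h|centred_torus. \<rho> (- (h /\<^sub>R \<epsilon>)) / \<epsilon> ^ 3) = 1 \<and>
      kernel_mass C \<epsilon> (\<lambda>h. 128 * (\<rho> (- (h /\<^sub>R \<epsilon>)) / \<epsilon> ^ 3)) \<and>
      dominated \<epsilon> (\<lambda>h. 128 * (\<rho> (- (h /\<^sub>R \<epsilon>)) / \<epsilon> ^ 3)) (\<lambda>h. \<rho> (- (h /\<^sub>R \<epsilon>)) / \<epsilon> ^ 3)"
      using mollifier_kernel[OF \<rho>] by blast
    have small: "eventually (\<lambda>\<epsilon>::real. 0 < \<epsilon> \<and> \<epsilon> < 1 / 2) (at_right 0)"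
      by (auto simp: eventually_at_right_field intro!: exI[where x = "1 / 2"])
    have "((\<lambda>\<epsilon>. LINT x|torus. conv (\<lambda>h. \<rho> (- (h /\<^sub>R \<epsilon>)) / \<epsilon> ^ 3) f x $ i *
        conv (\<lambda>h. \<rho> (- (h /\<^sub>R \<epsilon>)) / \<epsilon> ^ 3) g x $ j * \<phi> x) \<longlongrightarrow> ?X) (at_right 0)"
    proof (rule product_tendsto[OF C(1) filterlim_ident _ represents_torus_field[OF f] represents_torus_field[OF g]
          pq s fin test_fun_measurable[OF \<phi>] B])
      show "eventually (\<lambda>\<epsilon>. \<exists>\<kappa>. kernel_mass C \<epsilon> \<kappa> \<and> dominated \<epsilon> \<kappa> (\<lambda>h. \<rho> (- (h /\<^sub>R \<epsilon>)) / \<epsilon> ^ 3) \<and>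
          (LINT h|centred_torus. \<rho> (- (h /\<^sub>R \<epsilon>)) / \<epsilon> ^ 3) = 1) (at_right 0)"
        using small by eventually_elim (use C(2) in blast)
    qed
    then show ?thesis
    proof (rule Lim_transform_eventually)
      show "eventually (\<lambda>\<epsilon>. (LINT x|torus. conv (\<lambda>h. \<rho> (- (h /\<^sub>R \<epsilon>)) / \<epsilon> ^ 3) f x $ i *
        conv (\<lambda>h. \<rho> (- (h /\<^sub>R \<epsilon>)) / \<epsilon> ^ 3) g x $ j * \<phi> x) =
        (LINT x|torus. mollify \<rho> \<epsilon> (u $ i) x * mollify \<rho> \<epsilon> (w $ j) x * \<phi> x)) (at_right 0)"
        using small by eventually_elim (simp add: mollify_eq_conv[OF \<rho> _ _ f] mollify_eq_conv[OF \<rho> _ _ g])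
    qed
  qed
  obtain \<rho> where \<rho>: "mollifier \<rho>" using mollifier_exists by blast
  show ?thesis
    unfolding distr_mult_def
  proof (rule the_equality)
    fix L assume "\<forall>\<rho>. mollifier \<rho> \<longrightarrow>
      ((\<lambda>\<epsilon>. LINT x|torus. mollify \<rho> \<epsilon> (u $ i) x * mollify \<rho> \<epsilon> (w $ j) x * \<phi> x) \<longlongrightarrow> L) (at_right 0)"
    with \<rho> have "((\<lambda>\<epsilon>. LINT x|torus. mollify \<rho> \<epsilon> (u $ i) x * mollify \<rho> \<epsilon> (w $ j) x * \<phi> x) \<longlongrightarrow> L) (at_right 0)"
      by blast
    from tendsto_unique[OF _ this lim[OF \<rho>]] show "L = ?X" by simp
  qed (use lim in blast)
qed

lemma torus_field_cross3:
  assumes f: "torus_field f" and g: "torus_field g"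
    and pq: "1 \<le> p" "1 \<le> q" "1 / p + 1 / q = 1"
    and fin: "field_norm \<beta> (2 * p) f < \<infinity>" "field_norm \<alpha> q g < \<infinity>"
  shows "torus_field (\<lambda>y. cross3 (f y) (g y))"
  unfolding torus_field_def
proof (intro conjI)
  note [measurable] = torus_fieldD(1)[OF f] torus_fieldD(1)[OF g]
  show m: "(\<lambda>y. cross3 (f y) (g y)) \<in> borel_measurable borel" by measurable
  show "periodic (\<lambda>y. cross3 (f y) (g y))"
    using torus_fieldD(2)[OF f] torus_fieldD(2)[OF g] by (simp add: periodic_def)
  show "integrable torus (\<lambda>y. cross3 (f y) (g y))"
    by (rule Bochner_Integration.integrable_bound[OF integrable_product[OF torus_fieldD(1)[OF f] torus_fieldD(1)[OF g] pq fin]])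
      (use m in \<open>auto intro!: AE_I2 norm_cross3_le\<close>)
qed

definition field_distr :: "(real ^ 3 \<Rightarrow> real ^ 3) \<Rightarrow> distr ^ 3" where
  "field_distr f = (\<chi> i. (\<lambda>\<phi>. (LINT x|torus. f x $ i * \<phi> x)))"

lemma represents_field_distr: "torus_field f \<Longrightarrow> represents f (field_distr f)"
  by (simp add: represents_def torus_field_def field_distr_def)

text \<open>The identity div (f \<otimes> g - g \<otimes> f) = - curl (f \<times> g) in weak form.
  The off-diagonal entries of the antisymmetric matrix are, up to sign, the components of the cross
  product, and the diagonal term a = j cancels.\<close>

lemma matrix_bracket_eq_curl:
  assumes f: "represents f u" and g: "represents g w"
    and pq: "1 \<le> p" "1 \<le> q" "1 / p + 1 / q = 1" and s: "0 < \<beta>" "\<beta> < 1" "0 < \<alpha>" "\<alpha> < 1"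
    and fin: "field_norm \<beta> (2 * p) f < \<infinity>" "field_norm \<alpha> q g < \<infinity>"
    and \<phi>: "test_fun \<phi>"
  shows "matrix_bracket (tensor u w - tensor w u) (gradient (\<lambda>x. \<phi> x *\<^sub>R axis j 1)) =
    (curl (field_distr (\<lambda>y. cross3 (f y) (g y))) $ j) \<phi>"
proof -
  note F = represents_torus_field[OF f] and G = represents_torus_field[OF g]
  note mult = distr_mult_eq[OF f g pq s fin]
  let ?F = "\<lambda>y. cross3 (f y) (g y)"
  define Q where "Q a b \<eta> = (LINT x|torus. f x $ a * g x $ b * \<eta> x)" for a b \<eta>
  have zero: "test_fun (\<lambda>x. 0)" by (simp add: test_fun_def smooth_const periodic_def)
  have grad: "(\<lambda>x. gradient (\<lambda>x. \<phi> x *\<^sub>R axis j 1) x $ a $ b) = (if b = j then partial_deriv a \<phi> else (\<lambda>x. 0))" for a b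
  proof (cases "b = j")
    case False
    then have "(\<lambda>y. (\<phi> y *\<^sub>R axis j (1::real)) $ b) = (\<lambda>y. 0)" by (simp add: axis_def)
    then show ?thesis
      unfolding gradient_def vec_lambda_beta using False
      by (simp only: partial_deriv_eqI[OF has_derivative_const] if_False)
  qed (simp add: gradient_def)
  have "((tensor u w - tensor w u) $ a $ b) \<eta> = Q a b \<eta> - Q b a \<eta>" if "test_fun \<eta>" for a b \<eta>
    using mult[OF that] distr_mult_commute[of "w $ a" "u $ b"] by (simp add: tensor_def Q_def)
  then have "matrix_bracket (tensor u w - tensor w u) (gradient (\<lambda>x. \<phi> x *\<^sub>R axis j 1)) =
      (\<Sum>a\<in>UNIV. \<Sum>b\<in>UNIV. if b = j then Q a j (partial_deriv a \<phi>) - Q j a (partial_deriv a \<phi>) else 0)"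
    unfolding matrix_bracket_def grad using zero test_fun_partial_deriv[OF \<phi>]
    by (intro sum.cong refl) (auto simp: Q_def)
  also have "\<dots> = (\<Sum>a\<in>UNIV. Q a j (partial_deriv a \<phi>) - Q j a (partial_deriv a \<phi>))"
    by simp
  finally have 1: "matrix_bracket (tensor u w - tensor w u) (gradient (\<lambda>x. \<phi> x *\<^sub>R axis j 1)) =
      (\<Sum>a\<in>UNIV. Q a j (partial_deriv a \<phi>) - Q j a (partial_deriv a \<phi>))" .
  have int: "integrable torus (\<lambda>x. f x $ a * g x $ b * \<eta> x)" if \<eta>: "test_fun \<eta>" for a b \<eta>
  proof -
    obtain B where B: "0 \<le> B" "\<And>x. \<bar>\<eta> x\<bar> \<le> B" using test_fun_bounded[OF \<eta>] by blast
    note [measurable] = torus_fieldD(1)[OF F] torus_fieldD(1)[OF G] test_fun_measurable[OF \<eta>]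
    show ?thesis
    proof (rule Bochner_Integration.integrable_bound)
      show "integrable torus (\<lambda>x. norm (f x) * norm (g x) * B)"
        using integrable_product[OF torus_fieldD(1)[OF F] torus_fieldD(1)[OF G] pq fin] by simp
      have "norm (f x $ a * g x $ b * \<eta> x) \<le> norm (f x) * norm (g x) * B" for x
        unfolding norm_mult using B by (intro mult_mono) (auto simp: component_le_norm_cart)
      then show "AE x in torus. norm (f x $ a * g x $ b * \<eta> x) \<le> norm (norm (f x) * norm (g x) * B)"
        using B by (intro AE_I2) simp
    qed measurable
  qed
  have F_i: "(field_distr ?F $ i) \<eta> = Q (i + 1) (i + 2) \<eta> - Q (i + 2) (i + 1) \<eta>" if "test_fun \<eta>" for i \<eta>
    using int[OF that] by (simp add: field_distr_def Q_def cross3_component left_diff_distrib)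
  have "(3::3) = 0" "(4::3) = 1" by simp_all
  note numerals = this
  have sum: "(\<Sum>a\<in>UNIV. h a) = h j + h (j + 1) + h (j + 2)" for h :: "3 \<Rightarrow> real"
    using exhaust_3[of j] by (auto simp: sum_3 numerals)
  have add: "j + 1 + 1 = j + 2" "j + 1 + 2 = j" "j + 2 + 1 = j" "j + 2 + 2 = j + 1"
    using exhaust_3[of j] by (auto simp: numerals)
  show ?thesis
    unfolding 1 sum curl_def distr_deriv_def
    using F_i[OF test_fun_partial_deriv[OF \<phi>]] by (simp add: add)
qed

lemma trig_kernel_eps: "filterlim (\<lambda>m. 1 / sqrt (real m)) (at_right 0) sequentially"
proof -
  have "filterlim (\<lambda>m. sqrt (real m)) at_top sequentially"
    by (intro filterlim_compose[OF sqrt_at_top filterlim_real_sequentially])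
  from filterlim_compose[OF filterlim_inverse_at_right_top this] show ?thesis
    by (simp add: inverse_eq_divide)
qed

lemma trig_product_tendsto:
  assumes f: "torus_field f" and g: "torus_field g"
    and pq: "1 \<le> p" "1 \<le> q" "1 / p + 1 / q = 1" and s: "0 < \<beta>" "\<beta> < 1" "0 < \<alpha>" "\<alpha> < 1"
    and fin: "field_norm \<beta> (2 * p) f < \<infinity>" "field_norm \<alpha> q g < \<infinity>"
    and \<phi>: "\<phi> \<in> borel_measurable borel" "\<And>x. \<bar>\<phi> x\<bar> \<le> B"
  shows "(\<lambda>m. LINT x|torus. conv (trig_kernel (2 * m)) f x $ i * conv (trig_kernel (2 * m)) g x $ j * \<phi> x) \<longlonglongrightarrow>
    (LINT x|torus. f x $ i * g x $ j * \<phi> x)"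
proof -
  obtain C where C: "1 \<le> C" "\<And>m :: nat. 1 \<le> m \<Longrightarrow> \<exists>\<kappa>. kernel_mass C (1 / sqrt (real m)) \<kappa> \<and>
    dominated (1 / sqrt (real m)) \<kappa> (trig_kernel (2 * m)) \<and>
    dominated (1 / sqrt (real m)) \<kappa> (\<lambda>h. (1 / sqrt (real m)) * norm (- trig_grad (2 * m) h))"
    using trig_kernel_family by blast
  show ?thesis
  proof (rule product_tendsto[OF C(1) trig_kernel_eps _ f g pq s fin \<phi>])
    show "eventually (\<lambda>m. \<exists>\<kappa>. kernel_mass C (1 / sqrt (real m)) \<kappa> \<and> dominated (1 / sqrt (real m)) \<kappa> (trig_kernel (2 * m)) \<and>
      (LINT h|centred_torus. trig_kernel (2 * m) h) = 1) sequentially"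
      using eventually_ge_at_top[of 1] by eventually_elim (use C(2) integral_trig_kernel in blast)
  qed
qed

text \<open>The flux of helicity through the cutoff at frequencies of order \<open>sqrt m\<close>.\<close>

definition helicity_flux :: "nat \<Rightarrow> (real ^ 3 \<Rightarrow> real ^ 3) \<Rightarrow> (real ^ 3 \<Rightarrow> real ^ 3) \<Rightarrow> real" where
  "helicity_flux m f g = (\<Sum>k\<in>modes (2 * m). (weight (2 * m) k)\<^sup>2 *
    (field_coef (\<lambda>y. cross3 (f y) (g y)) k \<bullet> field_coef g k))"

text \<open>The constant comes from the kernel family alone and is obtained before cutoff, exponents
  and fields. It can therefore be used with one and the same value at almost every time.\<close>

lemma helicity_flux_bound:
  obtains C :: real where "0 \<le> C" "\<And>(m :: nat) p q \<alpha> \<beta> f g u w.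
    1 \<le> m \<Longrightarrow> represents f u \<Longrightarrow> represents g w \<Longrightarrow> (\<And>i. distr_eq (w $ i) (curl u $ i)) \<Longrightarrow>
    1 \<le> p \<Longrightarrow> 1 \<le> q \<Longrightarrow> 1 / p + 1 / q = 1 \<Longrightarrow> 0 < \<beta> \<Longrightarrow> \<beta> < 1 \<Longrightarrow> 0 < \<alpha> \<Longrightarrow> \<alpha> < 1 \<Longrightarrow>
    field_norm \<beta> (2 * p) f < \<infinity> \<Longrightarrow> field_norm \<alpha> q g < \<infinity> \<Longrightarrow>
    ennreal \<bar>helicity_flux m f g\<bar> \<le> ennreal (C * (1 / sqrt (real m)) powr (2 * \<beta> + \<alpha> - 1)) *
      (field_norm \<beta> (2 * p) f * field_norm \<beta> (2 * p) f * field_norm \<alpha> q g)"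
proof -
  obtain C where C: "1 \<le> C" "\<And>m :: nat. 1 \<le> m \<Longrightarrow> \<exists>\<kappa>. kernel_mass C (1 / sqrt (real m)) \<kappa> \<and>
    dominated (1 / sqrt (real m)) \<kappa> (trig_kernel (2 * m)) \<and>
    dominated (1 / sqrt (real m)) \<kappa> (\<lambda>h. (1 / sqrt (real m)) * norm (- trig_grad (2 * m) h))"
    using trig_kernel_family by blast
  show ?thesis
  proof (rule that)
    show "0 \<le> 2 * C ^ 9" using C by simp
    fix m :: nat and p q \<alpha> \<beta> f g u w
    assume m: "1 \<le> m" and f: "represents f u" and g: "represents g w"
      and curl: "\<And>i. distr_eq (w $ i) (curl u $ i)"
      and pq: "1 \<le> p" "1 \<le> q" "1 / p + 1 / q = (1 :: ennreal)" and s: "0 < \<beta>" "\<beta> < 1" "0 < \<alpha>" "\<alpha> < 1"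
      and fin: "field_norm \<beta> (2 * p) f < \<infinity>" "field_norm \<alpha> q g < \<infinity>"
    note F = represents_torus_field[OF f] and G = represents_torus_field[OF g]
    obtain \<kappa> where \<kappa>: "kernel_mass C (1 / sqrt (real m)) \<kappa>"
      "dominated (1 / sqrt (real m)) \<kappa> (trig_kernel (2 * m))"
      "dominated (1 / sqrt (real m)) \<kappa> (\<lambda>h. (1 / sqrt (real m)) * norm (- trig_grad (2 * m) h))"
      using C(2)[OF m] by blast
    interpret kernel C "1 / sqrt (real m)" \<kappa> using C m \<kappa> by unfold_locales auto
    have "helicity_flux m f g = (LINT x|torus. conv (trig_kernel (2 * m)) (\<lambda>y. cross3 (f y) (g y)) x \<bullet> conv (trig_kernel (2 * m)) g x)"
      unfolding helicity_flux_def
      by (rule integral_conv_inner[OF torus_field_cross3[OF F G pq fin] G, symmetric])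
    moreover have "(LINT h|centred_torus. - trig_grad (2 * m) h) = 0" by (simp add: integral_trig_grad)
    ultimately show "ennreal \<bar>helicity_flux m f g\<bar> \<le> ennreal (2 * C ^ 9 * (1 / sqrt (real m)) powr (2 * \<beta> + \<alpha> - 1)) *
      (field_norm \<beta> (2 * p) f * field_norm \<beta> (2 * p) f * field_norm \<alpha> q g)"
      using commutator_estimate[OF \<kappa>(2) integral_trig_kernel _ \<kappa>(3) _ F G pq s fin conv_curl[OF f g curl]]
      by simp
  qed
qed

section \<open>Measurability in time\<close>

lemma complete_measure_lebesgue_on:
  assumes "S \<in> sets lebesgue" shows "complete_measure (lebesgue_on S)"
proof
  fix A B assume "A \<subseteq> B" "B \<in> null_sets (lebesgue_on S)"
  then have "B \<subseteq> S" "B \<in> null_sets lebesgue"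
    using assms by (auto simp: null_sets_restrict_space)
  with \<open>A \<subseteq> B\<close> show "A \<in> sets (lebesgue_on S)"
    using assms completion.complete[of A B] by (auto simp: sets_restrict_space_iff)
qed

text \<open>Preimages that differ by a subset of a null set are both measurable in a complete
  measure. Equalities in time hold only almost everywhere, and they involve expressions in
  representatives chosen freely at each time; this makes such expressions measurable.\<close>

lemma (in complete_measure) measurable_AE_cong:
  assumes f: "f \<in> M \<rightarrow>\<^sub>M N" and "space N = UNIV" and eq: "AE x in M. f x = g x"
  shows "g \<in> M \<rightarrow>\<^sub>M N"
proof (rule measurableI)
  fix A assume "A \<in> sets N"
  then have "f -` A \<inter> space M \<in> sets M" using f by (rule measurable_sets[rotated])
  then show "g -` A \<inter> space M \<in> sets M"
  proof (rule in_sets_AE[rotated])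
    show "AE x in M. x \<in> f -` A \<inter> space M \<longleftrightarrow> x \<in> g -` A \<inter> space M"
      using eq by eventually_elim auto
  qed auto
qed (simp add: assms)

lemma time_interval_measurable: "{0<..<T} \<in> sets lebesgue" for T :: real
  by simp

lemmas time_AE_cong = complete_measure.measurable_AE_cong[OF complete_measure_lebesgue_on[OF time_interval_measurable]]

lemma time_measurable_limit:
  fixes f :: "nat \<Rightarrow> real \<Rightarrow> real"
  assumes f: "\<And>n. f n \<in> borel_measurable (lebesgue_on {0<..<T})"
    and lim: "AE t in lebesgue_on {0<..<T}. (\<lambda>n. f n t) \<longlonglongrightarrow> g t"
  shows "g \<in> borel_measurable (lebesgue_on {0<..<T})"
proof (rule time_AE_cong)
  show "(\<lambda>t. lim (\<lambda>n. f n t)) \<in> borel_measurable (lebesgue_on {0<..<T})"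
    using f by (rule borel_measurable_lim_metric)
  show "AE t in lebesgue_on {0<..<T}. lim (\<lambda>n. f n t) = g t"
    using lim by eventually_elim (rule limI)
qed simp

text \<open>The triangle inequality used in both directions squeezes N (s n t) between N (u t) minus
  and plus N (u t - s n t), which tends to 0. Hence the norm of u is the pointwise limit of norms of
  simple functions, taken as a \<open>liminf\<close> to have it measurable at all times.\<close>

lemma strongly_measurable_norm:
  assumes u: "strongly_measurable T N u"
    and tri: "\<And>v w. N v \<le> N w + N (v - w)" and sym: "\<And>v w. N (v - w) = N (w - v)"
  shows "(\<lambda>t. N (u t)) \<in> borel_measurable (lebesgue_on {0<..<T})"
proof -
  obtain s where s: "\<And>n. simple_function (lebesgue_on {0<..<T}) (s n)"
    and lim: "AE t in lebesgue_on {0<..<T}. (\<lambda>n. N (u t - s n t)) \<longlonglongrightarrow> 0"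
    using u unfolding strongly_measurable_def by blast
  have meas: "(\<lambda>t. N (s n t)) \<in> borel_measurable (lebesgue_on {0<..<T})" for n
    using simple_function_compose1[OF s, of N] by (intro borel_measurable_simple_function) (simp add: comp_def)
  show ?thesis
  proof (rule time_AE_cong)
    show "(\<lambda>t. liminf (\<lambda>n. N (s n t))) \<in> borel_measurable (lebesgue_on {0<..<T})"
      using meas by measurable
    show "AE t in lebesgue_on {0<..<T}. liminf (\<lambda>n. N (s n t)) = N (u t)"
      using lim
    proof eventually_elim
      case (elim t)
      have "(\<lambda>n. N (s n t)) \<longlonglongrightarrow> N (u t)"
      proof (rule tendsto_sandwich)
        have "N (u t) \<le> N (s n t) + N (u t - s n t)" for n
          by (rule tri)
        \<comment> \<open>Subtraction in \<open>ennreal\<close> moves across the inequality when the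
          subtrahend is finite.\<close>
        moreover have "eventually (\<lambda>n. N (u t - s n t) < top) sequentially"
          using order_tendstoD(2)[OF elim, of top] by simp
        ultimately show "eventually (\<lambda>n. N (u t) - N (u t - s n t) \<le> N (s n t)) sequentially"
          by (auto simp: ennreal_minus_le_iff add.commute elim!: eventually_mono)
        have "N (s n t) \<le> N (u t) + N (u t - s n t)" for n
          using tri[of "s n t" "u t"] sym[of "s n t" "u t"] by simp
        then show "eventually (\<lambda>n. N (s n t) \<le> N (u t) + N (u t - s n t)) sequentially" by simp
        have "(\<lambda>n. N (u t) - N (u t - s n t)) \<longlonglongrightarrow> N (u t) - 0"
          by (rule tendsto_diff_ennreal_general[OF tendsto_const elim]) simp
        then show "(\<lambda>n. N (u t) - N (u t - s n t)) \<longlonglongrightarrow> N (u t)" by simp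
        have "(\<lambda>n. N (u t) + N (u t - s n t)) \<longlonglongrightarrow> N (u t) + 0"
          by (intro tendsto_add tendsto_const elim)
        then show "(\<lambda>n. N (u t) + N (u t - s n t)) \<longlonglongrightarrow> N (u t)" by simp
      qed
      then show ?case by (simp add: lim_imp_Liminf)
    qed
  qed simp
qed

text \<open>A simple function takes finitely many values, so any functional of it is measurable; the
  bound by N carries this over to the limit.\<close>

lemma strongly_measurable_functional:
  assumes u: "strongly_measurable T N u" and c: "0 \<le> c"
    and bound: "\<And>v. ennreal \<bar>(v $ i) \<phi>\<bar> \<le> ennreal c * N v"
  shows "(\<lambda>t. (u t $ i) \<phi>) \<in> borel_measurable (lebesgue_on {0<..<T})"
proof -
  obtain s where s: "\<And>n. simple_function (lebesgue_on {0<..<T}) (s n)"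
    and lim: "AE t in lebesgue_on {0<..<T}. (\<lambda>n. N (u t - s n t)) \<longlonglongrightarrow> 0"
    using u unfolding strongly_measurable_def by blast
  have "(\<lambda>t. (s n t $ i) \<phi>) \<in> borel_measurable (lebesgue_on {0<..<T})" for n
    using simple_function_compose1[OF s, of "\<lambda>v. (v $ i) \<phi>"]
    by (intro borel_measurable_simple_function) (simp add: comp_def)
  then show ?thesis
  proof (rule time_measurable_limit)
    show "AE t in lebesgue_on {0<..<T}. (\<lambda>n. (s n t $ i) \<phi>) \<longlonglongrightarrow> (u t $ i) \<phi>"
      using lim
    proof eventually_elim
      case (elim t)
      have "(\<lambda>n. ennreal c * N (u t - s n t)) \<longlonglongrightarrow> ennreal c * 0"
        by (rule ennreal_tendsto_cmult[OF _ elim]) simp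
      then have upper: "(\<lambda>n. ennreal c * N (u t - s n t)) \<longlonglongrightarrow> 0" by simp
      have "(\<lambda>n. ennreal \<bar>((u t - s n t) $ i) \<phi>\<bar>) \<longlonglongrightarrow> 0"
        by (rule tendsto_sandwich[OF always_eventually always_eventually tendsto_const upper])
          (intro allI bound zero_le)+
      then have "(\<lambda>n. ennreal \<bar>((u t - s n t) $ i) \<phi>\<bar>) \<longlonglongrightarrow> ennreal 0"
        by (simp only: ennreal_0)
      then have "(\<lambda>n. \<bar>((u t - s n t) $ i) \<phi>\<bar>) \<longlonglongrightarrow> 0"
        by (rule tendsto_ennreal_iff[THEN iffD1, rotated 2]) simp_all
      then have "(\<lambda>n. (u t $ i) \<phi> - (s n t $ i) \<phi>) \<longlonglongrightarrow> 0"
        by (simp add: tendsto_rabs_zero_iff)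
      from tendsto_diff[OF tendsto_const[of "(u t $ i) \<phi>"] this] show ?case by simp
    qed
  qed
qed

section \<open>The fractional Sobolev norm as an infimum over representatives\<close>

lemma gagliardo_integrand_measurable:
  fixes f :: "real ^ 3 \<Rightarrow> real ^ 3"
  assumes [measurable]: "f \<in> borel_measurable borel"
  shows "(\<lambda>(h, x). ennreal (norm (f (x + h) - f x) / norm h powr b)) \<in> borel_measurable (centred_torus \<Otimes>\<^sub>M torus)"
proof -
  have fst': "fst \<in> centred_torus \<Otimes>\<^sub>M torus \<rightarrow>\<^sub>M borel" and snd': "snd \<in> centred_torus \<Otimes>\<^sub>M torus \<rightarrow>\<^sub>M borel"
    using measurable_compose[OF measurable_fst borel_measurable_centred_torus[OF measurable_ident]]
      measurable_compose[OF measurable_snd borel_measurable_torus[OF measurable_ident]] by simp_all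
  have "(\<lambda>(h, x). ennreal (norm (f (x + h) - f x) / norm h powr b)) \<in> borel_measurable (borel \<Otimes>\<^sub>M borel)"
    by measurable
  from measurable_compose[OF measurable_Pair[OF fst' snd'] this] show ?thesis by simp
qed

lemma field_norm_triangle:
  assumes f [measurable]: "f \<in> borel_measurable borel" and g [measurable]: "g \<in> borel_measurable borel" and p: "1 \<le> p"
  shows "field_norm s p (\<lambda>x. f x + g x) \<le> field_norm s p f + field_norm s p g"
proof -
  let ?G = "\<lambda>f (h, x). ennreal (norm (f (x + h) - f x) / norm h powr (s + enn2real (3 / p)))"
  have fg: "(\<lambda>x. f x + g x) \<in> borel_measurable borel" by measurable
  have "Lp_norm p torus (\<lambda>x. ennreal (norm (f x + g x))) \<le> Lp_norm p torus (\<lambda>x. ennreal (norm (f x)) + ennreal (norm (g x)))"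
    by (intro Lp_norm_mono_AE p AE_I2) (auto simp: norm_triangle_ineq simp flip: ennreal_plus intro!: ennreal_leI)
  also have "\<dots> \<le> Lp_norm p torus (\<lambda>x. ennreal (norm (f x))) + Lp_norm p torus (\<lambda>x. ennreal (norm (g x)))"
    by (intro Minkowski p) auto
  finally have 1: "Lp_norm p torus (\<lambda>x. ennreal (norm (f x + g x))) \<le> \<dots>" .
  have "?G (\<lambda>x. f x + g x) z \<le> ?G f z + ?G g z" for z
  proof -
    obtain h x where z: "z = (h, x)" by (cases z)
    have "norm ((f (x + h) + g (x + h)) - (f x + g x)) \<le> norm (f (x + h) - f x) + norm (g (x + h) - g x)"
      using norm_triangle_ineq[of "f (x + h) - f x" "g (x + h) - g x"] by (simp add: algebra_simps)
    then show ?thesis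
      unfolding z by (auto simp: divide_right_mono simp flip: ennreal_plus add_divide_distrib intro!: ennreal_leI)
  qed
  then have "gagliardo s p (\<lambda>x. f x + g x) \<le> Lp_norm p (centred_torus \<Otimes>\<^sub>M torus) (\<lambda>z. ?G f z + ?G g z)"
    unfolding gagliardo_def
    by (intro Lp_norm_mono_AE p AE_I2 gagliardo_integrand_measurable[OF fg]) auto
  also have "\<dots> \<le> gagliardo s p f + gagliardo s p g"
    unfolding gagliardo_def by (intro Minkowski p gagliardo_integrand_measurable f g)
  finally have 2: "gagliardo s p (\<lambda>x. f x + g x) \<le> gagliardo s p f + gagliardo s p g" .
  show ?thesis unfolding field_norm_def using add_mono[OF 1 2] by (simp only: ac_simps)
qed

lemma W_norm_eq: "W_norm s p u = (INF f\<in>{f. represents f u}. field_norm s p f)"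
  by (simp add: W_norm_def field_norm_def)

lemma W_norm_representative:
  assumes "W_norm s p u < \<infinity>" "0 < e"
  obtains f where "represents f u" "field_norm s p f \<le> W_norm s p u + ennreal e"
proof -
  have "W_norm s p u < W_norm s p u + ennreal e"
    using assms by (cases "W_norm s p u") (auto simp: ennreal_less_iff simp flip: ennreal_plus)
  then have "\<exists>f\<in>{f. represents f u}. field_norm s p f < W_norm s p u + ennreal e"
    unfolding W_norm_eq[of s p u] INF_less_iff .
  then show ?thesis using that less_imp_le by blast
qed

text \<open>Near-optimal representatives of v and of u - v add up to a representative of u; each of
  them may exceed its infimum by e / 2.\<close>

lemma W_norm_triangle:
  assumes p: "1 \<le> p" shows "W_norm s p u \<le> W_norm s p v + W_norm s p (u - v)"
proof (rule ennreal_le_epsilon)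
  fix e :: real assume fin: "W_norm s p v + W_norm s p (u - v) < top" and e: "0 < e"
  obtain f where f: "represents f v" "field_norm s p f \<le> W_norm s p v + ennreal (e / 2)"
    using W_norm_representative[of s p v "e / 2"] fin e by (auto simp: less_top[symmetric])
  obtain g where g: "represents g (u - v)" "field_norm s p g \<le> W_norm s p (u - v) + ennreal (e / 2)"
    using W_norm_representative[of s p "u - v" "e / 2"] fin e by (auto simp: less_top[symmetric])
  note F = represents_torus_field[OF f(1)] and G = represents_torus_field[OF g(1)]
  have int: "integrable torus (\<lambda>x. e x $ i * \<phi> x)" if e: "torus_field e" and \<phi>: "test_fun \<phi>" for e :: "real ^ 3 \<Rightarrow> real ^ 3" and \<phi> i
  proof -
    obtain B where B: "\<And>x. \<bar>\<phi> x\<bar> \<le> B" using test_fun_bounded[OF \<phi>] by blast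
    show ?thesis by (rule integrable_component_mult(1)[OF e test_fun_measurable[OF \<phi>] B])
  qed
  have "(u $ i) \<phi> = (LINT x|torus. (f x + g x) $ i * \<phi> x)" if \<phi>: "test_fun \<phi>" for i \<phi>
  proof -
    have "(u $ i) \<phi> = (v $ i) \<phi> + ((u - v) $ i) \<phi>" by simp
    also have "\<dots> = (LINT x|torus. f x $ i * \<phi> x + g x $ i * \<phi> x)"
      unfolding represents_eq[OF f(1) \<phi>] represents_eq[OF g(1) \<phi>]
      using int[OF F \<phi>] int[OF G \<phi>] by simp
    finally show ?thesis by (simp add: distrib_right)
  qed
  then have "represents (\<lambda>x. f x + g x) u"
    using F G unfolding represents_def torus_field_def by (auto simp: periodic_def)
  then have "W_norm s p u \<le> field_norm s p (\<lambda>x. f x + g x)"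
    unfolding W_norm_eq by (intro INF_lower) simp
  also have "\<dots> \<le> field_norm s p f + field_norm s p g"
    by (intro field_norm_triangle p torus_fieldD(1)[OF F] torus_fieldD(1)[OF G])
  also have "\<dots> \<le> (W_norm s p v + ennreal (e / 2)) + (W_norm s p (u - v) + ennreal (e / 2))"
    by (intro add_mono f g)
  also have "\<dots> = W_norm s p v + W_norm s p (u - v) + (ennreal (e / 2) + ennreal (e / 2))"
    by (simp only: ac_simps)
  also have "ennreal (e / 2) + ennreal (e / 2) = ennreal e"
    using e by (simp flip: ennreal_plus)
  finally show "W_norm s p u \<le> W_norm s p v + W_norm s p (u - v) + ennreal e" .
qed

lemma W_norm_minus_commute: "W_norm s p (u - v) = W_norm s p (v - u)"
proof -
  have neg: "field_norm s p (\<lambda>x. - f x) = field_norm s p f" for f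
    by (simp add: field_norm_def gagliardo_def norm_minus_commute)
  have rep: "represents (\<lambda>x. - f x) (v - u)" if f: "represents f (u - v)" for f u v
  proof -
    have "((v - u) $ i) \<phi> = (LINT x|torus. (- f x) $ i * \<phi> x)" if \<phi>: "test_fun \<phi>" for i \<phi>
    proof -
      have "((v - u) $ i) \<phi> = - ((u - v) $ i) \<phi>" by simp
      also have "\<dots> = (LINT x|torus. (- f x) $ i * \<phi> x)"
        unfolding represents_eq[OF f \<phi>] by simp
      finally show ?thesis .
    qed
    then show ?thesis using f unfolding represents_def by (auto simp: periodic_def)
  qed
  have le: "W_norm s p (v - u) \<le> W_norm s p (u - v)" for u v
    unfolding W_norm_eq[of s p "u - v"]
  proof (rule INF_greatest)
    fix f assume "f \<in> {f. represents f (u - v)}"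
    then have "(\<lambda>x. - f x) \<in> {f. represents f (v - u)}" using rep by simp
    then have "W_norm s p (v - u) \<le> field_norm s p (\<lambda>x. - f x)"
      unfolding W_norm_eq by (rule INF_lower)
    then show "W_norm s p (v - u) \<le> field_norm s p f" by (simp only: neg)
  qed
  show ?thesis by (intro antisym le)
qed

lemma field_norm_L1_bound:
  assumes pq: "1 \<le> p" "1 \<le> q" "1 / p + 1 / q = 1"
  obtains c :: real where "0 < c"
    "\<And>s f. f \<in> borel_measurable borel \<Longrightarrow> (\<integral>\<^sup>+x. ennreal (norm (f x)) \<partial>torus) \<le> ennreal c * field_norm s (2 * p) f"
    "\<And>s f. f \<in> borel_measurable borel \<Longrightarrow> (\<integral>\<^sup>+x. ennreal (norm (f x)) \<partial>torus) \<le> ennreal c * field_norm s q f"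
    "\<And>s s' f g. f \<in> borel_measurable borel \<Longrightarrow> g \<in> borel_measurable borel \<Longrightarrow>
      (\<integral>\<^sup>+x. ennreal (norm (f x) * norm (g x)) \<partial>torus) \<le> ennreal c * (field_norm s (2 * p) f * field_norm s' q g)"
proof -
  let ?a = "Lp_norm (2 * p) torus (\<lambda>x. ennreal 1)" and ?b = "Lp_norm q torus (\<lambda>x. ennreal 1)"
  have "?a < \<infinity>" "?b < \<infinity>"
    by (intro Lp_norm_const_finite torus.finite_measure_axioms one_le_double pq)+
  then obtain a b where ab: "?a = ennreal a" "0 \<le> a" "?b = ennreal b" "0 \<le> b"
    by (metis ennreal_cases infinity_ennreal_def less_irrefl)
  \<comment> \<open>The summands are the constants of the three instances; the leading 1 keeps the
    sum positive.\<close>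
  define c where "c = 1 + a + a * a + a * b"
  have c: "a \<le> c" "a * a \<le> c" "a * b \<le> c" "0 < c" using ab by (auto simp: c_def add_nonneg_pos add_pos_nonneg)
  show ?thesis
  proof (rule that[OF c(4)])
    fix s and f :: "real ^ 3 \<Rightarrow> real ^ 3" assume [measurable]: "f \<in> borel_measurable borel"
    have "(\<integral>\<^sup>+x. ennreal (norm (f x)) \<partial>torus) = (\<integral>\<^sup>+x. ennreal (norm (f x)) * ennreal 1 * ennreal 1 \<partial>torus)" by simp
    also have "\<dots> \<le> Lp_norm (2 * p) torus (\<lambda>x. ennreal (norm (f x))) * ?a * ?b"
      by (rule Hoelder_three[OF _ _ _ pq]) auto
    also have "\<dots> \<le> field_norm s (2 * p) f * ?a * ?b"
      by (intro mult_right_mono Lp_norm_le_field_norm) auto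
    also have "\<dots> = ennreal (a * b) * field_norm s (2 * p) f"
      using ab by (simp add: ennreal_mult mult_ac)
    also have "\<dots> \<le> ennreal c * field_norm s (2 * p) f"
      by (intro mult_right_mono ennreal_leI c) auto
    finally show "(\<integral>\<^sup>+x. ennreal (norm (f x)) \<partial>torus) \<le> ennreal c * field_norm s (2 * p) f" .
  next
    fix s and f :: "real ^ 3 \<Rightarrow> real ^ 3" assume [measurable]: "f \<in> borel_measurable borel"
    have "(\<integral>\<^sup>+x. ennreal (norm (f x)) \<partial>torus) = (\<integral>\<^sup>+x. ennreal 1 * ennreal 1 * ennreal (norm (f x)) \<partial>torus)" by simp
    also have "\<dots> \<le> ?a * ?a * Lp_norm q torus (\<lambda>x. ennreal (norm (f x)))"
      by (rule Hoelder_three[OF _ _ _ pq]) auto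
    also have "\<dots> \<le> ?a * ?a * field_norm s q f"
      by (intro mult_left_mono Lp_norm_le_field_norm) auto
    also have "\<dots> = ennreal (a * a) * field_norm s q f"
      using ab by (simp add: ennreal_mult mult_ac)
    also have "\<dots> \<le> ennreal c * field_norm s q f"
      by (intro mult_right_mono ennreal_leI c) auto
    finally show "(\<integral>\<^sup>+x. ennreal (norm (f x)) \<partial>torus) \<le> ennreal c * field_norm s q f" .
  next
    fix s s' and f g :: "real ^ 3 \<Rightarrow> real ^ 3" assume m: "f \<in> borel_measurable borel" "g \<in> borel_measurable borel"
    have "(\<integral>\<^sup>+x. ennreal (norm (f x) * norm (g x)) \<partial>torus) \<le> field_norm s (2 * p) f * ?a * field_norm s' q g"
      by (rule nn_integral_product_le[OF m pq])
    also have "\<dots> = ennreal a * (field_norm s (2 * p) f * field_norm s' q g)"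
      unfolding ab by (simp only: mult_ac)
    also have "\<dots> \<le> ennreal c * (field_norm s (2 * p) f * field_norm s' q g)"
      by (intro mult_right_mono ennreal_leI c) auto
    finally show "(\<integral>\<^sup>+x. ennreal (norm (f x) * norm (g x)) \<partial>torus) \<le> ennreal c * (field_norm s (2 * p) f * field_norm s' q g)" .
  qed
qed

text \<open>If no function represents v, the infimum is \<infinity> and the claim is trivial, as
  long as the constant in front is positive: 0 * \<infinity> would be 0. This is why 1 + B stands
  there, since B may be 0.\<close>

lemma W_norm_functional_bound:
  assumes c: "0 < c" and L1: "\<And>f. f \<in> borel_measurable borel \<Longrightarrow> (\<integral>\<^sup>+x. ennreal (norm (f x)) \<partial>torus) \<le> ennreal c * field_norm s p f"
    and \<phi>: "test_fun \<phi>" and B: "\<And>x. \<bar>\<phi> x\<bar> \<le> B"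
  shows "ennreal \<bar>(v $ i) \<phi>\<bar> \<le> ennreal (c * (1 + B)) * W_norm s p v"
proof -
  have B0: "0 \<le> B" using B[of 0] by linarith
  define d where "d = c * (1 + B)"
  have d: "0 < d" using c B0 by (simp add: d_def)
  \<comment> \<open>Dividing by d first leaves a bare infimum over representatives on the
    right.\<close>
  have "ennreal (1 / d) * ennreal \<bar>(v $ i) \<phi>\<bar> \<le> W_norm s p v"
    unfolding W_norm_eq
  proof (rule INF_greatest)
    fix f assume "f \<in> {f. represents f v}"
    then have f: "represents f v" by simp
    note F = represents_torus_field[OF f]
    note [measurable] = torus_fieldD(1)[OF F] test_fun_measurable[OF \<phi>]
    have "ennreal \<bar>(v $ i) \<phi>\<bar> \<le> (\<integral>\<^sup>+x. norm (f x $ i * \<phi> x) \<partial>torus)"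
      unfolding represents_eq[OF f \<phi>]
      using integral_norm_bound_ennreal[OF integrable_component_mult(1)[OF F test_fun_measurable[OF \<phi>] B], of i] by simp
    also have "\<dots> \<le> (\<integral>\<^sup>+x. ennreal (1 + B) * ennreal (norm (f x)) \<partial>torus)"
    proof (rule nn_integral_mono)
      fix x
      have "norm (f x $ i * \<phi> x) \<le> norm (f x) * (1 + B)"
        unfolding norm_mult using B[of x] by (intro mult_mono) (auto simp: component_le_norm_cart)
      then have "ennreal (norm (f x $ i * \<phi> x)) \<le> ennreal ((1 + B) * norm (f x))"
        by (simp only: mult.commute[of "norm (f x)"] ennreal_leI)
      also have "\<dots> = ennreal (1 + B) * ennreal (norm (f x))"
        using B0 by (intro ennreal_mult) auto
      finally show "ennreal (norm (f x $ i * \<phi> x)) \<le> ennreal (1 + B) * ennreal (norm (f x))" .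
    qed
    also have "\<dots> = ennreal (1 + B) * (\<integral>\<^sup>+x. ennreal (norm (f x)) \<partial>torus)"
      by (rule nn_integral_cmult) measurable
    also have "\<dots> \<le> ennreal (1 + B) * (ennreal c * field_norm s p f)"
      by (intro mult_left_mono L1 torus_fieldD(1)[OF F]) simp
    also have "\<dots> = ennreal d * field_norm s p f"
      using c B0 by (simp add: d_def ennreal_mult mult_ac)
    finally have "ennreal (1 / d) * ennreal \<bar>(v $ i) \<phi>\<bar> \<le> ennreal (1 / d) * (ennreal d * field_norm s p f)"
      by (rule mult_left_mono) simp
    also have "\<dots> = field_norm s p f"
      using d by (simp flip: mult.assoc ennreal_mult)
    finally show "ennreal (1 / d) * ennreal \<bar>(v $ i) \<phi>\<bar> \<le> field_norm s p f" .
  qed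
  then have "ennreal d * (ennreal (1 / d) * ennreal \<bar>(v $ i) \<phi>\<bar>) \<le> ennreal d * W_norm s p v"
    by (rule mult_left_mono) simp
  moreover have "ennreal d * (ennreal (1 / d) * ennreal \<bar>(v $ i) \<phi>\<bar>) = ennreal \<bar>(v $ i) \<phi>\<bar>"
    using d by (simp flip: mult.assoc ennreal_mult)
  ultimately show ?thesis by (simp add: d_def)
qed

section \<open>Weak derivatives in time\<close>

abbreviation time :: "real \<Rightarrow> real measure" where
  "time T \<equiv> lebesgue_on {0<..<T}"

definition primitive :: "real \<Rightarrow> (real \<Rightarrow> 'b::{banach, second_countable_topology}) \<Rightarrow> real \<Rightarrow> 'b" where
  "primitive T g t = (LINT s|time T. indicator {..<t} s *\<^sub>R g s)"

lemma finite_measure_time: "finite_measure (time T)"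
  by (intro finite_measure_lebesgue_on lmeasurable_interval)

lemma time_borel [measurable]: "(\<lambda>t. t) \<in> time T \<rightarrow>\<^sub>M borel"
  by (intro measurable_restrict_space1 measurable_completion) simp

lemma integrable_time_indicator:
  fixes g :: "real \<Rightarrow> 'b::{banach, second_countable_topology}"
  assumes "integrable (time T) g" "A \<in> sets borel"
  shows "integrable (time T) (\<lambda>s. indicator A s *\<^sub>R g s)"
proof -
  have "A \<inter> space (time T) \<in> sets (time T)"
    using measurable_sets[OF time_borel assms(2), of T] by simp
  then have "integrable (time T) (\<lambda>s. indicator (A \<inter> space (time T)) s *\<^sub>R g s)"
    using assms(1) by (rule integrable_mult_indicator)
  moreover have "integrable (time T) (\<lambda>s. indicator (A \<inter> space (time T)) s *\<^sub>R g s) \<longleftrightarrow>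
      integrable (time T) (\<lambda>s. indicator A s *\<^sub>R g s)"
    by (intro Bochner_Integration.integrable_cong) (auto simp: indicator_def)
  ultimately show ?thesis by simp
qed

lemma primitive_bounded_linear:
  assumes "bounded_linear L" "integrable (time T) g"
  shows "primitive T (\<lambda>s. L (g s)) t = L (primitive T g t)"
  unfolding primitive_def
  using integral_bounded_linear[OF assms(1) integrable_time_indicator[OF assms(2), of "{..<t}"]]
    bounded_linear.linear[OF assms(1)]
  by (simp add: linear_scale)

lemma primitive_norm_le:
  assumes "integrable (time T) g"
  shows "norm (primitive T g t) \<le> (LINT s|time T. norm (g s))"
proof -
  have "norm (primitive T g t) \<le> (LINT s|time T. norm (indicator {..<t} s *\<^sub>R g s))"
    unfolding primitive_def by (rule integral_norm_bound)
  also have "\<dots> \<le> (LINT s|time T. norm (g s))"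
    using assms integrable_time_indicator[OF assms, of "{..<t}"]
    by (intro integral_mono integrable_norm) (auto simp: indicator_def)
  finally show ?thesis .
qed

lemma order_indicator_measurable: "(\<lambda>z. indicator {..<fst z} (snd z) :: real) \<in> borel_measurable (time T \<Otimes>\<^sub>M time T)"
proof -
  have [measurable]: "fst \<in> time T \<Otimes>\<^sub>M time T \<rightarrow>\<^sub>M borel" "snd \<in> time T \<Otimes>\<^sub>M time T \<rightarrow>\<^sub>M borel"
    using measurable_compose[OF measurable_fst time_borel] measurable_compose[OF measurable_snd time_borel] by simp_all
  have "(\<lambda>z. if snd z < fst z then 1 else 0 :: real) \<in> borel_measurable (time T \<Otimes>\<^sub>M time T)" by measurable
  then show ?thesis by (simp add: indicator_def lessThan_def)
qed

lemma primitive_measurable: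
  fixes g :: "real \<Rightarrow> 'b::{banach, second_countable_topology}"
  assumes g: "integrable (time T) g"
  shows "primitive T g \<in> borel_measurable (time T)"
proof -
  interpret finite_measure "time T" by (rule finite_measure_time)
  have "(\<lambda>z. indicator {..<fst z} (snd z) *\<^sub>R g (snd z)) \<in> borel_measurable (time T \<Otimes>\<^sub>M time T)"
    using g by (intro borel_measurable_scaleR order_indicator_measurable measurable_compose[OF measurable_snd]) auto
  then show ?thesis
    unfolding primitive_def[abs_def] by (intro borel_measurable_lebesgue_integral) (simp add: case_prod_beta)
qed

lemma integrable_mult_primitive:
  fixes f g :: "real \<Rightarrow> real"
  assumes f: "integrable (time T) f" and g: "integrable (time T) g"
  shows "integrable (time T) (\<lambda>t. f t * primitive T g t)"
proof (rule Bochner_Integration.integrable_bound)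
  show "integrable (time T) (\<lambda>t. f t * (LINT s|time T. norm (g s)))" using f by simp
  have "norm (f t * primitive T g t) \<le> norm (f t * (LINT s|time T. norm (g s)))" for t
    unfolding norm_mult using primitive_norm_le[OF g, of t] by (intro mult_left_mono) (auto intro: order_trans)
  then show "AE t in time T. norm (f t * primitive T g t) \<le> norm (f t * (LINT s|time T. norm (g s)))" by simp
qed (use f primitive_measurable[OF g] in \<open>auto intro: borel_measurable_times\<close>)

lemma primitive_Fubini:
  fixes f g :: "real \<Rightarrow> real"
  assumes f: "integrable (time T) f" and g: "integrable (time T) g"
  shows "(LINT t|time T. f t * primitive T g t) = (LINT s|time T. g s * (LINT t|time T. indicator {s<..} t * f t))"
proof -
  interpret finite_measure "time T" by (rule finite_measure_time)
  interpret P: pair_sigma_finite "time T" "time T" ..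
  have prod: "integrable (time T \<Otimes>\<^sub>M time T) (\<lambda>z. f (fst z) * g (snd z))"
  proof (rule P.Fubini_integrable)
    show "(\<lambda>z. f (fst z) * g (snd z)) \<in> borel_measurable (time T \<Otimes>\<^sub>M time T)"
      using f g by (intro borel_measurable_times measurable_compose[OF measurable_fst] measurable_compose[OF measurable_snd]) auto
    show "integrable (time T) (\<lambda>x. LINT y|time T. norm (f (fst (x, y)) * g (snd (x, y))))"
      using f by (simp add: abs_mult)
  qed (use g in simp)
  have "integrable (time T \<Otimes>\<^sub>M time T) (\<lambda>z. indicator {..<fst z} (snd z) * (f (fst z) * g (snd z)))"
    by (rule Bochner_Integration.integrable_bound[OF prod])
      (auto intro!: borel_measurable_times order_indicator_measurable borel_measurable_integrable[OF prod] AE_I2 simp: indicator_def)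
  then have "(LINT s|time T. LINT t|time T. indicator {..<t} s * (f t * g s)) =
      (LINT t|time T. LINT s|time T. indicator {..<t} s * (f t * g s))"
    by (intro P.Fubini_integral) (simp add: case_prod_unfold)
  moreover have "f t * primitive T g t = (LINT s|time T. indicator {..<t} s * (f t * g s))" for t
    unfolding primitive_def by (subst integral_mult_right_zero[symmetric]) (simp add: mult.left_commute)
  moreover have "g s * (LINT t|time T. indicator {s<..} t * f t) = (LINT t|time T. indicator {..<t} s * (f t * g s))" for s
    by (subst integral_mult_right_zero[symmetric], intro Bochner_Integration.integral_cong refl)
      (auto simp: indicator_def)
  ultimately show ?thesis by simp
qed

lemma AE_time_neq: "AE s in time T. s \<noteq> t"
proof -
  have "AE s in lebesgue. s \<noteq> t"
    by (rule AE_completion) (rule AE_lborel_singleton)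
  then show ?thesis by (auto simp: AE_restrict_space_iff elim!: eventually_mono)
qed

text \<open>The product rule for absolutely continuous functions. The product of two integrals up to
  t is an integral over a square, which the diagonal divides into two triangles; each triangle is an
  iterated integral by Fubini, and the diagonal is a null set.\<close>

lemma primitive_mult:
  fixes f g :: "real \<Rightarrow> real"
  assumes f: "integrable (time T) f" and g: "integrable (time T) g"
  shows "primitive T f t * primitive T g t = primitive T (\<lambda>s. f s * primitive T g s + g s * primitive T f s) t"
proof -
  define f1 where "f1 = (\<lambda>s. indicator {..<t} s * f s)"
  define g1 where "g1 = (\<lambda>s. indicator {..<t} s * g s)"
  have f1: "integrable (time T) f1" and g1: "integrable (time T) g1"
    using integrable_time_indicator[OF f, of "{..<t}"] integrable_time_indicator[OF g, of "{..<t}"]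
    by (simp_all add: f1_def g1_def)
  have below: "primitive T g1 s = primitive T g s" "primitive T f1 s = primitive T f s" if "s < t" for s
    unfolding primitive_def g1_def f1_def using that
    by (intro Bochner_Integration.integral_cong refl; auto simp: indicator_def)+
  have split: "(LINT b|time T. g1 b) = primitive T g1 a + (LINT b|time T. indicator {a<..} b * g1 b)" for a
  proof -
    have "(LINT b|time T. g1 b) = (LINT b|time T. indicator {..<a} b *\<^sub>R g1 b + indicator {a<..} b *\<^sub>R g1 b)"
    proof (rule integral_cong_AE)
      show "AE b in time T. g1 b = indicator {..<a} b *\<^sub>R g1 b + indicator {a<..} b *\<^sub>R g1 b"
        using AE_time_neq[where T = T and t = a] by eventually_elim (auto simp: indicator_def)
    qed (use g1 integrable_time_indicator[OF g1, of "{..<a}"] integrable_time_indicator[OF g1, of "{a<..}"] in auto)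
    then show ?thesis
      using integrable_time_indicator[OF g1, of "{..<a}"] integrable_time_indicator[OF g1, of "{a<..}"]
      by (simp add: primitive_def)
  qed
  have "primitive T f t * primitive T g t = (LINT a|time T. f1 a) * (LINT b|time T. g1 b)"
    by (simp add: primitive_def f1_def g1_def)
  also have "\<dots> = (LINT a|time T. f1 a * (LINT b|time T. g1 b))"
    by simp
  also have "\<dots> = (LINT a|time T. f1 a * primitive T g1 a + f1 a * (LINT b|time T. indicator {a<..} b * g1 b))"
    by (intro Bochner_Integration.integral_cong refl, subst split) (rule distrib_left)
  also have "\<dots> = (LINT a|time T. f1 a * primitive T g1 a) + (LINT a|time T. f1 a * (LINT b|time T. indicator {a<..} b * g1 b))"
  proof (rule Bochner_Integration.integral_add[OF integrable_mult_primitive[OF f1 g1]])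
    have "integrable (time T) (\<lambda>a. f1 a * (LINT b|time T. g1 b) - f1 a * primitive T g1 a)"
      using f1 integrable_mult_primitive[OF f1 g1] by (intro Bochner_Integration.integrable_diff) auto
    moreover have "f1 a * (LINT b|time T. g1 b) - f1 a * primitive T g1 a = f1 a * (LINT b|time T. indicator {a<..} b * g1 b)" for a
      by (subst split[of a]) (simp add: distrib_left)
    ultimately show "integrable (time T) (\<lambda>a. f1 a * (LINT b|time T. indicator {a<..} b * g1 b))" by simp
  qed
  also have "(LINT a|time T. f1 a * (LINT b|time T. indicator {a<..} b * g1 b)) = (LINT b|time T. g1 b * primitive T f1 b)"
    by (rule primitive_Fubini[OF g1 f1, symmetric])
  also have "(LINT a|time T. f1 a * primitive T g1 a) + (LINT b|time T. g1 b * primitive T f1 b) =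
      (LINT s|time T. f1 s * primitive T g1 s + g1 s * primitive T f1 s)"
    by (rule Bochner_Integration.integral_add[symmetric]) (intro integrable_mult_primitive f1 g1)+
  also have "\<dots> = primitive T (\<lambda>s. f s * primitive T g s + g s * primitive T f s) t"
    unfolding primitive_def[of T "\<lambda>s. f s * primitive T g s + g s * primitive T f s"]
  proof (intro Bochner_Integration.integral_cong refl)
    fix s
    have "f1 s = (if s < t then f s else 0)" "g1 s = (if s < t then g s else 0)"
      by (simp_all add: f1_def g1_def)
    then show "f1 s * primitive T g1 s + g1 s * primitive T f1 s =
        indicator {..<t} s *\<^sub>R (f s * primitive T g s + g s * primitive T f s)"
      by (cases "s < t") (simp_all add: below)
  qed
  finally show ?thesis .
qed

section \<open>Vanishing weak derivatives\<close>

text \<open>The positive and the negative part of e define finite measures that agree on the rays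
  (x, \<infinity>), hence on all Borel sets. Comparing them on the set where e is positive kills the
  positive part, and then the negative part vanishes as well.\<close>

lemma AE_time_zero:
  fixes e :: "real \<Rightarrow> real"
  assumes e: "integrable (time T) e"
    and zero: "\<And>x. 0 \<le> x \<Longrightarrow> x < T \<Longrightarrow> (LINT t|time T. indicator {x<..} t * e t) = 0"
  shows "AE t in time T. e t = 0"
proof -
  have [measurable]: "e \<in> borel_measurable (time T)" using e by auto
  have zero': "(LINT t|time T. indicator {x<..} t * e t) = 0" for x
  proof -
    consider "0 \<le> x" "x < T" | "T \<le> x" | "x < 0" "0 < T" | "x < 0" "T \<le> 0" by linarith
    then show ?thesis
    proof cases
      case 2
      then have "(LINT t|time T. indicator {x<..} t * e t) = (LINT t|time T. 0)"
        by (intro Bochner_Integration.integral_cong) (auto simp: indicator_def)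
      then show ?thesis by simp
    next
      case 3
      then have "(LINT t|time T. indicator {x<..} t * e t) = (LINT t|time T. indicator {0<..} t * e t)"
        by (intro Bochner_Integration.integral_cong) (auto simp: indicator_def)
      then show ?thesis using zero[of 0] 3 by simp
    next
      case 4
      then have "(LINT t|time T. indicator {x<..} t * e t) = (LINT t|time T. 0)"
        by (intro Bochner_Integration.integral_cong) auto
      then show ?thesis by simp
    qed (use zero in simp)
  qed
  \<comment> \<open>Coercion to \<open>ennreal\<close> truncates negative values at 0, so
    \<open>M e\<close> and \<open>M (\<lambda>t. - e t)\<close> have as densities the positive and
    the negative part of \<open>e\<close>.\<close>
  define M where "M f = distr (density (time T) (\<lambda>t. ennreal (f t))) borel (\<lambda>t. t)" for f :: "real \<Rightarrow> real"
  have emeasure_M: "emeasure (M f) A = (\<integral>\<^sup>+t. ennreal (indicator A t * f t) \<partial>time T)"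
    if [measurable]: "A \<in> sets borel" "f \<in> borel_measurable (time T)" for f A
  proof -
    have "A \<inter> space (time T) \<in> sets (time T)"
      using measurable_sets[OF time_borel that(1), of T] by simp
    then have "emeasure (M f) A = (\<integral>\<^sup>+t. ennreal (f t) * indicator (A \<inter> space (time T)) t \<partial>time T)"
      unfolding M_def using that time_borel[of T]
      by (subst emeasure_distr) (auto simp: emeasure_density measurable_cong_sets[OF sets_density refl])
    also have "\<dots> = (\<integral>\<^sup>+t. ennreal (indicator A t * f t) \<partial>time T)"
      by (intro nn_integral_cong) (auto simp: indicator_def)
    finally show ?thesis .
  qed
  have fin: "(\<integral>\<^sup>+t. ennreal (indicator A t * f t) \<partial>time T) < \<infinity>" if "A \<in> sets borel" "integrable (time T) f" for f :: "real \<Rightarrow> real" and A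
    using integrable_time_indicator[OF that(2,1)] integrableD(2)[of "time T" "\<lambda>t. indicator A t * f t"]
    by (auto simp: real_integrable_def less_top)
  have "M e = M (\<lambda>t. - e t)"
  proof (rule measure_eqI_lessThan)
    fix x
    show "emeasure (M e) {x<..} < \<infinity>" using e fin[of "{x<..}" e] by (simp add: emeasure_M)
    have int: "integrable (time T) (\<lambda>t. indicator {x<..} t * e t)"
      using integrable_time_indicator[OF e, of "{x<..}"] by simp
    have *: "enn2real (\<integral>\<^sup>+t. ennreal (indicator {x<..} t * e t) \<partial>time T)
        = enn2real (\<integral>\<^sup>+t. ennreal (indicator {x<..} t * - e t) \<partial>time T)"
      using real_lebesgue_integral_def[OF int] zero'[of x] by simp
    have "a = b" if "a < \<infinity>" "b < \<infinity>" "enn2real a = enn2real b" for a b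
      using that by (cases a; cases b) auto
    from this[OF _ _ *] show "emeasure (M e) {x<..} = emeasure (M (\<lambda>t. - e t)) {x<..}"
      using fin[of "{x<..}" e] fin[of "{x<..}" "\<lambda>t. - e t"] e by (simp add: emeasure_M)
  qed (simp_all add: M_def)
  then have eq: "(\<integral>\<^sup>+t. ennreal (indicator A t * e t) \<partial>time T) = (\<integral>\<^sup>+t. ennreal (indicator A t * - e t) \<partial>time T)"
    if "A \<in> sets borel" for A
    using emeasure_M[OF that, of e] emeasure_M[OF that, of "\<lambda>t. - e t"] by simp
  \<comment> \<open>This set is Lebesgue measurable, while the two measures were compared on Borel
    sets; it is replaced by a Borel set that differs from it by a null set.\<close>
  have "{t \<in> space (time T). 0 < e t} \<in> sets (time T)" by measurable
  then have "{t \<in> space (time T). 0 < e t} \<in> sets lebesgue"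
    by (auto simp: sets_restrict_space_iff)
  then obtain S N N' where SN: "{t \<in> space (time T). 0 < e t} = S \<union> N" "N \<subseteq> N'" "N' \<in> null_sets lborel" "S \<in> sets lborel"
    by (rule sets_completionE)
  then have [measurable]: "S \<in> sets borel" by simp
  have "AE t in lebesgue. t \<notin> N'" using SN by (intro AE_completion AE_not_in)
  then have "AE t in time T. t \<notin> N'"
    by (auto simp: AE_restrict_space_iff elim!: eventually_mono)
  then have iff: "AE t in time T. 0 < e t \<longleftrightarrow> t \<in> S"
    by (rule AE_mp) (use SN in \<open>auto intro!: AE_I2\<close>)
  have "(\<integral>\<^sup>+t. ennreal (indicator S t * - e t) \<partial>time T) = 0"
    by (subst nn_integral_cong_AE[where v = "\<lambda>_. 0"]) (use iff in \<open>auto elim!: eventually_mono simp: indicator_def ennreal_neg\<close>)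
  then have "(\<integral>\<^sup>+t. ennreal (indicator S t * e t) \<partial>time T) = 0" using eq[of S] by simp
  also have "(\<integral>\<^sup>+t. ennreal (indicator S t * e t) \<partial>time T) = (\<integral>\<^sup>+t. ennreal (e t) \<partial>time T)"
    by (rule nn_integral_cong_AE) (use iff in \<open>auto elim!: eventually_mono simp: indicator_def ennreal_neg\<close>)
  finally have pos: "(\<integral>\<^sup>+t. ennreal (e t) \<partial>time T) = 0" .
  then have "(\<integral>\<^sup>+t. ennreal (- e t) \<partial>time T) = 0" using eq[of UNIV] by simp
  with pos show ?thesis
    by (subst (asm) (1 2) nn_integral_0_iff_AE) (auto elim!: eventually_elim2 simp: ennreal_eq_0_iff)
qed

lemma integral_time_eq:
  fixes \<eta> :: "real \<Rightarrow> real"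
  assumes "continuous_on UNIV \<eta>" "0 \<le> s" "s \<le> T"
  shows "integrable (time T) \<eta>" and "(LINT t|time T. indicator {s<..} t * \<eta> t) = integral {s..T} \<eta>"
proof -
  have "\<eta> absolutely_integrable_on {0..T}"
    using assms by (intro absolutely_integrable_continuous_real continuous_on_subset[OF assms(1)]) auto
  then have "\<eta> absolutely_integrable_on {0<..<T}"
    by (rule set_integrable_subset) auto
  then show int: "integrable (time T) \<eta>"
    unfolding set_integrable_def by (subst integrable_restrict_space) auto
  have "(LINT t|time T. indicator {s<..} t * \<eta> t) = integral {0<..<T} (\<lambda>t. indicator {s<..} t * \<eta> t)"
    using integrable_time_indicator[OF int, of "{s<..}"] by (intro lebesgue_integral_eq_integral) auto
  also have "\<dots> = integral {0<..<T} (\<lambda>t. if t \<in> {s<..<T} then \<eta> t else 0)"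
    by (intro Henstock_Kurzweil_Integration.integral_cong) (auto simp: indicator_def)
  also have "\<dots> = integral ({s<..<T} \<inter> {0<..<T}) \<eta>"
    by (rule Henstock_Kurzweil_Integration.integral_restrict_Int)
  also have "{s<..<T} \<inter> {0<..<T} = {s<..<T}" using assms by auto
  also have "integral {s<..<T} \<eta> = integral {s..T} \<eta>"
    by (simp add: integral_open_interval_real)
  finally show "(LINT t|time T. indicator {s<..} t * \<eta> t) = integral {s..T} \<eta>" .
qed

text \<open>Testing against antiderivatives of test functions of mean zero determines a function up to a
  constant.\<close>

lemma weak_derivative:
  fixes v G :: "real \<Rightarrow> real"
  assumes "0 < T" and v: "integrable (time T) v" and G: "integrable (time T) G"
    and weak: "\<And>X X' a b. smooth X \<Longrightarrow> (\<And>t. (X has_real_derivative X' t) (at t)) \<Longrightarrow> 0 < a \<Longrightarrow> b < T \<Longrightarrow>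
      (\<And>t. t \<notin> {a..b} \<Longrightarrow> X t = 0) \<Longrightarrow> (LINT t|time T. X' t * v t) + (LINT t|time T. X t * G t) = 0"
  shows "\<exists>c. AE t in time T. v t = c + primitive T G t"
proof -
  define d where "d = (\<lambda>t. v t - primitive T G t)"
  have prim_int: "integrable (time T) (primitive T G)"
    using integrable_mult_primitive[OF _ G, of "\<lambda>_. 1"] finite_measure.integrable_const[OF finite_measure_time[of T], of "1 :: real"]
    by simp
  have d: "integrable (time T) d" using v prim_int by (simp add: d_def)
  \<comment> \<open>Because \<eta> has mean zero, its primitive \<open>X\<close> is an admissible
    test function. By Fubini, testing the primitive of \<open>G\<close> with \<eta> gives minus the
    integral of X G, and the weak equation gives the same value for v.\<close>
  have mean_zero: "(LINT t|time T. \<eta> t * d t) = 0"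
    if \<eta>: "smooth \<eta>" and ab: "0 < a" "a < b" "b < T" and supp: "\<And>t. t \<notin> {a..b} \<Longrightarrow> \<eta> t = 0"
      and mean: "(LINT t|time T. \<eta> t) = 0" for \<eta> a b
  proof -
    have cont: "continuous_on UNIV \<eta>" using \<eta> by (rule smooth_continuous_on)
    have \<eta>int: "integrable (time T) \<eta>" using integral_time_eq(1)[OF cont, of 0 T] ab by simp
    have "(LINT t|time T. indicator {0<..} t * \<eta> t) = (LINT t|time T. \<eta> t)"
      by (intro Bochner_Integration.integral_cong) auto
    then have "integral {0..T} \<eta> = 0"
      using integral_time_eq(2)[OF cont, of 0 T] ab mean by simp
    moreover have "integral {0..T} \<eta> = integral {a..b} \<eta>"
    proof -
      have "{a..b} = {a..b} \<inter> {0..T}" using ab by auto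
      then have "integral {a..b} \<eta> = integral {0..T} (\<lambda>t. if t \<in> {a..b} then \<eta> t else 0)"
        by (simp only: Henstock_Kurzweil_Integration.integral_restrict_Int)
      also have "\<dots> = integral {0..T} \<eta>"
        using supp by (intro Henstock_Kurzweil_Integration.integral_cong) auto
      finally show ?thesis by simp
    qed
    ultimately have "integral {a..b} \<eta> = 0" by simp
    then obtain X where X: "smooth X" "\<And>t. (X has_real_derivative \<eta> t) (at t)" "\<And>t. t \<notin> {a..b} \<Longrightarrow> X t = 0"
      using smooth_antiderivative[OF \<eta> ab(2) supp] by blast
    have tail: "(LINT t|time T. indicator {s<..} t * \<eta> t) = - X s" if "0 \<le> s" "s \<le> T" for s
    proof -
      have "(\<eta> has_integral X T - X s) {s..T}"
        using that X(2) by (intro fundamental_theorem_of_calculus)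
          (auto simp: has_real_derivative_iff_has_vector_derivative[symmetric] intro: has_field_derivative_at_within)
      moreover have "X T = 0" using X(3) ab by simp
      ultimately show ?thesis using integral_time_eq(2)[OF cont that] by (simp add: integral_unique)
    qed
    have Xint: "integrable (time T) (\<lambda>t. G t * X t)"
    proof -
      have "continuous_on UNIV X" using X(1) by (rule smooth_continuous_on)
      then have "X \<in> borel_measurable borel" by (rule borel_measurable_continuous_onI)
      then have meas: "X \<in> borel_measurable (time T)" using measurable_compose[OF time_borel] by blast
      have "compact (X ` {a..b})"
        using X(1) by (intro compact_continuous_image smooth_continuous_on) auto
      then obtain B where B: "\<And>y. y \<in> X ` {a..b} \<Longrightarrow> norm y \<le> B"
        using compact_imp_bounded bounded_iff by metis
      have "\<bar>X t\<bar> \<le> \<bar>B\<bar>" for t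
        using B[of "X t"] X(3)[of t] by (cases "t \<in> {a..b}") force+
      then have "norm (G t * X t) \<le> norm (G t * \<bar>B\<bar>)" for t
        by (simp add: abs_mult mult_left_mono)
      with G meas show ?thesis
        by (intro Bochner_Integration.integrable_bound[OF integrable_mult_left[OF G, of "\<bar>B\<bar>"]]) auto
    qed
    have "(LINT t|time T. \<eta> t * primitive T G t) = (LINT s|time T. G s * (LINT t|time T. indicator {s<..} t * \<eta> t))"
      by (rule primitive_Fubini[OF \<eta>int G])
    also have "\<dots> = (LINT s|time T. - (G s * X s))"
      using tail by (intro Bochner_Integration.integral_cong) auto
    also have "\<dots> = - (LINT s|time T. X s * G s)" by (simp add: mult.commute)
    finally have 1: "(LINT t|time T. \<eta> t * primitive T G t) = - (LINT s|time T. X s * G s)" .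
    have 2: "(LINT t|time T. \<eta> t * v t) + (LINT t|time T. X t * G t) = 0"
      using weak[OF X(1,2) ab(1,3) X(3)] by simp
    have \<eta>v: "integrable (time T) (\<lambda>t. \<eta> t * v t)"
    proof -
      have meas: "\<eta> \<in> borel_measurable (time T)" using \<eta>int by auto
      have "compact (\<eta> ` {a..b})"
        using \<eta> by (intro compact_continuous_image smooth_continuous_on) auto
      then obtain B where B: "\<And>y. y \<in> \<eta> ` {a..b} \<Longrightarrow> norm y \<le> B"
        using compact_imp_bounded bounded_iff by metis
      have "\<bar>\<eta> t\<bar> \<le> \<bar>B\<bar>" for t
        using B[of "\<eta> t"] supp[of t] by (cases "t \<in> {a..b}") force+
      then have "norm (\<eta> t * v t) \<le> norm (\<bar>B\<bar> * v t)" for t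
        by (simp add: abs_mult mult_right_mono)
      with v meas show ?thesis
        by (intro Bochner_Integration.integrable_bound[OF integrable_mult_right[OF v, of "\<bar>B\<bar>"]]) auto
    qed
    show ?thesis
      using 1 2 \<eta>v integrable_mult_primitive[OF \<eta>int G] by (simp add: d_def right_diff_distrib)
  qed
  \<comment> \<open>Smooth cutoffs supported between x + 1 / j and T - 1 / j. As j grows they
    converge on (0, T) to the indicator of (x, \<infinity>), because \<open>bump\<close> tends to 1
    at infinity.\<close>
  define \<theta> where "\<theta> x j t = bump (real j * (t - x) - 1) * bump (real j * (T - t) - 1)" for x and j :: nat and t
  have smooth_\<theta>: "smooth (\<theta> x j)" for x j
  proof -
    have "smooth (\<lambda>t. bump (real j * t + (- real j * x - 1)))"
      by (rule smooth_compose_affine[OF bounded_linear_mult_right smooth_bump])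
    moreover have "smooth (\<lambda>t. bump (- real j * t + (real j * T - 1)))"
      by (rule smooth_compose_affine[OF bounded_linear_mult_right smooth_bump])
    ultimately have "smooth (\<lambda>t. bump (real j * t + (- real j * x - 1)) * bump (- real j * t + (real j * T - 1)))"
      by (rule smooth_mult)
    then show ?thesis by (simp add: \<theta>_def[abs_def] algebra_simps)
  qed
  have \<theta>_range: "0 \<le> \<theta> x j t" "\<theta> x j t \<le> 1" for x j t
    by (auto simp: \<theta>_def bump_nonneg bump_le_1 mult_le_one)
  have \<theta>_supp: "\<theta> x j t = 0" if "t \<notin> {x + 1 / real j..T - 1 / real j}" "0 < j" for x j t
  proof -
    have "t < x + 1 / real j \<or> T - 1 / real j < t" using that by auto
    then have "real j * (t - x) - 1 \<le> 0 \<or> real j * (T - t) - 1 \<le> 0"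
      using that(2) by (auto simp: field_simps)
    then show ?thesis by (auto simp: \<theta>_def bump_def)
  qed
  have \<theta>_int: "integrable (time T) (\<theta> x j)" for x j
    using integral_time_eq(1)[OF smooth_continuous_on[OF smooth_\<theta>[of x j]], of 0 T] \<open>0 < T\<close> by simp
  \<comment> \<open>The bound 3 / J < T leaves room for the interval (1 / J, 2 / J), on which
    \<open>\<theta> 0 J\<close> is positive; thus its integral \<open>Z\<close> can serve as a
    denominator.\<close>
  obtain J :: nat where J: "3 / T < real J" using reals_Archimedean2 by blast
  have J0: "0 < J" using J \<open>0 < T\<close> by (metis divide_pos_pos less_trans of_nat_0_less_iff zero_less_numeral)
  define \<eta>0 where "\<eta>0 = \<theta> 0 J"
  have J3: "3 / real J < T" using J J0 \<open>0 < T\<close> by (simp add: field_simps)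
  define Z where "Z = (LINT t|time T. \<eta>0 t)"
  have Z: "Z \<noteq> 0"
  proof
    assume "Z = 0"
    then have "AE t in time T. \<eta>0 t = 0"
      using \<theta>_int[of 0 J] \<theta>_range(1)[of 0 J]
      by (simp add: Z_def \<eta>0_def integral_nonneg_eq_0_iff_AE)
    moreover have "\<eta>0 t \<noteq> 0" if "t \<in> {1 / real J<..<2 / real J}" for t
    proof -
      have "1 < real J * t" using that J0 by (simp add: field_simps)
      moreover have "1 < real J * (T - t)"
      proof -
        have "real J * t < 2" using that J0 by (simp add: field_simps)
        moreover have "3 < real J * T" using J3 J0 by (simp add: field_simps)
        ultimately show ?thesis by (simp add: right_diff_distrib)
      qed
      ultimately show ?thesis
        using bump_pos[of "real J * t - 1"] bump_pos[of "real J * (T - t) - 1"] by (simp add: \<eta>0_def \<theta>_def)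
    qed
    ultimately have "AE t in time T. t \<notin> {1 / real J<..<2 / real J}"
      by (auto elim!: eventually_mono)
    then have "AE t in lebesgue. t \<in> {0<..<T} \<longrightarrow> t \<notin> {1 / real J<..<2 / real J}"
      by (simp add: AE_restrict_space_iff)
    then have "AE t in lebesgue. t \<notin> {1 / real J<..<2 / real J}"
    proof eventually_elim
      case (elim t)
      have "2 / real J < T" "0 < 1 / real J" using J3 J0 by (auto simp: field_simps)
      with elim show ?case by (auto dest: less_trans)
    qed
    then have "AE t in lborel. t \<notin> {1 / real J<..<2 / real J}"
      by (simp add: AE_completion_iff)
    then have "emeasure lborel {1 / real J<..<2 / real J} = 0"
      by (subst (asm) AE_iff_measurable[where N = "{1 / real J<..<2 / real J}"]) auto
    then show False using J0 by (simp add: divide_right_mono)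
  qed
  \<comment> \<open>The mean of \<open>d\<close> weighted by \<eta>0. Subtracting a suitable
    multiple of \<eta>0 gives any cutoff mean zero, so \<open>d - c\<close> integrates to 0 against
    all cutoffs.\<close>
  define c where "c = (LINT t|time T. \<eta>0 t * d t) / Z"
  have \<theta>d_int: "integrable (time T) (\<lambda>t. \<theta> x j t * d t)" for x j
    by (rule Bochner_Integration.integrable_bound[OF d])
      (use \<theta>_range d \<theta>_int[of x j] in \<open>auto simp: abs_mult mult_left_le_one_le\<close>)
  have zero_\<theta>: "(LINT t|time T. \<theta> x j t * (d t - c)) = 0"
    if x: "0 \<le> x" "x < T" and j: "0 < j" "x + 1 / real j < T - 1 / real j" for x j
  proof -
    define m where "m = (LINT t|time T. \<theta> x j t) / Z"
    have "(LINT t|time T. (\<theta> x j t + (- m) * \<eta>0 t) * d t) = 0"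
    proof (rule mean_zero)
      show "smooth (\<lambda>t. \<theta> x j t + (- m) * \<eta>0 t)"
        unfolding \<eta>0_def by (intro smooth_add smooth_cmult smooth_\<theta>)
      show "0 < min (1 / real j) (1 / real J)" using j J0 by simp
      show "max (T - 1 / real j) (T - 1 / real J) < T" using j J0 by simp
      show "min (1 / real j) (1 / real J) < max (T - 1 / real j) (T - 1 / real J)"
        using j x by auto
      show "\<theta> x j t + (- m) * \<eta>0 t = 0" if "t \<notin> {min (1 / real j) (1 / real J)..max (T - 1 / real j) (T - 1 / real J)}" for t
      proof -
        have "t \<notin> {x + 1 / real j..T - 1 / real j}" "t \<notin> {0 + 1 / real J..T - 1 / real J}"
          using that x by (auto simp: min_le_iff_disj le_max_iff_disj)
        then show ?thesis using \<theta>_supp[of t x j] \<theta>_supp[of t 0 J] j J0 by (simp add: \<eta>0_def)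
      qed
      show "(LINT t|time T. \<theta> x j t + (- m) * \<eta>0 t) = 0"
        using Z \<theta>_int by (simp add: m_def Z_def \<eta>0_def)
    qed
    then have "(LINT t|time T. \<theta> x j t * d t + (- m) * (\<eta>0 t * d t)) = 0" by (simp add: algebra_simps)
    then have "(LINT t|time T. \<theta> x j t * d t) = m * (LINT t|time T. \<eta>0 t * d t)"
      using \<theta>d_int unfolding \<eta>0_def by simp
    then have "(LINT t|time T. \<theta> x j t * d t) = c * (LINT t|time T. \<theta> x j t)" by (simp add: m_def c_def)
    then show ?thesis using \<theta>d_int \<theta>_int by (simp add: right_diff_distrib)
  qed
  have dc: "integrable (time T) (\<lambda>t. d t - c)"
    using d finite_measure.integrable_const[OF finite_measure_time] by (intro Bochner_Integration.integrable_diff) auto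
  have "AE t in time T. d t - c = 0"
  proof (rule AE_time_zero[OF dc])
    fix x assume x: "0 \<le> x" "x < T"
    have lim: "(\<lambda>j. LINT t|time T. \<theta> x j t * (d t - c)) \<longlonglongrightarrow> (LINT t|time T. indicator {x<..} t * (d t - c))"
    proof (rule integral_dominated_convergence[where w = "\<lambda>t. \<bar>d t - c\<bar>"])
      show "(\<lambda>t. indicator {x<..} t * (d t - c)) \<in> borel_measurable (time T)"
        using borel_measurable_integrable[OF integrable_time_indicator[OF dc, of "{x<..}"]] by simp
      show "(\<lambda>t. \<theta> x j t * (d t - c)) \<in> borel_measurable (time T)" for j
        using \<theta>_int[of x j] dc by (intro borel_measurable_times) auto
      show "integrable (time T) (\<lambda>t. \<bar>d t - c\<bar>)" using dc by (rule integrable_abs)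
      show "AE t in time T. norm (\<theta> x j t * (d t - c)) \<le> \<bar>d t - c\<bar>" for j
        using \<theta>_range by (simp add: abs_mult mult_left_le_one_le)
      have bump_lim: "(\<lambda>j. bump (real j * r - 1)) \<longlonglongrightarrow> 1" if "0 < r" for r
      proof -
        have lim: "filterlim (\<lambda>j. real j * r - 1) at_top sequentially"
          using filterlim_tendsto_add_at_top[OF tendsto_const[of "- 1"]
              filterlim_at_top_mult_tendsto_pos[OF tendsto_const that filterlim_real_sequentially]] by simp
        then have 1: "(\<lambda>j. inverse (real j * r - 1)) \<longlonglongrightarrow> 0"
          by (rule tendsto_inverse_0_at_top)
        have 2: "eventually (\<lambda>j. 0 < real j * r - 1) sequentially"
          using lim unfolding filterlim_at_top_dense by blast
        have "(\<lambda>j. exp (- inverse (real j * r - 1))) \<longlonglongrightarrow> exp (- 0)"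
          by (intro tendsto_intros 1)
        then show ?thesis
          by (simp, elim Lim_transform_eventually) (use 2 in \<open>auto simp: bump_def inverse_eq_divide elim!: eventually_mono\<close>)
      qed
      show "AE t in time T. (\<lambda>j. \<theta> x j t * (d t - c)) \<longlonglongrightarrow> indicator {x<..} t * (d t - c)"
      proof (rule AE_I2)
        fix t assume t: "t \<in> space (time T)"
        have "(\<lambda>j. bump (real j * (t - x) - 1)) \<longlonglongrightarrow> indicator {x<..} t"
        proof (cases "x < t")
          case False
          then have "real j * (t - x) \<le> 0" for j by (simp add: mult_nonneg_nonpos)
          then have "real j * (t - x) - 1 \<le> 0" for j by (smt (verit))
          then have "bump (real j * (t - x) - 1) = 0" for j by (simp add: bump_def not_less)
          then show ?thesis using False by simp
        qed (use bump_lim[of "t - x"] in simp)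
        moreover have "(\<lambda>j. bump (real j * (T - t) - 1)) \<longlonglongrightarrow> 1" using bump_lim[of "T - t"] t by simp
        ultimately have "(\<lambda>j. \<theta> x j t) \<longlonglongrightarrow> indicator {x<..} t * 1"
          unfolding \<theta>_def by (rule tendsto_mult)
        from tendsto_mult[OF this tendsto_const] show "(\<lambda>j. \<theta> x j t * (d t - c)) \<longlonglongrightarrow> indicator {x<..} t * (d t - c)"
          by simp
      qed
    qed
    \<comment> \<open>Beyond this index the interval from x + 1 / j to T - 1 / j is
      nondegenerate.\<close>
    obtain N :: nat where N: "2 / (T - x) < real N" using reals_Archimedean2 by blast
    have "(LINT t|time T. \<theta> x j t * (d t - c)) = 0" if "N \<le> j" for j
    proof (rule zero_\<theta>[OF x])
      have *: "2 / (T - x) < real j" using N that by simp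
      then have "0 < real j" using x by (smt (verit) divide_pos_pos)
      then show "0 < j" by simp
      have "2 / real j < T - x" using * x \<open>0 < real j\<close> by (simp add: field_simps)
      moreover have "2 / real j = 1 / real j + 1 / real j" by (simp flip: add_divide_distrib)
      ultimately show "x + 1 / real j < T - 1 / real j" by linarith
    qed
    then have "eventually (\<lambda>j. (LINT t|time T. \<theta> x j t * (d t - c)) = 0) sequentially"
      by (auto simp: eventually_sequentially)
    from tendsto_cong[OF this] lim have "(\<lambda>j. 0) \<longlonglongrightarrow> (LINT t|time T. indicator {x<..} t * (d t - c))" by simp
    then show "(LINT t|time T. indicator {x<..} t * (d t - c)) = 0"
      by (simp add: LIMSEQ_const_iff)
  qed
  then have "AE t in time T. v t = c + primitive T G t"
    by eventually_elim (simp add: d_def)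
  then show ?thesis ..
qed

text \<open>The symmetry of \<open>R\<close> makes the cross terms at the two times cancel, so no equation for \<open>U\<close> is needed.\<close>

lemma energy_identity:
  fixes V U \<phi> :: "real \<Rightarrow> 'b::euclidean_space"
  assumes R: "bounded_linear R" and sym: "\<And>a b. R a \<bullet> b = a \<bullet> R b"
    and \<phi>: "integrable (time T) \<phi>"
    and VU: "AE t in time T. V t = R (U t)" and V: "AE t in time T. V t = C + R (primitive T \<phi> t)"
  shows "\<exists>c. AE t in time T. V t \<bullet> U t = c + primitive T (\<lambda>s. 2 * (\<phi> s \<bullet> (C + R (primitive T \<phi> s)))) t"
    and "integrable (time T) (\<lambda>s. 2 * (\<phi> s \<bullet> (C + R (primitive T \<phi> s))))"
proof -
  let ?\<Phi> = "primitive T \<phi>"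
  \<comment> \<open>An explicit primitive of the density: by symmetry of \<open>R\<close> the
    derivative of \<Phi> \<bullet> R \<Phi> is 2 \<phi> \<bullet> R \<Phi>.\<close>
  define X where "X t = 2 * (C \<bullet> ?\<Phi> t) + ?\<Phi> t \<bullet> R (?\<Phi> t)" for t
  have comp: "integrable (time T) (\<lambda>s. \<phi> s \<bullet> b)" "primitive T (\<lambda>s. \<phi> s \<bullet> b) t = ?\<Phi> t \<bullet> b" for b t
    using integrable_bounded_linear[OF bounded_linear_inner_left \<phi>] primitive_bounded_linear[OF bounded_linear_inner_left \<phi>]
    by simp_all
  \<comment> \<open>Expansion in a basis reduces the product rule for vector-valued primitives to
    the scalar one.\<close>
  have expand: "x \<bullet> R y = (\<Sum>b\<in>Basis. (x \<bullet> b) * (y \<bullet> R b))" for x y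
  proof -
    have "x \<bullet> R y = (\<Sum>b\<in>Basis. (x \<bullet> b) * (R y \<bullet> b))" by (rule euclidean_inner)
    then show ?thesis by (simp add: sym)
  qed
  have int_term: "integrable (time T) (\<lambda>s. (\<phi> s \<bullet> b) * (?\<Phi> s \<bullet> b'))" for b b'
    using integrable_mult_primitive[OF comp(1) comp(1), of b b'] by (simp add: comp(2))
  have prim_add: "primitive T (\<lambda>s. f s + g s) t = primitive T f t + primitive T g t"
    if "integrable (time T) f" "integrable (time T) g" for f g :: "real \<Rightarrow> real" and t
    using integrable_time_indicator[OF that(1), of "{..<t}"] integrable_time_indicator[OF that(2), of "{..<t}"]
    by (simp add: primitive_def distrib_left)
  have prim_sum: "primitive T (\<lambda>s. \<Sum>b\<in>Basis. f b s) t = (\<Sum>b\<in>Basis. primitive T (f b) t)"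
    if "\<And>b. integrable (time T) (f b)" for f :: "'b \<Rightarrow> real \<Rightarrow> real" and t
    unfolding primitive_def scaleR_sum_right
    using integrable_time_indicator[OF that, of "{..<t}"] by (intro Bochner_Integration.integral_sum) auto
  have "2 * (\<phi> s \<bullet> (C + R (?\<Phi> s))) =
      \<phi> s \<bullet> (2 *\<^sub>R C) + (\<Sum>b\<in>Basis. (\<phi> s \<bullet> b) * (?\<Phi> s \<bullet> R b) + (\<phi> s \<bullet> R b) * (?\<Phi> s \<bullet> b))" for s
  proof -
    have "\<phi> s \<bullet> R (?\<Phi> s) = (\<Sum>b\<in>Basis. (\<phi> s \<bullet> b) * (?\<Phi> s \<bullet> R b))" by (rule expand)
    moreover have "?\<Phi> s \<bullet> R (\<phi> s) = (\<Sum>b\<in>Basis. (?\<Phi> s \<bullet> b) * (\<phi> s \<bullet> R b))" by (rule expand)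
    moreover have "?\<Phi> s \<bullet> R (\<phi> s) = \<phi> s \<bullet> R (?\<Phi> s)" by (simp add: inner_commute sym)
    ultimately show ?thesis by (simp add: inner_add_right sum.distrib mult.commute)
  qed
  then have eq: "(\<lambda>s. 2 * (\<phi> s \<bullet> (C + R (?\<Phi> s)))) =
      (\<lambda>s. \<phi> s \<bullet> (2 *\<^sub>R C) + (\<Sum>b\<in>Basis. (\<phi> s \<bullet> b) * (?\<Phi> s \<bullet> R b) + (\<phi> s \<bullet> R b) * (?\<Phi> s \<bullet> b)))" by blast
  show "integrable (time T) (\<lambda>s. 2 * (\<phi> s \<bullet> (C + R (?\<Phi> s))))"
    unfolding eq by (intro Bochner_Integration.integrable_add Bochner_Integration.integrable_sum comp int_term)
  have "primitive T (\<lambda>s. 2 * (\<phi> s \<bullet> (C + R (?\<Phi> s)))) t = X t" for t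
  proof -
    have "primitive T (\<lambda>s. 2 * (\<phi> s \<bullet> (C + R (?\<Phi> s)))) t =
        ?\<Phi> t \<bullet> (2 *\<^sub>R C) + (\<Sum>b\<in>Basis. primitive T (\<lambda>s. (\<phi> s \<bullet> b) * (?\<Phi> s \<bullet> R b) + (\<phi> s \<bullet> R b) * (?\<Phi> s \<bullet> b)) t)"
    proof -
      have ps: "primitive T (\<lambda>s. \<Sum>b\<in>Basis. (\<phi> s \<bullet> b) * (?\<Phi> s \<bullet> R b) + (\<phi> s \<bullet> R b) * (?\<Phi> s \<bullet> b)) t =
          (\<Sum>b\<in>Basis. primitive T (\<lambda>s. (\<phi> s \<bullet> b) * (?\<Phi> s \<bullet> R b) + (\<phi> s \<bullet> R b) * (?\<Phi> s \<bullet> b)) t)"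
        by (rule prim_sum) (intro Bochner_Integration.integrable_add int_term)
      show ?thesis
        unfolding eq
        by (subst prim_add)
          (intro Bochner_Integration.integrable_add Bochner_Integration.integrable_sum comp(1) int_term | simp only: ps comp(2))+
    qed
    also have "(\<Sum>b\<in>Basis. primitive T (\<lambda>s. (\<phi> s \<bullet> b) * (?\<Phi> s \<bullet> R b) + (\<phi> s \<bullet> R b) * (?\<Phi> s \<bullet> b)) t) =
        (\<Sum>b\<in>Basis. (?\<Phi> t \<bullet> b) * (?\<Phi> t \<bullet> R b))"
      using primitive_mult[OF comp(1) comp(1), where t = t] by (simp add: comp(2))
    also have "\<dots> = ?\<Phi> t \<bullet> R (?\<Phi> t)" by (rule expand[symmetric])
    finally show ?thesis by (simp add: X_def inner_commute)
  qed
  \<comment> \<open>A single time at which both identities hold serves as reference for almost all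
    others. If there is no such time, the two almost-everywhere statements contradict each other at
    every point where they hold.\<close>
  moreover have "\<exists>c. AE t in time T. V t \<bullet> U t = c + X t"
  proof (cases "\<exists>t0. V t0 = R (U t0) \<and> V t0 = C + R (?\<Phi> t0)")
    case False
    have "AE t in time T. V t \<bullet> U t = 0 + X t"
      using VU V by eventually_elim (use False in blast)
    then show ?thesis ..
  next
    case True
    then obtain s where s: "V s = R (U s)" "V s = C + R (?\<Phi> s)" by blast
    have "AE t in time T. V t \<bullet> U t = (V s \<bullet> U s - X s) + X t"
      using VU V
    proof eventually_elim
      case (elim t)
      have lin: "R (a - b) = R a - R b" for a b
        using R by (simp add: bounded_linear.linear linear_diff)
      have "V t \<bullet> U s = U t \<bullet> V s" unfolding elim(1) s(1) by (rule sym)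
      then have "V t \<bullet> U t - V s \<bullet> U s = (V t - V s) \<bullet> (U t + U s)"
        using inner_commute[of "U t" "V s"] by (simp add: inner_diff_left inner_add_right)
      also have "V t - V s = R (?\<Phi> t - ?\<Phi> s)" by (simp add: elim(2) s(2) lin)
      also have "R (?\<Phi> t - ?\<Phi> s) \<bullet> (U t + U s) = (?\<Phi> t - ?\<Phi> s) \<bullet> (V t + V s)"
        by (simp add: sym inner_add_right elim(1)[symmetric] s(1)[symmetric])
      also have "\<dots> = (?\<Phi> t - ?\<Phi> s) \<bullet> (2 *\<^sub>R C + R (?\<Phi> t) + R (?\<Phi> s))"
        by (simp add: elim(2) s(2) scaleR_2 algebra_simps)
      also have "\<dots> = X t - X s"
        using sym[of "?\<Phi> t" "?\<Phi> s"] inner_commute[of "R (?\<Phi> t)" "?\<Phi> s"]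
        by (simp add: X_def inner_diff_left inner_add_right inner_commute[of C])
      finally show ?case by simp
    qed
    then show ?thesis ..
  qed
  ultimately show "\<exists>c. AE t in time T. V t \<bullet> U t = c + primitive T (\<lambda>s. 2 * (\<phi> s \<bullet> (C + R (?\<Phi> s)))) t"
    by simp
qed

section \<open>Conservation of helicity\<close>

text \<open>If h is not integrable, its integral is 0 by convention and the bound is
  trivial.\<close>

lemma ennreal_abs_integral_le:
  fixes h G :: "'a \<Rightarrow> real"
  assumes B: "0 \<le> B" and h: "\<And>x. \<bar>h x\<bar> \<le> B * G x" and G: "\<And>x. 0 \<le> G x" "G \<in> borel_measurable M"
  shows "ennreal \<bar>LINT x|M. h x\<bar> \<le> ennreal B * (\<integral>\<^sup>+x. ennreal (G x) \<partial>M)"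
proof (cases "integrable M h")
  case True
  have "ennreal \<bar>LINT x|M. h x\<bar> \<le> (\<integral>\<^sup>+x. ennreal (norm (h x)) \<partial>M)"
    using integral_norm_bound_ennreal[OF True] by simp
  also have "\<dots> \<le> (\<integral>\<^sup>+x. ennreal B * ennreal (G x) \<partial>M)"
    using h by (intro nn_integral_mono) (simp add: ennreal_leI B G flip: ennreal_mult)
  also have "\<dots> = ennreal B * (\<integral>\<^sup>+x. ennreal (G x) \<partial>M)" using G by (intro nn_integral_cmult) simp
  finally show ?thesis .
qed (simp add: not_integrable_integral_eq)

lemma integrable_linear_bound:
  fixes h :: "'a \<Rightarrow> real"
  assumes "h \<in> borel_measurable M" "integrable M D" "AE t in M. \<bar>h t\<bar> \<le> c * D t"
  shows "integrable M h"
  by (rule Bochner_Integration.integrable_bound[of M "\<lambda>t. c * D t"])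
    (use assms in \<open>auto elim!: eventually_mono\<close>)

lemma integrable_vec_pair:
  fixes a b :: "3 \<Rightarrow> 'a \<Rightarrow> real"
  assumes "\<And>i. integrable M (a i)" "\<And>i. integrable M (b i)"
  shows "integrable M (\<lambda>t. ((\<chi> i. a i t, \<chi> i. b i t) :: (real ^ 3) \<times> (real ^ 3)))"
proof -
  have "((\<chi> i. a i t, \<chi> i. b i t) :: (real ^ 3) \<times> (real ^ 3)) =
      (\<Sum>i\<in>UNIV. a i t *\<^sub>R (axis i 1, 0) + b i t *\<^sub>R (0, axis i 1))" for t
    by (simp add: prod_eq_iff vec_eq_iff fst_sum snd_sum axis_def if_distrib[of "\<lambda>x. _ * x"] cong: if_cong)
  then show ?thesis
    using assms by (simp only:) (intro Bochner_Integration.integrable_sum Bochner_Integration.integrable_add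
      integrable_scaleR_left)
qed

text \<open>The smoothed field written through the coefficients of the distribution. In this form it
  is jointly measurable in time and space, although representing functions are chosen separately at
  each time.\<close>

definition trig_sum :: "nat \<Rightarrow> (int ^ 3 \<Rightarrow> (real ^ 3) \<times> (real ^ 3)) \<Rightarrow> real ^ 3 \<Rightarrow> real ^ 3" where
  "trig_sum n z x = (\<Sum>k\<in>modes n. weight n k *\<^sub>R (cos_mode k x *\<^sub>R fst (z k) + sin_mode k x *\<^sub>R snd (z k)))"

lemma conv_trig_kernel_coef:
  assumes "represents f u" shows "conv (trig_kernel n) f x = trig_sum n (coef u) x"
  using conv_trig_kernel[OF represents_torus_field[OF assms]] coef_eq_field_coef[OF assms] by (simp add: trig_sum_def)

lemma trig_sum_measurable:
  assumes "\<And>\<phi>. test_fun \<phi> \<Longrightarrow> (\<lambda>t. (u t $ i) \<phi>) \<in> borel_measurable M"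
  shows "(\<lambda>(t, x). trig_sum n (coef (u t)) x $ i) \<in> borel_measurable (M \<Otimes>\<^sub>M torus)"
proof -
  have eq: "(\<lambda>(t, x). trig_sum n (coef (u t)) x $ i) = (\<lambda>z. \<Sum>k\<in>modes n. weight n k *
      (cos_mode k (snd z) * (u (fst z) $ i) (cos_mode k) + sin_mode k (snd z) * (u (fst z) $ i) (sin_mode k)))"
    by (auto simp: trig_sum_def coef_def)
  show ?thesis
    unfolding eq
    by (intro borel_measurable_sum borel_measurable_times borel_measurable_add borel_measurable_const
        measurable_compose[OF measurable_fst assms] test_fun_cos_mode test_fun_sin_mode
        measurable_compose[OF measurable_snd borel_measurable_torus] mode_measurable)
qed

section \<open>Evolution of the smoothed helicity\<close>

text \<open>The properties used at one fixed time. The three quantities bounded by \<open>d\<close>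
  control in turn the vorticity tested with a function, the components of the flux u \<times>
  \<omega>, and the rate of change of the smoothed helicity.\<close>

definition regular_fields ::
    "real \<Rightarrow> ennreal \<Rightarrow> real \<Rightarrow> ennreal \<Rightarrow> distr ^ 3 \<Rightarrow> distr ^ 3 \<Rightarrow> (real ^ 3 \<Rightarrow> real ^ 3) \<Rightarrow> (real ^ 3 \<Rightarrow> real ^ 3) \<Rightarrow> real \<Rightarrow> bool" where
  "regular_fields \<beta> p \<alpha> q u w f g d \<longleftrightarrow>
     represents f u \<and> represents g w \<and> (\<forall>i. distr_eq (w $ i) (curl u $ i)) \<and>
     field_norm \<beta> (2 * p) f < \<infinity> \<and> field_norm \<alpha> q g < \<infinity> \<and>
     field_norm \<alpha> q g \<le> ennreal d \<and> field_norm \<beta> (2 * p) f * field_norm \<alpha> q g \<le> ennreal d \<and>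
     field_norm \<beta> (2 * p) f * field_norm \<beta> (2 * p) f * field_norm \<alpha> q g \<le> ennreal d \<and> 0 \<le> d"

text \<open>\<open>f t\<close> and \<open>g t\<close> are representatives picked at each time,
  whereas measurability in time is stated for the distributions tested with fixed functions.
  \<open>D\<close> is the majorant that Hoelder's inequality in time makes integrable.\<close>

locale conservation =
  fixes T \<alpha> \<beta> :: real and p q :: ennreal and u \<omega> :: "real \<Rightarrow> distr ^ 3"
    and f g :: "real \<Rightarrow> real ^ 3 \<Rightarrow> real ^ 3" and D :: "real \<Rightarrow> real"
  assumes T: "0 < T" and pq: "1 \<le> p" "1 \<le> q" "1 / p + 1 / q = 1"
    and s: "0 < \<beta>" "\<beta> < 1" "0 < \<alpha>" "\<alpha> < 1" and exponents: "1 < 2 * \<beta> + \<alpha>"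
    and weak: "\<And>\<psi>. spacetime_test_fun T \<psi> \<Longrightarrow>
        (LINT t|time T. bracket (\<omega> t) (time_deriv \<psi> t)) +
        (LINT t|time T. matrix_bracket (tensor (u t) (\<omega> t) - tensor (\<omega> t) (u t)) (gradient (\<psi> t))) = 0"
    and u_meas: "\<And>i \<phi>. test_fun \<phi> \<Longrightarrow> (\<lambda>t. (u t $ i) \<phi>) \<in> borel_measurable (time T)"
    and w_meas: "\<And>i \<phi>. test_fun \<phi> \<Longrightarrow> (\<lambda>t. (\<omega> t $ i) \<phi>) \<in> borel_measurable (time T)"
    and D: "integrable (time T) D"
    and fields: "AE t in time T. regular_fields \<beta> p \<alpha> q (u t) (\<omega> t) (f t) (g t) (D t)"
begin

lemma integrable_vorticity:
  assumes \<phi>: "test_fun \<phi>" shows "integrable (time T) (\<lambda>t. (\<omega> t $ i) \<phi>)"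
proof -
  obtain B where B: "0 \<le> B" "\<And>x. \<bar>\<phi> x\<bar> \<le> B" using test_fun_bounded[OF \<phi>] by blast
  obtain c :: real where c: "0 < c" "\<And>s f. f \<in> borel_measurable borel \<Longrightarrow> (\<integral>\<^sup>+x. ennreal (norm (f x)) \<partial>torus) \<le> ennreal c * field_norm s q f"
    by (rule field_norm_L1_bound[OF pq]) (rule that; blast)
  have "AE t in time T. \<bar>(\<omega> t $ i) \<phi>\<bar> \<le> (B * c) * D t"
    using fields
  proof eventually_elim
    case (elim t)
    have g: "represents (g t) (\<omega> t)" and d: "field_norm \<alpha> q (g t) \<le> ennreal (D t)" "0 \<le> D t"
      using elim by (auto simp: regular_fields_def)
    have gm: "g t \<in> borel_measurable borel" using g by (simp add: represents_def)
    have "ennreal \<bar>(\<omega> t $ i) \<phi>\<bar> \<le> ennreal B * (\<integral>\<^sup>+x. ennreal (norm (g t x)) \<partial>torus)"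
      unfolding represents_eq[OF g \<phi>]
    proof (rule ennreal_abs_integral_le)
      show "\<bar>g t x $ i * \<phi> x\<bar> \<le> B * norm (g t x)" for x
        using mult_mono[OF component_le_norm_cart[of "g t x" i] B(2)[of x]] by (simp add: abs_mult mult.commute)
    qed (use B gm in \<open>auto intro: borel_measurable_torus\<close>)
    also have "\<dots> \<le> ennreal B * (ennreal c * ennreal (D t))"
      using order_trans[OF c(2)[OF gm] mult_left_mono[OF d(1)]] by (intro mult_left_mono) auto
    also have "\<dots> = ennreal ((B * c) * D t)" using B c d by (simp add: ennreal_mult mult.assoc)
    finally show ?case using B c d by (simp add: ennreal_le_iff)
  qed
  then show ?thesis by (rule integrable_linear_bound[OF w_meas[OF \<phi>] D])
qed

definition flux_pairing :: "3 \<Rightarrow> 3 \<Rightarrow> (real ^ 3 \<Rightarrow> real) \<Rightarrow> real \<Rightarrow> real" where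
  "flux_pairing i j \<phi> t = (LINT x|torus. f t x $ i * g t x $ j * \<phi> x)"

text \<open>The pairing is a limit of pairings of trigonometric smoothings, which depend on t only
  through finitely many coefficients of u(t) and \<omega>(t); this gives measurability. A multiple
  of \<open>D\<close> bounds the pairing and gives integrability.\<close>

lemma integrable_flux_pairing:
  assumes \<phi>: "test_fun \<phi>" shows "integrable (time T) (flux_pairing i j \<phi>)"
proof -
  obtain B where B: "0 \<le> B" "\<And>x. \<bar>\<phi> x\<bar> \<le> B" using test_fun_bounded[OF \<phi>] by blast
  note \<phi>m = test_fun_measurable[OF \<phi>]
  obtain c :: real where c: "0 < c" "\<And>s s' f g. f \<in> borel_measurable borel \<Longrightarrow> g \<in> borel_measurable borel \<Longrightarrow>
      (\<integral>\<^sup>+x. ennreal (norm (f x) * norm (g x)) \<partial>torus) \<le> ennreal c * (field_norm s (2 * p) f * field_norm s' q g)"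
    by (rule field_norm_L1_bound[OF pq]) (rule that; blast)
  have meas: "flux_pairing i j \<phi> \<in> borel_measurable (time T)"
  proof (rule time_measurable_limit)
    show "(\<lambda>t. LINT x|torus. trig_sum (2 * m) (coef (u t)) x $ i * trig_sum (2 * m) (coef (\<omega> t)) x $ j * \<phi> x)
        \<in> borel_measurable (time T)" for m
    proof (rule torus.borel_measurable_lebesgue_integral)
      show "(\<lambda>(t, x). trig_sum (2 * m) (coef (u t)) x $ i * trig_sum (2 * m) (coef (\<omega> t)) x $ j * \<phi> x)
          \<in> borel_measurable (time T \<Otimes>\<^sub>M torus)"
        using borel_measurable_times[OF borel_measurable_times[OF trig_sum_measurable[where u = u and i = i, OF u_meas]
            trig_sum_measurable[where u = \<omega> and i = j, OF w_meas]] measurable_compose[OF measurable_snd borel_measurable_torus[OF \<phi>m]]]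
        by (simp add: case_prod_beta)
    qed
    show "AE t in time T. (\<lambda>m. LINT x|torus. trig_sum (2 * m) (coef (u t)) x $ i * trig_sum (2 * m) (coef (\<omega> t)) x $ j * \<phi> x)
        \<longlonglongrightarrow> flux_pairing i j \<phi> t"
      using fields
    proof eventually_elim
      case (elim t)
      then have r: "represents (f t) (u t)" "represents (g t) (\<omega> t)"
        and fin: "field_norm \<beta> (2 * p) (f t) < \<infinity>" "field_norm \<alpha> q (g t) < \<infinity>"
        by (auto simp: regular_fields_def)
      show ?case
        using trig_product_tendsto[OF r[THEN represents_torus_field] pq s fin \<phi>m B(2)]
        by (simp add: flux_pairing_def conv_trig_kernel_coef[OF r(1)] conv_trig_kernel_coef[OF r(2)])
    qed
  qed
  have "AE t in time T. \<bar>flux_pairing i j \<phi> t\<bar> \<le> (B * c) * D t"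
    using fields
  proof eventually_elim
    case (elim t)
    then have m: "f t \<in> borel_measurable borel" "g t \<in> borel_measurable borel"
      and d: "field_norm \<beta> (2 * p) (f t) * field_norm \<alpha> q (g t) \<le> ennreal (D t)" "0 \<le> D t"
      by (auto simp: regular_fields_def represents_def)
    have "ennreal \<bar>flux_pairing i j \<phi> t\<bar> \<le> ennreal B * (\<integral>\<^sup>+x. ennreal (norm (f t x) * norm (g t x)) \<partial>torus)"
      unfolding flux_pairing_def
    proof (rule ennreal_abs_integral_le)
      show "\<bar>f t x $ i * g t x $ j * \<phi> x\<bar> \<le> B * (norm (f t x) * norm (g t x))" for x
        using mult_mono[OF mult_mono[OF component_le_norm_cart[of "f t x" i] component_le_norm_cart[of "g t x" j]] B(2)[of x]]
        by (simp add: abs_mult mult.commute)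
      show "(\<lambda>x. norm (f t x) * norm (g t x)) \<in> borel_measurable torus"
        using m by (intro borel_measurable_torus) simp
    qed (use B in auto)
    also have "\<dots> \<le> ennreal B * (ennreal c * ennreal (D t))"
      using order_trans[OF c(2)[OF m] mult_left_mono[OF d(1)]] by (intro mult_left_mono) auto
    also have "\<dots> = ennreal ((B * c) * D t)" using B c d by (simp add: ennreal_mult mult.assoc)
    finally show ?case using B c d by (simp add: ennreal_le_iff)
  qed
  then show ?thesis by (rule integrable_linear_bound[OF meas D])
qed

text \<open>The Fourier coefficients of u \<times> \<omega>, assembled from scalar pairings that are
  known to be integrable in time. At regular times they agree with \<open>field_coef\<close> of the
  cross product of the representatives.\<close>

definition flux_coef :: "int ^ 3 \<Rightarrow> real \<Rightarrow> (real ^ 3) \<times> (real ^ 3)" where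
  "flux_coef k t =
     (\<chi> i. flux_pairing (i + 1) (i + 2) (cos_mode k) t - flux_pairing (i + 2) (i + 1) (cos_mode k) t,
      \<chi> i. flux_pairing (i + 1) (i + 2) (sin_mode k) t - flux_pairing (i + 2) (i + 1) (sin_mode k) t)"

lemma integrable_flux_coef: "integrable (time T) (flux_coef k)"
  unfolding flux_coef_def[abs_def]
  by (intro integrable_vec_pair Bochner_Integration.integrable_diff integrable_flux_pairing test_fun_cos_mode test_fun_sin_mode)

lemma flux_coef_eq:
  assumes "regular_fields \<beta> p \<alpha> q (u t) (\<omega> t) (f t) (g t) (D t)"
  shows "field_coef (\<lambda>y. cross3 (f t y) (g t y)) k = flux_coef k t"
proof -
  have r: "torus_field (f t)" "torus_field (g t)"
    and fin: "field_norm \<beta> (2 * p) (f t) < \<infinity>" "field_norm \<alpha> q (g t) < \<infinity>"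
    using assms by (auto simp: regular_fields_def represents_torus_field)
  note F = torus_field_cross3[OF r pq fin]
  have prod: "integrable torus (\<lambda>x. f t x $ i * g t x $ j * \<phi> x)" if \<phi>: "test_fun \<phi>" for i j \<phi>
  proof -
    obtain B where B: "0 \<le> B" "\<And>x. \<bar>\<phi> x\<bar> \<le> B" using test_fun_bounded[OF \<phi>] by blast
    note [measurable] = test_fun_measurable[OF \<phi>] torus_fieldD(1)[OF r(1)] torus_fieldD(1)[OF r(2)]
    show ?thesis
    proof (rule Bochner_Integration.integrable_bound)
      show "integrable torus (\<lambda>x. B * (norm (f t x) * norm (g t x)))"
        by (intro integrable_mult_right integrable_product[OF _ _ pq fin]) measurable
      show "(\<lambda>x. f t x $ i * g t x $ j * \<phi> x) \<in> borel_measurable torus"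
        by (intro borel_measurable_torus) measurable
      show "AE x in torus. norm (f t x $ i * g t x $ j * \<phi> x) \<le> norm (B * (norm (f t x) * norm (g t x)))"
      proof (rule AE_I2)
        fix x
        show "norm (f t x $ i * g t x $ j * \<phi> x) \<le> norm (B * (norm (f t x) * norm (g t x)))"
          using mult_mono[OF mult_mono[OF component_le_norm_cart[of "f t x" i] component_le_norm_cart[of "g t x" j]] B(2)[of x]] B(1)
          by (simp add: abs_mult mult.commute)
      qed
    qed
  qed
  have "(LINT x|torus. \<phi> x *\<^sub>R cross3 (f t x) (g t x)) $ i = flux_pairing (i + 1) (i + 2) \<phi> t - flux_pairing (i + 2) (i + 1) \<phi> t"
    if \<phi>: "test_fun \<phi>" "\<And>x. \<bar>\<phi> x\<bar> \<le> 1" for \<phi> i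
  proof -
    have "(LINT x|torus. \<phi> x *\<^sub>R cross3 (f t x) (g t x)) $ i = (LINT x|torus. cross3 (f t x) (g t x) $ i * \<phi> x)"
      using integrable_component_mult(2)[OF F test_fun_measurable[OF \<phi>(1)] \<phi>(2)] by simp
    also have "\<dots> = (LINT x|torus. f t x $ (i + 1) * g t x $ (i + 2) * \<phi> x - f t x $ (i + 2) * g t x $ (i + 1) * \<phi> x)"
      by (simp add: cross3_component left_diff_distrib)
    finally show ?thesis using prod[OF \<phi>(1)] by (simp add: flux_pairing_def)
  qed
  from this[OF test_fun_cos_mode mode_bounds(1)] this[OF test_fun_sin_mode mode_bounds(2)]
  show ?thesis by (simp add: field_coef_def flux_coef_def vec_eq_iff)
qed

end

lemma time_integral_cong_AE:
  fixes F G :: "real \<Rightarrow> real"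
  assumes F: "F \<in> borel_measurable (time T)" and eq: "AE t in time T. F t = G t"
  shows "(LINT t|time T. F t) = (LINT t|time T. G t)"
  using F time_AE_cong[OF F _ eq] eq by (intro integral_cong_AE) auto

lemma time_integrable_cong_AE:
  fixes F G :: "real \<Rightarrow> real"
  assumes F: "integrable (time T) F" and eq: "AE t in time T. F t = G t"
  shows "integrable (time T) G"
  using F time_AE_cong[OF borel_measurable_integrable[OF F] _ eq] eq
  by (subst integrable_cong_AE[symmetric, of F _ G]) auto

lemma primitive_cong_AE:
  fixes F G :: "real \<Rightarrow> real"
  assumes F: "integrable (time T) F" and eq: "AE t in time T. F t = G t"
  shows "primitive T F t = primitive T G t"
  unfolding primitive_def
  by (rule time_integral_cong_AE)
    (use integrable_time_indicator[OF F, of "{..<t}"] eq in \<open>auto elim!: eventually_mono\<close>)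

lemma curl_cmult:
  assumes f: "represents f v" and \<phi>: "test_fun \<phi>"
  shows "(curl v $ j) (\<lambda>x. c * \<phi> x) = c * (curl v $ j) \<phi>"
proof -
  have "partial_deriv i (\<lambda>x. c * \<phi> x) = (\<lambda>x. c * partial_deriv i \<phi> x)" for i
  proof
    fix x
    have "(\<phi> has_derivative frechet_derivative \<phi> (at x)) (at x)"
      using \<phi> by (intro smooth_has_derivative) (simp add: test_fun_def)
    from partial_deriv_eqI[OF has_derivative_mult_right[OF this]]
    show "partial_deriv i (\<lambda>x. c * \<phi> x) x = c * partial_deriv i \<phi> x" by (simp add: partial_deriv_def)
  qed
  then show ?thesis
    by (simp add: curl_def distr_deriv_def represents_cmult[OF f test_fun_partial_deriv[OF \<phi>]] algebra_simps)
qed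

lemma smooth_deriv_measurable:
  assumes "smooth X" "\<And>t. (X has_real_derivative X' t) (at t)"
  shows "X' \<in> borel_measurable borel"
proof -
  have "X' = (\<lambda>t. frechet_derivative X (at t) 1)"
    using frechet_derivative_at[OF assms(2)[unfolded has_field_derivative_def]] by (metis mult.right_neutral)
  then show ?thesis using smooth_borel_measurable[OF smooth_frechet_derivative[OF assms(1)]] by simp
qed

context conservation
begin

lemma weak_component:
  assumes \<phi>: "test_fun \<phi>" and G: "integrable (time T) G"
    and eq: "AE t in time T. (curl (field_distr (\<lambda>y. cross3 (f t y) (g t y))) $ j) \<phi> = G t"
  shows "\<exists>c. AE t in time T. (\<omega> t $ j) \<phi> = c + primitive T G t"
proof (rule weak_derivative[OF T integrable_vorticity[OF \<phi>] G])
  fix X X' a b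
  assume X: "smooth X" "\<And>t. (X has_real_derivative X' t) (at t)" and ab: "0 < a" "b < T"
    and supp: "\<And>t. t \<notin> {a..b} \<Longrightarrow> X t = 0"
  \<comment> \<open>A product test function isolates the j-th component and separates the variables:
    X carries the weak derivative in time, \<phi> the functional in space.\<close>
  define \<psi> where "\<psi> t x = (X t * \<phi> x) *\<^sub>R axis j (1 :: real)" for t x
  have \<phi>': "smooth \<phi>" "periodic \<phi>" using \<phi> by (auto simp: test_fun_def)
  have "smooth (\<lambda>z :: real \<times> (real ^ 3). (X (fst z + 0) * \<phi> (snd z + 0)) *\<^sub>R axis j (1 :: real))"
    by (intro smooth_compose_linear[OF bounded_linear_scaleR_left] smooth_mult
        smooth_compose_affine[OF bounded_linear_fst X(1)] smooth_compose_affine[OF bounded_linear_snd \<phi>'(1)])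
  then have "spacetime_test_fun T \<psi>"
    unfolding spacetime_test_fun_def \<psi>_def using supp ab \<phi>'(2)
    by (intro conjI exI[of _ a] exI[of _ b]) (auto simp: case_prod_unfold periodic_def)
  note weak = weak[OF this]
  have dt: "time_deriv \<psi> t x = (X' t * \<phi> x) *\<^sub>R axis j 1" for t x
    unfolding time_deriv_def \<psi>_def
    using X(2)[of t] bounded_linear.has_vector_derivative[OF bounded_linear_compose[OF
        bounded_linear_scaleR_left[of "axis j (1 :: real) :: real ^ 3"] bounded_linear_mult_left[of "\<phi> x"]]]
    by (intro vector_derivative_at) (auto simp: has_real_derivative_iff_has_vector_derivative)
  have "AE t in time T. X' t * (\<omega> t $ j) \<phi> = bracket (\<omega> t) (time_deriv \<psi> t)"
    using fields
  proof eventually_elim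
    case (elim t)
    then have g: "represents (g t) (\<omega> t)" by (simp add: regular_fields_def)
    \<comment> \<open>For i \<noteq> j the functional is evaluated at the zero function; homogeneity
      with the factor 0 gives the value 0.\<close>
    have "(\<omega> t $ i) (\<lambda>x. X' t * \<phi> x * axis j 1 $ i) = (if i = j then X' t * (\<omega> t $ j) \<phi> else 0)" for i
      using represents_cmult[OF g \<phi>, of i 0] represents_cmult[OF g \<phi>, of i "X' t"] by (cases "i = j") (auto simp: axis_def)
    then show ?case by (simp add: bracket_def dt)
  qed
  from time_integral_cong_AE[OF _ this]
  have 1: "(LINT t|time T. X' t * (\<omega> t $ j) \<phi>) = (LINT t|time T. bracket (\<omega> t) (time_deriv \<psi> t))"
    using w_meas[OF \<phi>] measurable_compose[OF time_borel smooth_deriv_measurable[OF X]] by simp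
  have "AE t in time T. X t * G t = matrix_bracket (tensor (u t) (\<omega> t) - tensor (\<omega> t) (u t)) (gradient (\<psi> t))"
    using fields eq
  proof eventually_elim
    case (elim t)
    then have r: "represents (f t) (u t)" "represents (g t) (\<omega> t)"
      and fin: "field_norm \<beta> (2 * p) (f t) < \<infinity>" "field_norm \<alpha> q (g t) < \<infinity>"
      by (auto simp: regular_fields_def)
    have "torus_field (\<lambda>y. cross3 (f t y) (g t y))"
      using torus_field_cross3[OF r[THEN represents_torus_field] pq fin] .
    from curl_cmult[OF represents_field_distr[OF this] \<phi>, of j "X t"]
      matrix_bracket_eq_curl[OF r pq s fin test_fun_cmult[OF \<phi>, of "X t"], of j] elim(2)
    show ?case by (simp add: \<psi>_def[abs_def])
  qed
  from time_integral_cong_AE[OF _ this]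
  have 2: "(LINT t|time T. X t * G t) =
      (LINT t|time T. matrix_bracket (tensor (u t) (\<omega> t) - tensor (\<omega> t) (u t)) (gradient (\<psi> t)))"
    using G measurable_compose[OF time_borel smooth_borel_measurable[OF X(1)]] by simp
  show "(LINT t|time T. X' t * (\<omega> t $ j) \<phi>) + (LINT t|time T. X t * G t) = 0"
    unfolding 1 2 by (rule weak)
qed

text \<open>The components of \<open>curl_symbol k\<close> are bounded linear and commute with
  \<open>primitive\<close>, so the scalar equation applies to each of the six components; their
  constants are collected into \<open>C\<close>.\<close>

lemma vorticity_coef_evolution:
  "\<exists>C. AE t in time T. coef (\<omega> t) k = C + curl_symbol k (primitive T (flux_coef k) t)"
proof -
  note R = bounded_linear_curl_symbol[of k] and \<Phi> = integrable_flux_coef[of k]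
  have curl: "AE t in time T. coef (curl (field_distr (\<lambda>y. cross3 (f t y) (g t y)))) k = curl_symbol k (flux_coef k t)"
    using fields
  proof eventually_elim
    case (elim t)
    then have r: "torus_field (f t)" "torus_field (g t)"
      and fin: "field_norm \<beta> (2 * p) (f t) < \<infinity>" "field_norm \<alpha> q (g t) < \<infinity>"
      by (auto simp: regular_fields_def represents_torus_field)
    note F = represents_field_distr[OF torus_field_cross3[OF r pq fin]]
    show ?case
      unfolding flux_coef_eq[OF elim, symmetric] coef_eq_field_coef[OF F, symmetric]
      by (intro coef_curl represents_cmult[OF F])
  qed
  have "\<exists>c. AE t in time T. (\<omega> t $ j) (cos_mode k) = c + fst (curl_symbol k (primitive T (flux_coef k) t)) $ j" for j
  proof -
    have L: "bounded_linear (\<lambda>z. fst (curl_symbol k z) $ j)"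
      by (intro bounded_linear_compose[OF bounded_linear_vec_nth] bounded_linear_compose[OF bounded_linear_fst R])
    have "AE t in time T. (curl (field_distr (\<lambda>y. cross3 (f t y) (g t y))) $ j) (cos_mode k) = fst (curl_symbol k (flux_coef k t)) $ j"
      using curl by eventually_elim (simp add: coef_def prod_eq_iff vec_eq_iff)
    from weak_component[OF test_fun_cos_mode integrable_bounded_linear[OF L \<Phi>] this]
    show ?thesis unfolding primitive_bounded_linear[OF L \<Phi>] .
  qed
  then obtain c where c: "\<forall>j. AE t in time T. (\<omega> t $ j) (cos_mode k) = c j + fst (curl_symbol k (primitive T (flux_coef k) t)) $ j"
    using choice[of "\<lambda>j e. AE t in time T. (\<omega> t $ j) (cos_mode k) = e + fst (curl_symbol k (primitive T (flux_coef k) t)) $ j"] by blast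
  have "\<exists>c. AE t in time T. (\<omega> t $ j) (sin_mode k) = c + snd (curl_symbol k (primitive T (flux_coef k) t)) $ j" for j
  proof -
    have L: "bounded_linear (\<lambda>z. snd (curl_symbol k z) $ j)"
      by (intro bounded_linear_compose[OF bounded_linear_vec_nth] bounded_linear_compose[OF bounded_linear_snd R])
    have "AE t in time T. (curl (field_distr (\<lambda>y. cross3 (f t y) (g t y))) $ j) (sin_mode k) = snd (curl_symbol k (flux_coef k t)) $ j"
      using curl by eventually_elim (simp add: coef_def prod_eq_iff vec_eq_iff)
    from weak_component[OF test_fun_sin_mode integrable_bounded_linear[OF L \<Phi>] this]
    show ?thesis unfolding primitive_bounded_linear[OF L \<Phi>] .
  qed
  then obtain d where d: "\<forall>j. AE t in time T. (\<omega> t $ j) (sin_mode k) = d j + snd (curl_symbol k (primitive T (flux_coef k) t)) $ j"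
    using choice[of "\<lambda>j e. AE t in time T. (\<omega> t $ j) (sin_mode k) = e + snd (curl_symbol k (primitive T (flux_coef k) t)) $ j"] by blast
  have "AE t in time T. \<forall>j. (\<omega> t $ j) (cos_mode k) = c j + fst (curl_symbol k (primitive T (flux_coef k) t)) $ j"
    "AE t in time T. \<forall>j. (\<omega> t $ j) (sin_mode k) = d j + snd (curl_symbol k (primitive T (flux_coef k) t)) $ j"
    using c d by (simp_all add: AE_all_countable)
  then have "AE t in time T. coef (\<omega> t) k = (\<chi> j. c j, \<chi> j. d j) + curl_symbol k (primitive T (flux_coef k) t)"
    by eventually_elim (simp add: coef_def prod_eq_iff vec_eq_iff)
  then show ?thesis ..
qed

text \<open>\<open>energy_identity\<close> for the curl multiplier, which is symmetric and sends the
  coefficient of u to that of \<omega>. In the resulting density the integrated flux is replaced by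
  the coefficient of \<omega>, to which it is equal almost everywhere.\<close>

lemma mode_helicity:
  "\<exists>c. AE t in time T. coef (\<omega> t) k \<bullet> coef (u t) k = c + primitive T (\<lambda>s. 2 * (flux_coef k s \<bullet> coef (\<omega> s) k)) t"
  "integrable (time T) (\<lambda>s. 2 * (flux_coef k s \<bullet> coef (\<omega> s) k))"
proof -
  obtain C where C: "AE t in time T. coef (\<omega> t) k = C + curl_symbol k (primitive T (flux_coef k) t)"
    using vorticity_coef_evolution by blast
  have VU: "AE t in time T. coef (\<omega> t) k = curl_symbol k (coef (u t) k)"
    using fields
  proof eventually_elim
    case (elim t)
    then have r: "represents (f t) (u t)" and e: "\<And>i. distr_eq (\<omega> t $ i) (curl (u t) $ i)"
      by (auto simp: regular_fields_def)
    show ?case unfolding coef_cong[OF e] by (intro coef_curl represents_cmult[OF r])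
  qed
  note E = energy_identity[OF bounded_linear_curl_symbol curl_symbol_symmetric integrable_flux_coef VU C]
  have eq: "AE s in time T. 2 * (flux_coef k s \<bullet> (C + curl_symbol k (primitive T (flux_coef k) s))) =
      2 * (flux_coef k s \<bullet> coef (\<omega> s) k)"
    using C by eventually_elim simp
  show "integrable (time T) (\<lambda>s. 2 * (flux_coef k s \<bullet> coef (\<omega> s) k))"
    by (rule time_integrable_cong_AE[OF E(2) eq])
  show "\<exists>c. AE t in time T. coef (\<omega> t) k \<bullet> coef (u t) k = c + primitive T (\<lambda>s. 2 * (flux_coef k s \<bullet> coef (\<omega> s) k)) t"
    using E(1) unfolding primitive_cong_AE[OF E(2) eq] .
qed

end

text \<open>The weights are squared because both fields are smoothed: for represented fields this
  is, by Parseval, the integral of the smoothed \<omega> times the smoothed u.\<close>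

definition smoothed_helicity :: "nat \<Rightarrow> distr ^ 3 \<Rightarrow> distr ^ 3 \<Rightarrow> real" where
  "smoothed_helicity m u w = (\<Sum>k\<in>modes (2 * m). (weight (2 * m) k)\<^sup>2 * (coef w k \<bullet> coef u k))"

text \<open>The deviation from a constant is the primitive of twice the flux, bounded by a multiple
  of (1 / sqrt m)^(2\<beta> + \<alpha> - 1) times the integral of \<open>D\<close>, uniformly in t;
  the exponent is positive. The constants \<open>c m\<close> depend on m but not on t, and one null
  set serves all modes because these are countable.\<close>

lemma (in conservation) smoothed_helicity_evolution:
  "\<exists>c. AE t in time T. (\<lambda>m. smoothed_helicity m (u t) (\<omega> t) - c m) \<longlonglongrightarrow> 0"
proof -
  define F where "F k s = 2 * (flux_coef k s \<bullet> coef (\<omega> s) k)" for k s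
  define \<Phi> where "\<Phi> m s = (\<Sum>k\<in>modes (2 * m). (weight (2 * m) k)\<^sup>2 * F k s)" for m s
  have F: "integrable (time T) (F k)" for k unfolding F_def by (rule mode_helicity(2))
  have \<Phi>: "integrable (time T) (\<Phi> m)" for m
    unfolding \<Phi>_def by (intro Bochner_Integration.integrable_sum integrable_mult_right F)
  have "\<forall>k. \<exists>c. AE t in time T. coef (\<omega> t) k \<bullet> coef (u t) k = c + primitive T (F k) t"
    using mode_helicity(1) by (simp add: F_def[abs_def])
  from choice[OF this] obtain c where c: "\<And>k. AE t in time T. coef (\<omega> t) k \<bullet> coef (u t) k = c k + primitive T (F k) t"
    by blast
  have prim: "primitive T (\<Phi> m) t = (\<Sum>k\<in>modes (2 * m). (weight (2 * m) k)\<^sup>2 * primitive T (F k) t)" for m t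
  proof -
    have "primitive T (\<Phi> m) t = (LINT s|time T. (\<Sum>k\<in>modes (2 * m). (weight (2 * m) k)\<^sup>2 * (indicator {..<t} s *\<^sub>R F k s)))"
      unfolding primitive_def \<Phi>_def by (simp add: sum_distrib_left mult.left_commute)
    also have "\<dots> = (\<Sum>k\<in>modes (2 * m). LINT s|time T. (weight (2 * m) k)\<^sup>2 * (indicator {..<t} s *\<^sub>R F k s))"
      by (intro Bochner_Integration.integral_sum integrable_mult_right integrable_time_indicator F) auto
    finally show ?thesis by (simp add: primitive_def)
  qed
  obtain C :: real where C: "0 \<le> C" "\<And>(m :: nat) p q \<alpha> \<beta> f g u w.
    1 \<le> m \<Longrightarrow> represents f u \<Longrightarrow> represents g w \<Longrightarrow> (\<And>i. distr_eq (w $ i) (curl u $ i)) \<Longrightarrow>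
    1 \<le> p \<Longrightarrow> 1 \<le> q \<Longrightarrow> 1 / p + 1 / q = 1 \<Longrightarrow> 0 < \<beta> \<Longrightarrow> \<beta> < 1 \<Longrightarrow> 0 < \<alpha> \<Longrightarrow> \<alpha> < 1 \<Longrightarrow>
    field_norm \<beta> (2 * p) f < \<infinity> \<Longrightarrow> field_norm \<alpha> q g < \<infinity> \<Longrightarrow>
    ennreal \<bar>helicity_flux m f g\<bar> \<le> ennreal (C * (1 / sqrt (real m)) powr (2 * \<beta> + \<alpha> - 1)) *
      (field_norm \<beta> (2 * p) f * field_norm \<beta> (2 * p) f * field_norm \<alpha> q g)"
    by (rule helicity_flux_bound) (rule that; blast)
  define e where "e m = 2 * (C * (1 / sqrt (real m)) powr (2 * \<beta> + \<alpha> - 1))" for m :: nat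
  have e0: "0 \<le> e m" for m using C(1) by (simp add: e_def)
  have \<Phi>_bound: "AE s in time T. \<bar>\<Phi> m s\<bar> \<le> e m * D s" if m: "1 \<le> m" for m
    using fields
  proof eventually_elim
    case (elim s)
    then have r: "represents (f s) (u s)" "represents (g s) (\<omega> s)" and dc: "\<And>i. distr_eq (\<omega> s $ i) (curl (u s) $ i)"
      and fin: "field_norm \<beta> (2 * p) (f s) < \<infinity>" "field_norm \<alpha> q (g s) < \<infinity>"
      and d: "field_norm \<beta> (2 * p) (f s) * field_norm \<beta> (2 * p) (f s) * field_norm \<alpha> q (g s) \<le> ennreal (D s)" "0 \<le> D s"
      by (auto simp: regular_fields_def)
    have \<Phi>_eq: "\<Phi> m s = 2 * helicity_flux m (f s) (g s)"
      by (simp add: \<Phi>_def F_def helicity_flux_def flux_coef_eq[OF elim] coef_eq_field_coef[OF r(2)] sum_distrib_left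
          mult.left_commute)
    have "ennreal \<bar>helicity_flux m (f s) (g s)\<bar> \<le> ennreal (e m / 2) * ennreal (D s)"
      using order_trans[OF C(2)[OF m r dc pq s fin] mult_left_mono[OF d(1)]] by (simp add: e_def)
    also have "\<dots> = ennreal (e m / 2 * D s)" using ennreal_mult[of "e m / 2" "D s"] e0[of m] d by simp
    finally show ?case using e0[of m] d(2) by (simp add: \<Phi>_eq abs_mult ennreal_le_iff)
  qed
  have prim_bound: "\<bar>primitive T (\<Phi> m) t\<bar> \<le> e m * (LINT s|time T. D s)" if m: "1 \<le> m" for m t
  proof -
    have "\<bar>primitive T (\<Phi> m) t\<bar> \<le> (LINT s|time T. \<bar>\<Phi> m s\<bar>)" using primitive_norm_le[OF \<Phi>] by simp
    also have "\<dots> \<le> (LINT s|time T. e m * D s)"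
      by (rule integral_mono_AE) (use \<Phi> D \<Phi>_bound[OF m] in auto)
    finally show ?thesis by simp
  qed
  have "(\<lambda>m. (1 / sqrt (real m)) powr (2 * \<beta> + \<alpha> - 1)) \<longlonglongrightarrow> 0"
    using trig_kernel_eps exponents by (intro tendsto_zero_powrI[OF _ tendsto_const]) (auto simp: filterlim_at)
  from tendsto_mult_left[OF tendsto_mult_left[OF this], of 2 C]
  have e_lim: "(\<lambda>m. e m * (LINT s|time T. D s)) \<longlonglongrightarrow> 0"
    unfolding e_def[abs_def] by (intro tendsto_mult_left_zero) simp
  define c' where "c' m = (\<Sum>k\<in>modes (2 * m). (weight (2 * m) k)\<^sup>2 * c k)" for m
  have "AE t in time T. \<forall>k. coef (\<omega> t) k \<bullet> coef (u t) k = c k + primitive T (F k) t"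
    using c by (simp add: AE_all_countable)
  then have "AE t in time T. (\<lambda>m. smoothed_helicity m (u t) (\<omega> t) - c' m) \<longlonglongrightarrow> 0"
  proof eventually_elim
    case (elim t)
    have eq: "smoothed_helicity m (u t) (\<omega> t) - c' m = primitive T (\<Phi> m) t" for m
      by (simp add: smoothed_helicity_def c'_def prim elim distrib_left sum.distrib)
    show ?case
      unfolding eq
      by (rule Lim_null_comparison[OF _ e_lim]) (use prim_bound in \<open>auto simp: eventually_sequentially\<close>)
  qed
  then show ?thesis by (intro exI[of _ c'])
qed

section \<open>Passage from the smoothed helicity to the helicity\<close>

lemma norm_curl_symbol_le: "norm (curl_symbol k z) \<le> 2 * pi * norm (lattice_vec k) * norm z"
proof -
  have le: "(norm (cross3 ((2 * pi) *\<^sub>R lattice_vec k) v))\<^sup>2 \<le> (2 * pi * norm (lattice_vec k))\<^sup>2 * (norm v)\<^sup>2" for v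
    using power_mono[OF norm_cross3_le[of "(2 * pi) *\<^sub>R lattice_vec k" v], of 2] by (simp add: power_mult_distrib)
  have "(norm (curl_symbol k z))\<^sup>2 \<le> (2 * pi * norm (lattice_vec k))\<^sup>2 * (norm z)\<^sup>2"
    using le[of "fst z"] le[of "snd z"] by (cases z) (simp add: curl_symbol_def norm_Pair distrib_left)
  then have "(norm (curl_symbol k z))\<^sup>2 \<le> (2 * pi * norm (lattice_vec k) * norm z)\<^sup>2"
    by (simp add: power_mult_distrib)
  then show ?thesis by (rule power2_le_imp_le) simp
qed

text \<open>The curl costs a factor 2 pi |k|, so each term is at most (1 + (2 pi |k|)^2)^(1/2) |coef
  u k|^2, which is summable by the Sobolev norm of order at least 1/2. The weights lie in [0, 1] and
  tend to 1, so dominated convergence applies to the sum over modes.\<close>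

lemma smoothed_helicity_tendsto:
  assumes fin: "H_norm s u < \<infinity>" and s: "1 / 2 \<le> s" and w: "\<And>k. coef w k = curl_symbol k (coef u k)"
  shows "(\<lambda>m. smoothed_helicity m u w) \<longlonglongrightarrow> sobolev_pairing w u"
proof -
  define b where "b i k = Re (fourier_coeff (w $ i) k * cnj (fourier_coeff (u $ i) k))" for i k
  define S where "S k = (1 + (2 * pi * norm (lattice_vec k))\<^sup>2) powr s * (norm (coef u k))\<^sup>2" for k
  have b_eq: "b i k = fst (coef w k) $ i * fst (coef u k) $ i + snd (coef w k) $ i * snd (coef u k) $ i" for i k
    by (simp add: b_def fourier_coeff_def coef_def cos_mode_def[abs_def] sin_mode_def[abs_def])
  have a_eq: "coef w k \<bullet> coef u k = (\<Sum>i\<in>UNIV. b i k)" for k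
    by (simp add: b_eq inner_prod_def inner_vec_def sum.distrib)
  have norm_eq: "(norm (coef u k))\<^sup>2 = (\<Sum>i\<in>UNIV. (cmod (fourier_coeff (u $ i) k))\<^sup>2)" for k
    by (simp add: norm_prod_def norm_vec_def L2_set_def sum_nonneg fourier_coeff_def cmod_def coef_def cos_mode_def[abs_def]
        sin_mode_def[abs_def] flip: sum.distrib)
  have "(\<integral>\<^sup>+k. ennreal (S k) \<partial>count_space UNIV) = (\<Sum>i\<in>UNIV. \<integral>\<^sup>+k. ennreal ((1 + (2 * pi * norm (lattice_vec k))\<^sup>2) powr s *
            (cmod (fourier_coeff (u $ i) k))\<^sup>2) \<partial>count_space UNIV)"
    by (simp add: S_def norm_eq sum_distrib_left flip: nn_integral_sum sum_ennreal)
  also have "\<dots> < \<infinity>"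
    using fin by (auto simp: H_norm_def less_top[symmetric] split: if_splits)
  finally have S_int: "integrable (count_space UNIV) S"
    by (intro integrableI_bounded) (auto simp: S_def)
  have b_bound: "\<bar>b i k\<bar> \<le> S k" for i k
  proof -
    have le: "norm (fst z $ i, snd z $ i) \<le> norm z" for z :: "(real ^ 3) \<times> (real ^ 3)"
      using power_mono[OF component_le_norm_cart[of "fst z" i], of 2] power_mono[OF component_le_norm_cart[of "snd z" i], of 2]
      by (cases z) (simp add: norm_Pair)
    have "\<bar>b i k\<bar> \<le> norm (fst (coef w k) $ i, snd (coef w k) $ i) * norm (fst (coef u k) $ i, snd (coef u k) $ i)"
      using Cauchy_Schwarz_ineq2[of "(fst (coef w k) $ i, snd (coef w k) $ i)" "(fst (coef u k) $ i, snd (coef u k) $ i)"]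
      by (simp add: b_eq)
    also have "\<dots> \<le> norm (coef w k) * norm (coef u k)" by (intro mult_mono le) auto
    also have "\<dots> \<le> (2 * pi * norm (lattice_vec k) * norm (coef u k)) * norm (coef u k)"
      unfolding w by (intro mult_right_mono norm_curl_symbol_le) simp
    also have "\<dots> = 2 * pi * norm (lattice_vec k) * (norm (coef u k))\<^sup>2" by (simp add: power2_eq_square)
    also have "\<dots> \<le> S k"
      unfolding S_def
    proof (intro mult_right_mono)
      have "2 * pi * norm (lattice_vec k) \<le> sqrt (1 + (2 * pi * norm (lattice_vec k))\<^sup>2)"
        by (intro real_le_rsqrt) simp
      also have "\<dots> = (1 + (2 * pi * norm (lattice_vec k))\<^sup>2) powr (1 / 2)" by (simp add: powr_half_sqrt)
      also have "\<dots> \<le> (1 + (2 * pi * norm (lattice_vec k))\<^sup>2) powr s" using s by (intro powr_mono) auto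
      finally show "2 * pi * norm (lattice_vec k) \<le> (1 + (2 * pi * norm (lattice_vec k))\<^sup>2) powr s" .
    qed simp
    finally show ?thesis .
  qed
  have b_int: "integrable (count_space UNIV) (b i)" for i
    by (rule Bochner_Integration.integrable_bound[OF S_int]) (use b_bound in \<open>auto simp: S_def\<close>)
  have a_int: "integrable (count_space UNIV) (\<lambda>k. coef w k \<bullet> coef u k)"
    unfolding a_eq by (intro Bochner_Integration.integrable_sum b_int)
  have pairing: "sobolev_pairing w u = (LINT k|count_space UNIV. coef w k \<bullet> coef u k)"
  proof -
    have "infsum (b i) UNIV = (LINT k|count_space UNIV. b i k)" for i
      using infsetsum_infsum[of "b i" UNIV] b_int[of i]
      by (simp add: infsetsum_def Infinite_Set_Sum.abs_summable_on_def abs_summable_equivalent)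
    moreover have "sobolev_pairing w u = (\<Sum>i\<in>UNIV. infsum (b i) UNIV)"
      by (simp only: sobolev_pairing_def b_def[abs_def])
    ultimately show ?thesis unfolding a_eq using b_int by simp
  qed
  have finite_sum: "smoothed_helicity m u w = (LINT k|count_space UNIV. (weight (2 * m) k)\<^sup>2 * (coef w k \<bullet> coef u k))" for m
  proof -
    let ?h = "\<lambda>k. (weight (2 * m) k)\<^sup>2 * (coef w k \<bullet> coef u k)"
    have sub: "{k \<in> UNIV. ?h k \<noteq> 0} \<subseteq> modes (2 * m)" using weight_eq_0 by fastforce
    have "(LINT k|count_space UNIV. ?h k) = (\<Sum>k | k \<in> UNIV \<and> ?h k \<noteq> 0. ?h k)"
      using finite_subset[OF sub] by (intro lebesgue_integral_count_space_finite_support) auto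
    also have "\<dots> = (\<Sum>k\<in>modes (2 * m). ?h k)"
      using sub by (intro sum.mono_neutral_left) auto
    finally show ?thesis by (simp add: smoothed_helicity_def)
  qed
  have weight_lim: "(\<lambda>m. weight (2 * m) k) \<longlonglongrightarrow> 1" for k
    using LIMSEQ_subseq_LIMSEQ[OF weight_tendsto[of k], of "\<lambda>m. 2 * m"] by (simp add: strict_mono_def comp_def)
  show ?thesis
    unfolding pairing finite_sum
  proof (rule integral_dominated_convergence[where w = "\<lambda>k. \<bar>coef w k \<bullet> coef u k\<bar>"])
    show "AE k in count_space UNIV. (\<lambda>m. (weight (2 * m) k)\<^sup>2 * (coef w k \<bullet> coef u k)) \<longlonglongrightarrow> coef w k \<bullet> coef u k"
    proof (rule AE_I2)
      fix k
      from tendsto_mult[OF tendsto_power[OF weight_lim[of k], of 2] tendsto_const[of "coef w k \<bullet> coef u k"]]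
      show "(\<lambda>m. (weight (2 * m) k)\<^sup>2 * (coef w k \<bullet> coef u k)) \<longlonglongrightarrow> coef w k \<bullet> coef u k" by simp
    qed
    show "AE k in count_space UNIV. norm ((weight (2 * m) k)\<^sup>2 * (coef w k \<bullet> coef u k)) \<le> \<bar>coef w k \<bullet> coef u k\<bar>" for m
      using weight_bounds[of "2 * m"] by (intro AE_I2) (simp add: abs_mult mult_left_le_one_le power_le_one)
    show "integrable (count_space UNIV) (\<lambda>k. \<bar>coef w k \<bullet> coef u k\<bar>)" using a_int by (rule integrable_abs)
  qed auto
qed

text \<open>The summand 1 has two uses: it is the slack that lets a representative exceed the
  infimum defining the norm, and it makes every factor at least 1, so that the shorter products are
  bounded by the product of all three factors.\<close>

lemma regular_fields_exist:
  assumes W: "W_norm \<beta> (2 * p) u < \<infinity>" "W_norm \<alpha> q w < \<infinity>" and curl: "\<And>i. distr_eq (w $ i) (curl u $ i)"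
    and d: "(W_norm \<beta> (2 * p) u + 1) * (W_norm \<beta> (2 * p) u + 1) * (W_norm \<alpha> q w + 1) = ennreal d" "0 \<le> d"
  shows "\<exists>f g. regular_fields \<beta> p \<alpha> q u w f g d"
proof -
  let ?a = "W_norm \<beta> (2 * p) u + 1" and ?b = "W_norm \<alpha> q w + 1"
  obtain f where f: "represents f u" "field_norm \<beta> (2 * p) f \<le> ?a"
    using W_norm_representative[OF W(1), of 1] by auto
  obtain g where g: "represents g w" "field_norm \<alpha> q g \<le> ?b"
    using W_norm_representative[OF W(2), of 1] by auto
  have fin: "?a < \<infinity>" "?b < \<infinity>" using W by auto
  have a: "1 \<le> ?a" by simp
  have "field_norm \<beta> (2 * p) f * field_norm \<beta> (2 * p) f * field_norm \<alpha> q g \<le> ?a * ?a * ?b"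
    by (intro mult_mono f g) auto
  moreover have "field_norm \<beta> (2 * p) f * field_norm \<alpha> q g \<le> ?a * ?a * ?b"
    using mult_mono[OF mult_mono[OF f(2) a] g(2)] by simp
  moreover have "field_norm \<alpha> q g \<le> ?a * ?a * ?b"
    using mult_mono[OF mult_mono[OF a a] g(2)] by simp
  ultimately show ?thesis
    using f g curl d le_less_trans[OF f(2) fin(1)] le_less_trans[OF g(2) fin(2)]
    unfolding regular_fields_def d(1) by blast
qed

lemma W_norm_time_measurable:
  assumes "strongly_measurable T (W_norm s p) u" "1 \<le> p"
  shows "(\<lambda>t. W_norm s p (u t)) \<in> borel_measurable (time T)"
  using assms by (intro strongly_measurable_norm W_norm_triangle W_norm_minus_commute)

lemma Lp_norm_add_one_finite:
  assumes "h \<in> borel_measurable M" "finite_measure M" "1 \<le> p" "Lp_norm p M h < \<infinity>"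
  shows "Lp_norm p M (\<lambda>x. h x + 1) < \<infinity>"
  using Minkowski[OF assms(1) _ assms(3), of "\<lambda>_. 1"] Lp_norm_const_finite[OF assms(2,3), of 1] assms(4)
  by (auto intro: le_less_trans)

theorem proposition2p13:
  fixes T \<alpha> \<beta> :: real
    and p q r k :: ennreal
    and u \<omega> :: "real \<Rightarrow> distr ^ 3"
  assumes "T > 0"
    and "functional_vorticity_solution T u \<omega>"
    and "0 < \<alpha>" "\<alpha> < 1" "0 < \<beta>" "\<beta> < 1"
    and "1 \<le> p" "1 \<le> q" "1 \<le> r" "1 \<le> k"
    and "u \<in> bochner_space T (2 * r) (W_norm \<beta> (2 * p))"
    and "\<omega> \<in> bochner_space T k (W_norm \<alpha> q)"
    and "1 / p + 1 / q = 1" "1 / r + 1 / k = 1"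
    and "2 * \<beta> + \<alpha> > 1"
  shows "AE t\<^sub>1 in lebesgue_on {0<..<T}. AE t\<^sub>2 in lebesgue_on {0<..<T}.
           helicity u \<omega> t\<^sub>1 = helicity u \<omega> t\<^sub>2"
proof -
  note T = assms(1) and sol = assms(2)[unfolded functional_vorticity_solution_def]
    and s = assms(5,6,3,4) and pq = assms(7,8,13) and rk = assms(9,10,14)
  obtain \<epsilon> where \<epsilon>: "0 < \<epsilon>" "u \<in> bochner_space T \<infinity> (H_norm (1 / 2 + \<epsilon>))" using sol by blast
  have curl: "AE t in time T. \<forall>i. distr_eq (\<omega> t $ i) (curl (u t) $ i)" using sol by blast
  note p2 = one_le_double[OF pq(1)] and r2 = one_le_double[OF rk(1)]
  have su: "strongly_measurable T (W_norm \<beta> (2 * p)) u" and sw: "strongly_measurable T (W_norm \<alpha> q) \<omega>"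
    using assms(11,12) by (auto simp: bochner_space_def)
  define a where "a t = W_norm \<beta> (2 * p) (u t) + 1" for t
  define b where "b t = W_norm \<alpha> q (\<omega> t) + 1" for t
  note um = W_norm_time_measurable[OF su p2] and wm = W_norm_time_measurable[OF sw pq(2)]
  have am [measurable]: "a \<in> borel_measurable (time T)" and bm [measurable]: "b \<in> borel_measurable (time T)"
    using um wm unfolding a_def[abs_def] b_def[abs_def] by simp_all
  have "Lp_norm (2 * r) (time T) a < \<infinity>" "Lp_norm k (time T) b < \<infinity>"
    using Lp_norm_add_one_finite[OF um finite_measure_time r2] Lp_norm_add_one_finite[OF wm finite_measure_time rk(2)] assms(11,12)
    by (auto simp: bochner_space_def a_def[abs_def] b_def[abs_def])
  \<comment> \<open>The three-factor inequality in time, with exponents 2r, 2r and k.\<close>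
  then have fin: "(\<integral>\<^sup>+t. a t * a t * b t \<partial>time T) < \<infinity>"
    using Hoelder_three[OF am am bm rk] by (auto simp: ennreal_mult_less_top intro: le_less_trans)
  define D where "D t = enn2real (a t * a t * b t)" for t
  have D: "integrable (time T) D"
  proof (rule integrableI_bounded)
    have "(\<integral>\<^sup>+t. ennreal (norm (D t)) \<partial>time T) \<le> (\<integral>\<^sup>+t. a t * a t * b t \<partial>time T)"
      by (intro nn_integral_mono) (auto simp: D_def ennreal_enn2real_if)
    then show "(\<integral>\<^sup>+t. ennreal (norm (D t)) \<partial>time T) < \<infinity>" using fin by (rule le_less_trans)
  qed (simp add: D_def[abs_def])
  \<comment> \<open>The choice is made time by time. \<open>g t\<close> is chosen after
    \<open>f t\<close>, so that both satisfy one joint property.\<close>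
  define f where "f t = (SOME f. \<exists>g. regular_fields \<beta> p \<alpha> q (u t) (\<omega> t) f g (D t))" for t
  define g where "g t = (SOME g. regular_fields \<beta> p \<alpha> q (u t) (\<omega> t) (f t) g (D t))" for t
  have "AE t in time T. a t * a t * b t \<noteq> \<infinity>"
    using fin by (intro nn_integral_PInf_AE) auto
  then have fields: "AE t in time T. regular_fields \<beta> p \<alpha> q (u t) (\<omega> t) (f t) (g t) (D t)"
    using curl
  proof eventually_elim
    case (elim t)
    have ab: "a t \<noteq> 0" "b t \<noteq> 0" by (simp_all add: a_def b_def)
    have "a t * a t * b t = ennreal (D t)" using elim(1) by (simp add: D_def less_top)
    moreover have "W_norm \<beta> (2 * p) (u t) < \<infinity>" "W_norm \<alpha> q (\<omega> t) < \<infinity>"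
      using elim(1) ab by (auto simp: ennreal_mult_eq_top_iff less_top[symmetric] a_def b_def)
    ultimately have "\<exists>f g. regular_fields \<beta> p \<alpha> q (u t) (\<omega> t) f g (D t)"
      using elim(2) by (intro regular_fields_exist) (auto simp: a_def b_def D_def)
    then have "\<exists>g. regular_fields \<beta> p \<alpha> q (u t) (\<omega> t) (f t) g (D t)" unfolding f_def by (rule someI_ex)
    then show ?case unfolding g_def by (rule someI_ex)
  qed
  obtain c :: real where c: "0 < c"
    "\<And>s f. f \<in> borel_measurable borel \<Longrightarrow> (\<integral>\<^sup>+x. ennreal (norm (f x)) \<partial>torus) \<le> ennreal c * field_norm s (2 * p) f"
    "\<And>s f. f \<in> borel_measurable borel \<Longrightarrow> (\<integral>\<^sup>+x. ennreal (norm (f x)) \<partial>torus) \<le> ennreal c * field_norm s q f"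
    by (rule field_norm_L1_bound[OF pq]) (rule that; blast)
  have meas: "(\<lambda>t. (u t $ i) \<phi>) \<in> borel_measurable (time T)" "(\<lambda>t. (\<omega> t $ i) \<phi>) \<in> borel_measurable (time T)"
    if \<phi>: "test_fun \<phi>" for i \<phi>
  proof -
    obtain B where B: "0 \<le> B" "\<And>x. \<bar>\<phi> x\<bar> \<le> B" using test_fun_bounded[OF \<phi>] by blast
    have cB: "0 \<le> c * (1 + B)" using c(1) B(1) by simp
    show "(\<lambda>t. (u t $ i) \<phi>) \<in> borel_measurable (time T)"
      by (rule strongly_measurable_functional[OF su cB W_norm_functional_bound[OF c(1) c(2) \<phi> B(2)]])
    show "(\<lambda>t. (\<omega> t $ i) \<phi>) \<in> borel_measurable (time T)"
      by (rule strongly_measurable_functional[OF sw cB W_norm_functional_bound[OF c(1) c(3) \<phi> B(2)]])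
  qed
  interpret conservation T \<alpha> \<beta> p q u \<omega> f g D
    using T pq s assms(15) sol meas D fields by unfold_locales blast+
  obtain h where h: "AE t in time T. (\<lambda>m. smoothed_helicity m (u t) (\<omega> t) - h m) \<longlonglongrightarrow> 0"
    using smoothed_helicity_evolution by blast
  have H: "AE t in time T. H_norm (1 / 2 + \<epsilon>) (u t) \<le> esssup (time T) (\<lambda>t. H_norm (1 / 2 + \<epsilon>) (u t))"
    by (rule esssup_AE)
  have "esssup (time T) (\<lambda>t. H_norm (1 / 2 + \<epsilon>) (u t)) < \<infinity>"
    using \<epsilon>(2) by (simp add: bochner_space_def Lp_norm_def)
  with H have H: "AE t in time T. H_norm (1 / 2 + \<epsilon>) (u t) < \<infinity>"
    by (auto elim!: eventually_mono intro: le_less_trans)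
  \<comment> \<open>The sequence \<open>h\<close> does not depend on t, so the helicity at almost
    every time is the limit of one and the same numerical sequence.\<close>
  have lim: "AE t in time T. h \<longlonglongrightarrow> helicity u \<omega> t"
    using h H fields
  proof eventually_elim
    case (elim t)
    then have r: "represents (f t) (u t)" and e: "\<And>i. distr_eq (\<omega> t $ i) (curl (u t) $ i)"
      by (auto simp: regular_fields_def)
    have "coef (\<omega> t) k = curl_symbol k (coef (u t) k)" for k
      unfolding coef_cong[OF e] by (intro coef_curl represents_cmult[OF r])
    then have "(\<lambda>m. smoothed_helicity m (u t) (\<omega> t)) \<longlonglongrightarrow> helicity u \<omega> t"
      unfolding helicity_def using elim(2) \<epsilon>(1) by (intro smoothed_helicity_tendsto[where s = "1 / 2 + \<epsilon>"]) auto
    from tendsto_diff[OF this elim(1)] show ?case by simp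
  qed
  show ?thesis
    using lim
  proof eventually_elim
    case (elim t\<^sub>1)
    show ?case
      using lim by eventually_elim (rule LIMSEQ_unique[OF elim])
  qed
qed

end
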